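(* Let $K$ be a number field, let $f(z) = -2z^3 + 3z^2\in K[z]$, and let $x \in K$. Suppose there exist primes $\mathfrak{p}$ and $\mathfrak{q}$ of $K$ lying over $2$ and $3$, respectively, such that $v_{\mathfrak{q}}(x) = 1$, and either $v_{\mathfrak{p}}(x) = \pm 1$ or $v_{\mathfrak{p}}(1-x) = 1$. Then for each $n \geq 1$: (1) the polynomial $f^n(z) - x$ is irreducible over $K$; (2) $\mathrm{Gal}\left(f^n(z) - x / K\right) \cong E_n$ as groups acting on $T_n$; that is, there is a rooted-tree isomorphism between the preimage tree of $x$ (defined below) and $T_n$ under which the action of $\mathrm{Gal}(f^n(z)-x/K)$ corresponds exactly to the subgroup $E_n\subseteq \mathrm{Aut}(T_n)$. Moreover, with $|E_n|$ and $|\mathrm{Aut}(T_n)|$ the orders of these finite groups, \[ \lim_{n \to \infty} \frac{\log |E_n|}{\log |\mathrm{Aut}(T_n)|} = 1 - \frac{1}{3}\cdot \frac{\log 2}{\log 6}. \]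
   Context: $f^n$ denotes the $n$-th iterate of $f$. The preimage tree of $x$ has vertex set $\bigsqcup_{0\le i\le n} f^{-i}(x)$ (roots in an algebraic closure) with an edge from $\alpha$ to $\beta$ when $f(\alpha)=\beta$; the Galois group of the splitting field acts on it. $T_n$ is the regular ternary rooted tree with $n$ levels: its vertices at level $i$ ($0\le i\le n$) are the sequences $(\ell_1,\dots,\ell_i)$ with $\ell_j\in\{1,2,3\}$ (the root is the empty sequence), and $(\ell_1,\dots,\ell_i)$ is joined to $(\ell_1,\dots,\ell_i,\ell_{i+1})$. For $n\ge2$, identify $\mathrm{Aut}(T_n)$ with $\mathrm{Aut}(T_{n-1})\wr \mathrm{Aut}(T_1)$: the element $((a_1,a_2,a_3),b)$, with $a_i\in\mathrm{Aut}(T_{n-1})$ and $b\in \mathrm{Aut}(T_1)\cong\mathfrak S_3$, sends the vertex $(i,\ell_2,\dots,\ell_k)$ to $(b(i), a_i(\ell_2,\dots,\ell_k))$. For $\sigma\in\mathrm{Aut}(T_n)$, $\mathrm{sgn}(\sigma)$ is the sign of the permutation $\sigma$ induces on the $3^n$ leaves; for $m\le n$, $\pi_m:\mathrm{Aut}(T_n)\to\mathrm{Aut}(T_m)$ is restriction to the subtree of vertices of level $\le m$, and $\mathrm{sgn}_m=\mathrm{sgn}\circ\pi_m$. Define $E_1=\mathrm{Aut}(T_1)$, and for $n\ge2$, $E_n$ is the set of $\sigma=((a_1,a_2,a_3),b)\in\mathrm{Aut}(T_n)$ with $a_1,a_2,a_3\in E_{n-1}$ and $\mathrm{sgn}_2(\sigma)=1$.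 *)

theory Defs
  imports
    Complex_Main
    "HOL-Library.Extended"
    "HOL-Combinatorics.Permutations"
    "HOL-Algebra.Ideal_Product"
    "HOL-Algebra.QuotRing"
    "HOL-Algebra.Bij"
    "HOL-Algebra.Generated_Fields"
    "HOL-Algebra.Algebraic_Closure_Type"
begin

section \<open>Number fields, primes and valuations\<close>

definition number_field :: "'k::field_char_0 itself \<Rightarrow> bool" where
  "number_field _ \<longleftrightarrow>
     (\<exists>B::'k set. finite B \<and> (\<forall>x. \<exists>c::'k \<Rightarrow> rat. x = (\<Sum>b\<in>B. of_rat (c b) * b)))"

definition ring_of_integers :: "'k::field_char_0 ring" where
  "ring_of_integers = ring_of_type_algebra\<lparr>carrier := {a. algebraic_int a}\<rparr>"

text \<open>A prime of \<open>K\<close> is a nonzero prime ideal of its ring of integers. The condition that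
  \<open>P\<close> meets the integers in \<open>p\<int>\<close> forces \<open>P\<close> to be nonzero when \<open>p\<close> is a prime number.\<close>

definition prime_over :: "nat \<Rightarrow> 'k::field_char_0 set \<Rightarrow> bool" where
  "prime_over p P \<longleftrightarrow>
     primeideal P ring_of_integers \<and> P \<inter> \<int> = {of_int (int p * k) | k. True}"

text \<open>The power is taken in the multiplicative monoid of ideals.\<close>

definition ideal_ord :: "'k::field_char_0 set \<Rightarrow> 'k \<Rightarrow> nat" where
  "ideal_ord P a = (GREATEST m. a \<in> P [^]\<^bsub>ideals_set ring_of_integers\<^esub> m)"

definition val :: "'k::field_char_0 set \<Rightarrow> 'k \<Rightarrow> int extended" where
  "val P x =
     (if x = 0 then \<infinity>
      else Fin (THE v. \<exists>a b. algebraic_int a \<and> algebraic_int b \<and> a \<noteq> 0 \<and> b \<noteq> 0 \<and> x = a / b \<and>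
                  v = int (ideal_ord P a) - int (ideal_ord P b)))"


section \<open>Galois groups\<close>

definition ac_roots :: "'k::field poly \<Rightarrow> 'k alg_closure set" where
  "ac_roots p = {\<alpha>. poly (map_poly to_ac p) \<alpha> = 0}"

definition splitting_field :: "'k::field poly \<Rightarrow> 'k alg_closure ring" where
  "splitting_field p =
     ring_of_type_algebra\<lparr>carrier := generate_field ring_of_type_algebra (range to_ac \<union> ac_roots p)\<rparr>"

text \<open>Automorphisms are extensional functions on the splitting field, as in \<^const>\<open>BijGroup\<close>.\<close>

definition galois_group :: "'k::field poly \<Rightarrow> ('k alg_closure \<Rightarrow> 'k alg_closure) monoid" where
  "galois_group p =
     BijGroup (carrier (splitting_field p))
       \<lparr>carrier := {g \<in> Bij (carrier (splitting_field p)).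
           g \<in> ring_iso (splitting_field p) (splitting_field p) \<and> (\<forall>c. g (to_ac c) = to_ac c)}\<rparr>"


section \<open>Rooted trees\<close>

record 'v rooted_graph =
  vertices :: "'v set"
  edges :: "'v set set"
  tree_root :: 'v

definition rooted_iso :: "'v rooted_graph \<Rightarrow> 'w rooted_graph \<Rightarrow> ('v \<Rightarrow> 'w) \<Rightarrow> bool" where
  "rooted_iso S T \<phi> \<longleftrightarrow>
     bij_betw \<phi> (vertices S) (vertices T) \<and> \<phi> (tree_root S) = tree_root T \<and>
     (\<forall>u\<in>vertices S. \<forall>v\<in>vertices S. {u, v} \<in> edges S \<longleftrightarrow> {\<phi> u, \<phi> v} \<in> edges T)"

text \<open>Automorphisms are normalised to be the identity outside the vertex set.\<close>

definition tree_aut :: "'v rooted_graph \<Rightarrow> ('v \<Rightarrow> 'v) monoid" where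
  "tree_aut T = \<lparr>carrier = {\<sigma>. \<sigma> permutes vertices T \<and> rooted_iso T T \<sigma>}, monoid.mult = (\<circ>), one = id\<rparr>"

definition iter_poly :: "'a::comm_ring_1 poly \<Rightarrow> nat \<Rightarrow> 'a poly" where
  "iter_poly f n = (pcompose f ^^ n) [:0, 1:]"

text \<open>The first component of a vertex is its level; it makes the union of the fibres disjoint.\<close>

definition preimage_tree :: "'k::field poly \<Rightarrow> 'k \<Rightarrow> nat \<Rightarrow> (nat \<times> 'k alg_closure) rooted_graph" where
  "preimage_tree f x n =
     \<lparr>vertices = {(i, \<alpha>). i \<le> n \<and> \<alpha> \<in> ac_roots (iter_poly f i - [:x:])},
      edges = {{(Suc i, \<alpha>), (i, poly (map_poly to_ac f) \<alpha>)} | i \<alpha>.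
                 Suc i \<le> n \<and> \<alpha> \<in> ac_roots (iter_poly f (Suc i) - [:x:])},
      tree_root = (0, to_ac x)\<rparr>"

definition level :: "nat \<Rightarrow> nat list set" where
  "level i = {w. length w = i \<and> set w \<subseteq> {1, 2, 3}}"

definition ternary_tree :: "nat \<Rightarrow> nat list rooted_graph" where
  "ternary_tree n =
     \<lparr>vertices = (\<Union>i\<le>n. level i),
      edges = {{w, w @ [l]} | w l. length w < n \<and> set w \<subseteq> {1, 2, 3} \<and> l \<in> {1, 2, 3}},
      tree_root = []\<rparr>"

abbreviation Aut :: "nat \<Rightarrow> (nat list \<Rightarrow> nat list) set" where
  "Aut n \<equiv> carrier (tree_aut (ternary_tree n))"

definition tree_sgn :: "nat \<Rightarrow> (nat list \<Rightarrow> nat list) \<Rightarrow> int" where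
  "tree_sgn n \<sigma> = sign_on (level n) \<sigma>"

definition tree_restrict :: "nat \<Rightarrow> (nat list \<Rightarrow> nat list) \<Rightarrow> nat list \<Rightarrow> nat list" where
  "tree_restrict m \<sigma> = restrict_id \<sigma> (vertices (ternary_tree m))"

definition sgn_at :: "nat \<Rightarrow> (nat list \<Rightarrow> nat list) \<Rightarrow> int" where
  "sgn_at m \<sigma> = tree_sgn m (tree_restrict m \<sigma>)"

text \<open>The automorphism of the tree with \<open>n\<close> levels written \<open>((a 1, a 2, a 3), b)\<close>; here
  \<open>b\<close> is given as a permutation of the labels \<open>{1, 2, 3}\<close>.\<close>

definition wreath :: "nat \<Rightarrow> (nat \<Rightarrow> nat list \<Rightarrow> nat list) \<Rightarrow> (nat \<Rightarrow> nat) \<Rightarrow> nat list \<Rightarrow> nat list" where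
  "wreath n a b = restrict_id (\<lambda>w. case w of [] \<Rightarrow> [] | i # v \<Rightarrow> b i # a i v) (vertices (ternary_tree n))"

text \<open>The value at \<open>0\<close> is a dummy: the groups start at \<open>n = 1\<close>.\<close>

fun E :: "nat \<Rightarrow> (nat list \<Rightarrow> nat list) set" where
  "E 0 = Aut 0"
| "E (Suc 0) = Aut 1"
| "E (Suc (Suc n)) =
     {\<sigma> \<in> Aut (Suc (Suc n)). sgn_at 2 \<sigma> = 1 \<and>
        (\<exists>a b. (\<forall>i\<in>{1, 2, 3}. a i \<in> E (Suc n)) \<and> b permutes {1, 2, 3} \<and>
               \<sigma> = wreath (Suc (Suc n)) a b)}"

end

theory Submission
  imports Defs
begin

text \<open>The map \<open>cubic\<close> has the fixed critical points 0 and 1, exchanged by z to 1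
  - z. Hence the discriminant of \<open>cubic z - t\<close> is a multiple of t (1 - t). The product
  of r (1 - r) over the three roots r is, up to a constant, the product of the values of
  \<open>cubic z - t\<close> at 0 and at 1, so again a multiple of t (1 - t); this is where the sign
  condition comes from. Modulo 3 the map is z^3, whence the total ramification. Above 2 it is z^2
  times a unit wherever 2 z has positive value, and the hypotheses put x near one of the fixed
  points 0, 1 and infinity. No completion or ramification index appears: values are compared through
  units of one valuation ring of the closure, and degrees are replaced by linear dependence, which
  forces two terms of a relation to have equal value. What shapes the lower bound is that the sign
  condition forbids an element of the kernel of restriction to be odd at just one of three siblings.
  Such elements are first obtained with odd permutations at exactly two siblings; even permutations
  at a single vertex then come from commutators of elements whose supports meet in that vertex
  only.\<close>

text \<open>The valuations at the two primes are extended to valuation rings of the algebraic closure by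
  Chevalley's theorem. Above \<open>3\<close>, a root \<open>z\<close> of \<open>f^n(z) = x\<close> has value \<open>1 / 3^n\<close>, so it has degree at
  least \<open>3^n\<close>; this gives irreducibility, and transitivity of the Galois group on every level.

  The discriminant of the cubic \<open>f(z) - t\<close> is, up to a square, \<open>3 t (1 - t)\<close>, and the product of these
  over the three children of a node is a square times the one of the node. Square roots of the
  discriminants can be chosen compatibly with this relation along the whole tree, and ordering
  siblings by them makes the Galois action satisfy the sign condition that defines \<open>E_n\<close>.

  Conversely, above \<open>2\<close> there is a branch of preimages that ramifies quadratically at each step, so the
  discriminants at its nodes, and products of consecutive ones, are not squares in the field that
  the node generates. This yields separating elements: they fix a node, are odd at it and even at
  its parent. The commutator of such an element with a rotation of the node and its siblings is
  trivial down to the level of the node and has odd local permutations there; with transitivity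
  these commutators generate everything that the sign condition allows, by induction on the level.
  The limit follows from the recursions for the orders.\<close>

section \<open>Valuation rings\<close>

locale type_subring =
  fixes R :: "'a::comm_ring_1 set"
  assumes one_mem: "1 \<in> R"
    and add_mem: "a \<in> R \<Longrightarrow> b \<in> R \<Longrightarrow> a + b \<in> R"
    and uminus_mem: "a \<in> R \<Longrightarrow> - a \<in> R"
    and mult_mem: "a \<in> R \<Longrightarrow> b \<in> R \<Longrightarrow> a * b \<in> R"
begin

lemma zero_mem: "0 \<in> R"
  using add_mem[OF one_mem uminus_mem[OF one_mem]] by simp

lemma diff_mem: "a \<in> R \<Longrightarrow> b \<in> R \<Longrightarrow> a - b \<in> R"
  using add_mem[of a "- b"] uminus_mem by simp

lemma power_mem: "a \<in> R \<Longrightarrow> a ^ n \<in> R"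
  by (induction n) (auto intro: one_mem mult_mem)

lemma sum_mem: "(\<And>i. i \<in> I \<Longrightarrow> g i \<in> R) \<Longrightarrow> sum g I \<in> R"
  by (induction I rule: infinite_finite_induct) (auto intro: zero_mem add_mem)

lemma of_nat_mem: "of_nat n \<in> R"
  by (induction n) (auto intro: zero_mem add_mem one_mem)

lemma of_int_mem: "of_int n \<in> R"
  by (cases n) (auto intro: of_nat_mem uminus_mem diff_mem one_mem)

lemma numeral_mem: "numeral n \<in> R"
  using of_nat_mem[of "numeral n"] by simp

lemma poly_mem: "(\<And>i. coeff p i \<in> R) \<Longrightarrow> y \<in> R \<Longrightarrow> poly p y \<in> R"
  by (auto simp: poly_altdef intro!: sum_mem mult_mem power_mem)

lemma coeff_mult_mem:
  "(\<And>i. coeff p i \<in> R) \<Longrightarrow> (\<And>i. coeff q i \<in> R) \<Longrightarrow> coeff (p * q) i \<in> R"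
  by (auto simp: coeff_mult intro!: sum_mem mult_mem)

end

definition adjoin :: "'a::comm_ring_1 set \<Rightarrow> 'a \<Rightarrow> 'a set" where
  "adjoin R y = {poly p y | p. \<forall>i. coeff p i \<in> R}"

lemma adjoinI: "(\<And>i. coeff p i \<in> R) \<Longrightarrow> poly p y \<in> adjoin R y"
  by (auto simp: adjoin_def)

context type_subring
begin

lemma type_subring_adjoin: "type_subring (adjoin R y)"
proof
  show "1 \<in> adjoin R y"
    using adjoinI[of 1 R y] by (simp add: one_mem zero_mem coeff_1)
next
  fix a b assume "a \<in> adjoin R y" "b \<in> adjoin R y"
  then obtain p q where pq: "a = poly p y" "b = poly q y" "\<forall>i. coeff p i \<in> R" "\<forall>i. coeff q i \<in> R"
    by (auto simp: adjoin_def)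
  show "a + b \<in> adjoin R y"
    using adjoinI[of "p + q" R y] pq by (simp add: add_mem)
  show "a * b \<in> adjoin R y"
    using adjoinI[of "p * q" R y] pq by (simp add: coeff_mult_mem)
next
  fix a assume "a \<in> adjoin R y"
  then obtain p where p: "a = poly p y" "\<forall>i. coeff p i \<in> R"
    by (auto simp: adjoin_def)
  show "- a \<in> adjoin R y"
    using adjoinI[of "- p" R y] p by (simp add: uminus_mem)
qed

lemma subset_adjoin: "R \<subseteq> adjoin R y"
proof
  fix a assume "a \<in> R"
  then show "a \<in> adjoin R y"
    using adjoinI[of "[:a:]" R y] by (auto simp: coeff_pCons zero_mem split: nat.splits)
qed

lemma mem_adjoin: "y \<in> adjoin R y"
  using adjoinI[of "[:0, 1:]" R y]
  by (auto simp: coeff_pCons zero_mem one_mem split: nat.splits)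

end

section \<open>Units and nonunits of a valuation ring\<close>

locale valuation_ring = type_subring B for B :: "'a::field set" +
  assumes mem_or_inverse_mem: "y \<in> B \<or> inverse y \<in> B"

definition vunit :: "'a::field set \<Rightarrow> 'a \<Rightarrow> bool" where
  "vunit B y \<longleftrightarrow> y \<noteq> 0 \<and> y \<in> B \<and> inverse y \<in> B"

text \<open>For a valuation ring this is the maximal ideal. No value group is constructed: "positive
  value" is membership here, and "equal value" is a quotient that is a \<open>vunit\<close>.\<close>

definition nonunits :: "'a::field set \<Rightarrow> 'a set" where
  "nonunits B = {y \<in> B. \<not> vunit B y}"

context valuation_ring
begin

lemma vunit_1: "vunit B 1"
  by (simp add: vunit_def one_mem)

lemma vunit_mult: "vunit B a \<Longrightarrow> vunit B b \<Longrightarrow> vunit B (a * b)"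
  by (auto simp: vunit_def mult_mem)

lemma vunit_inverse: "vunit B a \<Longrightarrow> vunit B (inverse a)"
  by (auto simp: vunit_def)

lemma vunit_inverse_iff: "vunit B (inverse a) \<longleftrightarrow> vunit B a"
  by (auto simp: vunit_def)

lemma vunit_divide: "vunit B a \<Longrightarrow> vunit B b \<Longrightarrow> vunit B (a / b)"
  by (simp add: divide_inverse vunit_mult vunit_inverse)

lemma vunit_uminus: "vunit B a \<Longrightarrow> vunit B (- a)"
  by (auto simp: vunit_def uminus_mem)

lemma vunit_power: "vunit B a \<Longrightarrow> vunit B (a ^ n)"
  by (induction n) (auto simp: vunit_1 vunit_mult)

lemma vunit_powi: "vunit B a \<Longrightarrow> vunit B (a powi n)"
  by (auto simp: power_int_def vunit_power vunit_inverse)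

lemma vunit_mult_cancel: "vunit B (a * b) \<Longrightarrow> vunit B a \<Longrightarrow> vunit B b"
  using vunit_divide[of "a * b" a] by (auto simp: vunit_def)

lemma nonunits_subset: "nonunits B \<subseteq> B"
  by (auto simp: nonunits_def)

lemma zero_nonunit: "0 \<in> nonunits B"
  by (auto simp: nonunits_def vunit_def zero_mem)

lemma nonunit_iff: "y \<noteq> 0 \<Longrightarrow> y \<in> nonunits B \<longleftrightarrow> inverse y \<notin> B"
  using mem_or_inverse_mem[of y] by (auto simp: nonunits_def vunit_def)

lemma one_not_nonunit: "1 \<notin> nonunits B"
  by (auto simp: nonunits_def vunit_1)

lemma nonunits_mult:
  assumes "y \<in> nonunits B" "b \<in> B"
  shows "b * y \<in> nonunits B"
proof (cases "b * y = 0")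
  case False
  then have nz: "b \<noteq> 0" "y \<noteq> 0" by auto
  have "inverse (b * y) \<notin> B"
  proof
    assume "inverse (b * y) \<in> B"
    then have "b * inverse (b * y) \<in> B" using assms mult_mem by blast
    then show False using nz assms nonunit_iff[of y] by (simp add: field_simps)
  qed
  then show ?thesis using False nonunit_iff by blast
qed (auto simp: zero_nonunit)

lemma nonunits_add:
  assumes "y \<in> nonunits B" "z \<in> nonunits B"
  shows "y + z \<in> nonunits B"
proof -
  have *: "y + z \<in> nonunits B" if "y \<in> nonunits B" "z / y \<in> B" "y \<noteq> 0" for y z
  proof -
    have "y + z = (1 + z / y) * y" using that by (simp add: field_simps)
    then show ?thesis using that nonunits_mult add_mem one_mem by metis
  qed
  show ?thesis
  proof (cases "y = 0 \<or> z = 0")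
    case False
    have "z / y \<in> B \<or> y / z \<in> B"
      using mem_or_inverse_mem[of "z / y"] by auto
    then show ?thesis using *[of y z] *[of z y] False assms by (auto simp: add.commute)
  qed (use assms in auto)
qed

lemma nonunits_uminus: "y \<in> nonunits B \<Longrightarrow> - y \<in> nonunits B"
  using nonunits_mult[of y "-1"] uminus_mem one_mem by auto

lemma nonunits_sum: "(\<And>i. i \<in> I \<Longrightarrow> g i \<in> nonunits B) \<Longrightarrow> sum g I \<in> nonunits B"
  by (induction I rule: infinite_finite_induct) (auto intro: zero_nonunit nonunits_add)

lemma nonunits_power: "y \<in> nonunits B \<Longrightarrow> n > 0 \<Longrightarrow> y ^ n \<in> nonunits B"
  using nonunits_mult[of y "y ^ (n - 1)"] nonunits_subset
  by (cases n) (auto simp: mult.commute intro: power_mem)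

lemma vunit_not_nonunit: "vunit B y \<Longrightarrow> y \<notin> nonunits B"
  by (auto simp: nonunits_def)

lemma vunit_add_nonunit:
  assumes "vunit B u" "y \<in> nonunits B"
  shows "vunit B (u + y)"
proof (rule ccontr)
  assume "\<not> vunit B (u + y)"
  moreover have "u + y \<in> B" using assms nonunits_subset by (auto simp: vunit_def add_mem)
  ultimately have "u + y \<in> nonunits B" by (auto simp: nonunits_def)
  then have "(u + y) + - y \<in> nonunits B" using assms nonunits_add nonunits_uminus by blast
  then show False using assms vunit_not_nonunit by auto
qed

lemma trichotomy:
  assumes "y \<noteq> 0"
  shows "vunit B y \<or> y \<in> nonunits B \<or> inverse y \<in> nonunits B"
  using assms mem_or_inverse_mem[of y] by (auto simp: nonunits_def vunit_def)

text \<open>Divisibility is a total preorder in a valuation ring, so a finite family has a term of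
  least value. This takes the place of a minimum in the value group.\<close>

lemma exists_dominant:
  assumes "finite I" "I \<noteq> {}" "\<And>i. i \<in> I \<Longrightarrow> t i \<noteq> 0"
  shows "\<exists>i\<in>I. \<forall>j\<in>I. t j / t i \<in> B"
  using assms
proof (induction rule: finite_ne_induct)
  case (singleton i)
  then show ?case by (auto simp: one_mem)
next
  case (insert k I)
  then obtain i where i: "i \<in> I" "\<forall>j\<in>I. t j / t i \<in> B" by auto
  have nz: "t i \<noteq> 0" "t k \<noteq> 0" using insert i by auto
  have "t k / t i \<in> B \<or> t i / t k \<in> B" using mem_or_inverse_mem[of "t k / t i"] by auto
  then show ?case
  proof
    assume "t k / t i \<in> B"
    then show ?thesis using i by blast
  next
    assume a: "t i / t k \<in> B"
    have "t j / t k \<in> B" if "j \<in> I" for j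
      using mult_mem[OF _ a, of "t j / t i"] i that nz by auto
    then show ?thesis using nz by (intro bexI[of _ k]) (auto simp: one_mem)
  qed
qed

text \<open>The ultrametric principle. After division by a term of least value the other terms add
  up to -1, so they cannot all be nonunits. All later statements about ramification and discreteness
  apply this to a linear relation.\<close>

lemma sum_zero_imp_associated:
  assumes "finite I" "I \<noteq> {}" "\<And>i. i \<in> I \<Longrightarrow> t i \<noteq> 0" "sum t I = 0"
  shows "\<exists>i\<in>I. \<exists>j\<in>I. i \<noteq> j \<and> vunit B (t i / t j)"
proof (rule ccontr)
  assume no: "\<not> ?thesis"
  obtain i where i: "i \<in> I" "\<forall>j\<in>I. t j / t i \<in> B"
    using exists_dominant[of I t] assms by auto
  have "(\<Sum>j\<in>I - {i}. t j / t i) \<in> nonunits B"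
    using no i by (intro nonunits_sum) (auto simp: nonunits_def)
  moreover have "(\<Sum>j\<in>I - {i}. t j / t i) = - 1"
  proof -
    have "(\<Sum>j\<in>I. t j / t i) = 0" using assms by (simp flip: sum_divide_distrib)
    moreover have "(\<Sum>j\<in>I. t j / t i) = t i / t i + (\<Sum>j\<in>I - {i}. t j / t i)"
      using assms i by (subst sum.remove[of _ i]) auto
    ultimately show ?thesis using assms i by (simp add: eq_neg_iff_add_eq_0 add.commute)
  qed
  ultimately show False using nonunits_uminus[of "-1"] one_not_nonunit by auto
qed

end

section \<open>Chevalley's theorem on the existence of valuation rings\<close>

definition low_degree_values :: "'a::comm_ring_1 set \<Rightarrow> 'a \<Rightarrow> nat \<Rightarrow> 'a set" where
  "low_degree_values R y d = {\<Sum>i\<le>d. c i * y ^ i | c. \<forall>i. c i \<in> R}"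

lemma low_degree_valuesI:
  "s = (\<Sum>i\<le>d. c i * y ^ i) \<Longrightarrow> (\<And>i. c i \<in> R) \<Longrightarrow> s \<in> low_degree_values R y d"
  by (auto simp: low_degree_values_def)

lemma adjoin_imp_low_degree:
  assumes "a \<in> adjoin R y"
  shows "\<exists>d. a \<in> low_degree_values R y d"
  using assms by (auto simp: adjoin_def poly_altdef intro!: low_degree_valuesI)

context type_subring
begin

lemma low_degree_values_add:
  assumes "a \<in> low_degree_values R y d" "b \<in> low_degree_values R y d"
  shows "a + b \<in> low_degree_values R y d"
proof -
  from assms obtain c c' where "a = (\<Sum>i\<le>d. c i * y ^ i)" "b = (\<Sum>i\<le>d. c' i * y ^ i)"
    "\<forall>i. c i \<in> R" "\<forall>i. c' i \<in> R" by (auto simp: low_degree_values_def)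
  then show ?thesis
    by (intro low_degree_valuesI[where c = "\<lambda>i. c i + c' i"])
       (auto simp: sum.distrib algebra_simps intro: add_mem)
qed

lemma low_degree_values_smult:
  assumes "b \<in> low_degree_values R y d" "r \<in> R"
  shows "r * b \<in> low_degree_values R y d"
proof -
  from assms obtain c where "b = (\<Sum>i\<le>d. c i * y ^ i)" "\<forall>i. c i \<in> R"
    by (auto simp: low_degree_values_def)
  with assms show ?thesis
    by (intro low_degree_valuesI[where c = "\<lambda>i. r * c i"])
       (auto simp: sum_distrib_left algebra_simps intro: mult_mem)
qed

lemma low_degree_values_power:
  assumes "k \<le> d"
  shows "y ^ k \<in> low_degree_values R y d"
proof (rule low_degree_valuesI[where c = "\<lambda>i. of_bool (i = k)"])
  show "y ^ k = (\<Sum>i\<le>d. of_bool (i = k) * y ^ i)"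
    using assms by (simp add: of_bool_def if_distrib[of "\<lambda>u. u * _"] sum.delta cong: if_cong)
qed (auto simp: one_mem zero_mem)

lemma low_degree_values_const: "r \<in> R \<Longrightarrow> r \<in> low_degree_values R y d"
  using low_degree_values_smult[OF low_degree_values_power[of 0 d y], of r] by simp

lemma low_degree_values_sum:
  "(\<And>i. i \<in> I \<Longrightarrow> g i \<in> low_degree_values R y d) \<Longrightarrow> sum g I \<in> low_degree_values R y d"
  by (induction I rule: infinite_finite_induct)
     (auto intro: low_degree_values_const zero_mem low_degree_values_add)

end

lemma low_degree_values_0: "a \<in> low_degree_values R y 0 \<Longrightarrow> a \<in> R"
  by (auto simp: low_degree_values_def)

text \<open>Multiplying a relation of degree \<open>n\<close> by the other relation lowers its degree, so a minimal
  pair of relations is impossible.\<close>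

lemma (in type_subring) relation_degree_reduction:
  fixes y p :: 'a
  assumes "p \<in> R" "p * p' = 1" "y * z = 1"
    and n: "p' \<in> low_degree_values R y (Suc n)" and m: "p' \<in> low_degree_values R z m" "m \<le> Suc n"
  shows "p' \<in> low_degree_values R y n"
proof -
  obtain a where a: "p' = (\<Sum>i\<le>Suc n. a i * y ^ i)" "\<forall>i. a i \<in> R"
    using n by (auto simp: low_degree_values_def)
  obtain q where q: "p' = (\<Sum>i\<le>m. q i * z ^ i)" "\<forall>i. q i \<in> R"
    using m by (auto simp: low_degree_values_def)
  define s where "s = (\<Sum>i\<le>n. a i * y ^ i)"
  define e where "e = p' - q 0"
  have s: "s \<in> low_degree_values R y n" unfolding s_def using a by (auto intro: low_degree_valuesI)
  have as: "p' = s + a (Suc n) * y ^ Suc n" using a by (simp add: s_def)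
  have e1: "e = p' * (1 - p * q 0)"
    using assms(2) by (simp add: e_def algebra_simps)
      (metis mult.commute mult.left_commute mult_1_right)
  have "e = (\<Sum>i\<in>{..m} - {0}. q i * z ^ i)"
    unfolding e_def q(1) by (subst sum.remove[of _ 0]) auto
  then have "y ^ Suc n * e = (\<Sum>i\<in>{..m} - {0}. q i * (y ^ Suc n * z ^ i))"
    by (simp only: sum_distrib_left) (simp add: algebra_simps)
  also have "\<dots> = (\<Sum>i\<in>{..m} - {0}. q i * y ^ (Suc n - i))"
  proof (intro sum.cong refl)
    fix i assume i: "i \<in> {..m} - {0}"
    have "y ^ Suc n * z ^ i = y ^ (Suc n - i) * (y ^ i * z ^ i)"
      using i m by (subst mult.assoc[symmetric], subst power_add[symmetric]) auto
    also have "y ^ i * z ^ i = 1" using assms by (simp flip: power_mult_distrib)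
    finally show "q i * (y ^ Suc n * z ^ i) = q i * y ^ (Suc n - i)" by simp
  qed
  finally have e2: "y ^ Suc n * e \<in> low_degree_values R y n"
    using q by (auto intro!: low_degree_values_sum low_degree_values_smult low_degree_values_power)
  have "p' = q 0 + e" by (simp add: e_def)
  \<comment> \<open>The top term of \<open>p'\<close> gets multiplied by \<open>1 - p * q 0\<close>,
    which equals \<open>p * e\<close>. This turns \<open>y ^ Suc n\<close> into
    \<open>y ^ Suc n * e\<close>, and the relation in \<open>z\<close> makes that a value of degree
    at most \<open>n\<close>.\<close>
  also have "e = (1 - p * q 0) * s + (a (Suc n) * p) * (y ^ Suc n * e)"
  proof -
    have "e = p' * (1 - p * q 0)" by (fact e1)
    also have "\<dots> = (1 - p * q 0) * s + a (Suc n) * y ^ Suc n * (1 - p * q 0)"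
      by (subst as) (simp add: algebra_simps)
    also have "1 - p * q 0 = p * e" using assms(2) by (simp add: e_def algebra_simps)
    also have "a (Suc n) * y ^ Suc n * (p * e) = (a (Suc n) * p) * (y ^ Suc n * e)"
      by (simp add: algebra_simps)
    finally show ?thesis using assms(2) by (simp add: e_def algebra_simps)
  qed
  finally have e: "p' = q 0 + ((1 - p * q 0) * s + (a (Suc n) * p) * (y ^ Suc n * e))" .
  show ?thesis
    by (subst e, intro low_degree_values_add low_degree_values_smult s e2)
       (use q a assms(1) in \<open>auto intro: low_degree_values_const diff_mem mult_mem one_mem\<close>)
qed

lemma type_subring_Union_chain:
  assumes "C \<noteq> {}" "\<And>R. R \<in> C \<Longrightarrow> type_subring R" "\<And>R S. R \<in> C \<Longrightarrow> S \<in> C \<Longrightarrow> R \<subseteq> S \<or> S \<subseteq> R"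
  shows "type_subring (\<Union> C)"
proof
  show "1 \<in> \<Union> C" using assms(1,2) type_subring.one_mem by blast
next
  fix a b assume "a \<in> \<Union> C" "b \<in> \<Union> C"
  then obtain R where "R \<in> C" "a \<in> R" "b \<in> R" using assms(3) by blast
  then show "a + b \<in> \<Union> C" "a * b \<in> \<Union> C"
    using assms(2) type_subring.add_mem type_subring.mult_mem by blast+
next
  fix a assume "a \<in> \<Union> C"
  then show "- a \<in> \<Union> C" using assms(2) type_subring.uminus_mem by blast
qed

text \<open>By Zorn there is a subring maximal among those that contain \<open>R\<close> and avoid
  \<open>inverse p\<close>. If it contained neither \<open>y\<close> nor \<open>inverse y\<close>,
  adjoining either of them would produce \<open>inverse p\<close>, and the two relations obtained in
  this way could be shortened.\<close>

theorem exists_valuation_ring: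
  fixes p :: "'a::field"
  assumes R: "type_subring R" and p: "p \<in> R" "p \<noteq> 0" "inverse p \<notin> R"
  shows "\<exists>B. valuation_ring B \<and> R \<subseteq> B \<and> inverse p \<notin> B"
proof -
  define A where "A = {S. type_subring S \<and> R \<subseteq> S \<and> inverse p \<notin> S}"
  have "\<exists>S\<in>A. (\<forall>T\<in>A. S \<subseteq> T \<longrightarrow> T = S)"
  proof (rule subset_Zorn_nonempty)
    show "A \<noteq> {}" using R p by (auto simp: A_def)
    fix C assume C: "C \<noteq> {}" "subset.chain A C"
    then have C': "S \<in> A" "S \<in> C \<Longrightarrow> T \<in> C \<Longrightarrow> S \<subseteq> T \<or> T \<subseteq> S" if "S \<in> C" for S T
      using that by (auto simp: subset_chain_def)
    obtain S where "S \<in> C" using C by blast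
    then have "type_subring (\<Union> C)"
      using C' C by (intro type_subring_Union_chain) (auto simp: A_def)
    moreover have "R \<subseteq> \<Union> C" "inverse p \<notin> \<Union> C"
      using C'(1) \<open>S \<in> C\<close> unfolding A_def by blast+
    ultimately show "\<Union> C \<in> A" by (simp add: A_def)
  qed
  then obtain B where B: "type_subring B" "R \<subseteq> B" "inverse p \<notin> B"
    and max: "\<And>T. type_subring T \<Longrightarrow> inverse p \<notin> T \<Longrightarrow> B \<subseteq> T \<Longrightarrow> T = B"
    by (auto simp: A_def)
  interpret type_subring B by fact
  have ex: "\<exists>d. inverse p \<in> low_degree_values B y d" if "y \<notin> B" for y
  proof -
    have "adjoin B y \<noteq> B" using that mem_adjoin[of y] by auto
    then have "inverse p \<in> adjoin B y"
      using max[OF type_subring_adjoin _ subset_adjoin] by blast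
    then show ?thesis by (rule adjoin_imp_low_degree)
  qed
  define least where "least y = (LEAST d. inverse p \<in> low_degree_values B y d)" for y
  \<comment> \<open>By symmetry it is enough to treat the case where the relation in
    \<open>y\<close> has the larger least degree; this is the one that gets shortened.\<close>
  have no: False if "y \<notin> B" "z \<notin> B" "y * z = 1" "least z \<le> least y" for y z
  proof -
    have y: "inverse p \<in> low_degree_values B y (least y)"
      unfolding least_def by (rule LeastI_ex[OF ex[OF that(1)]])
    have z: "inverse p \<in> low_degree_values B z (least z)"
      unfolding least_def by (rule LeastI_ex[OF ex[OF that(2)]])
    show False
    proof (cases "least y")
      case 0
      then show ?thesis using y low_degree_values_0 B by fastforce
    next
      case (Suc n)
      have "inverse p \<in> low_degree_values B y n"
        using relation_degree_reduction[of p "inverse p" y z n "least z"] that y z B p Suc by auto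
      then have "least y \<le> n" unfolding least_def by (rule Least_le)
      then show ?thesis using Suc by simp
    qed
  qed
  have "y \<in> B \<or> inverse y \<in> B" for y
  proof (rule ccontr)
    assume *: "\<not> ?thesis"
    then have "y \<noteq> 0" using zero_mem by auto
    then show False
      using * no[of y "inverse y"] no[of "inverse y" y] linear[of "least y" "least (inverse y)"]
      by auto
  qed
  then have "valuation_ring B" by unfold_locales
  then show ?thesis using B by blast
qed

section \<open>Algebraic integers through valuation rings\<close>

lemma type_subring_Ints: "type_subring (\<int> :: 'a::comm_ring_1 set)"
  by unfold_locales auto

text \<open>If t were not in Z[1/t], Chevalley's theorem would give a valuation ring that contains
  1/t but not t. So t = g(1/t) for an integral g, and multiplication by a power of t turns this into
  the monic relation \<open>h\<close>.\<close>

lemma algebraic_int_if_in_valuation_rings: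
  fixes t :: "'a::field_char_0"
  assumes "\<And>B. valuation_ring B \<Longrightarrow> t \<in> B"
  shows "algebraic_int t"
proof (cases "t = 0")
  case False
  interpret type_subring "adjoin \<int> (inverse t)"
    by (rule type_subring.type_subring_adjoin[OF type_subring_Ints])
  have "inverse (inverse t) \<in> adjoin \<int> (inverse t)"
  proof (rule ccontr)
    assume "\<not> ?thesis"
    then obtain B where "valuation_ring B" "inverse (inverse t) \<notin> B"
      using exists_valuation_ring[OF type_subring_axioms, of "inverse t"] False
        type_subring.mem_adjoin[OF type_subring_Ints] by auto
    then show False using assms by auto
  qed
  then obtain g where g: "t = poly g (inverse t)" "\<forall>i. coeff g i \<in> \<int>"
    by (auto simp: adjoin_def)
  define h where "h = monom 1 (Suc (degree g)) - reflect_poly g"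
  have deg: "degree (reflect_poly g) < Suc (degree g)"
    using degree_reflect_poly_le[of g] by simp
  have "coeff h i \<in> \<int>" for i
    using g by (auto simp: h_def coeff_reflect_poly)
  moreover have "lead_coeff h = 1"
  proof -
    have "degree h = Suc (degree g)"
      using deg unfolding h_def by (subst diff_conv_add_uminus, subst degree_add_eq_left)
        (auto simp: degree_monom_eq)
    then show ?thesis using deg by (simp add: h_def coeff_eq_0)
  qed
  moreover have "poly h t = 0"
    using False g(1) by (simp add: h_def poly_monom poly_reflect_poly_nz)
  ultimately show ?thesis by (intro algebraic_int.intros[of h]) auto
qed auto

text \<open>The \<open>b i\<close> are the Horner values c_i + c_(i+1) y + ... of the relation. They
  lie in every valuation ring: this is clear if y does, and otherwise
  \<open>b (Suc i) = (b i - c_i) / y\<close> can be read upwards from \<open>b 0 = 0\<close>. They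
  serve to write y as a quotient of algebraic integers with control of the denominator.\<close>

lemma horner_coefficients_algebraic_int:
  fixes y :: "'a::field_char_0"
  assumes "\<And>i. coeff g i \<in> \<int>" "poly g y = 0"
  obtains b where "b 0 = 0" "\<And>i. algebraic_int (b i)" "\<And>i. algebraic_int (b (Suc i) * y)"
    "\<And>i. coeff g i = b i - b (Suc i) * y"
proof -
  define b where "b i = poly (poly_shift i g) y" for i
  have rec: "b i = coeff g i + y * b (Suc i)" for i
  proof -
    have "poly_shift i g = pCons (coeff g i) (poly_shift (Suc i) g)"
      by (rule poly_eqI) (auto simp: coeff_poly_shift coeff_pCons split: nat.splits)
    then show ?thesis by (simp add: b_def)
  qed
  have inB: "b i \<in> B" if "valuation_ring B" for B i
  proof -
    interpret valuation_ring B by fact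
    have ints: "coeff g i \<in> B" for i using assms(1)[of i] by (auto elim!: Ints_cases intro: of_int_mem)
    show ?thesis
    proof (cases "y \<in> B")
      case True
      then show ?thesis using ints by (auto simp: b_def coeff_poly_shift intro!: poly_mem)
    next
      case False
      then have y: "inverse y \<in> B" "y \<noteq> 0" using mem_or_inverse_mem zero_mem by auto
      show ?thesis
      proof (induction i)
        case 0
        then show ?case using assms(2) by (simp add: b_def zero_mem)
      next
        case (Suc i)
        have "b (Suc i) = inverse y * (b i - coeff g i)"
          using rec[of i] y(2) by simp
        then show ?case using Suc y ints by (auto intro: mult_mem diff_mem)
      qed
    qed
  qed
  have "algebraic_int (b i)" for i
    by (intro algebraic_int_if_in_valuation_rings inB)
  moreover have "algebraic_int (b (Suc i) * y)" for i
  proof (rule algebraic_int_if_in_valuation_rings)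
    fix B :: "'a set" assume B: "valuation_ring B"
    interpret valuation_ring B by fact
    have "b (Suc i) * y = b i - coeff g i" using rec[of i] by simp
    then show "b (Suc i) * y \<in> B"
      using inB[OF B] assms(1)[of i] by (auto elim!: Ints_cases intro!: of_int_mem diff_mem)
  qed
  moreover have "coeff g i = b i - b (Suc i) * y" for i using rec[of i] by simp
  moreover have "b 0 = 0" using assms(2) by (simp add: b_def)
  ultimately show ?thesis by (intro that)
qed

section \<open>Linear dependence over a subfield\<close>

locale type_subfield = type_subring F for F :: "'a::field set" +
  assumes inverse_mem: "a \<in> F \<Longrightarrow> inverse a \<in> F"
begin

lemma divide_mem: "a \<in> F \<Longrightarrow> b \<in> F \<Longrightarrow> a / b \<in> F"
  by (simp add: divide_inverse mult_mem inverse_mem)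

text \<open>Gaussian elimination on one coordinate \<open>j\<close> at a time: a pivot vector
  \<open>k\<close> clears it from all the others, and its own coefficient is determined
  afterwards.\<close>

lemma linear_dependence:
  assumes "finite J" "finite I" "card J < card I" "\<And>i j. i \<in> I \<Longrightarrow> j \<in> J \<Longrightarrow> V i j \<in> F"
  shows "\<exists>c. (\<forall>i\<in>I. c i \<in> F) \<and> (\<exists>i\<in>I. c i \<noteq> 0) \<and> (\<forall>j\<in>J. (\<Sum>i\<in>I. c i * V i j) = 0)"
  using assms
proof (induction J arbitrary: I V rule: finite_induct)
  case empty
  then have "\<exists>i. i \<in> I" by (metis card_0_eq empty_iff equals0I not_less0)
  then show ?case by (intro exI[of _ "\<lambda>_. 1"]) (auto simp: one_mem)
next
  case (insert j J)
  show ?case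
  proof (cases "\<forall>i\<in>I. V i j = 0")
    case True
    then show ?thesis using insert.IH[of I V] insert.prems insert.hyps by auto
  next
    case False
    then obtain k where k: "k \<in> I" "V k j \<noteq> 0" by auto
    define V' where "V' i l = V i l - V i j / V k j * V k l" for i l
    have "\<exists>c. (\<forall>i\<in>I - {k}. c i \<in> F) \<and> (\<exists>i\<in>I - {k}. c i \<noteq> 0) \<and>
            (\<forall>l\<in>J. (\<Sum>i\<in>I - {k}. c i * V' i l) = 0)"
      using insert.prems insert.hyps k
      by (intro insert.IH) (auto simp: V'_def intro!: diff_mem mult_mem divide_mem)
    then obtain c where c: "\<forall>i\<in>I - {k}. c i \<in> F" "\<exists>i\<in>I - {k}. c i \<noteq> 0"
      "\<forall>l\<in>J. (\<Sum>i\<in>I - {k}. c i * V' i l) = 0" by auto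
    define s where "s = (\<Sum>i\<in>I - {k}. c i * (V i j / V k j))"
    define c' where "c' = c(k := - s)"
    have sum: "(\<Sum>i\<in>I. c' i * V i l) = (\<Sum>i\<in>I - {k}. c i * V' i l)" for l
    proof -
      have "(\<Sum>i\<in>I. c' i * V i l) = - s * V k l + (\<Sum>i\<in>I - {k}. c i * V i l)"
        using k insert.prems by (subst sum.remove[of _ k]) (auto simp: c'_def intro!: sum.cong)
      also have "- s * V k l = - (\<Sum>i\<in>I - {k}. c i * (V i j / V k j * V k l))"
        by (simp add: s_def sum_distrib_right sum_negf mult.assoc)
      finally show ?thesis by (simp add: V'_def algebra_simps sum_subtractf sum.distrib)
    qed
    have "s \<in> F" unfolding s_def
      using c insert.prems k by (intro sum_mem mult_mem divide_mem) auto
    moreover have "(\<Sum>i\<in>I. c' i * V i j) = 0"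
      unfolding sum using k by (simp add: V'_def)
    ultimately show ?thesis
      using c sum k by (intro exI[of _ c']) (auto simp: c'_def uminus_mem)
  qed
qed

lemma span_dependence:
  assumes "finite J" "finite I" "card J < card I"
    and "\<And>i. i \<in> I \<Longrightarrow> \<exists>a. (\<forall>j\<in>J. a j \<in> F) \<and> t i = (\<Sum>j\<in>J. a j * e j)"
  shows "\<exists>c. (\<forall>i\<in>I. c i \<in> F) \<and> (\<exists>i\<in>I. c i \<noteq> 0) \<and> (\<Sum>i\<in>I. c i * t i) = 0"
proof -
  obtain V where V: "\<And>i. i \<in> I \<Longrightarrow> (\<forall>j\<in>J. V i j \<in> F) \<and> t i = (\<Sum>j\<in>J. V i j * e j)"
    using assms(4) by metis
  obtain c where c: "\<forall>i\<in>I. c i \<in> F" "\<exists>i\<in>I. c i \<noteq> 0" "\<forall>j\<in>J. (\<Sum>i\<in>I. c i * V i j) = 0"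
    using linear_dependence[of J I V] assms V by blast
  have "(\<Sum>i\<in>I. c i * t i) = (\<Sum>i\<in>I. \<Sum>j\<in>J. c i * V i j * e j)"
    using V by (intro sum.cong) (auto simp: sum_distrib_left mult.assoc)
  also have "\<dots> = (\<Sum>j\<in>J. (\<Sum>i\<in>I. c i * V i j) * e j)"
    by (subst sum.swap) (simp add: sum_distrib_right)
  finally show ?thesis using c by auto
qed

end

lemma type_subfield_Rats: "type_subfield (\<rat> :: 'a::field_char_0 set)"
  by unfold_locales auto

text \<open>The point is that \<open>n\<close> is uniform in the family: it is the size of a
  spanning set. In this form the finite degree over the rationals enters the proof of
  discreteness.\<close>

lemma number_field_dependence:
  assumes "number_field TYPE('k::field_char_0)"
  obtains n where "\<And>t :: nat \<Rightarrow> 'k.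
    \<exists>c. (\<forall>i\<le>n. c i \<in> \<rat>) \<and> (\<exists>i\<le>n. c i \<noteq> 0) \<and> (\<Sum>i\<le>n. c i * t i) = 0"
proof -
  obtain B :: "'k set" where B: "finite B" "\<forall>x. \<exists>c::'k \<Rightarrow> rat. x = (\<Sum>b\<in>B. of_rat (c b) * b)"
    using assms by (auto simp: number_field_def)
  have "\<exists>c. (\<forall>i\<in>{..card B}. c i \<in> \<rat>) \<and> (\<exists>i\<in>{..card B}. c i \<noteq> 0) \<and> (\<Sum>i\<in>{..card B}. c i * t i) = 0"
    for t :: "nat \<Rightarrow> 'k"
  proof (rule type_subfield.span_dependence[OF type_subfield_Rats, of B _ _ id])
    fix i
    obtain c :: "'k \<Rightarrow> rat" where "t i = (\<Sum>b\<in>B. of_rat (c b) * b)" using B by blast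
    then show "\<exists>a. (\<forall>j\<in>B. a j \<in> \<rat>) \<and> t i = (\<Sum>j\<in>B. a j * id j)"
      by (intro exI[of _ "\<lambda>b. of_rat (c b)"]) auto
  qed (use B in auto)
  then show ?thesis by (intro that[of "card B"]) (simp add: Ball_def Bex_def)
qed

lemma number_field_algebraic:
  assumes "number_field TYPE('k::field_char_0)"
  shows "algebraic (y :: 'k)"
proof -
  obtain n where "\<And>t :: nat \<Rightarrow> 'k.
    \<exists>c. (\<forall>i\<le>n. c i \<in> \<rat>) \<and> (\<exists>i\<le>n. c i \<noteq> 0) \<and> (\<Sum>i\<le>n. c i * t i) = 0"
    using number_field_dependence[OF assms] by blast
  then obtain c where c: "\<forall>i\<le>n. c i \<in> \<rat>" "\<exists>i\<le>n. c i \<noteq> 0" "(\<Sum>i\<le>n. c i * y ^ i) = 0"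
    by blast
  define q where "q = (\<Sum>i\<le>n. monom (c i) i)"
  have co: "coeff q i = (if i \<le> n then c i else 0)" for i
    by (simp add: q_def coeff_sum sum.delta)
  have "q \<noteq> 0" using c(2) co by (metis coeff_0)
  moreover have "poly q y = 0" using c(3) by (simp add: q_def poly_sum poly_monom)
  moreover have "coeff q i \<in> \<rat>" for i using c(1) by (auto simp: co)
  ultimately show ?thesis unfolding algebraic_altdef by blast
qed

text \<open>Division by the content leaves some coefficient prime to \<open>p\<close>, so that the
  relation does not become trivial modulo a prime above \<open>p\<close>.\<close>

lemma algebraic_primitive_relation:
  assumes "algebraic (y :: 'a::field_char_0)" "prime (p::nat)"
  obtains g where "\<And>i. coeff g i \<in> \<int>" "poly g y = 0"
    "\<exists>i n. coeff g i = of_int n \<and> \<not> int p dvd n"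
proof -
  obtain q :: "int poly" where q: "q \<noteq> 0" "poly (map_poly of_int q) y = 0"
    using assms(1) by (elim algebraicE') blast
  define r where "r = primitive_part q"
  have "q = smult (content q) r" by (simp add: r_def)
  then have "map_poly of_int q = smult (of_int (content q)) (map_poly of_int r :: 'a poly)"
    by (metis (no_types, lifting) map_poly_smult of_int_0 of_int_mult)
  then have "poly (map_poly of_int r) y = 0" using q by auto
  moreover have "\<exists>i. \<not> int p dvd coeff r i"
  proof (rule ccontr)
    assume "\<not> ?thesis"
    then have "[:int p:] dvd r" by (simp add: const_poly_dvd_iff)
    then have "int p dvd content r" by (simp add: const_poly_dvd_iff_dvd_content)
    then show False using q assms(2) by (simp add: r_def content_primitive_part)
  qed
  ultimately show ?thesis
    by (intro that[of "map_poly of_int r"]) (auto simp: coeff_map_poly)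
qed

section \<open>Discrete valuation rings and discreteness over number fields\<close>

locale discrete_valuation_ring = valuation_ring B for B :: "'a::field set" +
  fixes u :: 'a
  assumes uniformizer_nz: "u \<noteq> 0"
    and uniformizer_nonunit: "u \<in> nonunits B"
    and exists_order: "y \<noteq> 0 \<Longrightarrow> \<exists>k. vunit B (y / u powi k)"
begin

lemma uniformizer_mem: "u \<in> B"
  using uniformizer_nonunit nonunits_subset by auto

lemma powi_uniformizer_mem_iff: "u powi k \<in> B \<longleftrightarrow> 0 \<le> k"
proof
  assume *: "u powi k \<in> B"
  show "0 \<le> k"
  proof (rule ccontr)
    assume k: "\<not> 0 \<le> k"
    have "u ^ nat (- k) \<in> nonunits B"
      using k by (intro nonunits_power uniformizer_nonunit) auto
    then have "inverse (u ^ nat (- k)) \<notin> B" using nonunit_iff uniformizer_nz by auto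
    then show False using * k by (auto simp: power_int_def power_inverse)
  qed
qed (auto simp: power_int_def uniformizer_mem power_mem)

lemma mem_iff_order:
  assumes "vunit B (y / u powi k)"
  shows "y \<in> B \<longleftrightarrow> 0 \<le> k"
proof
  assume "y \<in> B"
  have "inverse (y / u powi k) * y \<in> B"
    using \<open>y \<in> B\<close> assms by (intro mult_mem) (auto simp: vunit_def)
  moreover have "inverse (y / u powi k) * y = u powi k"
    using assms by (auto simp: vunit_def)
  ultimately show "0 \<le> k" using powi_uniformizer_mem_iff by auto
next
  assume "0 \<le> k"
  then have "(y / u powi k) * u powi k \<in> B"
    using assms powi_uniformizer_mem_iff by (intro mult_mem) (auto simp: vunit_def)
  then show "y \<in> B" using uniformizer_nz by simp
qed

lemma vunit_powi_uniformizer_iff: "vunit B (u powi k) \<longleftrightarrow> k = 0"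
  using powi_uniformizer_mem_iff[of k] powi_uniformizer_mem_iff[of "- k"] uniformizer_nz
  by (auto simp: vunit_def power_int_minus)

lemma order_unique:
  assumes "vunit B (y / u powi k)" "vunit B (y / u powi l)"
  shows "k = l"
proof -
  have "vunit B ((y / u powi k) / (y / u powi l))" using assms by (rule vunit_divide)
  also have "(y / u powi k) / (y / u powi l) = u powi (l - k)"
    using assms uniformizer_nz by (auto simp: vunit_def power_int_diff)
  finally show ?thesis by (simp add: vunit_powi_uniformizer_iff)
qed

lemma change_uniformizer:
  assumes "vunit B (w / u)"
  shows "vunit B (y / w powi k) \<longleftrightarrow> vunit B (y / u powi k)"
proof -
  have nz: "w \<noteq> 0" "u \<noteq> 0" using assms uniformizer_nz by (auto simp: vunit_def)
  have "vunit B ((w / u) powi k)" using assms vunit_powi by blast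
  moreover have "y / u powi k = (y / w powi k) * (w / u) powi k"
    using nz by (simp add: power_int_divide_distrib)
  ultimately show ?thesis
    using vunit_mult[of "y / w powi k"] vunit_mult_cancel[of "(w / u) powi k"]
    by (metis mult.commute)
qed

lemma discrete_valuation_ring_change:
  assumes "vunit B (w / u)"
  shows "discrete_valuation_ring B w"
proof
  show "w \<noteq> 0" using assms by (auto simp: vunit_def)
  have "w / u * u \<in> nonunits B"
    using assms uniformizer_nonunit by (intro nonunits_mult) (auto simp: vunit_def)
  then show "w \<in> nonunits B" using uniformizer_nz by simp
qed (use change_uniformizer[OF assms] exists_order in auto)

end

text \<open>On a number field, a valuation ring whose restriction to the rationals is the
  localisation at \<open>p\<close> is discrete: values that differ modulo the value of \<open>p\<close> belong to elements
  that are linearly independent over the rationals.\<close>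

locale number_field_valuation_ring = valuation_ring B for B :: "'k::field_char_0 set" +
  fixes p :: nat
  assumes number_field: "number_field TYPE('k)"
    and p_nonunit: "of_nat p \<in> nonunits B"
    and p_nz: "p \<noteq> 0"
    and rat_order: "q \<in> \<rat> \<Longrightarrow> q \<noteq> 0 \<Longrightarrow> \<exists>k. vunit B (q * of_nat p powi k)"
begin

lemma associated_up_to_p:
  "\<exists>n. \<forall>t :: nat \<Rightarrow> 'k. (\<forall>i. t i \<noteq> 0) \<longrightarrow> (\<exists>i j k. i < j \<and> j \<le> n \<and> vunit B (t i / t j * of_nat p powi k))"
proof -
  obtain n where n: "\<And>t :: nat \<Rightarrow> 'k.
    \<exists>c. (\<forall>i\<le>n. c i \<in> \<rat>) \<and> (\<exists>i\<le>n. c i \<noteq> 0) \<and> (\<Sum>i\<le>n. c i * t i) = 0"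
    using number_field_dependence[OF number_field] by blast
  have key: "\<exists>i j k. i < j \<and> j \<le> n \<and> vunit B (t i / t j * of_nat p powi k)"
    if nz: "\<forall>i. t i \<noteq> 0" for t :: "nat \<Rightarrow> 'k"
  proof -
    obtain c where c: "\<forall>i\<le>n. c i \<in> \<rat>" "\<exists>i\<le>n. c i \<noteq> 0" "(\<Sum>i\<le>n. c i * t i) = 0"
      using n by blast
    define I where "I = {i. i \<le> n \<and> c i \<noteq> 0}"
    have "\<exists>i\<in>I. \<exists>j\<in>I. i \<noteq> j \<and> vunit B (c i * t i / (c j * t j))"
    proof (rule sum_zero_imp_associated)
      have "(\<Sum>i\<in>I. c i * t i) = (\<Sum>i\<le>n. c i * t i)"
        by (rule sum.mono_neutral_left) (auto simp: I_def)
      then show "(\<Sum>i\<in>I. c i * t i) = 0" using c by simp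
    qed (use c nz in \<open>auto simp: I_def\<close>)
    then obtain i j where ij: "i \<in> I" "j \<in> I" "i \<noteq> j" "vunit B (c i * t i / (c j * t j))" by auto
    have *: "\<exists>i j k. i < j \<and> j \<le> n \<and> vunit B (t i / t j * of_nat p powi k)"
      if ij: "i \<in> I" "j \<in> I" "i < j" "vunit B (c i * t i / (c j * t j))" for i j
    proof -
      have "c i / c j \<in> \<rat>" "c i / c j \<noteq> 0" using c ij by (auto simp: I_def)
      then obtain k where "vunit B (c i / c j * of_nat p powi k)" using rat_order by blast
      from vunit_divide[OF ij(4) this]
      have "vunit B (t i / t j / of_nat p powi k)" using ij c by (simp add: I_def divide_simps)
      then have "vunit B (t i / t j * of_nat p powi (- k))" by (simp add: power_int_minus divide_inverse)
      then show ?thesis using ij by (auto simp: I_def)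
    qed
    show ?thesis
    proof (cases "i < j")
      case True
      then show ?thesis using * ij by blast
    next
      case False
      then show ?thesis using *[of j i] ij vunit_inverse[OF ij(4)] by auto
    qed
  qed
  show ?thesis by (rule exI[of _ n], rule allI, rule impI, rule key)
qed

lemma p_powi_mem: "0 \<le> k \<Longrightarrow> of_nat p powi k \<in> B"
  by (simp add: power_int_def of_nat_mem power_mem)

text \<open>Without a generator of the maximal ideal there would be a sequence of nonunits, starting
  with \<open>p\<close>, of strictly decreasing positive value. Two of its members differ in value
  by a multiple of the value of \<open>p\<close>, which is impossible because all these values are
  positive and at most that of \<open>p\<close>.\<close>

lemma exists_generator:
  obtains w where "w \<in> nonunits B" "w \<noteq> 0" "\<And>y. y \<in> nonunits B \<Longrightarrow> y / w \<in> B"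
proof (rule ccontr)
  assume *: "\<not> thesis"
  have no_gen: "\<exists>y. y \<in> nonunits B \<and> y / w \<notin> B" if "w \<in> nonunits B" "w \<noteq> 0" for w
    using * that \<open>\<And>w. \<lbrakk>w \<in> nonunits B; w \<noteq> 0; \<And>y. y \<in> nonunits B \<Longrightarrow> y / w \<in> B\<rbrakk> \<Longrightarrow> thesis\<close> by blast
  let ?N = "nonunits B - {0}"
  have "\<exists>y\<in>?N. w / y \<in> nonunits B" if wN: "w \<in> ?N" for w
  proof -
    obtain y where y: "y \<in> nonunits B" "y / w \<notin> B" using no_gen[of w] wN by blast
    then have "y \<noteq> 0" "w \<noteq> 0" using wN zero_mem by auto
    then have "w / y \<in> nonunits B" using nonunit_iff[of "w / y"] y by simp
    then show ?thesis using y \<open>y \<noteq> 0\<close> by auto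
  qed
  then obtain next_gen where ng: "\<And>w. w \<in> ?N \<Longrightarrow> next_gen w \<in> ?N \<and> w / next_gen w \<in> nonunits B"
    by metis
  define a where "a n = (next_gen ^^ n) (of_nat p)" for n
  have a: "a n \<in> ?N" for n
    using p_nonunit p_nz ng by (induction n) (auto simp: a_def)
  have step: "a n / a (Suc n) \<in> nonunits B" for n
    using ng[OF a[of n]] by (simp add: a_def)
  have less: "a i / a (i + Suc d) \<in> nonunits B" for i d
  proof (induction d)
    case (Suc d)
    have "a i / a (i + Suc d) * (a (i + Suc d) / a (Suc (i + Suc d))) \<in> nonunits B"
      using Suc step nonunits_subset by (intro nonunits_mult) auto
    then show ?case using a[of "i + Suc d"] by simp
  qed (use step in simp)
  have p_div: "of_nat p / a i \<in> B" for i
  proof (cases i)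
    case 0
    then show ?thesis using p_nz by (simp add: a_def one_mem)
  next
    case (Suc d)
    then show ?thesis using less[of 0 d] nonunits_subset by (auto simp: a_def)
  qed
  obtain n where n: "\<forall>t :: nat \<Rightarrow> 'k. (\<forall>i. t i \<noteq> 0) \<longrightarrow>
      (\<exists>i j k. i < j \<and> j \<le> n \<and> vunit B (t i / t j * of_nat p powi k))"
    using associated_up_to_p ..
  obtain i j k where ij: "i < j" and unit: "vunit B (a i / a j * of_nat p powi k)"
    using n[rule_format, of a] a by auto
  obtain d where d: "j = i + Suc d" using ij less_iff_Suc_add by auto
  have nu: "a i / a j \<in> nonunits B" using less[of i d] d by simp
  show False
  proof (cases "0 \<le> k")
    case True
    then have "of_nat p powi k * (a i / a j) \<in> nonunits B"
      by (intro nonunits_mult nu p_powi_mem)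
    then show ?thesis using unit vunit_not_nonunit by (simp add: mult.commute)
  next
    case False
    have nz: "a i \<noteq> 0" "a j \<noteq> 0" using a by auto
    have "((a i / a j * of_nat p powi k) * of_nat p powi (- k - 1)) * a j \<in> nonunits B"
      using unit False a p_powi_mem[of "- k - 1"]
      by (intro nonunits_mult[OF _ mult_mem[of _ "of_nat p powi (- k - 1)"]])
         (auto simp: vunit_def)
    also have "((a i / a j * of_nat p powi k) * of_nat p powi (- k - 1)) * a j = a i / of_nat p"
      using nz p_nz by (simp add: power_int_diff power_int_minus field_simps)
    finally have "inverse (a i / of_nat p) \<notin> B" using nonunit_iff nz p_nz by simp
    then show False using p_div[of i] by simp
  qed
qed

lemma exists_power_associated_to_p:
  assumes "y \<noteq> 0"
  obtains d k where "d > 0" "vunit B (y ^ d * of_nat p powi k)"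
proof -
  obtain n where n: "\<forall>t :: nat \<Rightarrow> 'k. (\<forall>i. t i \<noteq> 0) \<longrightarrow>
      (\<exists>i j k. i < j \<and> j \<le> n \<and> vunit B (t i / t j * of_nat p powi k))"
    using associated_up_to_p ..
  obtain i j k where ij: "i < j" "vunit B (y ^ i / y ^ j * of_nat p powi k)"
    using n[rule_format, of "\<lambda>i. y ^ i"] assms by auto
  have "inverse (y ^ i / y ^ j * of_nat p powi k) = y ^ (j - i) * of_nat p powi (- k)"
    using assms ij p_nz by (simp add: power_diff power_int_minus field_simps)
  then show ?thesis using vunit_inverse[OF ij(2)] that[of "j - i"] ij by auto
qed

text \<open>A generator \<open>w\<close> of the maximal ideal is a uniformizer as soon as no nonzero
  nonunit is divisible by all powers of \<open>w\<close>; the largest power that divides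
  \<open>y\<close> then leaves a unit as quotient.\<close>

theorem exists_uniformizer: "\<exists>w. discrete_valuation_ring B w"
proof -
  obtain w where w: "w \<in> nonunits B" "w \<noteq> 0" "\<And>y. y \<in> nonunits B \<Longrightarrow> y / w \<in> B"
    using exists_generator by blast
  have pos: "\<exists>k::nat. vunit B (y / w ^ k)" if y: "y \<in> nonunits B" "y \<noteq> 0" for y
  proof -
    \<comment> \<open>The Archimedean property. Suitable powers of \<open>y\<close> and of
      \<open>w\<close> are associated to powers of \<open>p\<close>; eliminating \<open>p\<close>
      shows that a power of \<open>y\<close> is a unit times a fixed power of \<open>w\<close>,
      which bounds the divisibility by \<open>w\<close>.\<close>
    have "\<exists>N. y / w ^ N \<notin> B"
    proof -
      obtain d k where dk: "d > 0" "vunit B (y ^ d * of_nat p powi k)"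
        using exists_power_associated_to_p[OF y(2)] by blast
      obtain d' k' where dk': "d' > 0" "vunit B (w ^ d' * of_nat p powi k')"
        using exists_power_associated_to_p[OF w(2)] by blast
      have neg: "k' < 0"
      proof (rule ccontr)
        assume "\<not> k' < 0"
        then have "of_nat p powi k' * w ^ d' \<in> nonunits B"
          using dk' by (intro nonunits_mult nonunits_power w p_powi_mem) auto
        then show False using dk' vunit_not_nonunit by (simp add: mult.commute)
      qed
      define m where "m = nat (- k')"
      have m: "k' = - int m" "m > 0" using neg by (auto simp: m_def)
      have "vunit B ((y ^ d * of_nat p powi k) ^ m * (w ^ d' * of_nat p powi k') powi k)"
        by (rule vunit_mult[OF vunit_power[OF dk(2)] vunit_powi[OF dk'(2)]])
      also have "(y ^ d * of_nat p powi k) ^ m * (w ^ d' * of_nat p powi k') powi k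
          = y ^ (d * m) * w powi (int d' * k)"
      proof -
        have "(of_nat p powi k :: 'k) ^ m * (of_nat p powi k') powi k
            = of_nat p powi (k * int m) * of_nat p powi (k' * k)"
          by (simp add: power_int_mult flip: power_int_of_nat)
        also have "\<dots> = of_nat p powi (k * int m + k' * k)"
          using p_nz by (simp add: power_int_add)
        also have "\<dots> = 1" by (simp add: m)
        finally have "(of_nat p powi k :: 'k) ^ m * (of_nat p powi k') powi k = 1" .
        moreover have "(w ^ d') powi k = w powi (int d' * k)"
          by (simp add: power_int_mult flip: power_int_of_nat)
        ultimately show ?thesis
          by (simp add: power_mult_distrib power_int_mult_distrib power_mult mult_ac)
      qed
      finally have u: "vunit B (y ^ (d * m) * w powi (int d' * k))" .
      define N where "N = Suc (nat \<bar>int d' * k\<bar>)"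
      have "y / w ^ N \<notin> B"
      proof
        assume "y / w ^ N \<in> B"
        then have "(y / w ^ N) ^ (d * m) \<in> B" by (rule power_mem)
        then have "inverse (y ^ (d * m) * w powi (int d' * k)) * (y / w ^ N) ^ (d * m) \<in> B"
          using u by (intro mult_mem) (auto simp: vunit_def)
        moreover have "inverse (y ^ (d * m) * w powi (int d' * k)) * (y / w ^ N) ^ (d * m)
            = inverse (w powi (int d' * k + int (N * (d * m))))"
        proof -
          have "w powi (int d' * k + int (N * (d * m))) = w powi (int d' * k) * w ^ (N * (d * m))"
            using w by (simp only: power_int_add power_int_of_nat simp_thms)
          moreover have "(y / w ^ N) ^ (d * m) = y ^ (d * m) / w ^ (N * (d * m))"
            by (simp add: power_divide flip: power_mult)
          ultimately show ?thesis using y w by (simp only:) (simp add: field_simps)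
        qed
        moreover have "int d' * k + int (N * (d * m)) > 0"
        proof -
          have "N * 1 \<le> N * (d * m)" using dk m by (intro mult_le_mono2) auto
          moreover have "\<bar>int d' * k\<bar> < int N" by (simp add: N_def)
          ultimately show ?thesis by linarith
        qed
        ultimately obtain r where r: "r > 0" "inverse (w ^ r) \<in> B"
          by (metis int_nat_eq less_le_not_le nat_0_le power_int_of_nat zero_less_nat_eq)
        then show False using nonunits_power[OF w(1) r(1)] nonunit_iff w by auto
      qed
      then show ?thesis by blast
    qed
    define N where "N = (LEAST N. y / w ^ N \<notin> B)"
    have N: "y / w ^ N \<notin> B" unfolding N_def by (rule LeastI_ex) fact
    have "N \<noteq> 0" using N y nonunits_subset by (intro notI) auto
    then obtain M where M: "N = Suc M" by (cases N) auto
    have "y / w ^ M \<in> B" using not_less_Least[of M "\<lambda>N. y / w ^ N \<notin> B"] M by (auto simp: N_def)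
    moreover have "y / w ^ M \<notin> nonunits B" using w(3)[of "y / w ^ M"] N M by (auto simp: mult.commute)
    ultimately show ?thesis by (auto simp: nonunits_def)
  qed
  have "\<exists>k. vunit B (y / w powi k)" if "y \<noteq> 0" for y
    using trichotomy[OF that]
  proof (elim disjE)
    assume "vunit B y"
    then show ?thesis by (intro exI[of _ 0]) simp
  next
    assume "y \<in> nonunits B"
    then show ?thesis using pos that by (metis power_int_of_nat)
  next
    assume "inverse y \<in> nonunits B"
    then obtain k where "vunit B (inverse y / w ^ k)" using pos[of "inverse y"] \<open>y \<noteq> 0\<close> by auto
    then have "vunit B (inverse (inverse y / w ^ k))" by (rule vunit_inverse)
    then show ?thesis
      using w by (intro exI[of _ "- int k"]) (simp add: power_int_minus divide_inverse mult.commute)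
  qed
  then show ?thesis using w by (intro exI[of _ w]) unfold_locales
qed

end

section \<open>A prime of the ring of integers\<close>

locale number_field_prime =
  fixes P :: "'k::field_char_0 set" and p :: nat
  assumes number_field: "number_field TYPE('k)"
    and prime_p: "prime p"
    and prime_over: "prime_over p P"
begin

abbreviation "OK \<equiv> ring_of_integers :: 'k ring"

lemma primeideal_P: "primeideal P OK"
  and P_inter_Ints: "P \<inter> \<int> = {of_int (int p * k) | k. True}"
  using prime_over by (auto simp: prime_over_def)

lemma OK_simps:
  "carrier OK = {a. algebraic_int a}" "x \<otimes>\<^bsub>OK\<^esub> y = x * y" "x \<oplus>\<^bsub>OK\<^esub> y = x + y"
  "\<one>\<^bsub>OK\<^esub> = 1" "\<zero>\<^bsub>OK\<^esub> = 0"
  by (auto simp: ring_of_integers_def ring_of_type_algebra_def)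

interpretation id: primeideal P OK by (rule primeideal_P)

lemma type_subring_algebraic_int: "type_subring {a :: 'k. algebraic_int a}"
  using id.one_closed id.a_closed id.m_closed
  by unfold_locales (auto simp: OK_simps)

interpretation type_subring "{a :: 'k. algebraic_int a}"
  by (rule type_subring_algebraic_int)

lemma P_subset: "a \<in> P \<Longrightarrow> algebraic_int a"
  using id.Icarr[of a] by (simp add: OK_simps)

lemma P_mult: "a \<in> P \<Longrightarrow> algebraic_int b \<Longrightarrow> b * a \<in> P"
  using id.I_l_closed[of a b] by (simp add: OK_simps)

lemma P_add: "a \<in> P \<Longrightarrow> b \<in> P \<Longrightarrow> a + b \<in> P"
  using additive_subgroup.a_closed[OF id.is_additive_subgroup] by (simp add: OK_simps)

lemma P_uminus: "a \<in> P \<Longrightarrow> - a \<in> P"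
  using P_mult[of a "- 1"] by auto

lemma P_zero: "0 \<in> P"
  using additive_subgroup.zero_closed[OF id.is_additive_subgroup] by (simp add: OK_simps)

lemma P_prime: "algebraic_int a \<Longrightarrow> algebraic_int b \<Longrightarrow> a * b \<in> P \<Longrightarrow> a \<in> P \<or> b \<in> P"
  using id.I_prime[of a b] by (simp add: OK_simps)

lemma one_notin_P: "1 \<notin> P"
proof
  assume "1 \<in> P"
  then have "P = carrier OK" using id.one_imp_carrier by (simp add: OK_simps)
  then show False using id.I_notcarr by simp
qed

lemma of_int_in_P_iff: "of_int n \<in> P \<longleftrightarrow> int p dvd n"
proof
  assume "of_int n \<in> P"
  then have "(of_int n :: 'k) \<in> P \<inter> \<int>" by simp
  then have "(of_int n :: 'k) \<in> {of_int (int p * k) | k. True}" by (simp only: P_inter_Ints)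
  then obtain k where "(of_int n :: 'k) = of_int (int p * k)" by blast
  then show "int p dvd n" by (simp only: of_int_eq_iff dvd_triv_left)
next
  assume "int p dvd n"
  then obtain k where "n = int p * k" by (elim dvdE)
  then have "(of_int n :: 'k) \<in> {of_int (int p * k) | k. True}" by blast
  then show "of_int n \<in> P" using P_inter_Ints by blast
qed

lemma P_maximal:
  assumes s: "algebraic_int s" "s \<notin> P"
  obtains t where "algebraic_int t" "1 - s * t \<in> P"
proof -
  obtain g where g: "lead_coeff g = 1" "\<forall>i. coeff g i \<in> \<int>" "poly g s = 0"
    using s(1) by (auto elim: algebraic_int.cases)
  have alg: "algebraic_int (poly h s)" if "\<forall>i. coeff h i \<in> \<int>" for h
    using poly_mem[of h s] that s by (auto intro: int_imp_algebraic_int)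
  have "\<exists>t. algebraic_int t \<and> 1 - s * t \<in> P"
    if "lead_coeff g = 1" "\<forall>i. coeff g i \<in> \<int>" "poly g s \<in> P" for g
    using that
  proof (induction g)
    case (pCons c h)
    show ?case
    proof (cases "h = 0")
      case True
      then show ?thesis using pCons one_notin_P by auto
    next
      case False
      have h: "lead_coeff h = 1" "\<forall>i. coeff h i \<in> \<int>"
        using pCons.prems False by (auto simp: coeff_pCons split: nat.splits)
      have "c \<in> \<int>" using pCons.prems(2)[rule_format, of 0] by simp
      then obtain n where n: "c = of_int n" by (auto elim: Ints_cases)
      show ?thesis
      proof (cases "int p dvd n")
        case True
        then have "- c \<in> P" using of_int_in_P_iff n P_uminus by auto
        then have "s * poly h s \<in> P" using P_add[of "poly (pCons c h) s" "- c"] pCons.prems by simp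
        then have "poly h s \<in> P" using P_prime s alg h by blast
        then show ?thesis using pCons.IH h by blast
      next
        case False
        then have "coprime (int p) n" using prime_p by (intro prime_imp_coprime) auto
        then obtain u w where "u * n + w * int p = 1"
          using bezout_int[of n "int p"] by (metis coprime_commute coprime_imp_gcd_eq_1)
        then have uw: "of_int u * c + of_int w * of_nat p = (1 :: 'k)"
          by (metis n of_int_1 of_int_add of_int_mult of_int_of_nat_eq)
        have "of_int u * poly (pCons c h) s + of_int w * of_nat p \<in> P"
          using pCons.prems of_int_in_P_iff[of "int p"] by (intro P_add P_mult) auto
        also have "of_int u * poly (pCons c h) s + of_int w * of_nat p
            = 1 - s * (- (of_int u * poly h s))"
          using uw by (simp add: algebra_simps)
        finally show ?thesis
          using mult_mem[of "of_int u" "poly h s"] alg h by (intro exI[of _ "- (of_int u * poly h s)"]) auto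
      qed
    qed
  qed auto
  then show ?thesis using g P_zero that by metis
qed

section \<open>The localization at the prime and its comparison with \<open>val\<close>\<close>

definition localization :: "'k set" where
  "localization = {a / b | a b. algebraic_int a \<and> algebraic_int b \<and> b \<notin> P}"

lemma localizationI: "algebraic_int a \<Longrightarrow> algebraic_int b \<Longrightarrow> b \<notin> P \<Longrightarrow> a / b \<in> localization"
  by (auto simp: localization_def)

lemma localizationE:
  assumes "y \<in> localization"
  obtains a b where "algebraic_int a" "algebraic_int b" "b \<notin> P" "b \<noteq> 0" "y = a / b"
  using assms P_zero by (auto simp: localization_def)

lemma algebraic_int_in_localization: "algebraic_int a \<Longrightarrow> a \<in> localization"
  using localizationI[of a 1] one_notin_P by simp

text \<open>Some coefficient of the primitive relation is an integer prime to \<open>p\<close>. It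
  is the difference of the algebraic integers \<open>b i\<close> and \<open>b (Suc i) * y\<close>,
  so one of them is outside \<open>P\<close> and serves as a denominator, of \<open>y\<close> in the
  first case and of \<open>inverse y\<close> in the second. This is what makes the localization a
  valuation ring.\<close>

lemma fraction_cases:
  obtains a b where "algebraic_int a" "algebraic_int b" "b \<notin> P" "y = a / b"
  | a b where "algebraic_int a" "algebraic_int b" "b \<notin> P" "inverse y = a / b" "y \<noteq> 0" "a \<noteq> 0"
proof -
  obtain g where g: "\<And>i. coeff g i \<in> \<int>" "poly g y = 0"
    "\<exists>i n. coeff g i = of_int n \<and> \<not> int p dvd n"
    using algebraic_primitive_relation[OF number_field_algebraic[OF number_field, of y] prime_p] by metis
  obtain b where b0: "b 0 = 0" and b: "\<And>i. algebraic_int (b i)"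
    "\<And>i. algebraic_int (b (Suc i) * y)" "\<And>i. coeff g i = b i - b (Suc i) * y"
    using horner_coefficients_algebraic_int[OF g(1,2)] by metis
  obtain i n where i: "coeff g i = of_int n" "\<not> int p dvd n" using g by blast
  have "b i \<notin> P \<or> b (Suc i) * y \<notin> P"
  proof (rule ccontr)
    assume "\<not> ?thesis"
    then have "b i + - (b (Suc i) * y) \<in> P" using P_add P_uminus by blast
    then show False using b(3)[of i] i of_int_in_P_iff[of n] by simp
  qed
  then consider "b i \<notin> P" | "b (Suc i) * y \<notin> P" by blast
  then show ?thesis
  proof cases
    case 1
    then have "i \<noteq> 0" using b0 P_zero by metis
    then have "algebraic_int (b i * y)" using b(2) by (cases i) auto
    moreover have "b i \<noteq> 0" using 1 P_zero by metis
    ultimately show ?thesis using that(1)[of "b i * y" "b i"] 1 b by simp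
  next
    case 2
    then have nz: "b (Suc i) \<noteq> 0" "y \<noteq> 0" using P_zero by auto
    then show ?thesis using that(2)[of "b (Suc i)" "b (Suc i) * y"] 2 b by (auto simp: inverse_eq_divide)
  qed
qed

lemma valuation_ring_localization: "valuation_ring localization"
proof
  show "1 \<in> localization" using algebraic_int_in_localization one_mem by blast
next
  fix y assume "y \<in> localization"
  then show "- y \<in> localization"
    by (elim localizationE) (metis algebraic_int_minus localizationI minus_divide_left)
next
  fix y z assume "y \<in> localization" "z \<in> localization"
  then obtain a b c d where ab: "algebraic_int a" "algebraic_int b" "b \<notin> P" "b \<noteq> 0" "y = a / b"
    and cd: "algebraic_int c" "algebraic_int d" "d \<notin> P" "d \<noteq> 0" "z = c / d"
    by (elim localizationE) blast
  have bd: "b * d \<notin> P" "algebraic_int (b * d)" using P_prime ab cd mult_mem[of b d] by auto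
  have "algebraic_int (a * d + c * b)" "algebraic_int (a * c)"
    using ab cd mult_mem[of a d] mult_mem[of c b] mult_mem[of a c] add_mem[of "a * d" "c * b"] by auto
  then have "(a * d + c * b) / (b * d) \<in> localization" "(a * c) / (b * d) \<in> localization"
    using bd localizationI by blast+
  then show "y + z \<in> localization" "y * z \<in> localization"
    using ab cd by (simp_all add: add_frac_eq)
next
  fix y :: 'k
  show "y \<in> localization \<or> inverse y \<in> localization"
    by (rule fraction_cases[of y]) (auto intro: localizationI)
qed

interpretation loc: valuation_ring localization by (rule valuation_ring_localization)

lemma vunit_iff_notin_P:
  assumes "algebraic_int a"
  shows "vunit localization a \<longleftrightarrow> a \<notin> P"
proof
  assume *: "vunit localization a"
  then obtain b c where bc: "algebraic_int b" "algebraic_int c" "c \<notin> P" "inverse a = b / c"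
    unfolding vunit_def by (auto elim: localizationE)
  show "a \<notin> P"
  proof
    assume "a \<in> P"
    then have "b * a \<in> P" using P_mult bc by blast
    moreover have "b * a = c" using * bc P_zero by (auto simp: vunit_def field_simps)
    ultimately show False using bc by simp
  qed
next
  assume "a \<notin> P"
  then have "1 / a \<in> localization" "a \<noteq> 0"
    using localizationI[of 1 a] assms one_mem P_zero by auto
  then show "vunit localization a"
    using assms algebraic_int_in_localization by (auto simp: vunit_def divide_inverse)
qed

lemma of_nat_p_in_P: "of_nat p \<in> P"
  using of_int_in_P_iff[of "int p"] by simp

lemma int_order:
  assumes "n \<noteq> 0"
  shows "\<exists>m::nat. vunit localization (of_int n / of_nat p ^ m)"
proof -
  have "\<not> is_unit (int p)" using prime_p by (metis int_dvd_int_iff not_prime_unit of_nat_1)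
  then obtain k where k: "n = int p ^ multiplicity (int p) n * k" "\<not> int p dvd k"
    using multiplicity_decompose'[of n "int p"] assms by auto
  have p0: "p \<noteq> 0" using prime_p by auto
  have "vunit localization (of_int k)" using k vunit_iff_notin_P of_int_in_P_iff by auto
  moreover have "(of_int n :: 'k) / of_nat p ^ multiplicity (int p) n = of_int k"
    using p0 by (subst k(1)) simp
  ultimately show ?thesis by metis
qed

lemma number_field_valuation_ring: "number_field_valuation_ring localization p"
proof
  show "number_field TYPE('k)" by (rule number_field)
  show p0: "p \<noteq> 0" using prime_p by auto
  show "of_nat p \<in> nonunits localization"
    using of_nat_p_in_P vunit_iff_notin_P P_subset algebraic_int_in_localization
    by (auto simp: nonunits_def)
  fix q :: 'k assume q: "q \<in> \<rat>" "q \<noteq> 0"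
  then obtain a b where ab: "b > 0" "q = of_int a / of_int b"
    by (auto elim!: Rats_cases')
  then have "a \<noteq> 0" using q by auto
  obtain m where m: "vunit localization (of_int a / of_nat p ^ m)" using int_order \<open>a \<noteq> 0\<close> by blast
  obtain l where l: "vunit localization (of_int b / of_nat p ^ l)" using int_order[of b] ab by blast
  have "vunit localization ((of_int a / of_nat p ^ m) / (of_int b / of_nat p ^ l))"
    using m l by (rule loc.vunit_divide)
  also have "(of_int a / of_nat p ^ m) / (of_int b / of_nat p ^ l) = q * of_nat p powi (int l - int m)"
    using p0 ab by (simp add: power_int_diff)
  finally show "\<exists>k. vunit localization (q * of_nat p powi k)" ..
qed

definition ideal_power :: "nat \<Rightarrow> 'k set" where
  "ideal_power m = P [^]\<^bsub>ideals_set OK\<^esub> m"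

lemma ideal_power_0: "ideal_power 0 = {a. algebraic_int a}"
  by (simp add: ideal_power_def nat_pow_def ideals_set_def OK_simps)

lemma ideal_power_Suc: "ideal_power (Suc m) = ideal_prod OK (ideal_power m) P"
  by (simp add: ideal_power_def nat_pow_def ideals_set_def)

lemma ideal_power_add: "a \<in> ideal_power m \<Longrightarrow> b \<in> ideal_power m \<Longrightarrow> a + b \<in> ideal_power m"
  using add_mem ideal_prod.sum[of a OK _ P b]
  by (cases m) (auto simp: ideal_power_0 ideal_power_Suc OK_simps)

lemma ideal_power_mult_P: "a \<in> ideal_power m \<Longrightarrow> b \<in> P \<Longrightarrow> a * b \<in> ideal_power (Suc m)"
  using ideal_prod.prod[of a _ b P OK] by (simp add: ideal_power_Suc OK_simps)

lemma ideal_power_mult: "a \<in> ideal_power m \<Longrightarrow> algebraic_int b \<Longrightarrow> b * a \<in> ideal_power m"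
proof (induction m arbitrary: a)
  case 0
  then show ?case using mult_mem by (simp add: ideal_power_0)
next
  case (Suc m)
  from Suc.prems(1) show ?case unfolding ideal_power_Suc
  proof (induction rule: ideal_prod.induct)
    case (prod i j)
    then show ?case
      using ideal_power_mult_P[of "b * i" m j] Suc
      by (simp add: OK_simps ideal_power_Suc mult.assoc)
  next
    case (sum s1 s2)
    then show ?case
      using ideal_power_add[of "b * s1" "Suc m" "b * s2"] by (simp add: OK_simps ideal_power_Suc algebra_simps)
  qed
qed

lemma ideal_power_antimono: "a \<in> ideal_power (m + d) \<Longrightarrow> a \<in> ideal_power m"
proof (induction d)
  case (Suc d)
  have "a \<in> ideal_prod OK (ideal_power (m + d)) P" using Suc.prems by (simp add: ideal_power_Suc)
  then have "a \<in> ideal_power (m + d)"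
  proof (induction rule: ideal_prod.induct)
    case (prod i j)
    then show ?case using ideal_power_mult[of i _ j] P_subset by (simp add: OK_simps mult.commute)
  next
    case (sum s1 s2)
    then show ?case using ideal_power_add by (simp add: OK_simps)
  qed
  then show ?case by (rule Suc.IH)
qed simp

lemma P_power_in_ideal_power: "r \<in> P \<Longrightarrow> r ^ m \<in> ideal_power m"
  using ideal_power_mult_P[of "r ^ _" _ r] one_mem
  by (induction m) (auto simp: ideal_power_0 mult.commute)

text \<open>Powers of a maximal ideal are primary. With \<open>t\<close> an inverse of
  \<open>s\<close> modulo \<open>P\<close>, the identity a = a (1 - s t) + t (s a) raises the
  exponent of the power that contains \<open>a\<close> by one at a time.\<close>

lemma ideal_power_cancel:
  assumes s: "algebraic_int s" "s \<notin> P" and a: "algebraic_int a" "s * a \<in> ideal_power m"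
  shows "a \<in> ideal_power m"
proof -
  obtain t where t: "algebraic_int t" "1 - s * t \<in> P" using P_maximal s by blast
  have "a \<in> ideal_power k" if "k \<le> m" for k
    using that
  proof (induction k)
    case 0
    then show ?case using a by (simp add: ideal_power_0)
  next
    case (Suc k)
    have "a * (1 - s * t) \<in> ideal_power (Suc k)" using Suc t by (intro ideal_power_mult_P) auto
    moreover have "t * (s * a) \<in> ideal_power (Suc k)"
      using ideal_power_antimono[of "s * a" "Suc k" "m - Suc k"] a t Suc.prems
        ideal_power_mult[of "s * a" "Suc k" t] by simp
    ultimately have "a * (1 - s * t) + t * (s * a) \<in> ideal_power (Suc k)" by (rule ideal_power_add)
    then show ?case by (simp add: algebra_simps)
  qed
  then show ?thesis by simp
qed

text \<open>The powers of \<open>P\<close> coincide with the filtration of the algebraic integers by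
  powers of a uniformizer, so \<open>ideal_ord\<close> is the order with respect to it. In
  particular the number described in \<open>val\<close> is the same for all representations as a
  quotient.\<close>

theorem exists_valuation:
  obtains B u where "discrete_valuation_ring B u" "of_nat p \<in> nonunits B"
    "\<And>y k. y \<noteq> 0 \<Longrightarrow> val P y = Fin k \<longleftrightarrow> vunit B (y / u powi k)"
proof -
  interpret nf: number_field_valuation_ring localization p by (rule number_field_valuation_ring)
  obtain w where "discrete_valuation_ring localization w" using nf.exists_uniformizer by blast
  then interpret dw: discrete_valuation_ring localization w .
  \<comment> \<open>The denominator \<open>s\<close> is a unit of the localization. Replacing
    \<open>w\<close> by its numerator \<open>r\<close> gives a uniformizer that lies in
    \<open>P\<close>, whose powers lie in the powers of \<open>P\<close>.\<close>
  obtain r s where rs: "algebraic_int r" "algebraic_int s" "s \<notin> P" "s \<noteq> 0" "w = r / s"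
    using dw.uniformizer_mem by (elim localizationE)
  have sunit: "vunit localization s" using rs vunit_iff_notin_P by auto
  have "r = w * s" using rs by simp
  then have "vunit localization (r / w)" using sunit dw.uniformizer_nz by simp
  then interpret dr: discrete_valuation_ring localization r by (rule dw.discrete_valuation_ring_change)
  have rP: "r \<in> P" using dr.uniformizer_nonunit vunit_iff_notin_P rs by (auto simp: nonunits_def)
  have power_iff: "a \<in> ideal_power m \<longleftrightarrow> a / r ^ m \<in> localization" if "algebraic_int a" for a m
  proof
    assume "a \<in> ideal_power m"
    then show "a / r ^ m \<in> localization"
    proof (induction m arbitrary: a)
      case 0
      then show ?case using algebraic_int_in_localization by (simp add: ideal_power_0)
    next
      case (Suc m)
      from Suc.prems show ?case unfolding ideal_power_Suc
      proof (induction rule: ideal_prod.induct)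
        case (prod i j)
        have "j / r \<in> localization"
        proof (cases "j = 0")
          case False
          then obtain k where k: "vunit localization (j / r powi k)" using dr.exists_order by blast
          have j: "j \<in> localization" "\<not> vunit localization j"
            using prod P_subset algebraic_int_in_localization vunit_iff_notin_P by auto
          then have "k \<noteq> 0" "0 \<le> k" using k dr.mem_iff_order by auto
          have "j / r / r powi (k - 1) = j / r powi k"
            using dr.uniformizer_nz by (simp add: power_int_diff)
          then have "vunit localization (j / r / r powi (k - 1))" using k by (simp only:)
          then have "j / r \<in> localization \<longleftrightarrow> 0 \<le> k - 1" by (rule dr.mem_iff_order)
          then show ?thesis using \<open>k \<noteq> 0\<close> \<open>0 \<le> k\<close> by simp
        qed (simp add: loc.zero_mem)
        then have "(i / r ^ m) * (j / r) \<in> localization" using Suc prod by (intro loc.mult_mem) auto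
        then show ?case by (simp add: OK_simps mult.commute)
      next
        case (sum s1 s2)
        then show ?case using loc.add_mem by (simp add: OK_simps add_divide_distrib)
      qed
    qed
  next
    assume "a / r ^ m \<in> localization"
    then obtain b c where bc: "algebraic_int b" "algebraic_int c" "c \<notin> P" "c \<noteq> 0" "a / r ^ m = b / c"
      by (elim localizationE)
    then have "c * a = b * r ^ m" using dr.uniformizer_nz by (simp add: field_simps)
    also have "\<dots> \<in> ideal_power m" using bc by (intro ideal_power_mult P_power_in_ideal_power rP)
    finally show "a \<in> ideal_power m" using ideal_power_cancel bc that by blast
  qed
  have ord: "int (ideal_ord P a) = k"
    if a: "algebraic_int a" "vunit localization (a / r powi k)" for a k
  proof -
    have "a \<in> localization" using a algebraic_int_in_localization by blast
    then have k: "k \<ge> 0" using a dr.mem_iff_order by blast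
    have "a \<in> ideal_power m \<longleftrightarrow> m \<le> nat k" for m
    proof -
      have "a / r ^ m / r powi (k - int m) = a / r powi k"
        using dr.uniformizer_nz by (simp add: power_int_diff)
      then have "a / r ^ m \<in> localization \<longleftrightarrow> 0 \<le> k - int m" using a dr.mem_iff_order by metis
      then show ?thesis using power_iff[OF a(1)] k by auto
    qed
    then have "ideal_ord P a = nat k" unfolding ideal_ord_def ideal_power_def[symmetric]
      by (intro Greatest_equality) auto
    then show ?thesis using k by simp
  qed
  have quot: "v = int (ideal_ord P a) - int (ideal_ord P b) \<longleftrightarrow> vunit localization (y / r powi v)"
    if ab: "algebraic_int a" "algebraic_int b" "a \<noteq> 0" "b \<noteq> 0" "y = a / b" for a b y v
  proof -
    obtain k l where kl: "vunit localization (a / r powi k)" "vunit localization (b / r powi l)"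
      using dr.exists_order ab by metis
    have "vunit localization ((a / r powi k) / (b / r powi l))" using kl by (rule loc.vunit_divide)
    moreover have "(a / r powi k) / (b / r powi l) = y / r powi (k - l)"
      using ab dr.uniformizer_nz by (simp add: power_int_diff)
    ultimately have "vunit localization (y / r powi (k - l))" by simp
    then show ?thesis using ord[OF ab(1) kl(1)] ord[OF ab(2) kl(2)] dr.order_unique by auto
  qed
  have "val P y = Fin k \<longleftrightarrow> vunit localization (y / r powi k)" if "y \<noteq> 0" for y k
  proof -
    obtain v where v: "vunit localization (y / r powi v)" using dr.exists_order[of y] \<open>y \<noteq> 0\<close> by auto
    have ex: "\<exists>a b. algebraic_int a \<and> algebraic_int b \<and> a \<noteq> 0 \<and> b \<noteq> 0 \<and> y = a / b"
    proof (rule fraction_cases[of y])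
      fix a b assume "algebraic_int a" "algebraic_int b" "b \<notin> P" "y = a / b"
      then show ?thesis using that by auto
    next
      fix a b assume "algebraic_int a" "algebraic_int b" "b \<notin> P" "inverse y = a / b" "a \<noteq> 0"
      moreover from this have "b \<noteq> 0" using P_zero by metis
      moreover from \<open>inverse y = a / b\<close> have "y = b / a" by (metis inverse_divide inverse_inverse_eq)
      ultimately show ?thesis by blast
    qed
    have "(THE v. \<exists>a b. algebraic_int a \<and> algebraic_int b \<and> a \<noteq> 0 \<and> b \<noteq> 0 \<and> y = a / b \<and>
                  v = int (ideal_ord P a) - int (ideal_ord P b)) = v"
    proof (rule the_equality)
      obtain a b where ab: "algebraic_int a" "algebraic_int b" "a \<noteq> 0" "b \<noteq> 0" "y = a / b"
        using ex by blast
      then show "\<exists>a b. algebraic_int a \<and> algebraic_int b \<and> a \<noteq> 0 \<and> b \<noteq> 0 \<and> y = a / b \<and>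
          v = int (ideal_ord P a) - int (ideal_ord P b)"
        using quot[OF ab] v by blast
    next
      fix l assume "\<exists>a b. algebraic_int a \<and> algebraic_int b \<and> a \<noteq> 0 \<and> b \<noteq> 0 \<and> y = a / b \<and>
          l = int (ideal_ord P a) - int (ideal_ord P b)"
      then obtain a b where ab: "algebraic_int a" "algebraic_int b" "a \<noteq> 0" "b \<noteq> 0" "y = a / b"
        and l: "l = int (ideal_ord P a) - int (ideal_ord P b)" by blast
      show "l = v" using quot[OF ab] l v dr.order_unique by blast
    qed
    then show ?thesis using that v dr.order_unique by (auto simp: val_def)
  qed
  moreover have "of_nat p \<in> nonunits localization" by (rule nf.p_nonunit)
  ultimately show ?thesis using that dr.discrete_valuation_ring_axioms by blast
qed

end

section \<open>Automorphisms of the algebraic closure\<close>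

abbreviation ac_poly :: "'k::field poly \<Rightarrow> 'k alg_closure poly" where
  "ac_poly \<equiv> map_poly to_ac"

lemma coeff_ac_poly [simp]: "coeff (ac_poly p) i = to_ac (coeff p i)"
  by (simp add: coeff_map_poly)

lemma ac_poly_pCons [simp]: "ac_poly (pCons c p) = pCons (to_ac c) (ac_poly p)"
  by (rule poly_eqI) (auto simp: coeff_pCons split: nat.splits)

lemma ac_poly_add [simp]: "ac_poly (p + q) = ac_poly p + ac_poly q"
  by (rule poly_eqI) auto

lemma ac_poly_diff [simp]: "ac_poly (p - q) = ac_poly p - ac_poly q"
  by (rule poly_eqI) auto

lemma ac_poly_mult [simp]: "ac_poly (p * q) = ac_poly p * ac_poly q"
  by (rule poly_eqI) (auto simp: coeff_mult to_ac_sum)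

lemma ac_poly_eq_0_iff [simp]: "ac_poly p = 0 \<longleftrightarrow> p = 0"
  by (auto simp: poly_eq_iff)

lemma degree_ac_poly [simp]: "degree (ac_poly p) = degree p"
  by (rule degree_map_poly) auto

lemma ac_poly_pcompose: "poly (ac_poly (pcompose p q)) y = poly (ac_poly p) (poly (ac_poly q) y)"
  by (induction p) (auto simp: pcompose_pCons)

lemma poly_altdef_le:
  fixes p :: "'a::comm_semiring_1 poly"
  assumes "degree p \<le> n"
  shows "poly p x = (\<Sum>i\<le>n. coeff p i * x ^ i)"
  unfolding poly_altdef by (rule sum.mono_neutral_left) (use assms in \<open>auto simp: coeff_eq_0\<close>)

lemma type_subring_range_to_ac: "type_subring (range (to_ac :: 'k::field \<Rightarrow> _))"
proof
  show "1 \<in> range (to_ac :: 'k \<Rightarrow> _)" by (metis rangeI to_ac_1)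
qed (auto simp flip: to_ac_add to_ac_mult to_ac_minus)

text \<open>Every element of the closure is algebraic over the base. From a relation with nonzero
  constant term the inverse can be read off as a polynomial value, so intermediate rings are
  fields.\<close>

lemma type_subfield_if_contains_base:
  fixes F :: "'k::field alg_closure set"
  assumes "type_subring F" "range to_ac \<subseteq> F"
  shows "type_subfield F"
proof -
  interpret type_subring F by fact
  have "inverse a \<in> F" if a: "a \<in> F" "a \<noteq> 0" for a
  proof -
    have "inverse a \<in> F" if "h \<noteq> 0" "poly (ac_poly h) a = 0" for h :: "'k poly"
      using that
    proof (induction h)
      case (pCons c h)
      show ?case
      proof (cases "c = 0")
        case True
        then show ?thesis using pCons a by auto
      next
        case False
        have "a * poly (ac_poly h) a = - to_ac c"
          using pCons.prems by (simp add: eq_neg_iff_add_eq_0 add.commute)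
        then have "inverse a = - (poly (ac_poly h) a * to_ac (inverse c))"
          using a False by (simp add: field_simps)
        also have "\<dots> \<in> F"
          using assms a by (intro uminus_mem mult_mem poly_mem) (auto simp del: to_ac_inverse)
        finally show ?thesis .
      qed
    qed auto
    then show ?thesis using alg_closure_algebraic[of a] by blast
  qed
  then have "inverse a \<in> F" if "a \<in> F" for a using that by (cases "a = 0") auto
  then show ?thesis by unfold_locales
qed

section \<open>Automorphisms over the base field and their construction from partial
  homomorphisms\<close>

definition ac_aut :: "('k::field alg_closure \<Rightarrow> 'k alg_closure) \<Rightarrow> bool" where
  "ac_aut \<sigma> \<longleftrightarrow> bij \<sigma> \<and> (\<forall>a b. \<sigma> (a + b) = \<sigma> a + \<sigma> b) \<and> (\<forall>a b. \<sigma> (a * b) = \<sigma> a * \<sigma> b) \<and>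
     (\<forall>c. \<sigma> (to_ac c) = to_ac c)"

context
  fixes \<sigma> :: "'k::field alg_closure \<Rightarrow> 'k alg_closure"
  assumes aut: "ac_aut \<sigma>"
begin

lemma ac_aut_simps:
  "\<sigma> (a + b) = \<sigma> a + \<sigma> b" "\<sigma> (a * b) = \<sigma> a * \<sigma> b" "\<sigma> (to_ac c) = to_ac c"
  using aut by (auto simp: ac_aut_def)

lemma ac_aut_bij: "bij \<sigma>"
  using aut by (auto simp: ac_aut_def)

lemma ac_aut_0_1: "\<sigma> 0 = 0" "\<sigma> 1 = 1"
  using ac_aut_simps(3)[of 0] ac_aut_simps(3)[of 1] by simp_all

lemma ac_aut_uminus: "\<sigma> (- a) = - \<sigma> a"
proof -
  have "\<sigma> (to_ac (- 1) * a) = to_ac (- 1) * \<sigma> a" by (simp only: ac_aut_simps)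
  then show ?thesis by simp
qed

lemma ac_aut_diff: "\<sigma> (a - b) = \<sigma> a - \<sigma> b"
  using ac_aut_simps(1)[of a "- b"] by (simp add: ac_aut_uminus)

lemma ac_aut_eq_iff: "\<sigma> a = \<sigma> b \<longleftrightarrow> a = b"
  using ac_aut_bij by (auto simp: bij_def inj_eq)

lemma ac_aut_inverse: "\<sigma> (inverse a) = inverse (\<sigma> a)"
proof (cases "a = 0")
  case False
  then have "\<sigma> a * \<sigma> (inverse a) = 1" by (simp add: ac_aut_0_1 flip: ac_aut_simps)
  then show ?thesis by (simp add: inverse_unique)
qed (simp add: ac_aut_0_1)

lemma ac_aut_inv: "ac_aut (inv_into UNIV \<sigma>)"
proof -
  have "inv_into UNIV \<sigma> (\<sigma> a) = a" "\<sigma> (inv_into UNIV \<sigma> a) = a" for a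
    using ac_aut_bij by (auto simp: bij_def surj_f_inv_f)
  then have *: "inv_into UNIV \<sigma> b = a \<longleftrightarrow> b = \<sigma> a" for a b by metis
  then show ?thesis
    unfolding ac_aut_def
    using ac_aut_bij by (auto simp: bij_imp_bij_inv * ac_aut_simps \<open>\<And>a. \<sigma> (inv_into UNIV \<sigma> a) = a\<close>)
qed

end

lemma ac_aut_comp: "ac_aut \<sigma> \<Longrightarrow> ac_aut \<tau> \<Longrightarrow> ac_aut (\<sigma> \<circ> \<tau>)"
  by (auto simp: ac_aut_def bij_comp)

lemma ac_aut_id: "ac_aut id"
  by (auto simp: ac_aut_def)

text \<open>Homomorphisms over the base field defined on a subring, given by their graphs.\<close>

definition partial_hom :: "('k::field alg_closure \<times> 'k alg_closure) set \<Rightarrow> bool" where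
  "partial_hom R \<longleftrightarrow> (\<forall>c. (to_ac c, to_ac c) \<in> R) \<and>
     (\<forall>a b a' b'. (a, b) \<in> R \<longrightarrow> (a', b') \<in> R \<longrightarrow> (a + a', b + b') \<in> R \<and> (a * a', b * b') \<in> R) \<and>
     (\<forall>b. (0, b) \<in> R \<longrightarrow> b = 0)"

text \<open>\<open>q\<close> is the polynomial obtained from \<open>p\<close> by applying the
  homomorphism to the coefficients; as the homomorphism is a graph, so is this transport.\<close>

definition paired :: "('k::field alg_closure \<times> 'k alg_closure) set \<Rightarrow>
    'k alg_closure poly \<Rightarrow> 'k alg_closure poly \<Rightarrow> bool" where
  "paired R p q \<longleftrightarrow> (\<forall>i. (coeff p i, coeff q i) \<in> R)"

context
  fixes R :: "('k::field alg_closure \<times> 'k alg_closure) set"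
  assumes R: "partial_hom R"
begin

lemma partial_hom_simps:
  "(to_ac c, to_ac c) \<in> R" "(a, b) \<in> R \<Longrightarrow> (a', b') \<in> R \<Longrightarrow> (a + a', b + b') \<in> R"
  "(a, b) \<in> R \<Longrightarrow> (a', b') \<in> R \<Longrightarrow> (a * a', b * b') \<in> R" "(0, b) \<in> R \<Longrightarrow> b = 0"
  using R unfolding partial_hom_def by blast+

lemma partial_hom_0_1: "(0, 0) \<in> R" "(1, 1) \<in> R"
  using partial_hom_simps(1)[of 0] partial_hom_simps(1)[of 1] by simp_all

lemma partial_hom_uminus: "(a, b) \<in> R \<Longrightarrow> (- a, - b) \<in> R"
  using partial_hom_simps(3)[OF partial_hom_simps(1)[of "- 1"], of a b] by simp

lemma partial_hom_diff: "(a, b) \<in> R \<Longrightarrow> (a', b') \<in> R \<Longrightarrow> (a - a', b - b') \<in> R"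
  using partial_hom_simps(2)[OF _ partial_hom_uminus, of a b a' b'] by simp

lemma partial_hom_power: "(a, b) \<in> R \<Longrightarrow> (a ^ n, b ^ n) \<in> R"
  by (induction n) (auto simp: partial_hom_0_1 partial_hom_simps)

lemma partial_hom_sum:
  "(\<And>i. i \<in> I \<Longrightarrow> (g i, h i) \<in> R) \<Longrightarrow> (sum g I, sum h I) \<in> R"
  by (induction I rule: infinite_finite_induct) (auto simp: partial_hom_0_1 partial_hom_simps)

lemma partial_hom_unique: "(a, b) \<in> R \<Longrightarrow> (a, b') \<in> R \<Longrightarrow> b = b'"
  using partial_hom_diff[of a b a b'] partial_hom_simps(4) by fastforce

lemma partial_hom_poly:
  assumes "paired R p q" "(a, b) \<in> R"
  shows "(poly p a, poly q b) \<in> R"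
proof -
  define n where "n = max (degree p) (degree q)"
  have "(\<Sum>i\<le>n. coeff p i * a ^ i, \<Sum>i\<le>n. coeff q i * b ^ i) \<in> R"
    using assms by (intro partial_hom_sum partial_hom_simps(3) partial_hom_power) (auto simp: paired_def)
  then show ?thesis using poly_altdef_le[of p n a] poly_altdef_le[of q n b] by (simp add: n_def)
qed

lemma paired_ac_poly: "paired R (ac_poly h) (ac_poly h)"
  by (simp add: paired_def partial_hom_simps)

text \<open>Injectivity of a homomorphism whose domain is only a subring. If a nonzero
  \<open>a\<close> were sent to 0, every base relation of \<open>a\<close> would have constant term
  0, so \<open>a\<close> could be cancelled from it again and again until nothing remains, against
  algebraicity.\<close>

lemma partial_hom_zero_iff:
  assumes "(a, b) \<in> R"
  shows "a = 0 \<longleftrightarrow> b = 0"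
proof
  assume "b = 0"
  then have a0: "(a, 0) \<in> R" using assms by simp
  show "a = 0"
  proof (rule ccontr)
    assume "a \<noteq> 0"
    have "h = 0" if "poly (ac_poly h) a = 0" for h
      using that
    proof (induction h)
      case (pCons c h)
      have "(poly (ac_poly (pCons c h)) a, poly (ac_poly (pCons c h)) 0) \<in> R"
        by (intro partial_hom_poly paired_ac_poly a0)
      then have "c = 0" using pCons.prems partial_hom_simps(4)[of "to_ac c"] by simp
      then show ?case using pCons \<open>a \<noteq> 0\<close> by simp
    qed simp
    then show False using alg_closure_algebraic[of a] by blast
  qed
qed (use assms partial_hom_simps in auto)

lemma paired_degree:
  assumes "paired R p q"
  shows "degree p = degree q"
proof -
  have "coeff p i = 0 \<longleftrightarrow> coeff q i = 0" for i
    using partial_hom_zero_iff assms by (auto simp: paired_def)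
  then show ?thesis by (metis coeff_eq_0 degree_le nle_le order.antisym)
qed

lemma paired_add: "paired R p q \<Longrightarrow> paired R p' q' \<Longrightarrow> paired R (p + p') (q + q')"
  by (simp add: paired_def partial_hom_simps)

lemma paired_diff: "paired R p q \<Longrightarrow> paired R p' q' \<Longrightarrow> paired R (p - p') (q - q')"
  by (simp add: paired_def partial_hom_diff)

lemma paired_mult: "paired R p q \<Longrightarrow> paired R p' q' \<Longrightarrow> paired R (p * p') (q * q')"
  unfolding paired_def coeff_mult by (auto intro!: partial_hom_sum partial_hom_simps(3))

lemma paired_monom: "(a, b) \<in> R \<Longrightarrow> paired R (monom a n) (monom b n)"
  by (simp add: paired_def partial_hom_0_1)

lemma paired_const: "(a, b) \<in> R \<Longrightarrow> paired R [:a:] [:b:]"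
  using paired_monom[of a b 0] by (simp add: monom_0)

definition extend_hom :: "'k alg_closure \<Rightarrow> 'k alg_closure \<Rightarrow> ('k alg_closure \<times> 'k alg_closure) set" where
  "extend_hom \<alpha> \<beta> = {(poly p \<alpha>, poly q \<beta>) | p q. paired R p q}"

lemma extend_homI: "paired R p q \<Longrightarrow> (poly p \<alpha>, poly q \<beta>) \<in> extend_hom \<alpha> \<beta>"
  by (auto simp: extend_hom_def)

lemma extend_hom:
  assumes "\<And>p q. paired R p q \<Longrightarrow> poly p \<alpha> = 0 \<Longrightarrow> poly q \<beta> = 0"
  shows "partial_hom (extend_hom \<alpha> \<beta>)" "R \<subseteq> extend_hom \<alpha> \<beta>" "(\<alpha>, \<beta>) \<in> extend_hom \<alpha> \<beta>"
proof -
  show sub: "R \<subseteq> extend_hom \<alpha> \<beta>"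
  proof clarify
    fix a b assume "(a, b) \<in> R"
    then show "(a, b) \<in> extend_hom \<alpha> \<beta>" using extend_homI[OF paired_const, of a b] by simp
  qed
  show "(\<alpha>, \<beta>) \<in> extend_hom \<alpha> \<beta>"
    using extend_homI[OF paired_monom[OF partial_hom_0_1(2), of 1], of \<alpha> \<beta>] by (simp add: poly_monom)
  show "partial_hom (extend_hom \<alpha> \<beta>)"
    unfolding partial_hom_def
  proof (intro conjI allI impI)
    fix c show "(to_ac c, to_ac c) \<in> extend_hom \<alpha> \<beta>" using sub partial_hom_simps(1) by blast
  next
    fix a b a' b' assume "(a, b) \<in> extend_hom \<alpha> \<beta>" "(a', b') \<in> extend_hom \<alpha> \<beta>"
    then obtain p q p' q' where *: "paired R p q" "paired R p' q'" "a = poly p \<alpha>" "b = poly q \<beta>"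
      "a' = poly p' \<alpha>" "b' = poly q' \<beta>" unfolding extend_hom_def by blast
    show "(a + a', b + b') \<in> extend_hom \<alpha> \<beta>" "(a * a', b * b') \<in> extend_hom \<alpha> \<beta>"
      using extend_homI[OF paired_add[OF *(1,2)], of \<alpha> \<beta>] extend_homI[OF paired_mult[OF *(1,2)], of \<alpha> \<beta>] *
      by simp_all
  next
    fix b assume "(0, b) \<in> extend_hom \<alpha> \<beta>"
    then show "b = 0" unfolding extend_hom_def using assms by force
  qed
qed

text \<open>\<open>\<beta>\<close> is a root of the image \<open>m'\<close> of a relation
  \<open>m\<close> of least degree for \<open>\<alpha>\<close>. The domain of \<open>R\<close> is a
  ring, so other relations are reduced by pseudo-division: they are first multiplied by the leading
  coefficient of \<open>m\<close>, whose image is nonzero and can be cancelled at the end.\<close>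

lemma extend_hom_exists:
  obtains \<beta> where "\<And>p q. paired R p q \<Longrightarrow> poly p \<alpha> = 0 \<Longrightarrow> poly q \<beta> = 0"
proof -
  define Q where "Q d \<longleftrightarrow> (\<exists>p q. paired R p q \<and> p \<noteq> 0 \<and> poly p \<alpha> = 0 \<and> degree p = d)" for d
  obtain h where "h \<noteq> 0" "poly (ac_poly h) \<alpha> = 0" using alg_closure_algebraic[of \<alpha>] by blast
  then have "Q (degree h)" unfolding Q_def using paired_ac_poly[of h] by (metis ac_poly_eq_0_iff degree_ac_poly)
  define d where "d = (LEAST d. Q d)"
  have "Q d" unfolding d_def by (rule LeastI) fact
  then obtain m m' where m: "paired R m m'" "m \<noteq> 0" "poly m \<alpha> = 0" "degree m = d"
    unfolding Q_def by blast
  have min: "d \<le> degree p" if "paired R p q" "p \<noteq> 0" "poly p \<alpha> = 0" for p q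
    using that unfolding d_def by (intro Least_le) (auto simp: Q_def)
  have "degree m' = d" using paired_degree m by auto
  have "d > 0"
  proof (rule ccontr)
    assume "\<not> d > 0"
    then have "degree m = 0" using m by simp
    then obtain c where "m = [:c:]" by (metis degree_eq_zeroE)
    then show False using m by auto
  qed
  then obtain \<beta> where \<beta>: "poly m' \<beta> = 0"
    using alg_closed_imp_poly_has_root[of m'] \<open>degree m' = d\<close> by auto
  have lead: "(lead_coeff m, lead_coeff m') \<in> R" "lead_coeff m' \<noteq> 0"
    using m \<open>degree m' = d\<close> partial_hom_zero_iff[of "lead_coeff m" "lead_coeff m'"]
    by (auto simp: paired_def)
  have "poly q \<beta> = 0" if "paired R p q" "poly p \<alpha> = 0" for p q
    using that
  proof (induction "degree p" arbitrary: p q rule: less_induct)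
    case less
    show ?case
    proof (cases "p = 0")
      case True
      have "coeff q i = 0" for i
        using less.prems(1)[unfolded paired_def, rule_format, of i] True partial_hom_simps(4) by simp
      then show ?thesis by (simp add: poly_altdef)
    next
      case False
      then have dp: "d \<le> degree p" using min less.prems by blast
      have dq: "degree q = degree p" using paired_degree less.prems by auto
      define e where "e = degree p - d"
      define p2 where "p2 = [:lead_coeff m:] * p - monom (lead_coeff p) e * m"
      define q2 where "q2 = [:lead_coeff m':] * q - monom (lead_coeff q) e * m'"
      have "(lead_coeff p, lead_coeff q) \<in> R" using less.prems dq by (auto simp: paired_def)
      then have pq2: "paired R p2 q2"
        unfolding p2_def q2_def
        by (intro paired_diff paired_mult paired_const paired_monom lead less.prems m)
      have p2: "poly p2 \<alpha> = 0" using less.prems m by (simp add: p2_def)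
      have "poly q2 \<beta> = 0"
      proof (cases "degree p = 0")
        case True
        then show ?thesis using dp \<open>d > 0\<close> by simp
      next
        case pos: False
        have "degree p2 < degree p"
        proof (rule degree_lessI)
          show "p2 \<noteq> 0 \<or> degree p > 0" using pos by simp
          show "\<forall>k\<ge>degree p. coeff p2 k = 0"
          proof (intro allI impI)
            fix k assume k: "degree p \<le> k"
            show "coeff p2 k = 0"
            proof (cases "k = degree p")
              case True
              then show ?thesis using dp m by (simp add: p2_def e_def coeff_monom_mult)
            next
              case False
              then have "coeff p k = 0" "coeff m (k - e) = 0"
                using k dp m by (auto intro!: coeff_eq_0 simp: e_def)
              then show ?thesis by (simp add: p2_def coeff_monom_mult)
            qed
          qed
        qed
        then show ?thesis using less.hyps pq2 p2 by blast
      qed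
      then show ?thesis using \<beta> lead by (simp add: q2_def)
    qed
  qed
  then show ?thesis using that by blast
qed

end

text \<open>A maximal partial homomorphism is total because it could otherwise be extended by one
  more element. It is surjective because it maps the finite root set of each base polynomial
  injectively into itself.\<close>

theorem exists_ac_aut_extending:
  fixes R :: "('k::field alg_closure \<times> 'k alg_closure) set"
  assumes "partial_hom R"
  shows "\<exists>\<sigma>. ac_aut \<sigma> \<and> (\<forall>(a, b)\<in>R. \<sigma> a = b)"
proof -
  define A where "A = {S. partial_hom S \<and> R \<subseteq> S}"
  have "\<exists>S\<in>A. (\<forall>T\<in>A. S \<subseteq> T \<longrightarrow> T = S)"
  proof (rule subset_Zorn_nonempty)
    show "A \<noteq> {}" using assms by (auto simp: A_def)
    fix C assume C: "C \<noteq> {}" "subset.chain A C"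
    then have hom: "partial_hom S" "R \<subseteq> S" if "S \<in> C" for S
      using that by (auto simp: subset_chain_def A_def)
    have lin: "S \<subseteq> T \<or> T \<subseteq> S" if "S \<in> C" "T \<in> C" for S T
      using C that by (auto simp: subset_chain_def)
    obtain S0 where S0: "S0 \<in> C" using C by blast
    have "partial_hom (\<Union> C)"
      unfolding partial_hom_def
    proof (intro conjI allI impI)
      fix c show "(to_ac c, to_ac c) \<in> \<Union> C" using S0 partial_hom_simps(1)[OF hom(1)] by blast
    next
      fix a b a' b' assume "(a, b) \<in> \<Union> C" "(a', b') \<in> \<Union> C"
      then obtain S where "S \<in> C" "(a, b) \<in> S" "(a', b') \<in> S" using lin by blast
      then show "(a + a', b + b') \<in> \<Union> C" "(a * a', b * b') \<in> \<Union> C"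
        using partial_hom_simps(2,3)[OF hom(1)] by blast+
    next
      fix b assume "(0, b) \<in> \<Union> C"
      then show "b = 0" using partial_hom_simps(4)[OF hom(1)] by blast
    qed
    moreover have "R \<subseteq> \<Union> C" using S0 hom(2) by blast
    ultimately show "\<Union> C \<in> A" by (simp add: A_def)
  qed
  then obtain S where S: "partial_hom S" "R \<subseteq> S"
    and max: "\<And>T. partial_hom T \<Longrightarrow> S \<subseteq> T \<Longrightarrow> T = S"
    by (force simp: A_def)
  have total: "\<exists>b. (a, b) \<in> S" for a
  proof -
    obtain b where b: "\<And>p q. paired S p q \<Longrightarrow> poly p a = 0 \<Longrightarrow> poly q b = 0"
      using extend_hom_exists[OF S(1)] by metis
    have ext: "partial_hom (extend_hom S a b)" "S \<subseteq> extend_hom S a b" "(a, b) \<in> extend_hom S a b"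
      by (rule extend_hom[OF S(1)], rule b, assumption+)+
    then show ?thesis using max by blast
  qed
  define \<sigma> where "\<sigma> a = (SOME b. (a, b) \<in> S)" for a
  have mem: "(a, \<sigma> a) \<in> S" for a unfolding \<sigma>_def using total by (rule someI_ex)
  have eq: "\<sigma> a = b" if "(a, b) \<in> S" for a b using partial_hom_unique[OF S(1)] mem that by blast
  have hom: "\<sigma> (a + b) = \<sigma> a + \<sigma> b" "\<sigma> (a * b) = \<sigma> a * \<sigma> b" "\<sigma> (to_ac c) = to_ac c" for a b c
    by (rule eq, intro partial_hom_simps[OF S(1)] mem)+
  have "inj \<sigma>"
  proof (rule injI)
    fix a b assume "\<sigma> a = \<sigma> b"
    then have "(a - b, 0) \<in> S" using partial_hom_diff[OF S(1) mem[of a] mem[of b]] by simp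
    then show "a = b" using partial_hom_zero_iff[OF S(1)] by fastforce
  qed
  moreover have "surj \<sigma>"
    unfolding surj_def
  proof (rule allI)
    fix b
    obtain h :: "'k poly" where h: "h \<noteq> 0" "poly (ac_poly h) b = 0" using alg_closure_algebraic[of b] by blast
    define Z where "Z = {z. poly (ac_poly h) z = 0}"
    have "\<sigma> (poly (ac_poly h) z) = poly (ac_poly h) (\<sigma> z)" for z
      using partial_hom_poly[OF S(1) paired_ac_poly[OF S(1)] mem] eq by blast
    then have "\<sigma> ` Z \<subseteq> Z" using hom(3)[of 0] by (auto simp: Z_def) (metis)
    moreover have "finite Z" unfolding Z_def using h by (intro poly_roots_finite) auto
    ultimately have "\<sigma> ` Z = Z"
      using \<open>inj \<sigma>\<close> by (intro endo_inj_surj) (auto intro: inj_on_subset)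
    then show "\<exists>a. b = \<sigma> a" using h by (auto simp: Z_def)
  qed
  ultimately have "ac_aut \<sigma>" using hom by (auto simp: ac_aut_def bij_def)
  then show ?thesis using eq S by (intro exI[of _ \<sigma>]) auto
qed

text \<open>By minimality of its degree, \<open>h\<close> divides every polynomial that vanishes at
  \<open>\<alpha>\<close>; hence evaluation at \<open>\<alpha>\<close> determines evaluation at
  \<open>\<beta>\<close>.\<close>

theorem exists_ac_aut_root:
  fixes h :: "'k::field poly"
  assumes "poly (ac_poly h) \<alpha> = 0" "poly (ac_poly h) \<beta> = 0" "h \<noteq> 0"
    and min: "\<And>p. p \<noteq> 0 \<Longrightarrow> poly (ac_poly p) \<alpha> = 0 \<Longrightarrow> degree h \<le> degree p"
  shows "\<exists>\<sigma>. ac_aut \<sigma> \<and> \<sigma> \<alpha> = \<beta>"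
proof -
  define R where "R = {(poly (ac_poly p) \<alpha>, poly (ac_poly p) \<beta>) | p. True}"
  have RI: "(poly (ac_poly p) \<alpha>, poly (ac_poly p) \<beta>) \<in> R" for p by (auto simp: R_def)
  have "partial_hom R"
    unfolding partial_hom_def
  proof (intro conjI allI impI)
    fix c show "(to_ac c, to_ac c) \<in> R" using RI[of "[:c:]"] by simp
  next
    fix a b a' b' assume "(a, b) \<in> R" "(a', b') \<in> R"
    then obtain p q where "a = poly (ac_poly p) \<alpha>" "b = poly (ac_poly p) \<beta>"
      "a' = poly (ac_poly q) \<alpha>" "b' = poly (ac_poly q) \<beta>" by (auto simp: R_def)
    then show "(a + a', b + b') \<in> R" "(a * a', b * b') \<in> R"
      using RI[of "p + q"] RI[of "p * q"] by simp_all
  next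
    fix b assume "(0, b) \<in> R"
    then obtain p where p: "poly (ac_poly p) \<alpha> = 0" "b = poly (ac_poly p) \<beta>" by (auto simp: R_def)
    have split: "ac_poly p = ac_poly (p div h) * ac_poly h + ac_poly (p mod h)"
      by (metis ac_poly_add ac_poly_mult div_mult_mod_eq)
    have "poly (ac_poly (p mod h)) \<alpha> = 0" using p assms(1) split by simp
    then have "p mod h = 0" using min[of "p mod h"] degree_mod_less'[of h p] assms(3) by fastforce
    then show "b = 0" using p split assms(2) by simp
  qed
  then obtain \<sigma> where "ac_aut \<sigma>" "\<forall>(a, b)\<in>R. \<sigma> a = b" using exists_ac_aut_extending by blast
  then show ?thesis using RI[of "[:0, 1:]"] by (intro exI[of _ \<sigma>]) auto
qed

text \<open>The conjugation a + b \<delta> to a - b \<delta> of the quadratic extension of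
  \<open>F\<close> is well defined because \<open>\<delta>\<close> is outside the field
  \<open>F\<close>. It is the source of all elements that are odd at a prescribed node.\<close>

theorem exists_ac_aut_conjugate_sqrt:
  fixes F :: "'k::field alg_closure set"
  assumes F: "type_subring F" "range to_ac \<subseteq> F" and d: "\<delta> \<notin> F" "\<delta> * \<delta> \<in> F"
  shows "\<exists>\<sigma>. ac_aut \<sigma> \<and> (\<forall>a\<in>F. \<sigma> a = a) \<and> \<sigma> \<delta> = - \<delta>"
proof -
  interpret type_subfield F by (rule type_subfield_if_contains_base) fact+
  define R where "R = {(a + b * \<delta>, a - b * \<delta>) | a b. a \<in> F \<and> b \<in> F}"
  have RI: "(a + b * \<delta>, a - b * \<delta>) \<in> R" if "a \<in> F" "b \<in> F" for a b using that by (auto simp: R_def)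
  have "partial_hom R"
    unfolding partial_hom_def
  proof (intro conjI allI impI)
    fix c show "(to_ac c, to_ac c) \<in> R" using RI[of "to_ac c" 0] F zero_mem by auto
  next
    fix a b a' b' assume "(a, b) \<in> R" "(a', b') \<in> R"
    then obtain s t s' t' where *: "s \<in> F" "t \<in> F" "s' \<in> F" "t' \<in> F" "a = s + t * \<delta>" "b = s - t * \<delta>"
      "a' = s' + t' * \<delta>" "b' = s' - t' * \<delta>" by (auto simp: R_def)
    have "(s + s') \<in> F" "t + t' \<in> F" using * add_mem by auto
    from RI[OF this] show "(a + a', b + b') \<in> R" by (simp add: * algebra_simps)
    have "s * s' + t * t' * (\<delta> * \<delta>) \<in> F" "s * t' + t * s' \<in> F" using * d add_mem mult_mem by simp_all
    from RI[OF this] show "(a * a', b * b') \<in> R" by (simp add: * algebra_simps)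
  next
    fix b assume "(0, b) \<in> R"
    then obtain s t where *: "s \<in> F" "t \<in> F" "s + t * \<delta> = 0" "b = s - t * \<delta>" by (auto simp: R_def)
    have "t = 0"
    proof (rule ccontr)
      assume "t \<noteq> 0"
      then have "\<delta> = - s / t" using * by (simp add: field_simps eq_neg_iff_add_eq_0)
      then show False using * d uminus_mem divide_mem by auto
    qed
    then show "b = 0" using * by simp
  qed
  then obtain \<sigma> where \<sigma>: "ac_aut \<sigma>" "\<forall>(a, b)\<in>R. \<sigma> a = b" using exists_ac_aut_extending by blast
  have "\<sigma> a = a" if "a \<in> F" for a using RI[OF that zero_mem] \<sigma> by auto
  moreover have "\<sigma> \<delta> = - \<delta>" using RI[OF zero_mem one_mem] \<sigma> by auto
  ultimately show ?thesis using \<sigma> by blast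
qed

section \<open>Extending the valuation to the algebraic closure\<close>

text \<open>A valuation ring of the closure above a discrete one of the base field. Base elements
  have integral order with respect to \<open>u\<close>; the values of other elements are only known
  as fractions, which explains the form of \<open>has_order\<close>.\<close>

locale ac_valuation = valuation_ring V for V :: "'k::field_char_0 alg_closure set" +
  fixes u :: 'k
  assumes u_nz: "u \<noteq> 0"
    and u_nonunit: "to_ac u \<in> nonunits V"
    and base_order: "c \<noteq> 0 \<Longrightarrow> \<exists>k. vunit V (to_ac c / to_ac u powi k)"
begin

text \<open>This says that the value of \<open>y\<close> is \<open>k / N\<close> times that of the uniformizer \<open>u\<close>.\<close>

definition has_order :: "nat \<Rightarrow> 'k alg_closure \<Rightarrow> int \<Rightarrow> bool" where
  "has_order N y k \<longleftrightarrow> vunit V (y ^ N / to_ac u powi k)"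

lemma has_order_mult:
  assumes "has_order N y k" "has_order N z l"
  shows "has_order N (y * z) (k + l)"
proof -
  have "(y * z) ^ N / to_ac u powi (k + l) = (y ^ N / to_ac u powi k) * (z ^ N / to_ac u powi l)"
    using u_nz by (simp add: power_int_add power_mult_distrib)
  then show ?thesis using assms vunit_mult unfolding has_order_def by metis
qed

lemma has_order_inverse:
  assumes "has_order N y k"
  shows "has_order N (inverse y) (- k)"
proof -
  have "inverse y ^ N / to_ac u powi (- k) = inverse (y ^ N / to_ac u powi k)"
    by (simp add: power_int_minus power_inverse field_simps)
  then show ?thesis using assms vunit_inverse unfolding has_order_def by metis
qed

lemma has_order_divide:
  assumes "has_order N y k" "has_order N z l"
  shows "has_order N (y / z) (k - l)"
  using has_order_mult[OF assms(1) has_order_inverse[OF assms(2)]] by (simp add: divide_inverse)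

lemma has_order_vunit: "vunit V y \<Longrightarrow> has_order N y 0"
  by (simp add: has_order_def vunit_power)

lemma has_order_power: "has_order N y k \<Longrightarrow> has_order N (y ^ m) (int m * k)"
proof (induction m)
  case (Suc m)
  then show ?case using has_order_mult[of N y k "y ^ m" "int m * k"] by (simp add: algebra_simps)
qed (simp add: has_order_vunit vunit_1)

lemma u_powi_vunit_iff: "vunit V (to_ac u powi k) \<longleftrightarrow> k = 0"
proof
  assume *: "vunit V (to_ac u powi k)"
  have **: False if "vunit V (to_ac u powi k)" "k > 0" for k
    using nonunits_power[OF u_nonunit, of "nat k"] vunit_not_nonunit that
    by (auto simp: power_int_def)
  show "k = 0"
  proof (rule ccontr)
    assume "k \<noteq> 0"
    then show False
      using ** * **[of "- k"] vunit_inverse[OF *] by (cases "k > 0") (auto simp: power_int_minus)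
  qed
qed (simp add: vunit_1)

lemma has_order_unique:
  assumes "has_order N y k" "has_order N y l"
  shows "k = l"
proof -
  have "vunit V ((y ^ N / to_ac u powi k) / (y ^ N / to_ac u powi l))"
    using assms unfolding has_order_def by (rule vunit_divide)
  also have "(y ^ N / to_ac u powi k) / (y ^ N / to_ac u powi l) = to_ac u powi (l - k)"
    using assms u_nz by (auto simp: has_order_def vunit_def power_int_diff)
  finally show ?thesis by (simp add: u_powi_vunit_iff)
qed

lemma has_order_nz: "has_order N y k \<Longrightarrow> N > 0 \<Longrightarrow> y \<noteq> 0"
  by (auto simp: has_order_def vunit_def zero_power)

lemma has_order_scale:
  assumes "has_order N y k"
  shows "has_order (N * m) y (k * int m)"
proof -
  have "y ^ (N * m) / to_ac u powi (k * int m) = (y ^ N / to_ac u powi k) ^ m"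
    by (simp add: power_divide power_mult power_int_mult)
  then show ?thesis using assms vunit_power unfolding has_order_def by metis
qed

lemma has_order_base: "c \<noteq> 0 \<Longrightarrow> \<exists>k. has_order N (to_ac c) (int N * k)"
proof -
  assume "c \<noteq> 0"
  then obtain k where "has_order 1 (to_ac c) k" using base_order by (auto simp: has_order_def)
  from has_order_scale[OF this, of N] show ?thesis by (auto simp: mult.commute)
qed

text \<open>If y has value 1/N, then the terms c_i y^i with i < N have values in different classes
  modulo the integers, so a sum of such terms cannot vanish.\<close>

lemma degree_ge_if_has_order_1:
  assumes "has_order N y 1" "p \<noteq> 0" "poly (ac_poly p) y = 0"
  shows "N \<le> degree p"
proof (rule ccontr)
  assume lt: "\<not> N \<le> degree p"
  define I where "I = {i. coeff p i \<noteq> 0}"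
  define t where "t i = to_ac (coeff p i) * y ^ i" for i
  have le: "i < N" if "i \<in> I" for i using that lt le_degree[of p i] by (auto simp: I_def)
  have y: "y \<noteq> 0" using has_order_nz assms(1) lt by auto
  have "\<exists>i\<in>I. \<exists>j\<in>I. i \<noteq> j \<and> vunit V (t i / t j)"
  proof (rule sum_zero_imp_associated)
    show fin: "finite I" using le by (auto intro: finite_subset[of I "{..<N}"])
    show "I \<noteq> {}" using assms(2) by (auto simp: I_def poly_eq_iff)
    have "poly (ac_poly p) y = (\<Sum>i\<in>I. t i)"
      unfolding poly_altdef t_def
      by (rule sum.mono_neutral_cong_right) (auto simp: I_def le_degree)
    then show "sum t I = 0" using assms(3) by simp
  qed (use y in \<open>auto simp: t_def I_def\<close>)
  then obtain i j where ij: "i \<in> I" "j \<in> I" "i \<noteq> j" "vunit V (t i / t j)" by blast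
  obtain k l where kl: "has_order N (to_ac (coeff p i)) (int N * k)"
    "has_order N (to_ac (coeff p j)) (int N * l)"
    using has_order_base ij unfolding I_def by blast
  have "has_order N (t i) (int N * k + int i)" "has_order N (t j) (int N * l + int j)"
    using has_order_mult[OF kl(1) has_order_power[OF assms(1), of i]]
      has_order_mult[OF kl(2) has_order_power[OF assms(1), of j]] by (simp_all add: t_def)
  from has_order_divide[OF this] have "(int N * k + int i) - (int N * l + int j) = 0"
    using has_order_unique has_order_vunit[OF ij(4)] by blast
  then have "int i - int j = int N * (l - k)" by (simp add: algebra_simps)
  then have "int N dvd int i - int j" by simp
  moreover have "\<bar>int i - int j\<bar> < int N" "int i - int j \<noteq> 0" using le[of i] le[of j] ij by auto
  ultimately show False using dvd_imp_le_int[of "int i - int j" "int N"] by simp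
qed

end

text \<open>Chevalley's theorem is applied to the image of \<open>B\<close>, avoiding the inverse of
  the uniformizer. Since every element of the base is a unit times a power of \<open>u\<close>, this
  single exclusion keeps all nonunits of \<open>B\<close> nonunits.\<close>

lemma exists_ac_valuation:
  fixes B :: "'k::field_char_0 set"
  assumes "discrete_valuation_ring B u"
  obtains V where "ac_valuation V u" "\<And>a. a \<in> B \<Longrightarrow> to_ac a \<in> V"
    "\<And>a. a \<in> nonunits B \<Longrightarrow> to_ac a \<in> nonunits V"
proof -
  interpret discrete_valuation_ring B u by fact
  have "type_subring (to_ac ` B)"
  proof
    show "1 \<in> to_ac ` B" using one_mem by (metis imageI to_ac_1)
  qed (auto simp: add_mem mult_mem uminus_mem simp flip: to_ac_add to_ac_mult to_ac_minus)
  moreover have "inverse (to_ac u) \<notin> to_ac ` B"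
    using uniformizer_nonunit nonunit_iff uniformizer_nz
    by (auto simp flip: to_ac_inverse)
  ultimately obtain V where V: "valuation_ring V" "to_ac ` B \<subseteq> V" "inverse (to_ac u) \<notin> V"
    using exists_valuation_ring[of "to_ac ` B" "to_ac u"] uniformizer_mem uniformizer_nz by auto
  interpret V: valuation_ring V by fact
  have u: "to_ac u \<in> nonunits V" using V V.nonunit_iff uniformizer_nz by auto
  have unit: "vunit V (to_ac a)" if "vunit B a" for a
    using that V(2) by (auto simp: vunit_def simp flip: to_ac_inverse)
  have base: "\<exists>k. vunit V (to_ac c / to_ac u powi k)" if "c \<noteq> 0" for c
  proof -
    obtain k where "vunit B (c / u powi k)" using exists_order \<open>c \<noteq> 0\<close> by blast
    from unit[OF this] show ?thesis
      by (intro exI[of _ k]) (cases "k \<ge> 0"; simp add: power_int_def)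
  qed
  have "to_ac a \<in> nonunits V" if "a \<in> nonunits B" for a
  proof (cases "a = 0")
    case False
    then obtain k where k: "vunit B (a / u powi k)" using exists_order by blast
    then have "k \<ge> 0" "k \<noteq> 0"
      using mem_iff_order that nonunits_subset vunit_not_nonunit by auto
    then obtain m where m: "k = int (Suc m)" by (metis nat_0_le nat_int not0_implies_Suc of_nat_0)
    have "a = (a / u powi k) * u ^ m * u" 
      using uniformizer_nz by (simp only: m power_int_of_nat) (simp add: field_simps)
    then have "to_ac a = to_ac ((a / u powi k) * u ^ m) * to_ac u" by (metis to_ac_mult)
    moreover have "(a / u powi k) * u ^ m \<in> B"
      using k uniformizer_mem by (intro mult_mem power_mem) (auto simp: vunit_def)
    then have "to_ac ((a / u powi k) * u ^ m) \<in> V" using V(2) by blast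
    ultimately show ?thesis using V.nonunits_mult[OF u] by metis
  qed (simp add: V.zero_nonunit)
  moreover have "ac_valuation V u"
    using u base uniformizer_nz by unfold_locales auto
  ultimately show ?thesis using that V(2) by blast
qed

section \<open>Ramification in the preimage tower\<close>

definition cubic :: "'a::field \<Rightarrow> 'a" where
  "cubic z = z\<^sup>2 * (3 - 2 * z)"

lemma cubic_one_minus: "cubic (1 - z) = 1 - cubic z"
  by (simp add: cubic_def power2_eq_square algebra_simps)

section \<open>Values of preimages: total ramification and quadratic steps\<close>

context ac_valuation
begin

text \<open>A Newton polygon with a single slope. The value of \<open>cubic b\<close> is positive
  and at most that of \<open>u\<close>, hence at most that of 3, so the term 3 b^2 is negligible and
  b has a third of the value of \<open>cubic b\<close>. The bound by \<open>u\<close> is carried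
  over to b so that the step can be iterated.\<close>

lemma totally_ramified_step:
  assumes three: "3 \<in> nonunits V" "3 / to_ac u \<in> V"
    and a: "cubic b \<in> nonunits V" "cubic b \<noteq> 0" "to_ac u / cubic b \<in> V"
  shows "b \<in> nonunits V" "b \<noteq> 0" "to_ac u / b \<in> V" "vunit V (cubic b / b ^ 3)"
proof -
  have two: "vunit V (- 2)"
    using vunit_add_nonunit[OF vunit_1 nonunits_uminus[OF three(1)]] by simp
  show b: "b \<noteq> 0" using a by (auto simp: cubic_def)
  have shape: "vunit V (cubic b / b ^ 3)" if "3 / b \<in> nonunits V"
  proof -
    have "vunit V (- 2 + 3 / b)" using two that by (rule vunit_add_nonunit)
    also have "- 2 + 3 / b = cubic b / b ^ 3"
      using b by (simp add: cubic_def field_simps power2_eq_square power3_eq_cube)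
    finally show ?thesis .
  qed
  have "\<not> inverse b \<in> nonunits V"
  proof
    assume inv: "inverse b \<in> nonunits V"
    then have "3 * inverse b \<in> nonunits V" by (intro nonunits_mult numeral_mem)
    then have "vunit V (cubic b / b ^ 3)" by (intro shape) (simp add: divide_inverse)
    moreover have "cubic b * inverse b ^ 3 \<in> nonunits V"
      using a inv nonunits_subset by (intro nonunits_mult nonunits_power) auto
    ultimately show False using vunit_not_nonunit by (simp add: divide_inverse power_inverse)
  qed
  moreover have "\<not> vunit V b"
  proof
    assume "vunit V b"
    then have "vunit V (- 2 * b + 3)" using two three by (intro vunit_add_nonunit vunit_mult)
    then have "vunit V (b ^ 2 * (- 2 * b + 3))" using \<open>vunit V b\<close> vunit_mult vunit_power by blast
    moreover have "b ^ 2 * (- 2 * b + 3) = cubic b" by (simp add: cubic_def)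
    ultimately show False using a vunit_not_nonunit by metis
  qed
  ultimately show bn: "b \<in> nonunits V" using trichotomy[OF b] by blast
  have "3 / b \<in> nonunits V"
  proof (rule ccontr)
    assume "3 / b \<notin> nonunits V"
    then have b3: "b / 3 \<in> V" using nonunit_iff[of "3 / b"] b by simp
    \<comment> \<open>If b were divisible by 3, both terms of \<open>cubic b\<close> would be
      divisible by 3 b^2, and \<open>cubic b\<close> would have larger value than
      \<open>u\<close>.\<close>
    have "((3 / to_ac u) * (1 - 2 * (b / 3)) * b) * b \<in> nonunits V"
      using three b3 bn nonunits_subset
      by (intro nonunits_mult mult_mem diff_mem one_mem numeral_mem) auto
    also have "((3 / to_ac u) * (1 - 2 * (b / 3)) * b) * b = cubic b / to_ac u"
      using u_nz by (simp add: cubic_def field_simps power2_eq_square)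
    finally have "(to_ac u / cubic b) * (cubic b / to_ac u) \<in> nonunits V"
      using a by (intro nonunits_mult)
    then show False using a u_nz one_not_nonunit by simp
  qed
  then show unit: "vunit V (cubic b / b ^ 3)" by (rule shape)
  have "to_ac u / b = (to_ac u / cubic b) * (cubic b / b ^ 3) * b\<^sup>2"
    using a b by (simp add: field_simps power2_eq_square power3_eq_cube)
  also have "\<dots> \<in> V" using a unit bn nonunits_subset by (intro mult_mem power_mem) (auto simp: vunit_def)
  finally show "to_ac u / b \<in> V" .
qed

lemma totally_ramified:
  assumes three: "3 \<in> nonunits V" "3 / to_ac u \<in> V" and a: "(cubic ^^ n) b = to_ac u"
  shows "b \<in> nonunits V \<and> b \<noteq> 0 \<and> to_ac u / b \<in> V \<and> has_order (3 ^ n) b 1"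
  using a
proof (induction n arbitrary: b)
  case 0
  then show ?case using u_nonunit u_nz by (auto simp: has_order_def one_mem vunit_1)
next
  case (Suc n)
  then have IH: "cubic b \<in> nonunits V" "cubic b \<noteq> 0" "to_ac u / cubic b \<in> V"
    "has_order (3 ^ n) (cubic b) 1" by (auto simp: funpow_swap1)
  note * = totally_ramified_step[OF three IH(1,2,3)]
  have "has_order (3 ^ n) (cubic b / (cubic b / b ^ 3)) (1 - 0)"
    by (intro has_order_divide IH(4) has_order_vunit *)
  moreover have "cubic b / (cubic b / b ^ 3) = b ^ 3" using IH by simp
  ultimately have "has_order (3 ^ Suc n) b 1" by (simp add: has_order_def power_mult)
  then show ?case using * by blast
qed

text \<open>In an extension of degree at most three an even ramification index has to be two. The
  elements 1, b, y and b y are dependent over \<open>M\<close>, so two of the terms of a relation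
  have equal value; this expresses the value of y through that of b and values of
  \<open>M\<close>.\<close>

lemma has_order_quadratic_extension:
  assumes M: "type_subfield M" "\<And>c. c \<in> M \<Longrightarrow> c \<noteq> 0 \<Longrightarrow> \<exists>k. has_order N c k" "N > 0"
    and b: "has_order (N * 2) b e" "odd e"
    and y: "y \<noteq> 0" and J: "finite J" "card J < 4"
    and span: "\<And>t. t \<in> {1, b, y, b * y} \<Longrightarrow> \<exists>a. (\<forall>j\<in>J. a j \<in> M) \<and> t = (\<Sum>j\<in>J. a j * g j)"
  shows "\<exists>k. has_order (N * 2) y k"
proof -
  define t where "t i = [1, b, y, b * y] ! i" for i
  have b0: "b \<noteq> 0" using has_order_nz[OF b(1)] M by simp
  have t4: "i = 0 \<and> t i = 1 \<or> i = 1 \<and> t i = b \<or> i = 2 \<and> t i = y \<or> i = 3 \<and> t i = b * y"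
    if "i < 4" for i
  proof -
    have "i = 0 \<or> i = 1 \<or> i = 2 \<or> i = 3" using that by auto
    then show ?thesis by (auto simp: t_def)
  qed
  have "\<exists>c. (\<forall>i\<in>{..<4}. c i \<in> M) \<and> (\<exists>i\<in>{..<4}. c i \<noteq> 0) \<and> (\<Sum>i\<in>{..<4::nat}. c i * t i) = 0"
  proof (rule type_subfield.span_dependence[OF M(1) J(1)])
    fix i :: nat assume "i \<in> {..<4}"
    then have "t i \<in> {1, b, y, b * y}" using t4[of i] by auto
    then show "\<exists>a. (\<forall>j\<in>J. a j \<in> M) \<and> t i = (\<Sum>j\<in>J. a j * g j)" by (rule span)
  qed (use J in auto)
  then obtain c where c: "\<forall>i\<in>{..<4}. c i \<in> M" "\<exists>i\<in>{..<4}. c i \<noteq> 0"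
    "(\<Sum>i\<in>{..<4::nat}. c i * t i) = 0" by blast
  define I where "I = {i. i < 4 \<and> c i \<noteq> 0}"
  have "\<exists>i\<in>I. \<exists>j\<in>I. i \<noteq> j \<and> vunit V ((c i * t i) / (c j * t j))"
  proof (rule sum_zero_imp_associated)
    have "(\<Sum>i\<in>I. c i * t i) = (\<Sum>i\<in>{..<4::nat}. c i * t i)"
      by (rule sum.mono_neutral_left) (auto simp: I_def)
    then show "(\<Sum>i\<in>I. c i * t i) = 0" using c by simp
    show "I \<noteq> {}" using c by (auto simp: I_def)
    fix i assume "i \<in> I"
    then show "c i * t i \<noteq> 0" using t4[of i] b0 y by (auto simp: I_def)
  qed (simp add: I_def)
  then obtain i j where ij: "i \<in> I" "j \<in> I" "i < j" "vunit V ((c i * t i) / (c j * t j))"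
    using vunit_inverse by (metis inverse_divide linorder_neqE_nat)
  have cij: "c i / c j \<in> M" "c i / c j \<noteq> 0"
    using c ij type_subfield.divide_mem[OF M(1)] by (auto simp: I_def)
  then obtain k where "has_order N (c i / c j) k" using M(2) by blast
  from has_order_scale[OF this, of 2] have k: "has_order (N * 2) (c i / c j) (k * 2)" by simp
  have q: "has_order (N * 2) (t i / t j) (- (k * 2))"
  proof -
    have "(c i * t i) / (c j * t j) / (c i / c j) = t i / t j" using ij by (simp add: I_def)
    then show ?thesis
      using has_order_divide[OF has_order_vunit[OF ij(4)] k] by simp
  qed
  \<comment> \<open>The pairs (1, b) and (y, b y) give no information on y. They are excluded
    because the order of b is odd while quotients of elements of \<open>M\<close> have even order on
    the scale \<open>N * 2\<close>.\<close>
  have no: False if "t i / t j = inverse b"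
  proof -
    have "- (k * 2) = - e" using has_order_unique[OF q] has_order_inverse[OF b(1)] that by simp
    then have "e = 2 * k" by simp
    then show False using b(2) by simp
  qed
  have ij4: "i < 4" "j < 4" using ij by (auto simp: I_def)
  have "t i / t j = inverse b \<or> t i / t j = inverse y \<or> t i / t j = inverse (b * y) \<or> t i / t j = b / y"
    using t4[OF ij4(1)] t4[OF ij4(2)] ij(3) b0 y by (auto simp: field_simps)
  then have "y = inverse (t i / t j) \<or> y = inverse (t i / t j) / b \<or> y = b / (t i / t j)"
  proof (elim disjE)
    assume "t i / t j = inverse b" then show ?thesis using no by blast
  qed (use b0 y in simp_all)
  then show ?thesis
    using has_order_inverse[OF q] has_order_divide[OF has_order_inverse[OF q] b(1)]
      has_order_divide[OF b(1) q] by metis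
qed

end

section \<open>Roots of the cubic and the fields generated by nodes\<close>

lemma cubic_roots:
  fixes a :: "'k::field_char_0 alg_closure"
  obtains r1 r2 r3 where "2 * (r1 + r2 + r3) = 3" "r1 * r2 + r1 * r3 + r2 * r3 = 0"
    "2 * (r1 * r2 * r3) = - a"
proof -
  obtain r1 where "poly [:- a, 0, 3, - 2:] r1 = 0"
    using alg_closed_imp_poly_has_root[of "[:- a, 0, 3, - 2:]"] by auto
  then have r1: "a = 3 * r1\<^sup>2 - 2 * r1 ^ 3"
    by (simp add: algebra_simps power2_eq_square power3_eq_cube)
  \<comment> \<open>The sum of the other two roots; since the second elementary symmetric function
    vanishes, their product is \<open>- (r1 * s)\<close>.\<close>
  define s where "s = 3 / 2 - r1"
  obtain r2 where "poly [:- (r1 * s), - s, 1:] r2 = 0"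
    using alg_closed_imp_poly_has_root[of "[:- (r1 * s), - s, 1:]"] by auto
  then have r2: "r2 * (s - r2) = - (r1 * s)" by (simp add: algebra_simps)
  have "2 * (r1 * r2 * (s - r2)) = 2 * r1 * (r2 * (s - r2))" by simp
  also have "\<dots> = - a"
    unfolding r2 by (simp add: r1 s_def field_simps power2_eq_square power3_eq_cube)
  finally have "2 * (r1 * r2 * (s - r2)) = - a" .
  moreover have "r1 * r2 + r1 * (s - r2) + r2 * (s - r2) = 0"
    unfolding r2 by (simp add: algebra_simps)
  moreover have "2 * (r1 + r2 + (s - r2)) = 3" by (simp add: s_def)
  ultimately show ?thesis using that[of r1 r2 "s - r2"] by blast
qed

lemma cubic_factorization:
  fixes z :: "'a::field_char_0"
  assumes "2 * (r1 + r2 + r3) = 3" "r1 * r2 + r1 * r3 + r2 * r3 = 0" "2 * (r1 * r2 * r3) = - a"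
  shows "cubic z - a = - 2 * ((z - r1) * (z - r2) * (z - r3))"
proof -
  have "- 2 * ((z - r1) * (z - r2) * (z - r3)) =
      - 2 * z ^ 3 + (2 * (r1 + r2 + r3)) * z\<^sup>2 - 2 * (r1 * r2 + r1 * r3 + r2 * r3) * z + 2 * (r1 * r2 * r3)"
    by (simp add: algebra_simps power2_eq_square power3_eq_cube)
  then show ?thesis
    unfolding assms by (simp add: cubic_def algebra_simps power2_eq_square power3_eq_cube)
qed

text \<open>Polynomial expressions are enough: generators are algebraic, so this ring is already the
  field generated by \<open>a\<close> over the base.\<close>

abbreviation simple_ext :: "'k::field alg_closure \<Rightarrow> 'k alg_closure set" where
  "simple_ext a \<equiv> adjoin (range to_ac) a"

lemma range_subset_simple_ext: "range to_ac \<subseteq> simple_ext a"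
  by (rule type_subring.subset_adjoin[OF type_subring_range_to_ac])

lemma type_subfield_simple_ext: "type_subfield (simple_ext a)"
  by (rule type_subfield_if_contains_base[OF
        type_subring.type_subring_adjoin[OF type_subring_range_to_ac] range_subset_simple_ext])

lemma mem_simple_ext: "a \<in> simple_ext a"
  by (rule type_subring.mem_adjoin[OF type_subring_range_to_ac])

lemma simple_ext_subset:
  assumes "type_subring F" "range to_ac \<subseteq> F" "a \<in> F"
  shows "simple_ext a \<subseteq> F"
  using assms by (auto simp: adjoin_def intro!: type_subring.poly_mem[OF assms(1)])

text \<open>The equation 2 b^3 = 3 b^2 - \<open>cubic b\<close> removes powers above the second. The
  resulting three spanning elements are the set \<open>J\<close> with fewer than four elements in
  the quadratic step.\<close>

lemma simple_ext_cubic_span: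
  fixes b :: "'k::field_char_0 alg_closure"
  assumes "y \<in> simple_ext b"
  shows "\<exists>c. (\<forall>j\<in>{0,1,2::nat}. c j \<in> simple_ext (cubic b)) \<and> y = (\<Sum>j\<in>{0,1,2}. c j * b ^ j)"
proof -
  interpret type_subfield "simple_ext (cubic b)" by (rule type_subfield_simple_ext)
  define M where "M = simple_ext (cubic b)"
  have mem: "cubic b \<in> M" "\<And>c. to_ac c \<in> M" unfolding M_def using mem_simple_ext[of "cubic b"] range_subset_simple_ext[of "cubic b"] by auto
  have "\<exists>a0 a1 a2. a0 \<in> M \<and> a1 \<in> M \<and> a2 \<in> M \<and> poly p b = a0 + a1 * b + a2 * b ^ 2"
    if "\<forall>i. coeff p i \<in> range (to_ac :: 'k \<Rightarrow> _)" for p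
    using that
  proof (induction p)
    case 0
    then show ?case using zero_mem unfolding M_def by (intro exI[of _ 0]) auto
  next
    case (pCons c p)
    have "\<forall>i. coeff p i \<in> range (to_ac :: 'k \<Rightarrow> _)"
    proof
      fix i show "coeff p i \<in> range (to_ac :: 'k \<Rightarrow> _)" using pCons.prems[rule_format, of "Suc i"] by simp
    qed
    then obtain a0 a1 a2 where a: "a0 \<in> M" "a1 \<in> M" "a2 \<in> M" "poly p b = a0 + a1 * b + a2 * b ^ 2"
      using pCons.IH by blast
    have c: "c \<in> M" using pCons.prems[rule_format, of 0] mem by auto
    have "2 * b ^ 3 = 3 * b\<^sup>2 - cubic b"
      by (simp add: cubic_def algebra_simps power2_eq_square power3_eq_cube)
    then have b3: "b ^ 3 = 3 / 2 * b\<^sup>2 - cubic b / 2"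
      by (metis (no_types) add_divide_distrib diff_divide_distrib nonzero_mult_div_cancel_left
          times_divide_eq_left zero_neq_numeral)
    have "poly (pCons c p) b = c + a0 * b + a1 * b\<^sup>2 + a2 * b ^ 3"
      using a by (simp add: algebra_simps power2_eq_square power3_eq_cube)
    also have "\<dots> = (c - a2 * cubic b / 2) + a0 * b + (a1 + 3 * a2 / 2) * b ^ 2"
      unfolding b3 by (simp add: algebra_simps)
    finally have "poly (pCons c p) b = (c - a2 * cubic b / 2) + a0 * b + (a1 + 3 * a2 / 2) * b ^ 2" .
    moreover have "c - a2 * cubic b / 2 \<in> M" "a1 + 3 * a2 / 2 \<in> M"
      using a c mem unfolding M_def by (auto intro!: diff_mem add_mem mult_mem divide_mem numeral_mem)
    ultimately show ?case using a by blast
  qed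
  moreover obtain p where "\<forall>i. coeff p i \<in> range (to_ac :: 'k \<Rightarrow> _)" "y = poly p b"
    using assms by (auto simp: adjoin_def)
  ultimately obtain a0 a1 a2 where a: "a0 \<in> M" "a1 \<in> M" "a2 \<in> M" "y = a0 + a1 * b + a2 * b ^ 2"
    by blast
  then show ?thesis
    by (intro exI[of _ "\<lambda>j. if j = 0 then a0 else if j = 1 then a1 else a2"]) (auto simp: M_def)
qed

text \<open>The discriminant of \<open>cubic z - t\<close> divided by the fourth power of the leading coefficient.\<close>

definition node_disc :: "'a::field_char_0 \<Rightarrow> 'a" where
  "node_disc t = 27 / 4 * t * (1 - t)"

lemma node_disc_one_minus: "node_disc (1 - t) = node_disc t"
  by (simp add: node_disc_def)

text \<open>The conditions range over all square roots, so they can later be applied to the square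
  roots chosen in a labelling of the tree that is constructed independently of the chain.\<close>

definition ramified_chain :: "(nat \<Rightarrow> 'k::field_char_0 alg_closure) \<Rightarrow> bool" where
  "ramified_chain \<alpha> \<longleftrightarrow> (\<forall>n. cubic (\<alpha> (Suc n)) = \<alpha> n) \<and>
     (\<forall>n \<delta>. \<delta> * \<delta> = node_disc (\<alpha> n) \<longrightarrow> \<delta> \<notin> simple_ext (\<alpha> n)) \<and>
     (\<forall>n \<delta> \<delta>'. \<delta> * \<delta> = node_disc (\<alpha> (Suc n)) \<longrightarrow> \<delta>' * \<delta>' = node_disc (\<alpha> n) \<longrightarrow>
        \<delta> * \<delta>' \<notin> simple_ext (\<alpha> (Suc n)))"

text \<open>The symmetry z to 1 - z commutes with \<open>cubic\<close> and preserves the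
  discriminants and the fields; it reduces the hypothesis on 1 - x to the one on x.\<close>

lemma ramified_chain_one_minus:
  assumes "ramified_chain \<alpha>"
  shows "ramified_chain (\<lambda>n. 1 - \<alpha> n)"
proof -
  have "simple_ext (1 - a) \<subseteq> simple_ext a" for a :: "'a alg_closure"
  proof (rule simple_ext_subset)
    interpret type_subfield "simple_ext a" by (rule type_subfield_simple_ext)
    show "type_subring (simple_ext a)" by (rule type_subring_axioms)
    show "1 - a \<in> simple_ext a" by (intro diff_mem one_mem mem_simple_ext)
  qed (rule range_subset_simple_ext)
  from this[of "1 - _"] this have "simple_ext (1 - a) = simple_ext a" for a :: "'a alg_closure"
    by (metis (no_types, lifting) diff_diff_eq2 add_diff_cancel_left' subset_antisym)
  then show ?thesis using assms by (simp add: ramified_chain_def cubic_one_minus node_disc_one_minus)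
qed

section \<open>Quadratically ramified branches above 2\<close>

context ac_valuation
begin

context
  fixes \<alpha> :: "nat \<Rightarrow> 'k alg_closure" and e :: int
  assumes chain: "\<And>n. cubic (\<alpha> (Suc n)) = \<alpha> n" and base: "\<alpha> 0 \<in> range to_ac"
    and order: "\<And>n. has_order (2 ^ n) (\<alpha> n) e" and odd: "odd e"
begin

text \<open>All values in the n-th field of the tower are multiples of 2^(-n), because at each step
  the new generator has odd order on the doubled scale. Consequently an element of odd order on the
  scale 2^n has no square root in that field.\<close>

lemma has_order_tower: "y \<in> simple_ext (\<alpha> n) \<Longrightarrow> y \<noteq> 0 \<Longrightarrow> \<exists>k. has_order (2 ^ n) y k"
proof (induction n arbitrary: y)
  case 0
  have "simple_ext (\<alpha> 0) \<subseteq> range to_ac"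
    by (rule simple_ext_subset[OF type_subring_range_to_ac _ base]) simp
  then obtain c where "y = to_ac c" "c \<noteq> 0" using 0 by auto
  then show ?case using has_order_base[of c 1] by auto
next
  case (Suc n)
  interpret M': type_subfield "simple_ext (\<alpha> (Suc n))" by (rule type_subfield_simple_ext)
  have "\<exists>k. has_order (2 ^ n * 2) y k"
  proof (rule has_order_quadratic_extension[OF type_subfield_simple_ext[of "\<alpha> n"]])
    show "has_order (2 ^ n * 2) (\<alpha> (Suc n)) e" using order[of "Suc n"] by (simp add: mult.commute)
    fix t assume "t \<in> {1, \<alpha> (Suc n), y, \<alpha> (Suc n) * y}"
    then have "t \<in> simple_ext (\<alpha> (Suc n))"
      using Suc.prems mem_simple_ext M'.one_mem M'.mult_mem by auto
    from simple_ext_cubic_span[OF this]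
    show "\<exists>a. (\<forall>j\<in>{0,1,2::nat}. a j \<in> simple_ext (\<alpha> n)) \<and> t = (\<Sum>j\<in>{0,1,2}. a j * \<alpha> (Suc n) ^ j)"
      by (simp only: chain)
  qed (use Suc odd in auto)
  then show ?case by (simp add: mult.commute)
qed

lemma no_sqrt_of_odd_order:
  assumes "\<delta> \<in> simple_ext (\<alpha> n)" "has_order (2 ^ n) (\<delta> * \<delta>) k"
  shows "even k"
proof -
  have "\<delta> * \<delta> \<noteq> 0" using has_order_nz[OF assms(2)] by simp
  then obtain l where l: "has_order (2 ^ n) \<delta> l" using has_order_tower assms(1) by auto
  have "k = l + l" using has_order_unique[OF assms(2) has_order_mult[OF l l]] .
  then show ?thesis by simp
qed

end

lemma vunit_3: "2 \<in> nonunits V \<Longrightarrow> vunit V 3"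
  using vunit_add_nonunit[OF vunit_1, of 2] by simp

lemma vunit_27: "2 \<in> nonunits V \<Longrightarrow> vunit V 27"
  using vunit_power[OF vunit_3, of 3] by simp

lemma vunit_one_minus: "a \<in> nonunits V \<Longrightarrow> vunit V (1 - a)"
  using vunit_add_nonunit[OF vunit_1 nonunits_uminus, of a] by simp

lemma half_order_step:
  assumes "has_order (2 ^ n) a e" "vunit V (a / b\<^sup>2)"
  shows "has_order (2 ^ Suc n) b e"
proof -
  have "has_order (2 ^ n) (a / (a / b\<^sup>2)) (e - 0)"
    by (intro has_order_divide assms has_order_vunit)
  moreover have "a / (a / b\<^sup>2) = b\<^sup>2" using assms(2) by (auto simp: vunit_def)
  ultimately show ?thesis by (simp add: has_order_def flip: power_mult)
qed

text \<open>If no root had positive value, the inverses of the roots would lie in \<open>V\<close>;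
  but the second symmetric function of the inverses is -3/a, so 3 would be a nonunit. At a root b of
  positive value, a = b^2 (3 - 2 b) with a unit as second factor.\<close>

lemma zero_side_step:
  assumes two: "2 \<in> nonunits V" and a: "a \<in> nonunits V" "a \<noteq> 0"
  obtains b where "cubic b = a" "b \<in> nonunits V" "b \<noteq> 0" "vunit V (a / b\<^sup>2)"
proof -
  obtain r1 r2 r3 where r: "2 * (r1 + r2 + r3) = 3" "r1 * r2 + r1 * r3 + r2 * r3 = 0"
    "2 * (r1 * r2 * r3) = - a" by (rule cubic_roots)
  have root: "cubic z = a" if "z \<in> {r1, r2, r3}" for z
    using cubic_factorization[OF r, of z] that by auto
  have nz: "r1 \<noteq> 0" "r2 \<noteq> 0" "r3 \<noteq> 0" using r a by auto
  have "\<exists>z\<in>{r1, r2, r3}. z \<in> nonunits V"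
  proof (rule ccontr)
    assume "\<not> ?thesis"
    then have i: "inverse r1 \<in> V" "inverse r2 \<in> V" "inverse r3 \<in> V" using nz nonunit_iff by auto
    have "(inverse r1 * inverse r2 + inverse r1 * inverse r3 + inverse r2 * inverse r3) * a \<in> nonunits V"
      using i a by (intro nonunits_mult add_mem mult_mem) auto
    also have "(inverse r1 * inverse r2 + inverse r1 * inverse r3 + inverse r2 * inverse r3) * a = - 3"
    proof -
      have "a = - (2 * (r1 * r2 * r3))" using r(3) by simp
      then have "(inverse r1 * inverse r2 + inverse r1 * inverse r3 + inverse r2 * inverse r3) * a
          = - (2 * (r1 + r2 + r3))"
        using nz by (simp add: field_simps)
      then show ?thesis by (simp only: r(1))
    qed
    finally show False using vunit_3[OF two] vunit_uminus[of 3] vunit_not_nonunit by blast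
  qed
  then obtain b where b: "b \<in> {r1, r2, r3}" "b \<in> nonunits V" by blast
  have b0: "b \<noteq> 0" using b nz by auto
  have "vunit V (3 + - (2 * b))"
    using vunit_3[OF two] b two nonunits_subset
    by (intro vunit_add_nonunit nonunits_uminus nonunits_mult) auto
  also have "3 + - (2 * b) = a / b\<^sup>2" using root[OF b(1)] b0 by (auto simp: cubic_def)
  finally show ?thesis using that root b b0 by blast
qed

text \<open>Up to units and the square 1/4, the discriminant at \<open>\<alpha> n\<close> has the
  odd order of \<open>\<alpha> n\<close> itself. The square roots are multiplied by 2 or 4 to remove
  this denominator, which is not a unit above 2.\<close>

theorem ramified_chain_zero_side:
  assumes two: "2 \<in> nonunits V"
  obtains \<alpha> where "ramified_chain \<alpha>" "\<alpha> 0 = to_ac u"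
proof -
  have "\<exists>\<alpha>. \<forall>n. ((n = 0 \<longrightarrow> \<alpha> n = to_ac u) \<and> \<alpha> n \<in> nonunits V \<and> \<alpha> n \<noteq> 0 \<and> has_order (2 ^ n) (\<alpha> n) 1) \<and>
      cubic (\<alpha> (Suc n)) = \<alpha> n"
  proof (rule dependent_nat_choice)
    show "\<exists>a. (0 = 0 \<longrightarrow> a = to_ac u) \<and> a \<in> nonunits V \<and> a \<noteq> 0 \<and> has_order (2 ^ 0) a 1"
      using u_nz u_nonunit by (auto simp: has_order_def vunit_1)
  next
    fix a and n :: nat
    assume a: "(n = 0 \<longrightarrow> a = to_ac u) \<and> a \<in> nonunits V \<and> a \<noteq> 0 \<and> has_order (2 ^ n) a 1"
    obtain b where "cubic b = a" "b \<in> nonunits V" "b \<noteq> 0" "vunit V (a / b\<^sup>2)"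
      using zero_side_step[OF two] a by blast
    then show "\<exists>b. ((Suc n = 0 \<longrightarrow> b = to_ac u) \<and> b \<in> nonunits V \<and> b \<noteq> 0 \<and> has_order (2 ^ Suc n) b 1) \<and>
        cubic b = a"
      using half_order_step a by blast
  qed
  then obtain \<alpha> where \<alpha>0: "\<alpha> 0 = to_ac u" and \<alpha>: "\<And>n. \<alpha> n \<in> nonunits V" "\<And>n. \<alpha> n \<noteq> 0"
    "\<And>n. has_order (2 ^ n) (\<alpha> n) 1" "\<And>n. cubic (\<alpha> (Suc n)) = \<alpha> n" by metis
  note no_sqrt = no_sqrt_of_odd_order[OF \<alpha>(4) _ \<alpha>(3)]
  have unit: "vunit V (27 * (1 - \<alpha> n))" for n
    using vunit_27[OF two] vunit_one_minus[OF \<alpha>(1)] by (rule vunit_mult)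
  have "\<delta> \<notin> simple_ext (\<alpha> n)" if "\<delta> * \<delta> = node_disc (\<alpha> n)" for n \<delta>
  proof
    assume "\<delta> \<in> simple_ext (\<alpha> n)"
    interpret M: type_subfield "simple_ext (\<alpha> n)" by (rule type_subfield_simple_ext)
    have "2 * \<delta> \<in> simple_ext (\<alpha> n)" by (intro M.mult_mem M.numeral_mem) fact
    moreover have "2 * \<delta> * (2 * \<delta>) = 4 * (\<delta> * \<delta>)" by simp
    then have "2 * \<delta> * (2 * \<delta>) = \<alpha> n * (27 * (1 - \<alpha> n))"
      unfolding that by (simp add: node_disc_def)
    then have "has_order (2 ^ n) (2 * \<delta> * (2 * \<delta>)) (1 + 0)"
      using has_order_mult[OF \<alpha>(3) has_order_vunit[OF unit]] by simp
    ultimately show False using no_sqrt[of "2 * \<delta>" n 1] \<alpha>0 by auto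
  qed
  moreover have "\<delta> * \<delta>' \<notin> simple_ext (\<alpha> (Suc n))"
    if "\<delta> * \<delta> = node_disc (\<alpha> (Suc n))" "\<delta>' * \<delta>' = node_disc (\<alpha> n)" for n \<delta> \<delta>'
  proof
    assume *: "\<delta> * \<delta>' \<in> simple_ext (\<alpha> (Suc n))"
    define b where "b = \<alpha> (Suc n)"
    interpret M: type_subfield "simple_ext b" by (rule type_subfield_simple_ext)
    \<comment> \<open>\<open>\<alpha> n\<close> is b^2 times a unit. Dividing by b removes this
      square from the product of the two discriminants and leaves b times a unit, of odd
      order.\<close>
    define s where "s = 4 * (\<delta> * \<delta>') / b"
    have sM: "s \<in> simple_ext b"
      unfolding s_def b_def by (intro M.divide_mem[unfolded b_def] M.mult_mem[unfolded b_def]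
          M.numeral_mem[unfolded b_def] mem_simple_ext *)
    have b: "b \<noteq> 0" "\<alpha> n = cubic b" using \<alpha> by (simp_all add: b_def)
    have "s * s = (4 * (\<delta> * \<delta>)) * (4 * (\<delta>' * \<delta>')) / b\<^sup>2"
      by (simp add: s_def power2_eq_square algebra_simps)
    also have "\<dots> = b * ((27 * (1 - \<alpha> (Suc n))) * (27 * (1 - \<alpha> n)) * (\<alpha> n / b\<^sup>2))"
    proof -
      have "4 * (\<delta> * \<delta>) = 27 * (b * (1 - \<alpha> (Suc n)))" "4 * (\<delta>' * \<delta>') = 27 * (\<alpha> n * (1 - \<alpha> n))"
        unfolding that by (simp_all add: node_disc_def b_def)
      then show ?thesis by simp (simp add: algebra_simps)
    qed
    also have "\<alpha> n / b\<^sup>2 = 3 + - (2 * b)" using b by (simp add: cubic_def)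
    finally have "s * s = b * ((27 * (1 - \<alpha> (Suc n))) * (27 * (1 - \<alpha> n)) * (3 + - (2 * b)))" .
    moreover have "vunit V ((27 * (1 - \<alpha> (Suc n))) * (27 * (1 - \<alpha> n)) * (3 + - (2 * b)))"
    proof -
      have "vunit V (3 + - (2 * b))"
        using vunit_3[OF two] \<alpha>(1)[of "Suc n"] two nonunits_subset
        unfolding b_def by (intro vunit_add_nonunit nonunits_uminus nonunits_mult) auto
      then show ?thesis by (rule vunit_mult[OF vunit_mult[OF unit unit]])
    qed
    ultimately have "has_order (2 ^ Suc n) (s * s) (1 + 0)"
      using has_order_mult[OF \<alpha>(3)[of "Suc n"] has_order_vunit] by (simp add: b_def)
    then show False using no_sqrt[of s "Suc n" 1] sM \<alpha>0 by (auto simp: b_def)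
  qed
  ultimately have "ramified_chain \<alpha>" using \<alpha> by (auto simp: ramified_chain_def)
  then show ?thesis using that \<alpha>0 by blast
qed

text \<open>The step in the coordinate y = 1/z at infinity. If 2 z were not a nonunit for any root
  z, the second symmetric function of the 1/(2 z), which is -3 c/4, would lie in \<open>V\<close>,
  and with 2/c also 1/2. At a root with 2 z a nonunit the factor 3 - 2 z is a unit, so y has half
  the value of c.\<close>

lemma pole_side_step:
  assumes two: "2 \<in> nonunits V" and c: "c \<in> nonunits V" "c \<noteq> 0" "2 / c \<in> V"
  obtains y where "cubic (inverse y) = inverse c" "y \<in> nonunits V" "y \<noteq> 0" "2 / y \<in> V" "vunit V (c / y\<^sup>2)"
proof -
  obtain r1 r2 r3 where r: "2 * (r1 + r2 + r3) = 3" "r1 * r2 + r1 * r3 + r2 * r3 = 0"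
    "2 * (r1 * r2 * r3) = - inverse c" by (rule cubic_roots)
  have root: "cubic z = inverse c" if "z \<in> {r1, r2, r3}" for z
    using cubic_factorization[OF r, of z] that by auto
  have nz: "r1 \<noteq> 0" "r2 \<noteq> 0" "r3 \<noteq> 0" using r c by auto
  have "\<exists>z\<in>{r1, r2, r3}. 2 * z \<in> nonunits V"
  proof (rule ccontr)
    assume "\<not> ?thesis"
    then have i: "inverse (2 * r1) \<in> V" "inverse (2 * r2) \<in> V" "inverse (2 * r3) \<in> V"
      using nz nonunit_iff[of "2 * _"] by auto
    have "inverse (2 * r1) * inverse (2 * r2) + inverse (2 * r1) * inverse (2 * r3)
        + inverse (2 * r2) * inverse (2 * r3) \<in> V" (is "?e \<in> V")
      using i by (intro add_mem mult_mem)
    moreover have "?e = - (3 * c / 4)"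
    proof -
      have c': "c = - inverse (2 * (r1 * r2 * r3))" using r(3) by simp
      have "?e = (2 * (r1 + r2 + r3)) * inverse (2 * (r1 * r2 * r3)) / 4"
        using nz by (simp add: field_simps)
      then show ?thesis by (subst c') (simp only: r(1), simp)
    qed
    ultimately have "- (?e * (2 / c)) * inverse 3 \<in> V"
      using c vunit_3[OF two] by (intro mult_mem uminus_mem) (auto simp: vunit_def)
    also have "- (?e * (2 / c)) * inverse 3 = inverse 2"
      using c unfolding \<open>?e = - (3 * c / 4)\<close> by simp
    finally show False using two nonunit_iff[of 2] by simp
  qed
  then obtain z where z: "z \<in> {r1, r2, r3}" "2 * z \<in> nonunits V" by blast
  have z0: "z \<noteq> 0" using z nz by auto
  define y where "y = inverse z"
  have y0: "y \<noteq> 0" using z0 by (simp add: y_def)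
  have u: "vunit V (3 + - (2 * z))" using vunit_3[OF two] z by (intro vunit_add_nonunit nonunits_uminus)
  have "c / y\<^sup>2 = inverse (3 + - (2 * z))"
  proof -
    have "z\<^sup>2 * (3 - 2 * z) * c = 1" using root[OF z(1)] c by (simp add: cubic_def)
    then have "(3 + - (2 * z)) * (z\<^sup>2 * c) = 1" by (simp add: mult_ac)
    moreover have "c / y\<^sup>2 = z\<^sup>2 * c" by (simp add: y_def divide_inverse power_inverse mult.commute)
    ultimately show ?thesis using inverse_unique by metis
  qed
  then have cy: "vunit V (c / y\<^sup>2)" using vunit_inverse[OF u] by simp
  have "y \<in> nonunits V"
  proof (rule ccontr)
    assume "y \<notin> nonunits V"
    then have "inverse y \<in> V" using nonunit_iff y0 by auto
    then have "(inverse y * inverse y) * c \<in> nonunits V" using c by (intro nonunits_mult mult_mem)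
    then show False using cy vunit_not_nonunit by (simp add: divide_inverse power2_eq_square mult.commute)
  qed
  moreover have "2 / y \<in> V" using z nonunits_subset by (auto simp: y_def divide_inverse)
  ultimately show ?thesis using that[of y] cy y0 root[OF z(1)] by (simp add: y_def)
qed

text \<open>At infinity the discriminant is quadratic in the pole and has even order, so parity
  alone does not decide. After rescaling, a square root of it becomes an element s whose square
  differs from 1 by an element with the odd order of \<open>y n\<close>, and this is excluded by
  looking at s - 1.\<close>

theorem ramified_chain_pole_side:
  assumes two: "2 \<in> nonunits V" "2 / to_ac u \<in> V"
  obtains \<alpha> where "ramified_chain \<alpha>" "\<alpha> 0 = to_ac (inverse u)"
proof -
  have "\<exists>y. \<forall>n. ((n = 0 \<longrightarrow> y n = to_ac u) \<and> y n \<in> nonunits V \<and> y n \<noteq> 0 \<and> 2 / y n \<in> V \<and>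
      has_order (2 ^ n) (y n) 1) \<and> cubic (inverse (y (Suc n))) = inverse (y n) \<and> vunit V (y n / (y (Suc n))\<^sup>2)"
  proof (rule dependent_nat_choice)
    show "\<exists>a. (0 = 0 \<longrightarrow> a = to_ac u) \<and> a \<in> nonunits V \<and> a \<noteq> 0 \<and> 2 / a \<in> V \<and> has_order (2 ^ 0) a 1"
      using u_nz u_nonunit two by (auto simp: has_order_def vunit_1)
  next
    fix c and n :: nat
    assume c: "(n = 0 \<longrightarrow> c = to_ac u) \<and> c \<in> nonunits V \<and> c \<noteq> 0 \<and> 2 / c \<in> V \<and> has_order (2 ^ n) c 1"
    obtain y where "cubic (inverse y) = inverse c" "y \<in> nonunits V" "y \<noteq> 0" "2 / y \<in> V" "vunit V (c / y\<^sup>2)"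
      using pole_side_step[OF two(1)] c by blast
    then show "\<exists>y. ((Suc n = 0 \<longrightarrow> y = to_ac u) \<and> y \<in> nonunits V \<and> y \<noteq> 0 \<and> 2 / y \<in> V \<and>
        has_order (2 ^ Suc n) y 1) \<and> cubic (inverse y) = inverse c \<and> vunit V (c / y\<^sup>2)"
      using half_order_step c by blast
  qed
  then obtain y where y_0: "y 0 = to_ac u" and y: "\<And>n. y n \<in> nonunits V" "\<And>n. y n \<noteq> 0"
    "\<And>n. 2 / y n \<in> V" "\<And>n. has_order (2 ^ n) (y n) 1" "\<And>n. cubic (inverse (y (Suc n))) = inverse (y n)"
    "\<And>n. vunit V (y n / (y (Suc n))\<^sup>2)" by metis
  define \<alpha> where "\<alpha> n = inverse (y n)" for n
  have base: "\<alpha> 0 \<in> range to_ac" by (simp add: \<alpha>_def y_0 flip: to_ac_inverse)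
  have chain: "cubic (\<alpha> (Suc n)) = \<alpha> n" for n by (simp add: \<alpha>_def y)
  have order: "has_order (2 ^ n) (\<alpha> n) (- 1)" for n unfolding \<alpha>_def by (intro has_order_inverse y)
  have no_sqrt: False if "h \<in> simple_ext (\<alpha> n)" "has_order (2 ^ n) (h * h) 1" for h n
    using no_sqrt_of_odd_order[OF chain base order _ that] by simp
  have four: "4 / y n \<in> nonunits V" for n
    using nonunits_mult[OF two(1) y(3)[of n]] by simp
  \<comment> \<open>With h = s - 1, the difference is h (h + 2). Either h has smaller value than 2,
    and then h^2 has the odd order of \<open>y n\<close>; or 2 divides h, and then 4 divides the
    difference although \<open>4 / y n\<close> is a nonunit.\<close>
  have no_near_one: False if s: "s \<in> simple_ext (\<alpha> n)" and sy: "vunit V ((s * s - 1) / y n)" for s n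
  proof -
    interpret M: type_subfield "simple_ext (\<alpha> n)" by (rule type_subfield_simple_ext)
    define h where "h = s - 1"
    have hM: "h \<in> simple_ext (\<alpha> n)" unfolding h_def by (intro M.diff_mem M.one_mem s)
    have hh: "s * s - 1 = h * (h + 2)" by (simp add: h_def algebra_simps)
    have ord: "has_order (2 ^ n) (h * (h + 2)) 1"
      using has_order_mult[OF y(4)[of n] has_order_vunit[OF sy]] y(2)[of n] hh by simp
    have h0: "h \<noteq> 0" using sy hh by (auto simp: vunit_def)
    show False
    proof (cases "2 / h \<in> nonunits V")
      case True
      then have "vunit V (1 + 2 / h)" by (intro vunit_add_nonunit vunit_1)
      from has_order_divide[OF ord has_order_vunit[OF this]]
      have "has_order (2 ^ n) (h * (h + 2) / (1 + 2 / h)) 1" by simp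
      also have "h * (h + 2) / (1 + 2 / h) = h * h"
      proof -
        have "h + 2 = h * (1 + 2 / h)" using h0 by (simp add: field_simps)
        moreover have "1 + 2 / h \<noteq> 0" using \<open>vunit V (1 + 2 / h)\<close> by (auto simp: vunit_def)
        ultimately show ?thesis by simp
      qed
      finally show False using no_sqrt hM by blast
    next
      case False
      then have h2: "h / 2 \<in> V" using nonunit_iff[of "2 / h"] h0 by simp
      have "((h / 2) * (1 + h / 2)) * (4 / y n) \<in> nonunits V"
        using h2 four by (intro nonunits_mult mult_mem add_mem one_mem)
      also have "((h / 2) * (1 + h / 2)) * (4 / y n) = (s * s - 1) / y n"
      proof -
        obtain k where k: "h = 2 * k" using that[of "h / 2"] by simp
        have "(h / 2) * (1 + h / 2) * 4 = h * (h + 2)" unfolding k by (simp add: algebra_simps)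
        then show ?thesis unfolding hh by (metis times_divide_eq_right)
      qed
      finally show False using sy vunit_not_nonunit by blast
    qed
  qed
  have "\<delta> \<notin> simple_ext (\<alpha> n)" if d: "\<delta> * \<delta> = node_disc (\<alpha> n)" for n \<delta>
  proof
    assume *: "\<delta> \<in> simple_ext (\<alpha> n)"
    interpret M: type_subfield "simple_ext (\<alpha> n)" by (rule type_subfield_simple_ext)
    have yM: "y n \<in> simple_ext (\<alpha> n)"
      using M.inverse_mem[OF mem_simple_ext] by (simp add: \<alpha>_def)
    \<comment> \<open>The scaling gives s^2 = 3 (y - 1) for y = \<open>y n\<close>, so s^2 - 1 = 3 y
      - 4, where 4 has larger value than y.\<close>
    define s where "s = 2 * \<delta> * y n / 3"
    have sM: "s \<in> simple_ext (\<alpha> n)"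
      unfolding s_def by (intro M.divide_mem M.mult_mem M.numeral_mem * yM)
    have d4: "4 * (\<delta> * \<delta>) = 27 * (\<alpha> n * (1 - \<alpha> n))" unfolding d by (simp add: node_disc_def)
    have "s * s = 4 * (\<delta> * \<delta>) * (y n * y n) / 9" by (simp add: s_def)
    also have "\<dots> = 3 * ((\<alpha> n * (1 - \<alpha> n)) * (y n * y n))" unfolding d4 by simp
    also have "\<dots> = 3 * (\<alpha> n * y n) * (y n - \<alpha> n * y n)" by (simp add: algebra_simps)
    finally have "s * s = 3 * (\<alpha> n * y n) * (y n - \<alpha> n * y n)" .
    then have "s * s = 3 * (y n - 1)" using y(2)[of n] by (simp add: \<alpha>_def)
    then have "(s * s - 1) / y n = 3 + - (4 / y n)" using y(2)[of n] by (simp add: field_simps)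
    then have "vunit V ((s * s - 1) / y n)"
      using vunit_add_nonunit[OF vunit_3[OF two(1)] nonunits_uminus[OF four]] by simp
    with sM show False by (rule no_near_one)
  qed
  moreover have "\<delta> * \<delta>' \<notin> simple_ext (\<alpha> (Suc n))"
    if d: "\<delta> * \<delta> = node_disc (\<alpha> (Suc n))" "\<delta>' * \<delta>' = node_disc (\<alpha> n)" for n \<delta> \<delta>'
  proof
    assume *: "\<delta> * \<delta>' \<in> simple_ext (\<alpha> (Suc n))"
    interpret M: type_subfield "simple_ext (\<alpha> (Suc n))" by (rule type_subfield_simple_ext)
    define b c where "b = y (Suc n)" and "c = y n"
    have nz: "b \<noteq> 0" "c \<noteq> 0" using y by (auto simp: b_def c_def)
    have bM: "b \<in> simple_ext (\<alpha> (Suc n))"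
      using M.inverse_mem[OF mem_simple_ext] by (simp add: \<alpha>_def b_def)
    have "inverse c = cubic (\<alpha> (Suc n))" unfolding chain c_def by (simp add: \<alpha>_def)
    also have "\<dots> \<in> simple_ext (\<alpha> (Suc n))"
      unfolding cubic_def by (intro M.mult_mem M.diff_mem M.numeral_mem M.power_mem mem_simple_ext)
    finally have cM: "c \<in> simple_ext (\<alpha> (Suc n))" using M.inverse_mem by fastforce
    \<comment> \<open>The scaling gives s^2 = (b - 1) (c - 1), so s^2 - 1 = b c - b - c. As c is b^2
      times a unit, the term - b dominates.\<close>
    define s where "s = 4 * (\<delta> * \<delta>') * (b * c) / 27"
    have sM: "s \<in> simple_ext (\<alpha> (Suc n))"
      unfolding s_def by (intro M.divide_mem M.mult_mem[of _ "b * c"] M.mult_mem[OF bM cM]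
          M.mult_mem[of 4] M.numeral_mem *)
    have d4: "4 * (\<delta> * \<delta>) = 27 * (\<alpha> (Suc n) * (1 - \<alpha> (Suc n)))"
      "4 * (\<delta>' * \<delta>') = 27 * (\<alpha> n * (1 - \<alpha> n))"
      unfolding d by (simp_all add: node_disc_def)
    have "s * s = (4 * (\<delta> * \<delta>)) * (4 * (\<delta>' * \<delta>')) * (b * b) * (c * c) / (27 * 27)"
      by (simp add: s_def)
    also have "\<dots> = (\<alpha> (Suc n) * (1 - \<alpha> (Suc n))) * (\<alpha> n * (1 - \<alpha> n)) * (b * b) * (c * c)"
      unfolding d4 by simp
    also have "\<dots> = (\<alpha> (Suc n) * b) * (b - \<alpha> (Suc n) * b) * ((\<alpha> n * c) * (c - \<alpha> n * c))"
      by (simp add: algebra_simps)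
    finally have "s * s = (\<alpha> (Suc n) * b) * (b - \<alpha> (Suc n) * b) * ((\<alpha> n * c) * (c - \<alpha> n * c))" .
    then have "s * s = (b - 1) * (c - 1)" using nz by (simp add: \<alpha>_def flip: b_def c_def)
    then have "(s * s - 1) / b = - 1 + (c - c / b\<^sup>2 * b)"
      using nz by (simp add: field_simps power2_eq_square)
    moreover have "vunit V (- 1 + (c - c / b\<^sup>2 * b))"
    proof -
      have "c / b\<^sup>2 * b \<in> nonunits V"
        unfolding b_def c_def using y(6)[of n] y(1) by (intro nonunits_mult) (auto simp: vunit_def)
      then have "c + - (c / b\<^sup>2 * b) \<in> nonunits V"
        unfolding c_def by (intro nonunits_add y nonunits_uminus)
      then show ?thesis by (intro vunit_add_nonunit vunit_uminus vunit_1) simp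
    qed
    ultimately have "vunit V ((s * s - 1) / y (Suc n))" by (simp add: b_def)
    with sM show False by (rule no_near_one)
  qed
  ultimately have "ramified_chain \<alpha>" using chain by (auto simp: ramified_chain_def)
  then show ?thesis using that[of \<alpha>] y_0 by (simp add: \<alpha>_def)
qed

end

section \<open>Permutations of three letters\<close>

context
  notes One_nat_def [simp del]
begin

text \<open>One-line notation. Facts about the symmetric group on the labels are settled by listing
  its six elements in this form.\<close>

definition tri :: "nat \<Rightarrow> nat \<Rightarrow> nat \<Rightarrow> nat \<Rightarrow> nat" where
  "tri a b c x = (if x = 1 then a else if x = 2 then b else if x = 3 then c else x)"

abbreviation S3 :: "(nat \<Rightarrow> nat) \<Rightarrow> bool" where
  "S3 p \<equiv> p permutes {1, 2, 3}"

abbreviation inverse_fun :: "('a \<Rightarrow> 'b) \<Rightarrow> 'b \<Rightarrow> 'a" where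
  "inverse_fun \<equiv> inv_into UNIV"

lemma tri_comp: "tri a b c \<circ> tri 1 2 3 = tri a b c" "tri a b c \<circ> tri 1 3 2 = tri a c b"
  "tri a b c \<circ> tri 2 1 3 = tri b a c" "tri a b c \<circ> tri 2 3 1 = tri b c a"
  "tri a b c \<circ> tri 3 1 2 = tri c a b" "tri a b c \<circ> tri 3 2 1 = tri c b a"
  by (auto simp: tri_def fun_eq_iff)

lemma tri_id: "tri 1 2 3 = id"
  by (auto simp: tri_def fun_eq_iff)

lemma tri_eq_iff: "tri a b c = tri a' b' c' \<longleftrightarrow> a = a' \<and> b = b' \<and> c = c'"
proof
  assume "tri a b c = tri a' b' c'"
  from fun_cong[OF this, of 1] fun_cong[OF this, of 2] fun_cong[OF this, of 3]
  show "a = a' \<and> b = b' \<and> c = c'" by (simp add: tri_def)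
qed simp

lemma S3_tri: "S3 (tri 1 2 3)" "S3 (tri 1 3 2)" "S3 (tri 2 1 3)" "S3 (tri 2 3 1)"
    "S3 (tri 3 1 2)" "S3 (tri 3 2 1)"
  by (rule bij_imp_permutes; auto simp: tri_def bij_betw_def inj_on_def)+

lemma S3_cases:
  assumes "S3 p"
  shows "p \<in> {tri 1 2 3, tri 1 3 2, tri 2 1 3, tri 2 3 1, tri 3 1 2, tri 3 2 1}"
proof -
  have p: "p = tri (p 1) (p 2) (p 3)"
  proof
    fix x show "p x = tri (p 1) (p 2) (p 3) x"
      using permutes_not_in[OF assms, of x] by (cases "x \<in> {1, 2, 3}") (auto simp only: tri_def insert_iff empty_iff split: if_splits)
  qed
  have "p 1 \<in> {1, 2, 3}" "p 2 \<in> {1, 2, 3}" "p 3 \<in> {1, 2, 3}"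
    using permutes_in_image[OF assms, of 1] permutes_in_image[OF assms, of 2]
      permutes_in_image[OF assms, of 3] by simp_all
  moreover have "p 1 \<noteq> p 2" "p 1 \<noteq> p 3" "p 2 \<noteq> p 3"
    using inj_eq[OF permutes_inj[OF assms]] by simp_all
  ultimately have "tri (p 1) (p 2) (p 3) \<in>
      {tri 1 2 3, tri 1 3 2, tri 2 1 3, tri 2 3 1, tri 3 1 2, tri 3 2 1}"
    unfolding insert_iff empty_iff tri_eq_iff by metis
  then show ?thesis by (subst p)
qed

lemma S3_permutation: "S3 p \<Longrightarrow> permutation p"
  by (rule permutes_imp_permutation[of "{1, 2, 3}"]) simp_all

lemma sign_S3_comp: "S3 p \<Longrightarrow> S3 q \<Longrightarrow> sign (p \<circ> q) = sign p * sign q"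
  by (intro sign_compose S3_permutation)

lemma sign_tri: "sign (tri 1 2 3) = 1" "sign (tri 1 3 2) = - 1" "sign (tri 2 1 3) = - 1"
  "sign (tri 2 3 1) = 1" "sign (tri 3 1 2) = 1" "sign (tri 3 2 1) = - 1"
proof -
  show 1: "sign (tri 1 2 3) = 1" by (simp add: tri_id sign_id)
  have "tri 1 3 2 = Transposition.transpose 2 3" "tri 2 1 3 = Transposition.transpose 1 2"
    "tri 3 2 1 = Transposition.transpose 1 3"
    by (auto simp: tri_def fun_eq_iff Transposition.transpose_def)
  then show 2: "sign (tri 1 3 2) = - 1" "sign (tri 2 1 3) = - 1" "sign (tri 3 2 1) = - 1"
    by (simp_all add: sign_swap_id)
  have "sign (tri 2 1 3 \<circ> tri 1 3 2) = 1" "sign (tri 1 3 2 \<circ> tri 2 1 3) = 1"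
    using sign_S3_comp[OF S3_tri(3) S3_tri(2)] sign_S3_comp[OF S3_tri(2) S3_tri(3)]
    by (simp_all only: 2)
  then show "sign (tri 2 3 1) = 1" "sign (tri 3 1 2) = 1" unfolding tri_comp by simp_all
qed

lemma sign_cases: "sign p = 1 \<or> sign p = - 1"
  by (simp add: sign_def)

lemmas S3_simps = tri_comp sign_tri tri_eq_iff

lemma S3_comp: "S3 p \<Longrightarrow> S3 q \<Longrightarrow> S3 (p \<circ> q)"
  by (rule permutes_compose)

lemma S3_inverse: "S3 p \<Longrightarrow> S3 (inverse_fun p)"
  by (rule permutes_inv)

lemma S3_id: "S3 id"
  by (rule permutes_id)

lemma S3_inverse_comp: "S3 p \<Longrightarrow> inverse_fun p \<circ> p = id" "S3 p \<Longrightarrow> p \<circ> inverse_fun p = id"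
  by (auto dest: permutes_inv_o)

lemma sign_S3_inverse: "S3 p \<Longrightarrow> sign (inverse_fun p) = sign p"
  by (intro sign_inverse S3_permutation)

lemma S3_odd_square: "S3 p \<Longrightarrow> sign p = - 1 \<Longrightarrow> p \<circ> p = id"
  using S3_cases[of p] by (auto simp: S3_simps simp flip: tri_id)

lemma S3_even_cube: "S3 p \<Longrightarrow> sign p = 1 \<Longrightarrow> p \<circ> p \<circ> p = id"
  using S3_cases[of p] by (auto simp: S3_simps simp flip: tri_id)

lemma S3_even_fixpoint: "S3 p \<Longrightarrow> sign p = 1 \<Longrightarrow> l \<in> {1, 2, 3} \<Longrightarrow> p l = l \<Longrightarrow> p = id"
  using S3_cases[of p] by (auto simp: S3_simps tri_def simp flip: tri_id)

lemma S3_odd_fixpoint: "S3 p \<Longrightarrow> sign p = - 1 \<Longrightarrow> \<exists>l\<in>{1, 2, 3}. p l = l"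
  using S3_cases[of p] by (auto simp: S3_simps tri_def)

lemma S3_odd_inverse: "S3 p \<Longrightarrow> sign p = - 1 \<Longrightarrow> inverse_fun p = p"
  using S3_odd_square[of p] by (intro inv_unique_comp) auto

lemma S3_even_inverse: "S3 p \<Longrightarrow> sign p = 1 \<Longrightarrow> inverse_fun p = p \<circ> p"
  using S3_even_cube[of p] by (intro inv_unique_comp) (auto simp: o_assoc)

lemma S3_even_generated:
  "S3 p \<Longrightarrow> S3 q \<Longrightarrow> sign p = 1 \<Longrightarrow> sign q = 1 \<Longrightarrow> q \<noteq> id \<Longrightarrow> p \<in> {id, q, q \<circ> q}"
  using S3_cases[of p] S3_cases[of q] by (auto simp: S3_simps simp flip: tri_id)

definition commutator :: "('a \<Rightarrow> 'a) \<Rightarrow> ('a \<Rightarrow> 'a) \<Rightarrow> 'a \<Rightarrow> 'a" where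
  "commutator p q = p \<circ> q \<circ> inverse_fun p \<circ> inverse_fun q"

lemma commutator_id: "S3 p \<Longrightarrow> commutator p id = id" "S3 p \<Longrightarrow> commutator id p = id"
  by (simp_all add: commutator_def S3_inverse_comp)

lemma sign_commutator: "S3 p \<Longrightarrow> S3 q \<Longrightarrow> sign (commutator p q) = 1"
  using sign_cases[of p] sign_cases[of q]
  by (auto simp: commutator_def sign_S3_comp sign_S3_inverse S3_comp S3_inverse)

text \<open>A transposition conjugates a 3-cycle to its inverse, so the commutator is the square of
  the 3-cycle.\<close>

lemma S3_commutator_even_odd:
  assumes "S3 p" "S3 q" "sign p = 1" "p \<noteq> id" "sign q = - 1"
  shows "commutator p q \<noteq> id"
  unfolding commutator_def S3_even_inverse[OF assms(1,3)] S3_odd_inverse[OF assms(2,5)]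
  using S3_cases[OF assms(1)] S3_cases[OF assms(2)] assms(3-)
  by (auto simp: S3_simps o_assoc simp flip: tri_id)

text \<open>Two transpositions with different fixed points do not commute.\<close>

lemma S3_commutator_conjugate:
  assumes "S3 p" "S3 q" "sign p = - 1" "l \<in> {1, 2, 3}" "p l = l" "q l \<noteq> l"
  shows "commutator p (q \<circ> p \<circ> inverse_fun q) \<noteq> id"
proof -
  define p' where "p' = q \<circ> p \<circ> inverse_fun q"
  have p': "S3 p'" unfolding p'_def using assms by (intro S3_comp S3_inverse)
  have "sign p' = sign q * sign p * sign q"
    using assms by (simp add: p'_def sign_S3_comp sign_S3_inverse S3_comp S3_inverse)
  then have s: "sign p' = - 1" using assms(3) sign_cases[of q] by auto
  have "p' \<circ> q = q \<circ> p" by (simp add: p'_def comp_assoc S3_inverse_comp assms)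
  then have "p' (q l) = q l" using assms(5) by (metis comp_apply)
  then have "p' \<noteq> p"
    using assms S3_cases[OF assms(1)] S3_cases[OF assms(2)] by (auto simp: S3_simps tri_def)
  then have "p \<circ> p' \<circ> p \<circ> p' \<noteq> id"
    using S3_cases[OF assms(1)] S3_cases[OF p'] assms(3) s
    by (auto simp: S3_simps o_assoc simp flip: tri_id)
  then show ?thesis
    unfolding commutator_def p'_def[symmetric] S3_odd_inverse[OF assms(1,3)] S3_odd_inverse[OF p' s] .
qed

lemma S3_cycle:
  assumes "m \<in> {1, 2, 3}" "l \<in> {1, 2, 3}" "m \<noteq> l"
  obtains p where "S3 p" "sign p = 1" "p m = l"
proof -
  have "(tri 2 3 1) m = l \<or> (tri 3 1 2) m = l" using assms by (auto simp: tri_def)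
  then show ?thesis using that S3_tri(4,5) sign_tri(4,5) by blast
qed

end

section \<open>Groups of tree automorphisms\<close>

text \<open>Otherwise the simplifier rewrites the label \<open>1\<close> to \<open>Suc 0\<close>.\<close>

declare One_nat_def [simp del]

text \<open>Only the levels up to \<open>n\<close> are concerned, so a single function can satisfy
  this for every \<open>n\<close>. The groups act on the infinite tree, and finite trees are cut out
  only when comparing with \<open>Aut n\<close>.\<close>

definition tree_auto :: "nat \<Rightarrow> (nat list \<Rightarrow> nat list) \<Rightarrow> bool" where
  "tree_auto n g \<longleftrightarrow> (\<forall>i\<le>n. bij_betw g (level i) (level i)) \<and>
     (\<forall>i<n. \<forall>w\<in>level (Suc i). butlast (g w) = g (butlast w))"

definition local_perm :: "(nat list \<Rightarrow> nat list) \<Rightarrow> nat list \<Rightarrow> nat \<Rightarrow> nat" where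
  "local_perm g w l = (if l \<in> {1, 2, 3} then last (g (w @ [l])) else l)"

lemma level_0 [simp]: "level 0 = {[]}"
  by (auto simp: level_def)

lemma finite_level [simp]: "finite (level n)"
  using finite_lists_length_eq[of "{1, 2, 3 :: nat}" n] by (simp add: level_def conj_commute)

lemma level_SucI: "w \<in> level n \<Longrightarrow> l \<in> {1, 2, 3} \<Longrightarrow> w @ [l] \<in> level (Suc n)"
  by (auto simp: level_def)

lemma level_SucE:
  assumes "w \<in> level (Suc n)"
  obtains v l where "w = v @ [l]" "v \<in> level n" "l \<in> {1, 2, 3}"
proof -
  have "w \<noteq> []" using assms by (auto simp: level_def)
  then obtain v l where "w = v @ [l]" by (metis append_butlast_last_id)
  then show ?thesis using assms that by (auto simp: level_def)
qed

lemma level_length: "w \<in> level n \<Longrightarrow> length w = n"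
  by (simp add: level_def)

lemma tree_auto_level: "tree_auto n g \<Longrightarrow> w \<in> level i \<Longrightarrow> i \<le> n \<Longrightarrow> g w \<in> level i"
  by (auto simp: tree_auto_def bij_betw_def)

lemma tree_auto_inj: "tree_auto n g \<Longrightarrow> w \<in> level i \<Longrightarrow> v \<in> level i \<Longrightarrow> i \<le> n \<Longrightarrow> g w = g v \<Longrightarrow> w = v"
  unfolding tree_auto_def bij_betw_def by (meson inj_onD)

lemma tree_auto_surj: "tree_auto n g \<Longrightarrow> w \<in> level i \<Longrightarrow> i \<le> n \<Longrightarrow> \<exists>v\<in>level i. g v = w"
  unfolding tree_auto_def bij_betw_def by (metis imageE)

lemma tree_auto_Nil: "tree_auto n g \<Longrightarrow> g [] = []"
  using tree_auto_level[of n g "[]" 0] by simp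

lemma tree_auto_snoc:
  assumes "tree_auto n g" "w \<in> level i" "i < n" "l \<in> {1, 2, 3}"
  shows "g (w @ [l]) = g w @ [local_perm g w l]"
proof -
  have 1: "w @ [l] \<in> level (Suc i)" using assms by (intro level_SucI)
  then have "g (w @ [l]) \<in> level (Suc i)" using tree_auto_level[OF assms(1)] assms(3) by auto
  then have "g (w @ [l]) \<noteq> []" by (auto simp: level_def)
  moreover have "butlast (g (w @ [l])) = g w" using assms 1 by (auto simp: tree_auto_def)
  ultimately show ?thesis using assms(4) by (metis append_butlast_last_id local_perm_def)
qed

lemma S3_local_perm:
  assumes "tree_auto n g" "w \<in> level i" "i < n"
  shows "S3 (local_perm g w)"
proof (rule bij_imp_permutes)
  have inj: "inj_on (local_perm g w) {1, 2, 3}"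
  proof (rule inj_onI)
    fix a b assume ab: "a \<in> {1, 2, 3}" "b \<in> {1, 2, 3}" "local_perm g w a = local_perm g w b"
    then have "g (w @ [a]) = g (w @ [b])" using tree_auto_snoc[OF assms] by simp
    then have "w @ [a] = w @ [b]"
      using tree_auto_inj[OF assms(1) level_SucI level_SucI, of w i a w b] assms ab by auto
    then show "a = b" by simp
  qed
  have "local_perm g w ` {1, 2, 3} \<subseteq> {1, 2, 3}"
  proof
    fix y assume "y \<in> local_perm g w ` {1, 2, 3}"
    then obtain l where l: "l \<in> {1, 2, 3}" "y = local_perm g w l" by blast
    have "g (w @ [l]) \<in> level (Suc i)"
      using tree_auto_level[OF assms(1) level_SucI[OF assms(2) l(1)]] assms(3) by simp
    then have "g w @ [y] \<in> level (Suc i)" using tree_auto_snoc[OF assms l(1)] l(2) by simp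
    then show "y \<in> {1, 2, 3}" by (auto simp: level_def)
  qed
  then have "local_perm g w ` {1, 2, 3} = {1, 2, 3}" using inj by (intro endo_inj_surj) auto
  then show "bij_betw (local_perm g w) {1, 2, 3} {1, 2, 3}" using inj by (simp add: bij_betw_def)
qed (simp add: local_perm_def)

lemma tree_auto_id: "tree_auto n id"
  by (auto simp: tree_auto_def)

lemma local_perm_comp:
  assumes "tree_auto n g" "tree_auto n h" "w \<in> level i" "i < n"
  shows "local_perm (g \<circ> h) w = local_perm g (h w) \<circ> local_perm h w"
proof
  fix l
  have hw: "h w \<in> level i" using tree_auto_level[OF assms(2,3)] assms(4) by simp
  show "local_perm (g \<circ> h) w l = (local_perm g (h w) \<circ> local_perm h w) l"
  proof (cases "l \<in> {1, 2, 3}")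
    case True
    have p: "local_perm h w l \<in> {1, 2, 3}"
      using permutes_in_image[OF S3_local_perm[OF assms(2-4)], of l] True by blast
    have "local_perm (g \<circ> h) w l = last (g (h (w @ [l])))" using True by (simp add: local_perm_def)
    also have "\<dots> = last (g (h w @ [local_perm h w l]))"
      by (simp only: tree_auto_snoc[OF assms(2-4) True])
    also have "\<dots> = local_perm g (h w) (local_perm h w l)"
      by (simp only: tree_auto_snoc[OF assms(1) hw assms(4) p] last_snoc)
    finally show ?thesis by simp
  qed (simp add: local_perm_def)
qed

lemma local_perm_eq_id:
  assumes "\<And>l. l \<in> {1, 2, 3} \<Longrightarrow> g (w @ [l]) = w @ [l]"
  shows "local_perm g w = id"
proof
  fix l show "local_perm g w l = id l" using assms[of l] by (auto simp: local_perm_def)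
qed

lemma tree_auto_eq_if_local_perm_eq:
  assumes "tree_auto n g" "tree_auto n h"
    and "\<And>i v. i < j \<Longrightarrow> v \<in> level i \<Longrightarrow> local_perm g v = local_perm h v" "w \<in> level j" "j \<le> n"
  shows "g w = h w"
  using assms(3-)
proof (induction j arbitrary: w)
  case 0
  then show ?case using tree_auto_Nil[OF assms(1)] tree_auto_Nil[OF assms(2)] by simp
next
  case (Suc j)
  from Suc.prems(2) obtain v l where vl: "w = v @ [l]" "v \<in> level j" "l \<in> {1, 2, 3}" by (rule level_SucE)
  have "g v = h v"
  proof (rule Suc.IH[OF _ vl(2)])
    fix i v assume "i < j" "v \<in> level i"
    then show "local_perm g v = local_perm h v" using Suc.prems(1)[of i v] by simp
  qed (use Suc.prems in simp)
  then show ?case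
    using tree_auto_snoc[OF assms(1) vl(2) _ vl(3)] tree_auto_snoc[OF assms(2) vl(2) _ vl(3)]
      Suc.prems(1)[of j v] Suc.prems(3) vl by simp
qed

section \<open>Groups of tree automorphisms that satisfy the sign relation everywhere\<close>

definition sign_relation :: "(nat list \<Rightarrow> nat \<Rightarrow> nat) \<Rightarrow> nat list \<Rightarrow> bool" where
  "sign_relation c w \<longleftrightarrow> sign (c (w @ [1])) * sign (c (w @ [2])) * sign (c (w @ [3])) = sign (c w)"

text \<open>The properties of the Galois image that are used. \<open>signs\<close> is the upper
  bound; \<open>transitive\<close>, \<open>odd_root\<close> and \<open>separating\<close> are the
  input for the lower bound. One separating element per level suffices since transitivity moves what
  is built from it to the other vertices.\<close>

locale tree_group =
  fixes G :: "(nat list \<Rightarrow> nat list) set"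
  assumes aut: "g \<in> G \<Longrightarrow> tree_auto n g"
    and id_mem: "id \<in> G"
    and comp_mem: "g \<in> G \<Longrightarrow> h \<in> G \<Longrightarrow> g \<circ> h \<in> G"
    and exists_inverse: "g \<in> G \<Longrightarrow> \<exists>g'\<in>G. \<forall>n. \<forall>w\<in>level n. g' (g w) = w \<and> g (g' w) = w"
    and signs: "g \<in> G \<Longrightarrow> w \<in> level n \<Longrightarrow> sign_relation (local_perm g) w"
    and transitive: "w \<in> level n \<Longrightarrow> w' \<in> level n \<Longrightarrow> \<exists>g\<in>G. g w = w'"
    and odd_root: "\<exists>g\<in>G. sign (local_perm g []) = - 1"
    and separating: "\<exists>g\<in>G. \<exists>u\<in>level n. \<exists>l\<in>{1, 2, 3}. g (u @ [l]) = u @ [l] \<and>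
      sign (local_perm g u) = 1 \<and> sign (local_perm g (u @ [l])) = - 1"
begin

lemma local_perm_S3: "g \<in> G \<Longrightarrow> w \<in> level i \<Longrightarrow> S3 (local_perm g w)"
  using S3_local_perm[OF aut] by blast

lemma comp_local_perm:
  "g \<in> G \<Longrightarrow> h \<in> G \<Longrightarrow> w \<in> level i \<Longrightarrow> local_perm (g \<circ> h) w = local_perm g (h w) \<circ> local_perm h w"
  by (rule local_perm_comp[of "Suc i"]) (auto intro: aut)

lemma mem_level: "g \<in> G \<Longrightarrow> w \<in> level i \<Longrightarrow> g w \<in> level i"
  using tree_auto_level[OF aut] by blast

lemma snoc: "g \<in> G \<Longrightarrow> w \<in> level i \<Longrightarrow> l \<in> {1, 2, 3} \<Longrightarrow> g (w @ [l]) = g w @ [local_perm g w l]"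
  using tree_auto_snoc[OF aut, of g w i "Suc i" l] by blast

lemma injective: "g \<in> G \<Longrightarrow> w \<in> level i \<Longrightarrow> v \<in> level i \<Longrightarrow> g w = g v \<Longrightarrow> w = v"
  using tree_auto_inj[OF aut, of g w i v i] by blast

lemma local_perm_inverse:
  assumes "g \<in> G" "g' \<in> G" "\<forall>n. \<forall>w\<in>level n. g' (g w) = w \<and> g (g' w) = w" "w \<in> level i"
  shows "local_perm g' (g w) = inverse_fun (local_perm g w)"
proof -
  have "local_perm (g' \<circ> g) w = id"
    using assms(3) level_SucI[OF assms(4)] by (intro local_perm_eq_id) auto
  then have "local_perm g' (g w) \<circ> local_perm g w = id" using comp_local_perm assms by simp
  then show ?thesis
    using S3_inverse_comp(2)[OF local_perm_S3[OF assms(1,4)]] by (metis comp_assoc comp_id id_comp)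
qed

text \<open>Describes the kernel of the restriction to the tree with \<open>n\<close> levels,
  through its action one level further down, as a subgroup of a power of the symmetric group on
  three letters. Nothing is said about deeper levels.\<close>

definition realized :: "nat \<Rightarrow> (nat list \<Rightarrow> nat \<Rightarrow> nat) \<Rightarrow> bool" where
  "realized n d \<longleftrightarrow> (\<exists>h\<in>G. (\<forall>i<n. \<forall>v\<in>level i. local_perm h v = id) \<and> (\<forall>v\<in>level n. local_perm h v = d v))"

lemma fixes_if_local_perm_id:
  assumes "h \<in> G" "\<forall>i<n. \<forall>v\<in>level i. local_perm h v = id" "v \<in> level i" "i \<le> n"
  shows "h v = v"
proof -
  have "h v = id v"
  proof (rule tree_auto_eq_if_local_perm_eq[OF aut[OF assms(1)] tree_auto_id _ assms(3) order_refl])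
    fix j v assume "j < i" "v \<in> level j"
    then show "local_perm h v = local_perm id v"
      using assms(2)[rule_format, of j v] assms(4) local_perm_eq_id[of id v] by simp
  qed
  then show ?thesis by simp
qed

lemma realizedI:
  assumes "h \<in> G" "\<And>v i. i \<le> n \<Longrightarrow> v \<in> level i \<Longrightarrow> h v = v" "\<And>v. v \<in> level n \<Longrightarrow> local_perm h v = d v"
  shows "realized n d"
  unfolding realized_def
proof (intro bexI[of _ h] conjI allI impI ballI)
  fix i v assume "i < n" "v \<in> level i"
  then show "local_perm h v = id"
    using assms(2)[of "Suc i"] level_SucI by (intro local_perm_eq_id) auto
qed (use assms in auto)

lemma realizedE:
  assumes "realized n d"
  obtains h where "h \<in> G" "\<And>v i. i \<le> n \<Longrightarrow> v \<in> level i \<Longrightarrow> h v = v" "\<And>v. v \<in> level n \<Longrightarrow> local_perm h v = d v"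
  using assms fixes_if_local_perm_id unfolding realized_def by metis

lemma realized_S3: "realized n d \<Longrightarrow> v \<in> level n \<Longrightarrow> S3 (d v)"
  by (metis local_perm_S3 realizedE)

lemma realized_cong: "realized n d \<Longrightarrow> (\<And>v. v \<in> level n \<Longrightarrow> d v = d' v) \<Longrightarrow> realized n d'"
  by (auto simp: realized_def)

lemma realized_id: "realized n (\<lambda>v. id)"
  by (rule realizedI[OF id_mem]) (auto intro: local_perm_eq_id)

lemma realized_comp:
  assumes "realized n d" "realized n d'"
  shows "realized n (\<lambda>v. d v \<circ> d' v)"
proof -
  obtain h where h: "h \<in> G" "\<And>v i. i \<le> n \<Longrightarrow> v \<in> level i \<Longrightarrow> h v = v" "\<And>v. v \<in> level n \<Longrightarrow> local_perm h v = d v"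
    using realizedE[OF assms(1)] by metis
  obtain h' where h': "h' \<in> G" "\<And>v i. i \<le> n \<Longrightarrow> v \<in> level i \<Longrightarrow> h' v = v"
    "\<And>v. v \<in> level n \<Longrightarrow> local_perm h' v = d' v" using realizedE[OF assms(2)] by metis
  show ?thesis
    by (rule realizedI[OF comp_mem[OF h(1) h'(1)]])
       (use h h' h'(2)[OF order_refl] in \<open>simp_all add: comp_local_perm\<close>)
qed

lemma realized_conjugate:
  assumes "realized n d" "g \<in> G"
  obtains d' where "realized n d'"
    "\<And>v. v \<in> level n \<Longrightarrow> d' (g v) = local_perm g v \<circ> d v \<circ> inverse_fun (local_perm g v)"
proof -
  obtain h where h: "h \<in> G" "\<And>v i. i \<le> n \<Longrightarrow> v \<in> level i \<Longrightarrow> h v = v" "\<And>v. v \<in> level n \<Longrightarrow> local_perm h v = d v"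
    using realizedE[OF assms(1)] by metis
  obtain g' where g': "g' \<in> G" "\<forall>n. \<forall>w\<in>level n. g' (g w) = w \<and> g (g' w) = w"
    using exists_inverse assms(2) by blast
  have k: "g \<circ> h \<circ> g' \<in> G" using assms h g' comp_mem by blast
  have "realized n (local_perm (g \<circ> h \<circ> g'))"
  proof (rule realizedI[OF k])
    fix v i assume *: "i \<le> n" "v \<in> level i"
    then have "h (g' v) = g' v" using h(2) mem_level[OF g'(1)] by blast
    then show "(g \<circ> h \<circ> g') v = v" using g'(2) * by auto
  qed simp
  moreover have "local_perm (g \<circ> h \<circ> g') (g v) = local_perm g v \<circ> d v \<circ> inverse_fun (local_perm g v)"
    if v: "v \<in> level n" for v
  proof -
    have gv: "g v \<in> level n" using mem_level assms v by blast
    have "local_perm (g \<circ> h \<circ> g') (g v) = local_perm (g \<circ> h) (g' (g v)) \<circ> local_perm g' (g v)"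
      using comp_mem[OF assms(2) h(1)] g'(1) gv by (rule comp_local_perm)
    also have "g' (g v) = v" using g' v by blast
    also have "local_perm (g \<circ> h) v = local_perm g (h v) \<circ> local_perm h v"
      using assms(2) h(1) v by (rule comp_local_perm)
    also have "h v = v" using h v by blast
    also have "local_perm h v = d v" using h v by blast
    also have "local_perm g' (g v) = inverse_fun (local_perm g v)"
      using local_perm_inverse[OF assms(2) g' v] .
    finally show ?thesis .
  qed
  ultimately show ?thesis using that by blast
qed

lemma realized_inverse:
  assumes "realized n d"
  shows "realized n (\<lambda>v. inverse_fun (d v))"
proof -
  obtain h where h: "h \<in> G" "\<And>v i. i \<le> n \<Longrightarrow> v \<in> level i \<Longrightarrow> h v = v" "\<And>v. v \<in> level n \<Longrightarrow> local_perm h v = d v"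
    using realizedE[OF assms] by metis
  obtain h' where h': "h' \<in> G" "\<forall>n. \<forall>w\<in>level n. h' (h w) = w \<and> h (h' w) = w"
    using exists_inverse h by blast
  have "h' v = v" if "i \<le> n" "v \<in> level i" for v i using h'(2) h(2) that by metis
  moreover have "local_perm h' v = inverse_fun (d v)" if "v \<in> level n" for v
    using local_perm_inverse[OF h(1) h' that] h(3)[OF that] h(2)[OF order_refl that] by simp
  ultimately show ?thesis using h'(1) by (intro realizedI)
qed

lemma realized_commutator:
  "realized n d \<Longrightarrow> realized n d' \<Longrightarrow> realized n (\<lambda>v. commutator (d v) (d' v))"
  unfolding commutator_def by (intro realized_comp realized_inverse)

text \<open>A single even permutation at one vertex generates all of them, by transitivity.\<close>

lemma realized_even_at:
  assumes d: "realized n d" "w \<in> level n" "d w \<noteq> id" "sign (d w) = 1" "\<And>v. v \<in> level n \<Longrightarrow> v \<noteq> w \<Longrightarrow> d v = id"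
    and p: "S3 p" "sign p = 1" and w': "w' \<in> level n"
  shows "realized n (\<lambda>v. if v = w' then p else id)"
proof -
  obtain g where g: "g \<in> G" "g w = w'" using transitive d w' by blast
  obtain d' where d': "realized n d'"
    "\<And>v. v \<in> level n \<Longrightarrow> d' (g v) = local_perm g v \<circ> d v \<circ> inverse_fun (local_perm g v)"
    using realized_conjugate[OF d(1) g(1)] by metis
  note S = local_perm_S3[OF g(1)] and Sd = realized_S3[OF d(1)]
  have outside: "d' v = id" if vn: "v \<in> level n" and "v \<noteq> w'" for v
  proof -
    obtain v0 where v0: "v0 \<in> level n" "g v0 = v" using tree_auto_surj[OF aut[OF g(1)] vn, of n] by auto
    then have "v0 \<noteq> w" using g \<open>v \<noteq> w'\<close> by auto
    then show ?thesis using d'(2)[OF v0(1)] v0 d(5)[OF v0(1)] S3_inverse_comp(2)[OF S] by simp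
  qed
  have at: "d' w' = local_perm g w \<circ> d w \<circ> inverse_fun (local_perm g w)" using d'(2)[OF d(2)] g by simp
  have Sw: "S3 (local_perm g w)" "S3 (d w)" using S Sd d by auto
  have q: "S3 (d' w')" unfolding at using Sw by (intro S3_comp S3_inverse)
  have "sign (d' w') = 1"
    unfolding at using Sw d(4) sign_cases[of "local_perm g w"]
    by (auto simp: sign_S3_comp sign_S3_inverse S3_comp S3_inverse)
  moreover have "d' w' \<noteq> id"
  proof
    assume "d' w' = id"
    then have "local_perm g w \<circ> d w = local_perm g w"
      unfolding at using S3_inverse_comp(1)[OF Sw(1)] by (metis comp_assoc comp_id id_comp)
    then have "d w = id" using S3_inverse_comp(1)[OF Sw(1)] by (metis comp_assoc id_comp)
    then show False using d by simp
  qed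
  ultimately have "p = id \<or> p = d' w' \<or> p = d' w' \<circ> d' w'" using S3_even_generated[OF p(1) q p(2)] by auto
  then show ?thesis
  proof (elim disjE)
    assume "p = id"
    then show ?thesis using realized_cong[OF realized_id] by simp
  next
    assume "p = d' w'"
    then show ?thesis using realized_cong[OF d'(1)] outside by simp
  next
    assume "p = d' w' \<circ> d' w'"
    then show ?thesis using realized_cong[OF realized_comp[OF d'(1) d'(1)]] outside by simp
  qed
qed

lemma realized_even:
  assumes "\<And>p w. S3 p \<Longrightarrow> sign p = 1 \<Longrightarrow> w \<in> level n \<Longrightarrow> realized n (\<lambda>v. if v = w then p else id)"
    and d: "\<And>v. v \<in> level n \<Longrightarrow> S3 (d v)" "\<And>v. v \<in> level n \<Longrightarrow> sign (d v) = 1"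
  shows "realized n d"
proof -
  have "realized n (\<lambda>v. if v \<in> A then d v else id)" if "finite A" "A \<subseteq> level n" for A
    using that
  proof (induction A rule: finite_induct)
    case empty
    show ?case by (rule realized_cong[OF realized_id]) (simp add: id_def)
  next
    case (insert w A)
    have "realized n (\<lambda>v. (if v = w then d w else id) \<circ> (if v \<in> A then d v else id))"
      using insert assms(1)[of "d w" w] d by (intro realized_comp) auto
    then show ?case by (rule realized_cong) (use insert in auto)
  qed
  then have "realized n (\<lambda>v. if v \<in> level n then d v else id)" by simp
  then show ?thesis by (rule realized_cong) simp
qed

text \<open>Once single even permutations are available, only the pattern of signs of a kernel
  element matters. This splits the inductive step into producing even permutations and producing
  sign patterns.\<close>

lemma realized_same_sign:
  assumes "\<And>p w. S3 p \<Longrightarrow> sign p = 1 \<Longrightarrow> w \<in> level n \<Longrightarrow> realized n (\<lambda>v. if v = w then p else id)"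
    and "realized n e" "\<And>v. v \<in> level n \<Longrightarrow> S3 (d v)" "\<And>v. v \<in> level n \<Longrightarrow> sign (d v) = sign (e v)"
  shows "realized n d"
proof -
  note S = realized_S3[OF assms(2)]
  have "realized n (\<lambda>v. d v \<circ> inverse_fun (e v))"
  proof (rule realized_even[OF assms(1)])
    fix v assume v: "v \<in> level n"
    show "S3 (d v \<circ> inverse_fun (e v))" using assms v S by (intro S3_comp S3_inverse) auto
    show "sign (d v \<circ> inverse_fun (e v)) = 1"
      using assms v S sign_cases[of "e v"] by (auto simp: sign_S3_comp S3_inverse sign_S3_inverse)
  qed
  from realized_comp[OF this assms(2)] show ?thesis
    by (rule realized_cong) (simp add: comp_assoc S3_inverse_comp S)
qed

text \<open>An odd permutation at the root fixes a label; by transitivity it has a conjugate with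
  another fixed label. Their commutator is a 3-cycle, and together with the odd permutation it
  generates the whole symmetric group.\<close>

lemma realized_root:
  assumes "S3 (d [])"
  shows "realized 0 d"
proof -
  obtain h where h: "h \<in> G" "sign (local_perm h []) = - 1" using odd_root by blast
  define e where "e = local_perm h"
  have e: "realized 0 e" by (rule realizedI[OF h(1)]) (use tree_auto_Nil[OF aut[OF h(1)]] in \<open>auto simp: e_def\<close>)
  have nil: "[] \<in> level 0" by simp
  have S: "S3 (e [])" using local_perm_S3[OF h(1) nil] by (simp add: e_def)
  obtain l where l: "l \<in> {1, 2, 3}" "e [] l = l" using S3_odd_fixpoint[OF S] h by (auto simp: e_def)
  obtain l' where l': "l' \<in> {1, 2, 3}" "l' \<noteq> l" by (metis insertI1 insertI2 num.distinct(1) numeral_eq_one_iff)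
  obtain g where g: "g \<in> G" "g [l] = [l']"
    using transitive[of "[l]" "Suc 0" "[l']"] l l' level_SucI[OF nil] by auto
  have q: "local_perm g [] l \<noteq> l" using l l' g by (simp add: local_perm_def)
  obtain e' where e': "realized 0 e'"
    "\<And>v. v \<in> level 0 \<Longrightarrow> e' (g v) = local_perm g v \<circ> e v \<circ> inverse_fun (local_perm g v)"
    using realized_conjugate[OF e g(1)] by metis
  have e'_nil: "e' [] = local_perm g [] \<circ> e [] \<circ> inverse_fun (local_perm g [])"
    using e'(2)[OF nil] tree_auto_Nil[OF aut[OF g(1)]] by simp
  have cn: "commutator (e []) (e' []) \<noteq> id"
    unfolding e'_nil using S local_perm_S3[OF g(1) nil] h l q
    by (intro S3_commutator_conjugate) (auto simp: e_def)
  have cs: "sign (commutator (e []) (e' [])) = 1"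
    using S realized_S3[OF e'(1) nil] by (rule sign_commutator)
  have even: "realized 0 (\<lambda>v. if v = w then p else id)" if "S3 p" "sign p = 1" "w \<in> level 0" for p w
    using realized_even_at[OF realized_commutator[OF e e'(1)] nil cn cs _ that] by simp
  show ?thesis
  proof (cases "sign (d []) = 1")
    case True
    show ?thesis by (rule realized_even[OF even]) (use assms True in auto)
  next
    case False
    then have "sign (d []) = - 1" using sign_cases by blast
    then show ?thesis using assms h by (intro realized_same_sign[OF even e]) (simp_all add: e_def)
  qed
qed

text \<open>Local permutations are prescribed on the levels below \<open>m\<close> only. The
  relation at \<open>v\<close> involves the children of \<open>v\<close>, whence the bound
  \<open>Suc i < m\<close>.\<close>

definition attains :: "nat \<Rightarrow> bool" where
  "attains m \<longleftrightarrow> (\<forall>c. (\<forall>v. S3 (c v)) \<longrightarrow> (\<forall>i v. Suc i < m \<longrightarrow> v \<in> level i \<longrightarrow> sign_relation c v) \<longrightarrow>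
     (\<exists>g\<in>G. \<forall>i<m. \<forall>v\<in>level i. local_perm g v = c v))"

lemma attainsD:
  assumes "attains m" "\<And>v. S3 (c v)" "\<And>i v. Suc i < m \<Longrightarrow> v \<in> level i \<Longrightarrow> sign_relation c v"
  shows "\<exists>g\<in>G. \<forall>i<m. \<forall>v\<in>level i. local_perm g v = c v"
  using assms unfolding attains_def by metis

text \<open>An even local permutation at one vertex is compatible with all sign relations, so
  \<open>attains\<close> provides it. The action of \<open>k\<close> on the levels below
  \<open>Suc n\<close> remains unknown and has to cancel wherever \<open>k\<close> is used.\<close>

lemma exists_rotation_below:
  assumes "attains (Suc n)" "u \<in> level n" "S3 p" "sign p = 1"
  obtains k where "k \<in> G" "\<And>l. l \<in> {1, 2, 3} \<Longrightarrow> k (u @ [l]) = u @ [p l]"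
    "\<And>v i. i \<le> Suc n \<Longrightarrow> v \<in> level i \<Longrightarrow> (\<And>l. l \<in> {1, 2, 3} \<Longrightarrow> v \<noteq> u @ [l]) \<Longrightarrow> k v = v"
proof -
  define c where "c v = (if v = u then p else id)" for v
  have sc: "sign (c v) = 1" "S3 (c v)" for v using assms S3_id by (auto simp: c_def sign_id)
  obtain k where k: "k \<in> G" "\<And>i v. i < Suc n \<Longrightarrow> v \<in> level i \<Longrightarrow> local_perm k v = c v"
    using attainsD[OF assms(1), of c] sc by (auto simp: sign_relation_def)
  have fix_le: "k v = v" if "v \<in> level i" "i \<le> n" for v i
    using that
  proof (induction i arbitrary: v)
    case 0
    then show ?case using tree_auto_Nil[OF aut[OF k(1)]] by simp
  next
    case (Suc i)
    obtain w l where wl: "v = w @ [l]" "w \<in> level i" "l \<in> {1, 2, 3}" using level_SucE[OF Suc.prems(1)] .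
    have "w \<noteq> u" using wl(2) assms(2) Suc.prems(2) by (auto simp: level_def)
    then have "local_perm k w = id" using k(2)[of i w] wl Suc.prems by (simp add: c_def)
    then show ?case using snoc[OF k(1) wl(2,3)] Suc.IH[OF wl(2)] Suc.prems wl by simp
  qed
  have u: "k u = u" "local_perm k u = p" using fix_le[OF assms(2)] k(2)[OF _ assms(2)] by (auto simp: c_def)
  show ?thesis
  proof (rule that[OF k(1)])
    fix l assume "l \<in> {1, 2, 3 :: nat}"
    then show "k (u @ [l]) = u @ [p l]" using snoc[OF k(1) assms(2)] u by simp
  next
    fix v i assume v: "i \<le> Suc n" "v \<in> level i" "\<And>l. l \<in> {1, 2, 3} \<Longrightarrow> v \<noteq> u @ [l]"
    show "k v = v"
    proof (cases "i \<le> n")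
      case False
      then have "v \<in> level (Suc n)" using v by (simp add: le_Suc_eq)
      then obtain w l where wl: "v = w @ [l]" "w \<in> level n" "l \<in> {1, 2, 3}" by (rule level_SucE)
      then have "w \<noteq> u" using v(3)[of l] by auto
      then have "local_perm k w = id" using k(2)[of n w] wl by (simp add: c_def)
      then show ?thesis using snoc[OF k(1) wl(2,3)] fix_le[OF wl(2)] wl by simp
    qed (use fix_le v in blast)
  qed
qed

lemma sign_product_one_neg:
  fixes s :: "nat \<Rightarrow> int"
  assumes "\<And>l. s l = 1 \<or> s l = - 1" "s 1 * s 2 * s 3 = 1" "l \<in> {1, 2, 3}" "s l = - 1"
  obtains m where "m \<in> {1, 2, 3}" "m \<noteq> l" "s m = 1" "\<And>k. k \<in> {1, 2, 3} \<Longrightarrow> k \<noteq> m \<Longrightarrow> s k = - 1"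
proof -
  have "\<exists>m\<in>{1, 2, 3}. m \<noteq> l \<and> s m = 1 \<and> (\<forall>k\<in>{1, 2, 3}. k \<noteq> m \<longrightarrow> s k = - 1)"
    using assms(1)[of 1] assms(1)[of 2] assms(1)[of 3] assms(2-4) by auto
  then show ?thesis using that by blast
qed

text \<open>A separating element fixes the three children of \<open>u\<close> and is even at exactly one of them. It
  commutes with a rotation of these children up to level \<open>n + 1\<close>, and the commutator is odd at two
  of them.\<close>

lemma exists_realized_odd:
  assumes "attains (Suc n)"
  obtains d v where "realized (Suc n) d" "v \<in> level (Suc n)" "sign (d v) = - 1"
proof -
  obtain g u l where g: "g \<in> G" "u \<in> level n" "l \<in> {1, 2, 3}" "g (u @ [l]) = u @ [l]"
    "sign (local_perm g u) = 1" "sign (local_perm g (u @ [l])) = - 1"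
    using separating[of n] by blast
  have "g u @ [local_perm g u l] = u @ [l]" using snoc[OF g(1-3)] g(4) by simp
  then have gu: "g u = u" "local_perm g u l = l" by auto
  have lid: "local_perm g u = id"
    using S3_even_fixpoint[OF local_perm_S3[OF g(1,2)] g(5) g(3)] gu by simp
  have gchild: "g (u @ [a]) = u @ [a]" if "a \<in> {1, 2, 3}" for a
    using snoc[OF g(1,2) that] gu lid by simp
  define s where "s a = sign (local_perm g (u @ [a]))" for a
  have "s 1 * s 2 * s 3 = 1"
    using signs[OF g(1,2)] by (simp add: sign_relation_def s_def g)
  then obtain m where m: "m \<in> {1, 2, 3}" "m \<noteq> l" "s m = 1"
    using sign_product_one_neg[of s l] g(3,6) sign_cases by (metis s_def)
  obtain p where p: "S3 p" "sign p = 1" "p m = l" using S3_cycle[OF m(1) g(3) m(2)] .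
  obtain k where k: "k \<in> G" "\<And>l. l \<in> {1, 2, 3} \<Longrightarrow> k (u @ [l]) = u @ [p l]"
    "\<And>v i. i \<le> Suc n \<Longrightarrow> v \<in> level i \<Longrightarrow> (\<And>l. l \<in> {1, 2, 3} \<Longrightarrow> v \<noteq> u @ [l]) \<Longrightarrow> k v = v"
    using exists_rotation_below[OF assms g(2) p(1,2)] by metis
  have comm: "g (k v) = k (g v)" if v: "i \<le> Suc n" "v \<in> level i" for i v
  proof (cases "\<exists>a\<in>{1, 2, 3}. v = u @ [a]")
    case True
    then obtain a where a: "a \<in> {1, 2, 3}" "v = u @ [a]" by blast
    moreover have "p a \<in> {1, 2, 3}" using permutes_in_image[OF p(1), of a] a by blast
    ultimately show ?thesis using k(2) gchild by simp
  next
    case False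
    then have kv: "k v = v" using k(3)[OF v] by blast
    have "g v \<noteq> u @ [a]" if a: "a \<in> {1, 2, 3}" for a
    proof
      assume "g v = u @ [a]"
      then have eq: "g v = g (u @ [a])" using gchild a by simp
      have "u @ [a] \<in> level (Suc n)" using level_SucI g(2) a by blast
      moreover have "g v \<in> level i" using mem_level g(1) v(2) by blast
      ultimately have "i = Suc n" using \<open>g v = u @ [a]\<close> level_length by metis
      then have "v = u @ [a]"
        using injective[OF g(1) v(2) _ eq] \<open>u @ [a] \<in> level (Suc n)\<close> by blast
      then show False using False a by blast
    qed
    then have "k (g v) = g v" using k(3)[OF v(1) mem_level[OF g(1) v(2)]] by blast
    then show ?thesis using kv by simp
  qed
  obtain g' where g': "g' \<in> G" "\<forall>n. \<forall>w\<in>level n. g' (g w) = w \<and> g (g' w) = w"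
    using exists_inverse g by blast
  obtain k' where k': "k' \<in> G" "\<forall>n. \<forall>w\<in>level n. k' (k w) = w \<and> k (k' w) = w"
    using exists_inverse k by blast
  define h where "h = (g \<circ> k) \<circ> (g' \<circ> k')"
  have gk: "g \<circ> k \<in> G" "g' \<circ> k' \<in> G" using comp_mem g k g' k' by auto
  then have hG: "h \<in> G" unfolding h_def using comp_mem by blast
  have "realized (Suc n) (local_perm h)"
  proof (rule realizedI[OF hG])
    fix v i assume v: "i \<le> Suc n" "v \<in> level i"
    have lv: "k' v \<in> level i" "g' (k' v) \<in> level i"
      using mem_level v g'(1) k'(1) by blast+
    have "h v = k (g (g' (k' v)))" using comm[OF v(1) lv(2)] by (simp add: h_def)
    then show "h v = v" using g'(2) k'(2) lv v by metis
  qed simp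
  moreover have wl: "u @ [l] \<in> level (Suc n)" "u @ [m] \<in> level (Suc n)" using level_SucI g m by blast+
  moreover have "sign (local_perm h (u @ [l])) = - 1"
  proof -
    have km: "k (u @ [m]) = u @ [l]" using k(2)[OF m(1)] p by simp
    have k'l: "k' (u @ [l]) = u @ [m]" using k'(2) wl km by metis
    have g'm: "g' (u @ [m]) = u @ [m]" using g'(2) wl gchild[OF m(1)] by metis
    have "local_perm h (u @ [l]) = local_perm (g \<circ> k) (u @ [m]) \<circ> local_perm (g' \<circ> k') (u @ [l])"
      unfolding h_def using comp_local_perm[OF gk wl(1)] k'l g'm by simp
    also have "local_perm (g' \<circ> k') (u @ [l]) = local_perm g' (u @ [m]) \<circ> local_perm k' (u @ [l])"
      using comp_local_perm[OF g'(1) k'(1) wl(1)] k'l by simp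
    also have "local_perm (g \<circ> k) (u @ [m]) = local_perm g (u @ [l]) \<circ> local_perm k (u @ [m])"
      using comp_local_perm[OF g(1) k(1) wl(2)] km by simp
    also have "local_perm k' (u @ [l]) = inverse_fun (local_perm k (u @ [m]))"
      using local_perm_inverse[OF k(1) k' wl(2)] km by simp
    also have "local_perm g' (u @ [m]) = inverse_fun (local_perm g (u @ [m]))"
      using local_perm_inverse[OF g(1) g' wl(2)] gchild[OF m(1)] by simp
    \<comment> \<open>The unknown local permutation of \<open>k\<close> enters once directly and
      once inverted, so its sign cancels; what remains is the odd sign of \<open>g\<close> at the
      child \<open>l\<close> and the even one at \<open>m\<close>.\<close>
    finally have h: "local_perm h (u @ [l]) = (local_perm g (u @ [l]) \<circ> local_perm k (u @ [m])) \<circ>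
        (inverse_fun (local_perm g (u @ [m])) \<circ> inverse_fun (local_perm k (u @ [m])))" .
    note S = local_perm_S3[OF g(1) wl(1)] local_perm_S3[OF g(1) wl(2)] local_perm_S3[OF k(1) wl(2)]
    have "sign (local_perm h (u @ [l])) = - 1 * sign (local_perm k (u @ [m])) * (1 * sign (local_perm k (u @ [m])))"
      unfolding h using S g(6) m(3) by (simp add: sign_S3_comp S3_comp S3_inverse sign_S3_inverse s_def)
    then show ?thesis using sign_cases[of "local_perm k (u @ [m])"] by auto
  qed
  ultimately show ?thesis using that by blast
qed

lemma realized_sign_relation:
  assumes "realized (Suc n) d" "u \<in> level n"
  shows "sign (d (u @ [1])) * sign (d (u @ [2])) * sign (d (u @ [3])) = 1"
proof -
  obtain h where h: "h \<in> G" "\<And>v i. i \<le> Suc n \<Longrightarrow> v \<in> level i \<Longrightarrow> h v = v"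
    "\<And>v. v \<in> level (Suc n) \<Longrightarrow> local_perm h v = d v"
    using realizedE[OF assms(1)] by metis
  have "local_perm h u = id"
    using h(2)[OF order_refl] level_SucI[OF assms(2)] by (intro local_perm_eq_id) blast
  then show ?thesis
    using signs[OF h(1) assms(2)] h(3)[OF level_SucI[OF assms(2)]] by (simp add: sign_relation_def sign_id)
qed

text \<open>The smallest nontrivial sign pattern that a kernel element can have: odd at the two
  children of \<open>u\<close> other than \<open>c\<close>. Elsewhere the identity is required, not
  just evenness, so that commutators have small support.\<close>

definition odd_pair :: "nat \<Rightarrow> nat list \<Rightarrow> nat \<Rightarrow> (nat list \<Rightarrow> nat \<Rightarrow> nat) \<Rightarrow> bool" where
  "odd_pair n u c d \<longleftrightarrow> realized (Suc n) d \<and> (\<forall>v\<in>level (Suc n).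
     if \<exists>m\<in>{1, 2, 3}. m \<noteq> c \<and> v = u @ [m] then sign (d v) = - 1 else d v = id)"

text \<open>The element at hand is odd at two children of some \<open>u\<close>, but its
  permutations at other vertices are unknown. Multiplying it with a conjugate by a rotation of these
  children cancels the signs elsewhere, and cubing removes the even permutations. Transitivity then
  moves the pair to the prescribed place.\<close>

lemma exists_odd_pair:
  assumes "attains (Suc n)" "u' \<in> level n" "c' \<in> {1, 2, 3}"
  shows "\<exists>d. odd_pair n u' c' d"
proof -
  obtain d v where d: "realized (Suc n) d" "v \<in> level (Suc n)" "sign (d v) = - 1"
    using exists_realized_odd[OF assms(1)] .
  obtain u l where u: "v = u @ [l]" "u \<in> level n" "l \<in> {1, 2, 3}" using level_SucE[OF d(2)] .
  define s where "s a = sign (d (u @ [a]))" for a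
  obtain m where m: "m \<in> {1, 2, 3}" "m \<noteq> l" "s m = 1" "\<And>k. k \<in> {1, 2, 3} \<Longrightarrow> k \<noteq> m \<Longrightarrow> s k = - 1"
    using sign_product_one_neg[of s l] realized_sign_relation[OF d(1) u(2)] u d(3) sign_cases
    unfolding s_def by metis
  obtain p where p: "S3 p" "sign p = 1" "p m = l" using S3_cycle[OF m(1) u(3) m(2)] .
  obtain k where k: "k \<in> G" "\<And>l. l \<in> {1, 2, 3} \<Longrightarrow> k (u @ [l]) = u @ [p l]"
    "\<And>v i. i \<le> Suc n \<Longrightarrow> v \<in> level i \<Longrightarrow> (\<And>l. l \<in> {1, 2, 3} \<Longrightarrow> v \<noteq> u @ [l]) \<Longrightarrow> k v = v"
    using exists_rotation_below[OF assms(1) u(2) p(1,2)] by metis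
  obtain d' where d': "realized (Suc n) d'"
    "\<And>v. v \<in> level (Suc n) \<Longrightarrow> d' (k v) = local_perm k v \<circ> d v \<circ> inverse_fun (local_perm k v)"
    using realized_conjugate[OF d(1) k(1)] by metis
  note Sd = realized_S3[OF d(1)] and Sd' = realized_S3[OF d'(1)] and Sk = local_perm_S3[OF k(1)]
  have sd': "sign (d' (k v)) = sign (d v)" if "v \<in> level (Suc n)" for v
    using d'(2)[OF that] Sd[OF that] Sk[OF that] sign_cases[of "local_perm k v"]
    by (auto simp: sign_S3_comp sign_S3_inverse S3_comp S3_inverse)
  \<comment> \<open>Away from the children of \<open>u\<close> both factors have the same sign. At
    these children two different patterns with two odd entries are multiplied, which gives a pattern
    of the same kind.\<close>
  define e where "e v = d' v \<circ> d v" for v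
  have e: "realized (Suc n) e" unfolding e_def by (intro realized_comp d' d)
  have se: "sign (e v) = sign (d' v) * sign (d v)" if "v \<in> level (Suc n)" for v
    using sign_S3_comp[OF Sd'[OF that] Sd[OF that]] by (simp add: e_def)
  have e_out: "sign (e v) = 1" if "v \<in> level (Suc n)" "\<And>l. l \<in> {1, 2, 3} \<Longrightarrow> v \<noteq> u @ [l]" for v
    using se[OF that(1)] sd'[OF that(1)] k(3)[OF order_refl that] sign_cases[of "d v"] by auto
  have child: "u @ [a] \<in> level (Suc n)" if "a \<in> {1, 2, 3}" for a using level_SucI[OF u(2) that] .
  have pl: "p l \<in> {1, 2, 3}" using permutes_in_image[OF p(1), of l] u by blast
  have pll: "p l \<noteq> l" using p(3) m(2) inj_eq[OF permutes_inj[OF p(1)], of l m] by auto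
  have el: "sign (e (u @ [l])) = - 1"
    using se[OF child[OF u(3)]] sd'[OF child[OF m(1)]] k(2)[OF m(1)] p(3) m(3) m(4)[OF u(3)] m(2)
    by (simp add: s_def)
  define t where "t a = sign (e (u @ [a]))" for a
  obtain c where c: "c \<in> {1, 2, 3}" "t c = 1" "\<And>k. k \<in> {1, 2, 3} \<Longrightarrow> k \<noteq> c \<Longrightarrow> t k = - 1"
    using sign_product_one_neg[of t l] realized_sign_relation[OF e u(2)] u(3) el sign_cases
    unfolding t_def by metis
  \<comment> \<open>The cube of an even permutation of three letters is the identity, while an odd
    one is its own cube.\<close>
  define q where "q v = e v \<circ> e v \<circ> e v" for v
  have q: "realized (Suc n) q" unfolding q_def by (intro realized_comp e)
  have q_even: "q v = id" if "v \<in> level (Suc n)" "sign (e v) = 1" for v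
    using S3_even_cube[OF realized_S3[OF e that(1)] that(2)] by (simp add: q_def)
  have q_odd: "sign (q v) = - 1" if "v \<in> level (Suc n)" "sign (e v) = - 1" for v
    using S3_odd_square[OF realized_S3[OF e that(1)] that(2)] that by (simp add: q_def)
  obtain g where g: "g \<in> G" "g (u @ [c]) = u' @ [c']"
    using transitive[OF child[OF c(1)] level_SucI[OF assms(2,3)]] by blast
  have gu: "g u = u'" using snoc[OF g(1) u(2) c(1)] g(2) by simp
  obtain r where r: "realized (Suc n) r"
    "\<And>v. v \<in> level (Suc n) \<Longrightarrow> r (g v) = local_perm g v \<circ> q v \<circ> inverse_fun (local_perm g v)"
    using realized_conjugate[OF q g(1)] by metis
  have "if \<exists>m\<in>{1, 2, 3}. m \<noteq> c' \<and> v = u' @ [m] then sign (r v) = - 1 else r v = id"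
    if v: "v \<in> level (Suc n)" for v
  proof -
    obtain w where w: "w \<in> level (Suc n)" "g w = v" using tree_auto_surj[OF aut[OF g(1)] v, of "Suc n"] by auto
    obtain b a where ba: "w = b @ [a]" "b \<in> level n" "a \<in> {1, 2, 3}" using level_SucE[OF w(1)] .
    have gw: "v = g b @ [local_perm g b a]" using snoc[OF g(1) ba(2,3)] w ba by simp
    note Sg = local_perm_S3[OF g(1) w(1)] and Sq = realized_S3[OF q w(1)]
    show ?thesis
    proof (cases "b = u \<and> a \<noteq> c")
      case True
      have "v \<noteq> u' @ [c']" using g w ba True injective[OF g(1) w(1) child[OF c(1)]] by auto
      then have *: "\<exists>m\<in>{1, 2, 3}. m \<noteq> c' \<and> v = u' @ [m]"
        using gw gu True permutes_in_image[OF local_perm_S3[OF g(1) u(2)], of a] ba(3) by auto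
      have "sign (q w) = - 1" using q_odd[OF w(1)] c(3)[OF ba(3)] True ba(1) by (simp add: t_def)
      then have "sign (r v) = - 1"
        using r(2)[OF w(1)] w(2) Sg Sq sign_cases[of "local_perm g w"]
        by (auto simp: sign_S3_comp sign_S3_inverse S3_comp S3_inverse)
      then show ?thesis using * by simp
    next
      case False
      have "sign (e w) = 1"
      proof (cases "b = u")
        case True
        then show ?thesis using False c ba by (simp add: t_def)
      next
        case False
        then show ?thesis using e_out[OF w(1)] ba by simp
      qed
      then have "r v = id" using r(2)[OF w(1)] w(2) q_even[OF w(1)] S3_inverse_comp(2)[OF Sg] by simp
      moreover have "\<not> (\<exists>m\<in>{1, 2, 3}. m \<noteq> c' \<and> v = u' @ [m])"
      proof
        assume "\<exists>m\<in>{1, 2, 3}. m \<noteq> c' \<and> v = u' @ [m]"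
        then have "g b = u'" "v \<noteq> u' @ [c']" using gw by auto
        then have "b = u" using injective[OF g(1) ba(2) u(2)] gu by simp
        then show False using False \<open>v \<noteq> u' @ [c']\<close> g(2) w(2) ba(1) by auto
      qed
      ultimately show ?thesis by simp
    qed
  qed
  then show ?thesis using r(1) unfolding odd_pair_def by blast
qed

lemma odd_pairD:
  assumes "odd_pair n u c d" "u \<in> level n"
  shows "realized (Suc n) d" "\<And>m. m \<in> {1, 2, 3} \<Longrightarrow> m \<noteq> c \<Longrightarrow> sign (d (u @ [m])) = - 1"
    "\<And>v. v \<in> level (Suc n) \<Longrightarrow> (\<And>m. m \<in> {1, 2, 3} \<Longrightarrow> m \<noteq> c \<Longrightarrow> v \<noteq> u @ [m]) \<Longrightarrow> d v = id"
proof -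
  note * = assms(1)[unfolded odd_pair_def]
  show "realized (Suc n) d" using * by blast
  show "sign (d (u @ [m])) = - 1" if "m \<in> {1, 2, 3}" "m \<noteq> c" for m
    using *[THEN conjunct2, rule_format, OF level_SucI[OF assms(2) that(1)]] that by auto
  show "d v = id" if "v \<in> level (Suc n)" "\<And>m. m \<in> {1, 2, 3} \<Longrightarrow> m \<noteq> c \<Longrightarrow> v \<noteq> u @ [m]" for v
    using *[THEN conjunct2, rule_format, OF that(1)] that(2) by (auto split: if_splits)
qed

text \<open>\<open>e\<close> is odd at the first two children of \<open>u\<close>. Conjugating it by
  an element that fixes the first child \<open>x\<close> but moves the letter fixed by
  \<open>e x\<close> gives a commutator \<open>D\<close> that is a 3-cycle at \<open>x\<close> and
  trivial outside the first two children. A second commutator, with an element \<open>f\<close> that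
  is odd at the first and third child and trivial elsewhere, survives at \<open>x\<close>
  only.\<close>

lemma realized_even_below:
  assumes att: "attains (Suc n)" and p: "S3 p" "sign p = 1" "w \<in> level (Suc n)"
  shows "realized (Suc n) (\<lambda>v. if v = w then p else id)"
proof -
  define u where "u = replicate n (1 :: nat)"
  have u: "u \<in> level n" by (auto simp: u_def level_def)
  have child: "u @ [a] \<in> level (Suc n)" if "a \<in> {1, 2, 3}" for a using level_SucI[OF u that] .
  define x where "x = u @ [1]"
  have x: "x \<in> level (Suc n)" using child[of 1] by (simp add: x_def)
  obtain e where "odd_pair n u 3 e" using exists_odd_pair[OF att u, of 3] by auto
  note e = odd_pairD[OF this u]
  have ex: "S3 (e x)" "sign (e x) = - 1" using realized_S3[OF e(1) x] e(2)[of 1] by (auto simp: x_def)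
  obtain l where l: "l \<in> {1, 2, 3}" "e x l = l" using S3_odd_fixpoint[OF ex] by auto
  obtain l' where l': "l' \<in> {1, 2, 3}" "l' \<noteq> l" by (metis insertI1 insertI2 num.distinct(1) numeral_eq_one_iff)
  obtain g where g: "g \<in> G" "g (x @ [l]) = x @ [l']"
    using transitive[OF level_SucI[OF x l(1)] level_SucI[OF x l'(1)]] by auto
  have gx: "g x = x" "local_perm g x l = l'" using snoc[OF g(1) x l(1)] g(2) by auto
  have gu: "g u = u" using snoc[OF g(1) u, of 1] gx by (simp add: x_def)
  obtain e' where e': "realized (Suc n) e'"
    "\<And>v. v \<in> level (Suc n) \<Longrightarrow> e' (g v) = local_perm g v \<circ> e v \<circ> inverse_fun (local_perm g v)"
    using realized_conjugate[OF e(1) g(1)] by metis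
  define D where "D v = commutator (e v) (e' v)" for v
  have D: "realized (Suc n) D" unfolding D_def by (intro realized_commutator e e')
  have Dx: "S3 (D x)" "sign (D x) = 1" "D x \<noteq> id"
  proof -
    show "S3 (D x)" using realized_S3[OF D x] .
    show "sign (D x) = 1" unfolding D_def by (intro sign_commutator realized_S3[OF _ x] e e')
    have "e' x = local_perm g x \<circ> e x \<circ> inverse_fun (local_perm g x)" using e'(2)[OF x] gx by simp
    then show "D x \<noteq> id"
      unfolding D_def using S3_commutator_conjugate[OF ex(1) local_perm_S3[OF g(1) x] ex(2) l] gx l' by simp
  qed
  have Dout: "D v = id" if "v \<in> level (Suc n)" "v \<noteq> x" "v \<noteq> u @ [2]" for v
  proof -
    have "e v = id"
      using that by (intro e(3)) (auto simp: x_def)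
    then show ?thesis using commutator_id(2)[OF realized_S3[OF e'(1) that(1)]] by (simp add: D_def)
  qed
  obtain f where "odd_pair n u 2 f" using exists_odd_pair[OF att u, of 2] by auto
  note f = odd_pairD[OF this u]
  define C where "C v = commutator (D v) (f v)" for v
  have C: "realized (Suc n) C" unfolding C_def by (intro realized_commutator D f)
  have fx: "S3 (f x)" "sign (f x) = - 1" using realized_S3[OF f(1) x] f(2)[of 1] by (auto simp: x_def)
  have "C x \<noteq> id" unfolding C_def by (intro S3_commutator_even_odd Dx fx)
  moreover have "sign (C x) = 1" unfolding C_def by (intro sign_commutator Dx fx)
  moreover have "C v = id" if v: "v \<in> level (Suc n)" "v \<noteq> x" for v
  proof (cases "v = u @ [2]")
    case True
    then have "f v = id" using v by (intro f(3)) auto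
    then show ?thesis using commutator_id(1)[OF realized_S3[OF D v(1)]] by (simp add: C_def)
  next
    case False
    then show ?thesis
      using Dout[OF v] commutator_id(2)[OF realized_S3[OF f(1) v(1)]] by (simp add: C_def)
  qed
  ultimately show ?thesis using realized_even_at[OF C x _ _ _ p] by blast
qed

text \<open>A triple of signs with product 1 has no or exactly two entries -1, so each triple of
  siblings costs at most one odd pair. The even discrepancy is supplied at single vertices.\<close>

lemma realized_if_signs:
  assumes att: "attains (Suc n)" and d: "\<And>v. S3 (d v)"
    "\<And>u. u \<in> level n \<Longrightarrow> sign (d (u @ [1])) * sign (d (u @ [2])) * sign (d (u @ [3])) = 1"
  shows "realized (Suc n) d"
proof -
  have "\<exists>e. realized (Suc n) e \<and> (\<forall>u\<in>level n. \<forall>a\<in>{1, 2, 3}.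
      sign (e (u @ [a])) = (if u \<in> A then sign (d (u @ [a])) else 1))" if "finite A" "A \<subseteq> level n" for A
    using that
  proof (induction A rule: finite_induct)
    case empty
    then show ?case using realized_id by (intro exI[of _ "\<lambda>v. id"]) (auto simp: sign_id id_def)
  next
    case (insert u A)
    then obtain e where e: "realized (Suc n) e" "\<And>w a. w \<in> level n \<Longrightarrow> a \<in> {1, 2, 3} \<Longrightarrow>
      sign (e (w @ [a])) = (if w \<in> A then sign (d (w @ [a])) else 1)" by auto
    have u: "u \<in> level n" using insert by auto
    have "\<exists>f. realized (Suc n) f \<and> (\<forall>w\<in>level n. \<forall>a\<in>{1, 2, 3}.
        sign (f (w @ [a])) = (if w = u then sign (d (w @ [a])) else 1))"
    proof (cases "\<exists>l\<in>{1, 2, 3}. sign (d (u @ [l])) = - 1")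
      case False
      then have "sign (d (u @ [l])) = 1" if "l \<in> {1, 2, 3}" for l using that sign_cases by blast
      then show ?thesis using realized_id by (intro exI[of _ "\<lambda>v. id"]) (auto simp: sign_id id_def)
    next
      case True
      then obtain l where l: "l \<in> {1, 2, 3}" "sign (d (u @ [l])) = - 1" by blast
      define s where "s a = sign (d (u @ [a]))" for a
      obtain m where m: "m \<in> {1, 2, 3}" "s m = 1" "\<And>k. k \<in> {1, 2, 3} \<Longrightarrow> k \<noteq> m \<Longrightarrow> s k = - 1"
        using sign_product_one_neg[of s l] d(2)[OF u] l sign_cases unfolding s_def by metis
      obtain f where "odd_pair n u m f" using exists_odd_pair[OF att u m(1)] by auto
      note f = odd_pairD[OF this u]
      have "sign (f (w @ [a])) = (if w = u then sign (d (w @ [a])) else 1)"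
        if w: "w \<in> level n" "a \<in> {1, 2, 3}" for w a
      proof (cases "w = u \<and> a \<noteq> m")
        case True
        then show ?thesis using f(2)[OF w(2)] m(3)[OF w(2)] by (simp add: s_def)
      next
        case False
        then have "f (w @ [a]) = id" using level_SucI[OF w] by (intro f(3)) auto
        then show ?thesis using False m(2) by (auto simp: sign_id s_def)
      qed
      then show ?thesis using f(1) by blast
    qed
    then obtain f where f: "realized (Suc n) f" "\<And>w a. w \<in> level n \<Longrightarrow> a \<in> {1, 2, 3} \<Longrightarrow>
        sign (f (w @ [a])) = (if w = u then sign (d (w @ [a])) else 1)" by blast
    have "sign (f (w @ [a]) \<circ> e (w @ [a])) = (if w \<in> insert u A then sign (d (w @ [a])) else 1)"
      if w: "w \<in> level n" "a \<in> {1, 2, 3}" for w a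
    proof -
      have "sign (f (w @ [a]) \<circ> e (w @ [a])) = sign (f (w @ [a])) * sign (e (w @ [a]))"
        using level_SucI[OF w] by (intro sign_S3_comp realized_S3[OF f(1)] realized_S3[OF e(1)])
      then show ?thesis using f(2)[OF w] e(2)[OF w] insert.hyps by auto
    qed
    then show ?case using realized_comp[OF f(1) e(1)] by (intro exI[of _ "\<lambda>v. f v \<circ> e v"]) blast
  qed
  from this[of "level n"] obtain e where e: "realized (Suc n) e"
    "\<And>u a. u \<in> level n \<Longrightarrow> a \<in> {1, 2, 3} \<Longrightarrow> sign (e (u @ [a])) = sign (d (u @ [a]))" by auto
  show ?thesis
  proof (rule realized_same_sign[OF realized_even_below[OF att] e(1) d(1)])
    fix v assume "v \<in> level (Suc n)"
    then show "sign (d v) = sign (e v)" using e(2) by (elim level_SucE) simp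
  qed
qed

text \<open>An element that is right above level \<open>m\<close> is corrected at level
  \<open>m\<close> by a kernel element. The sign relations of \<open>g\<close> and of the target
  \<open>c\<close> at the level above have equal right-hand sides there, so the quotient
  \<open>d\<close> has product of signs 1 over siblings and is realized.\<close>

theorem attains_all: "attains m"
proof (induction m)
  case 0
  then show ?case using id_mem by (auto simp: attains_def)
next
  case (Suc m)
  show ?case
    unfolding attains_def
  proof (intro allI impI)
    fix c assume c: "\<forall>v. S3 (c v)" "\<forall>i v. Suc i < Suc m \<longrightarrow> v \<in> level i \<longrightarrow> sign_relation c v"
    have "\<exists>g\<in>G. \<forall>i<m. \<forall>v\<in>level i. local_perm g v = c v"
    proof (rule attainsD[OF Suc])
      fix i v assume "Suc i < m" "v \<in> level i"
      then show "sign_relation c v" using c(2)[rule_format, of i v] by simp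
    qed (use c in blast)
    then obtain g where g: "g \<in> G" "\<And>i v. i < m \<Longrightarrow> v \<in> level i \<Longrightarrow> local_perm g v = c v" by blast
    define d where "d v = (if v \<in> level m then inverse_fun (local_perm g v) \<circ> c v else id)" for v
    have Sd: "S3 (d v)" for v
    proof (cases "v \<in> level m")
      case True
      have "S3 (inverse_fun (local_perm g v) \<circ> c v)"
        by (intro S3_comp S3_inverse local_perm_S3[OF g(1) True] c(1)[rule_format])
      then show ?thesis using True by (simp add: d_def)
    next
      case False
      then show ?thesis unfolding d_def by (simp only: if_False S3_id)
    qed
    have "realized m d"
    proof (cases m)
      case 0
      then show ?thesis using realized_root Sd by simp
    next
      case (Suc n)
      have "sign (d (u @ [1])) * sign (d (u @ [2])) * sign (d (u @ [3])) = 1" if u: "u \<in> level n" for u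
      proof -
        have "sign (d (u @ [a])) = sign (local_perm g (u @ [a])) * sign (c (u @ [a]))" if "a \<in> {1, 2, 3}" for a
          using level_SucI[OF u that] c(1) local_perm_S3[OF g(1) level_SucI[OF u that]] Suc
          by (simp add: d_def sign_S3_comp sign_S3_inverse S3_inverse)
        then have "sign (d (u @ [1])) * sign (d (u @ [2])) * sign (d (u @ [3])) =
            (sign (local_perm g (u @ [1])) * sign (local_perm g (u @ [2])) * sign (local_perm g (u @ [3]))) *
            (sign (c (u @ [1])) * sign (c (u @ [2])) * sign (c (u @ [3])))" by simp
        also have "\<dots> = sign (local_perm g u) * sign (c u)"
          using signs[OF g(1) u] c(2)[rule_format, of n u] u Suc unfolding sign_relation_def by simp
        also have "\<dots> = 1" using g(2)[of n u] u Suc sign_cases[of "c u"] by auto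
        finally show ?thesis .
      qed
      then show ?thesis using realized_if_signs[of n d] Suc Sd \<open>attains m\<close> by simp
    qed
    then obtain h where h: "h \<in> G" "\<And>v i. i \<le> m \<Longrightarrow> v \<in> level i \<Longrightarrow> h v = v"
      "\<And>v. v \<in> level m \<Longrightarrow> local_perm h v = d v" by (elim realizedE) blast
    have "local_perm (g \<circ> h) v = c v" if v: "i < Suc m" "v \<in> level i" for i v
    proof -
      have *: "local_perm (g \<circ> h) v = local_perm g v \<circ> local_perm h v"
        using comp_local_perm[OF g(1) h(1) v(2)] h(2)[of i v] v by simp
      show ?thesis
      proof (cases "i = m")
        case True
        then have "local_perm h v = inverse_fun (local_perm g v) \<circ> c v" using h(3) v by (simp add: d_def)
        then show ?thesis using * S3_inverse_comp(2)[OF local_perm_S3[OF g(1) v(2)]]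
          by (metis comp_assoc id_comp)
      next
        case False
        have "local_perm h v = id"
          using h(2)[of "Suc i"] False v level_SucI[OF v(2)] by (intro local_perm_eq_id) auto
        then show ?thesis using * g(2)[of i v] False v by simp
      qed
    qed
    then show "\<exists>g\<in>G. \<forall>i<Suc m. \<forall>v\<in>level i. local_perm g v = c v" using comp_mem[OF g(1) h(1)] by blast
  qed
qed

end

section \<open>Comparison with the automorphism groups and with \<open>E\<close>\<close>

lemma mem_vertices_ternary: "w \<in> vertices (ternary_tree n) \<longleftrightarrow> w \<in> level (length w) \<and> length w \<le> n"
  by (auto simp: ternary_tree_def level_def)

lemma vertices_ternary: "vertices (ternary_tree n) = (\<Union>i\<le>n. level i)"
  by (simp add: ternary_tree_def)

lemma tree_auto_butlast:
  "tree_auto n g \<Longrightarrow> w \<in> level (Suc i) \<Longrightarrow> i < n \<Longrightarrow> butlast (g w) = g (butlast w)"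
  by (simp add: tree_auto_def)

lemma level_subset_vertices: "w \<in> level i \<Longrightarrow> i \<le> n \<Longrightarrow> w \<in> vertices (ternary_tree n)"
  by (auto simp: vertices_ternary)

lemma edge_ternary_iff:
  assumes "u \<in> level i" "v \<in> level j" "i \<le> n" "j \<le> n"
  shows "{u, v} \<in> edges (ternary_tree n) \<longleftrightarrow> v \<noteq> [] \<and> u = butlast v \<or> u \<noteq> [] \<and> v = butlast u"
proof
  assume "{u, v} \<in> edges (ternary_tree n)"
  then obtain w l where "{u, v} = {w, w @ [l]}" by (auto simp: ternary_tree_def)
  then show "v \<noteq> [] \<and> u = butlast v \<or> u \<noteq> [] \<and> v = butlast u" by (auto simp: doubleton_eq_iff)
next
  have *: "{u, v} \<in> edges (ternary_tree n)" if "v \<noteq> []" "u = butlast v" "v \<in> level j" "j \<le> n" for u v j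
  proof -
    have v: "v = u @ [last v]" using that by simp
    have "length v = Suc (length u)" "set v = insert (last v) (set u)"
      by (subst v, simp)+
    then have "length u < n" "set u \<subseteq> {1, 2, 3}" "last v \<in> {1, 2, 3}"
      using that(3,4) by (auto simp: level_def)
    then have "\<exists>w l. {u, v} = {w, w @ [l]} \<and> length w < n \<and> set w \<subseteq> {1, 2, 3} \<and> l \<in> {1, 2, 3}"
      using v by metis
    then show ?thesis by (simp add: ternary_tree_def)
  qed
  assume "v \<noteq> [] \<and> u = butlast v \<or> u \<noteq> [] \<and> v = butlast u"
  then show "{u, v} \<in> edges (ternary_tree n)"
    using *[of v u j] *[of u v i] assms by (auto simp: insert_commute)
qed

lemma butlast_level: "w \<in> level (Suc i) \<Longrightarrow> butlast w \<in> level i"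
  by (auto elim: level_SucE)

text \<open>Edges are undirected, so preservation of levels is derived downwards from the root: the
  image of a child is adjacent to the image of its parent, and it cannot be the vertex above that
  one, which by injectivity is already the image of the grandparent.\<close>

lemma Aut_imp_tree_auto:
  assumes "\<sigma> \<in> Aut n"
  shows "tree_auto n \<sigma>"
proof -
  have iso: "rooted_iso (ternary_tree n) (ternary_tree n) \<sigma>" and perm: "\<sigma> permutes vertices (ternary_tree n)"
    using assms by (auto simp: tree_aut_def)
  have edge: "{u, v} \<in> edges (ternary_tree n) \<longleftrightarrow> {\<sigma> u, \<sigma> v} \<in> edges (ternary_tree n)"
    if "u \<in> vertices (ternary_tree n)" "v \<in> vertices (ternary_tree n)" for u v
    using iso that by (auto simp: rooted_iso_def)
  have root: "\<sigma> [] = []" using iso by (simp add: rooted_iso_def ternary_tree_def)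
  have inj: "\<sigma> u = \<sigma> v \<Longrightarrow> u = v" for u v using permutes_inj[OF perm] by (auto dest: injD)
  have vert: "\<sigma> w \<in> level (length (\<sigma> w)) \<and> length (\<sigma> w) \<le> n" if "w \<in> level i" "i \<le> n" for w i
  proof -
    have "w \<in> vertices (ternary_tree n)" using that by (auto simp: vertices_ternary)
    then show ?thesis using permutes_in_image[OF perm] mem_vertices_ternary by blast
  qed
  have main: "\<sigma> w \<in> level i \<and> (i > 0 \<longrightarrow> butlast (\<sigma> w) = \<sigma> (butlast w))" if "w \<in> level i" "i \<le> n" for w i
    using that
  proof (induction i arbitrary: w)
    case 0
    then show ?case using root by simp
  next
    case (Suc i)
    obtain u l where u: "w = u @ [l]" "u \<in> level i" "l \<in> {1, 2, 3}" using level_SucE[OF Suc.prems(1)] .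
    have IH: "\<sigma> u \<in> level i" "i > 0 \<longrightarrow> butlast (\<sigma> u) = \<sigma> (butlast u)" using Suc.IH[OF u(2)] Suc.prems by auto
    have "{u, w} \<in> edges (ternary_tree n)"
      using edge_ternary_iff[OF u(2) Suc.prems(1)] u Suc.prems by simp
    then have "{\<sigma> u, \<sigma> w} \<in> edges (ternary_tree n)"
      using edge[OF level_subset_vertices[OF u(2)] level_subset_vertices[OF Suc.prems]] Suc.prems by simp
    then have "\<sigma> w \<noteq> [] \<and> \<sigma> u = butlast (\<sigma> w) \<or> \<sigma> u \<noteq> [] \<and> \<sigma> w = butlast (\<sigma> u)"
      using edge_ternary_iff[of "\<sigma> u" i "\<sigma> w" "length (\<sigma> w)" n] IH vert[OF Suc.prems] Suc.prems by simp
    then show ?case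
    proof
      assume *: "\<sigma> w \<noteq> [] \<and> \<sigma> u = butlast (\<sigma> w)"
      then have "length (\<sigma> w) = Suc i" using IH(1) by (auto simp: level_def)
      then show ?thesis using * vert[OF Suc.prems] u(1) by simp
    next
      assume *: "\<sigma> u \<noteq> [] \<and> \<sigma> w = butlast (\<sigma> u)"
      then have "i > 0" using IH(1) by (cases i) auto
      then have "\<sigma> w = \<sigma> (butlast u)" using * IH(2) by simp
      then have "u @ [l] = butlast u" using inj u(1) by blast
      then have "length (u @ [l]) = length (butlast u)" by (rule arg_cong)
      then show ?thesis by simp
    qed
  qed
  show ?thesis
    unfolding tree_auto_def
  proof (intro conjI allI impI ballI)
    fix i assume i: "i \<le> n"
    have "inj_on \<sigma> (level i)" using inj by (auto intro: inj_onI)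
    moreover have "\<sigma> ` level i \<subseteq> level i" using main i by blast
    ultimately show "bij_betw \<sigma> (level i) (level i)"
      by (simp add: bij_betw_def endo_inj_surj)
  next
    fix i w assume "i < n" "w \<in> level (Suc i)"
    then show "butlast (\<sigma> w) = \<sigma> (butlast w)" using main[of w "Suc i"] by simp
  qed
qed

lemma AutI:
  assumes g: "tree_auto n g" and out: "\<And>w. w \<notin> vertices (ternary_tree n) \<Longrightarrow> g w = w"
  shows "g \<in> Aut n"
proof -
  have inj: "inj_on g (vertices (ternary_tree n))"
  proof (rule inj_onI)
    fix u v assume uv: "u \<in> vertices (ternary_tree n)" "v \<in> vertices (ternary_tree n)" "g u = g v"
    then obtain i j where ij: "u \<in> level i" "v \<in> level j" "i \<le> n" "j \<le> n" by (auto simp: vertices_ternary)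
    then have "g u \<in> level i" "g v \<in> level j" using tree_auto_level[OF g] by auto
    then have "i = j" using uv(3) by (auto simp: level_def)
    then show "u = v" using tree_auto_inj[OF g ij(1) _ ij(3) uv(3)] ij by simp
  qed
  have bij: "bij_betw g (vertices (ternary_tree n)) (vertices (ternary_tree n))"
    unfolding bij_betw_def
  proof (intro conjI inj endo_inj_surj)
    show "finite (vertices (ternary_tree n))" by (simp add: vertices_ternary)
    show "g ` vertices (ternary_tree n) \<subseteq> vertices (ternary_tree n)"
      using tree_auto_level[OF g] by (fastforce simp: vertices_ternary)
  qed
  have edge: "{u, v} \<in> edges (ternary_tree n) \<longleftrightarrow> {g u, g v} \<in> edges (ternary_tree n)"
    if uv: "u \<in> vertices (ternary_tree n)" "v \<in> vertices (ternary_tree n)" for u v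
  proof -
    obtain i j where ij: "u \<in> level i" "v \<in> level j" "i \<le> n" "j \<le> n" using uv by (auto simp: vertices_ternary)
    have lev: "g u \<in> level i" "g v \<in> level j" using tree_auto_level[OF g] ij by auto
    have *: "v \<noteq> [] \<and> u = butlast v \<longleftrightarrow> g v \<noteq> [] \<and> g u = butlast (g v)"
      if ij: "u \<in> level i" "v \<in> level j" "i \<le> n" "j \<le> n" for u v i j
    proof (cases j)
      case 0
      then show ?thesis using ij tree_auto_Nil[OF g] by simp
    next
      case (Suc k)
      have nz: "v \<noteq> []" "g v \<noteq> []" using tree_auto_level[OF g ij(2,4)] ij(2) Suc by (auto simp: level_def)
      have b: "butlast (g v) = g (butlast v)" using tree_auto_butlast[OF g, of v k] ij Suc by simp
      have bv: "butlast v \<in> level k" using butlast_level ij Suc by blast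
      have "u = butlast v" if "g u = g (butlast v)"
        using inj that ij(1,3) bv Suc ij(4) by (intro inj_onD[OF inj that]) (auto simp: vertices_ternary)
      then show ?thesis using nz b by auto
    qed
    show ?thesis
      unfolding edge_ternary_iff[OF ij] edge_ternary_iff[OF lev ij(3,4)]
      using *[OF ij] *[OF ij(2,1,4,3)] by auto
  qed
  have "g permutes vertices (ternary_tree n)" by (rule bij_imp_permutes[OF bij out])
  moreover have "rooted_iso (ternary_tree n) (ternary_tree n) g"
    using bij edge tree_auto_Nil[OF g] by (auto simp: rooted_iso_def ternary_tree_def)
  ultimately show ?thesis by (simp add: tree_aut_def)
qed

lemma Aut_outside: "\<sigma> \<in> Aut n \<Longrightarrow> w \<notin> vertices (ternary_tree n) \<Longrightarrow> \<sigma> w = w"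
  by (auto simp: tree_aut_def permutes_not_in)

lemma Aut_eqI:
  assumes "\<sigma> \<in> Aut n" "\<tau> \<in> Aut n" "\<And>i v. i < n \<Longrightarrow> v \<in> level i \<Longrightarrow> local_perm \<sigma> v = local_perm \<tau> v"
  shows "\<sigma> = \<tau>"
proof
  fix w show "\<sigma> w = \<tau> w"
  proof (cases "w \<in> vertices (ternary_tree n)")
    case True
    then obtain i where i: "w \<in> level i" "i \<le> n" by (auto simp: vertices_ternary)
    show ?thesis
      by (rule tree_auto_eq_if_local_perm_eq[OF Aut_imp_tree_auto[OF assms(1)] Aut_imp_tree_auto[OF assms(2)] _ i])
         (use assms(3) i(2) less_le_trans in blast)+
  qed (use Aut_outside assms in metis)
qed

lemma level_Cons: "i # v \<in> level (Suc m) \<longleftrightarrow> i \<in> {1, 2, 3} \<and> v \<in> level m"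
  by (auto simp: level_def)

lemma level_Suc_Cons:
  assumes "w \<in> level (Suc m)"
  obtains i v where "w = i # v" "i \<in> {1, 2, 3}" "v \<in> level m"
  using assms by (cases w) (auto simp: level_def)

context
  fixes m :: nat and a :: "nat \<Rightarrow> nat list \<Rightarrow> nat list" and b :: "nat \<Rightarrow> nat"
  assumes a: "\<And>i. i \<in> {1, 2, 3} \<Longrightarrow> a i \<in> Aut m" and b: "S3 b"
begin

lemma wreath_Cons: "i \<in> {1, 2, 3} \<Longrightarrow> v \<in> level k \<Longrightarrow> k \<le> m \<Longrightarrow> wreath (Suc m) a b (i # v) = b i # a i v"
  using level_Cons[of i v k] by (auto simp: wreath_def mem_vertices_ternary level_def)

lemma wreath_Nil: "wreath (Suc m) a b [] = []"
  by (auto simp: wreath_def restrict_id_def)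

lemma b_mem: "i \<in> {1, 2, 3} \<Longrightarrow> b i \<in> {1, 2, 3}"
  using permutes_in_image[OF b] by blast

lemma wreath_Aut: "wreath (Suc m) a b \<in> Aut (Suc m)"
proof (rule AutI)
  show "tree_auto (Suc m) (wreath (Suc m) a b)"
    unfolding tree_auto_def
  proof (intro conjI allI impI ballI)
    fix j assume j: "j \<le> Suc m"
    show "bij_betw (wreath (Suc m) a b) (level j) (level j)"
    proof (cases j)
      case 0
      then show ?thesis by (simp add: wreath_Nil)
    next
      case (Suc k)
      have k: "k \<le> m" using j Suc by simp
      have inj: "inj_on (wreath (Suc m) a b) (level j)"
      proof (rule inj_onI)
        fix u v assume uv: "u \<in> level j" "v \<in> level j" "wreath (Suc m) a b u = wreath (Suc m) a b v"
        obtain i u' where u: "u = i # u'" "i \<in> {1, 2, 3}" "u' \<in> level k" using level_Suc_Cons uv(1) Suc by metis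
        obtain i' v' where v: "v = i' # v'" "i' \<in> {1, 2, 3}" "v' \<in> level k" using level_Suc_Cons uv(2) Suc by metis
        have eq: "b i = b i'" "a i u' = a i' v'"
          using uv(3) wreath_Cons[OF u(2,3) k] wreath_Cons[OF v(2,3) k] u v by auto
        then have "i = i'" using permutes_inj[OF b] by (auto dest: injD)
        then show "u = v" using eq u v tree_auto_inj[OF Aut_imp_tree_auto[OF a[OF u(2)]] u(3) v(3) k] by simp
      qed
      have "wreath (Suc m) a b ` level j \<subseteq> level j"
      proof
        fix y assume "y \<in> wreath (Suc m) a b ` level j"
        then obtain i u' where u: "y = wreath (Suc m) a b (i # u')" "i \<in> {1, 2, 3}" "u' \<in> level k"
          using Suc by (auto elim!: level_Suc_Cons)
        then have "y = b i # a i u'" using wreath_Cons k by simp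
        then show "y \<in> level j"
          using Suc level_Cons b_mem[OF u(2)] tree_auto_level[OF Aut_imp_tree_auto[OF a[OF u(2)]] u(3) k] by simp
      qed
      then show ?thesis using inj by (simp add: bij_betw_def endo_inj_surj)
    qed
  next
    fix j w assume j: "j < Suc m" and w: "w \<in> level (Suc j)"
    obtain i v where v: "w = i # v" "i \<in> {1, 2, 3}" "v \<in> level j" using level_Suc_Cons w by metis
    show "butlast (wreath (Suc m) a b w) = wreath (Suc m) a b (butlast w)"
    proof (cases j)
      case 0
      then have "v = []" "w = [i]" using v by auto
      have "a i [] = []" by (rule tree_auto_Nil[OF Aut_imp_tree_auto[OF a[OF v(2)]]])
      then show ?thesis using v wreath_Cons[OF v(2), of "[]" 0] wreath_Nil \<open>v = []\<close> by simp
    next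
      case (Suc k)
      have av: "a i v \<in> level j" using tree_auto_level[OF Aut_imp_tree_auto[OF a[OF v(2)]] v(3)] j by simp
      then have nz: "v \<noteq> []" "a i v \<noteq> []" using v Suc by (auto simp: level_def)
      have "butlast (wreath (Suc m) a b w) = b i # butlast (a i v)"
        using wreath_Cons[OF v(2,3)] j nz v by simp
      also have "butlast (a i v) = a i (butlast v)"
        using tree_auto_butlast[OF Aut_imp_tree_auto[OF a[OF v(2)]], of v k] v(3) Suc j by simp
      also have "b i # a i (butlast v) = wreath (Suc m) a b (i # butlast v)"
        using wreath_Cons[OF v(2), of "butlast v" k] butlast_level v(3) Suc j by simp
      also have "i # butlast v = butlast w" using v nz by simp
      finally show ?thesis .
    qed
  qed
qed (simp add: wreath_def)

lemma local_perm_wreath_Nil: "local_perm (wreath (Suc m) a b) [] = b"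
proof
  fix l show "local_perm (wreath (Suc m) a b) [] l = b l"
  proof (cases "l \<in> {1, 2, 3}")
    case True
    have "a l [] = []" by (rule tree_auto_Nil[OF Aut_imp_tree_auto[OF a[OF True]]])
    then show ?thesis using wreath_Cons[OF True, of "[]" 0] True by (simp add: local_perm_def)
  next
    case False
    then show ?thesis using permutes_not_in[OF b False] by (simp add: local_perm_def)
  qed
qed

lemma local_perm_wreath_Cons:
  assumes "i \<in> {1, 2, 3}" "v \<in> level k" "k < m"
  shows "local_perm (wreath (Suc m) a b) (i # v) = local_perm (a i) v"
proof
  fix l show "local_perm (wreath (Suc m) a b) (i # v) l = local_perm (a i) v l"
  proof (cases "l \<in> {1, 2, 3}")
    case True
    have *: "a i (v @ [l]) = a i v @ [local_perm (a i) v l]"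
      using tree_auto_snoc[OF Aut_imp_tree_auto[OF a[OF assms(1)]] assms(2,3) True] .
    have "local_perm (wreath (Suc m) a b) (i # v) l = last (wreath (Suc m) a b (i # (v @ [l])))"
      using True by (simp add: local_perm_def)
    also have "\<dots> = last (b i # (a i v @ [local_perm (a i) v l]))"
      using wreath_Cons[OF assms(1) level_SucI[OF assms(2) True]] assms(3) by (simp only: * Suc_leI)
    finally show ?thesis by simp
  qed (simp add: local_perm_def)
qed

end

lemma Aut_wreath_decomposition:
  assumes "\<sigma> \<in> Aut (Suc m)"
  obtains a where "\<And>i. i \<in> {1, 2, 3} \<Longrightarrow> a i \<in> Aut m" "\<sigma> = wreath (Suc m) a (local_perm \<sigma> [])"
    "\<And>i v k. i \<in> {1, 2, 3} \<Longrightarrow> v \<in> level k \<Longrightarrow> k < m \<Longrightarrow> local_perm (a i) v = local_perm \<sigma> (i # v)"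
proof -
  note auto = Aut_imp_tree_auto[OF assms]
  define b where "b = local_perm \<sigma> []"
  have b: "S3 b" unfolding b_def by (rule S3_local_perm[OF auto, of "[]" 0]) auto
  define a where "a i = restrict_id (\<lambda>v. tl (\<sigma> (i # v))) (vertices (ternary_tree m))" for i
  have bl: "butlast (\<sigma> w) = \<sigma> (butlast w)" if "w \<in> level (Suc j)" "j \<le> m" for w j
    using tree_auto_butlast[OF auto that(1)] that(2) by simp
  have hd: "\<sigma> (i # v) = b i # tl (\<sigma> (i # v)) \<and> tl (\<sigma> (i # v)) \<in> level k"
    if i: "i \<in> {1, 2, 3}" and "v \<in> level k" "k \<le> m" for i v k
    using that(2,3)
  proof (induction k arbitrary: v)
    case 0
    have "\<sigma> [i] = [b i]"
      using tree_auto_snoc[OF auto, of "[]" 0 i] i tree_auto_Nil[OF auto] by (simp add: b_def)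
    then show ?case using 0 by simp
  next
    case (Suc k)
    obtain u l where u: "v = u @ [l]" "u \<in> level k" "l \<in> {1, 2, 3}" using level_SucE[OF Suc.prems(1)] .
    have iu: "i # u \<in> level (Suc k)" using level_Cons i u by blast
    have "\<sigma> (i # v) = \<sigma> (i # u) @ [local_perm \<sigma> (i # u) l]"
      using tree_auto_snoc[OF auto iu _ u(3)] Suc.prems u by simp
    moreover have "\<sigma> (i # u) = b i # tl (\<sigma> (i # u))" "tl (\<sigma> (i # u)) \<in> level k"
      using Suc.IH[OF u(2)] Suc.prems by auto
    moreover have "local_perm \<sigma> (i # u) l \<in> {1, 2, 3}"
      using permutes_in_image[OF S3_local_perm[OF auto iu], of l] Suc.prems u(3) by simp
    ultimately show ?case by (metis append_Cons level_SucI list.sel(3))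
  qed
  have a_eq: "a i v = tl (\<sigma> (i # v))" if "v \<in> level k" "k \<le> m" for i v k
    using that by (auto simp: a_def restrict_id_def vertices_ternary)
  have a: "a i \<in> Aut m" if i: "i \<in> {1, 2, 3}" for i
  proof (rule AutI)
    show "tree_auto m (a i)"
      unfolding tree_auto_def
    proof (intro conjI allI impI ballI)
      fix k assume k: "k \<le> m"
      have "inj_on (a i) (level k)"
      proof (rule inj_onI)
        fix u v assume uv: "u \<in> level k" "v \<in> level k" "a i u = a i v"
        then have "\<sigma> (i # u) = \<sigma> (i # v)" using hd[OF i uv(1) k] hd[OF i uv(2) k] a_eq k by metis
        then show "u = v"
          using tree_auto_inj[OF auto, of "i # u" "Suc k" "i # v"] level_Cons i uv k by auto
      qed
      moreover have "a i ` level k \<subseteq> level k" using hd[OF i _ k] a_eq k by auto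
      ultimately show "bij_betw (a i) (level k) (level k)" by (simp add: bij_betw_def endo_inj_surj)
    next
      fix k v assume k: "k < m" and v: "v \<in> level (Suc k)"
      have iv: "i # v \<in> level (Suc (Suc k))" using level_Cons i v by blast
      have "tl (\<sigma> (i # v)) \<noteq> []" using hd[OF i v] k by (auto simp: level_def)
      then have "butlast (tl (\<sigma> (i # v))) = tl (butlast (\<sigma> (i # v)))" by (simp add: butlast_tl)
      also have "butlast (\<sigma> (i # v)) = \<sigma> (i # butlast v)" using bl[OF iv] k v by (auto simp: level_def)
      finally show "butlast (a i v) = a i (butlast v)"
        using a_eq[OF v] a_eq[OF butlast_level[OF v]] k by simp
    qed
  qed (simp add: a_def)
  have eq: "\<sigma> = wreath (Suc m) a b"
  proof
    fix w show "\<sigma> w = wreath (Suc m) a b w"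
    proof (cases "w \<in> vertices (ternary_tree (Suc m))")
      case True
      then obtain j where j: "w \<in> level j" "j \<le> Suc m" by (auto simp: vertices_ternary)
      show ?thesis
      proof (cases j)
        case 0
        then show ?thesis using j tree_auto_Nil[OF auto] wreath_Nil[OF a b] by simp
      next
        case (Suc k)
        obtain i v where v: "w = i # v" "i \<in> {1, 2, 3}" "v \<in> level k" using level_Suc_Cons j(1) Suc by metis
        have "wreath (Suc m) a b w = b i # a i v" using wreath_Cons[OF a b v(2,3)] v(1) j Suc by simp
        then show ?thesis using hd[OF v(2,3)] a_eq[OF v(3)] j Suc v(1) by simp
      qed
    next
      case False
      then show ?thesis using Aut_outside[OF assms] by (simp add: wreath_def)
    qed
  qed
  have "local_perm (a i) v = local_perm \<sigma> (i # v)" if "i \<in> {1, 2, 3}" "v \<in> level k" "k < m" for i v k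
    using local_perm_wreath_Cons[OF a b that] eq by simp
  then show ?thesis using that a eq unfolding b_def by blast
qed

text \<open>On words of length two the automorphism is a product of three permutations
  \<open>A i\<close> of the second letter, one for each first letter, followed by copies
  \<open>C l\<close> of the root permutation acting on the first letter, one for each second letter.
  The root sign thus occurs three times, which is the same as once.\<close>

lemma sgn_at_2_eq:
  assumes "tree_auto n \<sigma>" "2 \<le> n"
  shows "sgn_at 2 \<sigma> = sign (local_perm \<sigma> []) * (sign (local_perm \<sigma> [1]) * sign (local_perm \<sigma> [2]) * sign (local_perm \<sigma> [3]))"
proof -
  define b where "b = local_perm \<sigma> []"
  define a where "a i = local_perm \<sigma> [i]" for i
  have nil: "[] \<in> level 0" by simp
  have b: "S3 b" unfolding b_def using S3_local_perm[OF assms(1) nil] assms(2) by simp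
  have single: "[i] \<in> level (Suc 0)" if "i \<in> {1, 2, 3}" for i using level_SucI[OF nil that] by simp
  have a: "S3 (a i)" if "i \<in> {1, 2, 3}" for i
    unfolding a_def using S3_local_perm[OF assms(1) single[OF that]] assms(2) by simp
  have act: "\<sigma> [i, l] = [b i, a i l]" if "i \<in> {1, 2, 3}" "l \<in> {1, 2, 3}" for i l
  proof -
    have "\<sigma> ([] @ [i]) = [] @ [b i]"
      using tree_auto_snoc[OF assms(1) nil _ that(1)] tree_auto_Nil[OF assms(1)] assms(2) by (simp add: b_def)
    moreover have "\<sigma> ([i] @ [l]) = \<sigma> [i] @ [a i l]"
      using tree_auto_snoc[OF assms(1) single[OF that(1)] _ that(2)] assms(2) by (simp add: a_def)
    ultimately show ?thesis by simp
  qed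
  define f where "f i l = [i, l]" for i l :: nat
  define g where "g l i = [i, l]" for i l :: nat
  define A where "A i = map_permutation {1, 2, 3} (f i) (a i)" for i
  define C where "C l = map_permutation {1, 2, 3} (g l) b" for l
  have inj: "inj_on (f i) S" "inj_on (g i) S" for i S by (auto simp: f_def g_def inj_on_def)
  have A: "permutation (A i)" "sign (A i) = sign (a i)" if "i \<in> {1, 2, 3}" for i
  proof -
    have "A i permutes (f i ` {1, 2, 3})"
      unfolding A_def by (rule map_permutation_permutes[OF _ a[OF that]]) (simp only: bij_betw_def inj simp_thms)
    then show "permutation (A i)" by (rule permutes_imp_permutation[rotated]) simp
    show "sign (A i) = sign (a i)" unfolding A_def by (rule sign_map_permutation[OF inj(1) a[OF that]]) simp
  qed
  have C: "permutation (C i)" "sign (C i) = sign b" for i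
  proof -
    have "C i permutes (g i ` {1, 2, 3})"
      unfolding C_def by (rule map_permutation_permutes[OF _ b]) (simp only: bij_betw_def inj simp_thms)
    then show "permutation (C i)" by (rule permutes_imp_permutation[rotated]) simp
    show "sign (C i) = sign b" unfolding C_def by (rule sign_map_permutation[OF inj(2) b]) simp
  qed
  have A_apply: "A i w = (if \<exists>l\<in>{1, 2, 3}. w = [i, l] then [i, a i (last w)] else w)" for i w
  proof (cases "\<exists>l\<in>{1, 2, 3}. w = [i, l]")
    case True
    then obtain l where l: "l \<in> {1, 2, 3}" "w = f i l" by (auto simp: f_def)
    then have "A i w = f i (a i l)" unfolding A_def using map_permutation_apply[OF inj(1) l(1)] by simp
    then show ?thesis using True l by (simp add: f_def)
  next
    case False
    then have "w \<notin> f i ` {1, 2, 3}" by (auto simp: f_def)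
    then have "A i w = w" unfolding A_def map_permutation_def by (rule restrict_id_simps(2))
    then show ?thesis by (simp only: False if_False)
  qed
  have C_apply: "C l w = (if \<exists>i\<in>{1, 2, 3}. w = [i, l] then [b (hd w), l] else w)" for l w
  proof (cases "\<exists>i\<in>{1, 2, 3}. w = [i, l]")
    case True
    then obtain i where i: "i \<in> {1, 2, 3}" "w = g l i" by (auto simp: g_def)
    then have "C l w = g l (b i)" unfolding C_def using map_permutation_apply[OF inj(2) i(1)] by simp
    then show ?thesis using True i by (simp add: g_def)
  next
    case False
    then have "w \<notin> g l ` {1, 2, 3}" by (auto simp: g_def)
    then have "C l w = w" unfolding C_def map_permutation_def by (rule restrict_id_simps(2))
    then show ?thesis by (simp only: False if_False)
  qed
  have A_pair: "l \<in> {1, 2, 3} \<Longrightarrow> A i [i, l] = [i, a i l]" "j \<noteq> i \<Longrightarrow> A i [j, l] = [j, l]" for i j l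
    by (auto simp: A_apply)
  have C_pair: "i \<in> {1, 2, 3} \<Longrightarrow> C m [i, m] = [b i, m]" "l \<noteq> m \<Longrightarrow> C m [i, l] = [i, l]" for i l m
    by (auto simp: C_apply)
  have lev2: "w \<in> level 2 \<longleftrightarrow> (\<exists>i\<in>{1, 2, 3}. \<exists>l\<in>{1, 2, 3}. w = [i, l])" for w
  proof -
    have l2: "level 2 = level (Suc (Suc 0))" by (simp only: numeral_2_eq_2)
    show ?thesis
    proof
      assume "w \<in> level 2"
      then obtain i v where v: "w = i # v" "i \<in> {1, 2, 3}" "v \<in> level (Suc 0)" using level_Suc_Cons l2 by metis
      obtain l u where "v = l # u" "l \<in> {1, 2, 3}" "u \<in> level 0" using level_Suc_Cons v(3) by metis
      then show "\<exists>i\<in>{1, 2, 3}. \<exists>l\<in>{1, 2, 3}. w = [i, l]" using v by auto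
    qed (auto simp: l2 level_Cons)
  qed
  have eq: "restrict_id \<sigma> (level 2) = C 1 \<circ> C 2 \<circ> C 3 \<circ> (A 1 \<circ> A 2 \<circ> A 3)"
  proof
    fix w show "restrict_id \<sigma> (level 2) w = (C 1 \<circ> C 2 \<circ> C 3 \<circ> (A 1 \<circ> A 2 \<circ> A 3)) w"
    proof (cases "w \<in> level 2")
      case True
      then obtain i l where il: "i \<in> {1, 2, 3}" "l \<in> {1, 2, 3}" "w = [i, l]" using lev2 by blast
      have al: "a i l \<in> {1, 2, 3}" using permutes_in_image[OF a[OF il(1)], of l] il by blast
      have "(A 1 \<circ> A 2 \<circ> A 3) [i, l] = [i, a i l]" using il(1) il(2) by (auto simp: A_pair)
      moreover have "(C 1 \<circ> C 2 \<circ> C 3) [i, a i l] = [b i, a i l]" using al il(1) by (auto simp: C_pair)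
      ultimately show ?thesis using act[OF il(1,2)] True il(3) by (simp only: restrict_id_simps comp_apply)
    next
      case False
      then have "A i w = w" "C i w = w" if "i \<in> {1, 2, 3}" for i
        using that lev2[of w] by (auto simp: A_apply C_apply)
      then show ?thesis using False by simp
    qed
  qed
  have res: "restrict_id (restrict_id \<sigma> (vertices (ternary_tree 2))) (level 2) = restrict_id \<sigma> (level 2)"
    by (auto simp: restrict_id_def vertices_ternary fun_eq_iff)
  have "sgn_at 2 \<sigma> = sign (restrict_id \<sigma> (level 2))"
    by (simp add: sgn_at_def tree_sgn_def tree_restrict_def sign_on_def res)
  also have "\<dots> = sign b * sign b * sign b * (sign (a 1) * sign (a 2) * sign (a 3))"
    unfolding eq using A C by (simp add: sign_compose permutation_compose)
  finally show ?thesis using sign_cases[of b] by (auto simp: a_def b_def)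
qed

lemma sgn_at_2_iff:
  assumes "tree_auto n \<sigma>" "2 \<le> n"
  shows "sgn_at 2 \<sigma> = 1 \<longleftrightarrow> sign_relation (local_perm \<sigma>) []"
  using sgn_at_2_eq[OF assms] sign_cases[of "local_perm \<sigma> []"] by (auto simp: sign_relation_def)

text \<open>The recursion unrolled: the sign condition of each group in the recursion is the
  relation at its own root, and the membership of the a_i passes it on to deeper vertices. It stops
  at \<open>i < n\<close> since the children of \<open>v\<close> must still have local
  permutations.\<close>

theorem E_iff:
  "\<sigma> \<in> E (Suc n) \<longleftrightarrow> \<sigma> \<in> Aut (Suc n) \<and> (\<forall>i v. i < n \<longrightarrow> v \<in> level i \<longrightarrow> sign_relation (local_perm \<sigma>) v)"
proof (induction n arbitrary: \<sigma>)
  case 0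
  then show ?case by (simp add: One_nat_def)
next
  case (Suc n)
  show ?case
  proof
    assume "\<sigma> \<in> E (Suc (Suc n))"
    then obtain a b where \<sigma>: "\<sigma> \<in> Aut (Suc (Suc n))" "sgn_at 2 \<sigma> = 1"
      "\<And>i. i \<in> {1, 2, 3} \<Longrightarrow> a i \<in> E (Suc n)" "S3 b" "\<sigma> = wreath (Suc (Suc n)) a b" by auto
    have a: "a i \<in> Aut (Suc n)" if "i \<in> {1, 2, 3}" for i using \<sigma>(3)[OF that] Suc.IH by blast
    have "sign_relation (local_perm \<sigma>) v" if i: "i < Suc n" and v: "v \<in> level i" for i v
    proof (cases i)
      case 0
      then show ?thesis using sgn_at_2_iff[OF Aut_imp_tree_auto[OF \<sigma>(1)]] \<sigma>(2) v by simp
    next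
      case (Suc k)
      obtain l u where u: "v = l # u" "l \<in> {1, 2, 3}" "u \<in> level k" using level_Suc_Cons v Suc by metis
      have "sign_relation (local_perm (a l)) u" using Suc.IH \<sigma>(3)[OF u(2)] u(3) i Suc by auto
      moreover have "local_perm \<sigma> (l # w) = local_perm (a l) w" if "w \<in> level j" "j < Suc n" for w j
        unfolding \<sigma>(5) by (rule local_perm_wreath_Cons[where a = a and i = l]) (use a \<sigma>(4) u(2) that in blast)+
      ultimately show ?thesis
        using u(3) i Suc level_SucI[OF u(3), of 1] level_SucI[OF u(3), of 2] level_SucI[OF u(3), of 3]
        unfolding sign_relation_def u(1) by simp
    qed
    then show "\<sigma> \<in> Aut (Suc (Suc n)) \<and> (\<forall>i v. i < Suc n \<longrightarrow> v \<in> level i \<longrightarrow> sign_relation (local_perm \<sigma>) v)"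
      using \<sigma>(1) by blast
  next
    assume *: "\<sigma> \<in> Aut (Suc (Suc n)) \<and> (\<forall>i v. i < Suc n \<longrightarrow> v \<in> level i \<longrightarrow> sign_relation (local_perm \<sigma>) v)"
    then obtain a where a: "\<And>i. i \<in> {1, 2, 3} \<Longrightarrow> a i \<in> Aut (Suc n)"
      "\<sigma> = wreath (Suc (Suc n)) a (local_perm \<sigma> [])"
      "\<And>i v k. i \<in> {1, 2, 3} \<Longrightarrow> v \<in> level k \<Longrightarrow> k < Suc n \<Longrightarrow> local_perm (a i) v = local_perm \<sigma> (i # v)"
      using Aut_wreath_decomposition by blast
    have "a i \<in> E (Suc n)" if i: "i \<in> {1, 2, 3}" for i
    proof -
      have "sign_relation (local_perm (a i)) v" if "k < n" "v \<in> level k" for k v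
      proof -
        have "sign_relation (local_perm \<sigma>) (i # v)" using * that level_Cons[of i v k] i by (auto intro: Suc_mono)
        then show ?thesis
          using a(3)[OF i that(2)] a(3)[OF i level_SucI[OF that(2)]] that unfolding sign_relation_def by simp
      qed
      then show ?thesis using Suc.IH a(1)[OF i] by blast
    qed
    moreover have "S3 (local_perm \<sigma> [])"
      using S3_local_perm[OF Aut_imp_tree_auto, of \<sigma> "Suc (Suc n)" "[]" 0] * by simp
    moreover have "sgn_at 2 \<sigma> = 1" using sgn_at_2_iff[OF Aut_imp_tree_auto, of \<sigma> "Suc (Suc n)"]
        conjunct1[OF *] conjunct2[OF *, rule_format, of 0 "[]"] by simp
    ultimately show "\<sigma> \<in> E (Suc (Suc n))" using * a(2) by auto
  qed
qed

section \<open>Orders of the groups\<close>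

text \<open>The first subtree automorphism is a separate argument because in the count of
  \<open>E\<close> its sign at the root is determined by the other data.\<close>

definition node_wreath ::
  "nat \<Rightarrow> (nat \<Rightarrow> nat) \<times> (nat list \<Rightarrow> nat list) \<times> (nat list \<Rightarrow> nat list) \<Rightarrow> (nat list \<Rightarrow> nat list) \<Rightarrow> nat list \<Rightarrow> nat list"
  where "node_wreath m = (\<lambda>(b, a2, a3) a1. wreath (Suc m) (\<lambda>i. if i = 1 then a1 else if i = 2 then a2 else a3) b)"

lemma wreath_cong:
  assumes "\<And>i. i \<in> {1, 2, 3} \<Longrightarrow> a i = a' i"
  shows "wreath (Suc m) a b = wreath (Suc m) a' b"
proof
  fix w show "wreath (Suc m) a b w = wreath (Suc m) a' b w"
  proof (cases "w \<in> vertices (ternary_tree (Suc m))")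
    case True
    then have "set w \<subseteq> {1, 2, 3}" by (auto simp: vertices_ternary level_def)
    then show ?thesis using assms True by (cases w) (auto simp: wreath_def)
  qed (simp add: wreath_def)
qed

lemma node_wreath_wreath: "wreath (Suc m) a b = node_wreath m (b, a 2, a 3) (a 1)"
  unfolding node_wreath_def by (auto intro: wreath_cong)

context
  fixes m b a1 a2 a3
  assumes b: "S3 b" and a: "a1 \<in> Aut m" "a2 \<in> Aut m" "a3 \<in> Aut m"
begin

lemma node_wreath_Aut: "node_wreath m (b, a2, a3) a1 \<in> Aut (Suc m)"
  unfolding node_wreath_def prod.case by (rule wreath_Aut) (use a b in auto)

lemma local_perm_node_wreath_Nil: "local_perm (node_wreath m (b, a2, a3) a1) [] = b"
  unfolding node_wreath_def prod.case by (rule local_perm_wreath_Nil) (use a b in auto)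

lemma local_perm_node_wreath_Cons:
  assumes "v \<in> level k" "k < m"
  shows "local_perm (node_wreath m (b, a2, a3) a1) (1 # v) = local_perm a1 v"
    "local_perm (node_wreath m (b, a2, a3) a1) (2 # v) = local_perm a2 v"
    "local_perm (node_wreath m (b, a2, a3) a1) (3 # v) = local_perm a3 v"
proof -
  let ?a = "\<lambda>i :: nat. if i = 1 then a1 else if i = 2 then a2 else a3"
  have *: "local_perm (wreath (Suc m) ?a b) (i # v) = local_perm (?a i) v" if "i \<in> {1, 2, 3}" for i
    by (rule local_perm_wreath_Cons[where a = ?a]) (use a b assms that in auto)
  show "local_perm (node_wreath m (b, a2, a3) a1) (1 # v) = local_perm a1 v"
    "local_perm (node_wreath m (b, a2, a3) a1) (2 # v) = local_perm a2 v"
    "local_perm (node_wreath m (b, a2, a3) a1) (3 # v) = local_perm a3 v"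
    unfolding node_wreath_def prod.case using *[of 1] *[of 2] *[of 3] by simp_all
qed

end

lemma node_wreath_inject:
  assumes "S3 b" "a1 \<in> Aut m" "a2 \<in> Aut m" "a3 \<in> Aut m"
    and "S3 b'" "a1' \<in> Aut m" "a2' \<in> Aut m" "a3' \<in> Aut m"
    and eq: "node_wreath m (b, a2, a3) a1 = node_wreath m (b', a2', a3') a1'"
  shows "b = b' \<and> a1 = a1' \<and> a2 = a2' \<and> a3 = a3'"
proof -
  have "b = b'"
    using local_perm_node_wreath_Nil[OF assms(1-4)] local_perm_node_wreath_Nil[OF assms(5-8)] eq by simp
  moreover have "local_perm a1 v = local_perm a1' v" "local_perm a2 v = local_perm a2' v"
    "local_perm a3 v = local_perm a3' v" if "i < m" "v \<in> level i" for i v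
    using local_perm_node_wreath_Cons[OF assms(1-4) that(2,1)]
      local_perm_node_wreath_Cons[OF assms(5-8) that(2,1)] eq by simp_all
  then have "a1 = a1'" "a2 = a2'" "a3 = a3'" using assms by (blast intro: Aut_eqI)+
  ultimately show ?thesis by blast
qed

lemma Aut_0: "Aut 0 = {id}"
proof -
  have "\<sigma> = id" if "\<sigma> \<in> Aut 0" for \<sigma>
  proof
    fix w show "\<sigma> w = id w"
      using tree_auto_Nil[OF Aut_imp_tree_auto[OF that]] Aut_outside[OF that, of w]
      by (cases "w = []") (auto simp: vertices_ternary)
  qed
  moreover have "id \<in> Aut 0" by (rule AutI[OF tree_auto_id]) simp
  ultimately show ?thesis by blast
qed

lemma inj_on_node_wreath:
  assumes "\<And>b a2 a3 a1. ((b, a2, a3), a1) \<in> D \<Longrightarrow> S3 b \<and> a1 \<in> Aut m \<and> a2 \<in> Aut m \<and> a3 \<in> Aut m"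
  shows "inj_on (case_prod (node_wreath m)) D"
proof (rule inj_onI)
  fix x y assume xy: "x \<in> D" "y \<in> D" "case_prod (node_wreath m) x = case_prod (node_wreath m) y"
  obtain b a2 a3 a1 where x: "x = ((b, a2, a3), a1)" by (metis prod.exhaust)
  obtain b' a2' a3' a1' where y: "y = ((b', a2', a3'), a1')" by (metis prod.exhaust)
  show "x = y"
    using assms[OF xy(1)[unfolded x]] assms[OF xy(2)[unfolded y]] xy(3)
      node_wreath_inject[of b a1 m a2 a3 b' a1' a2' a3'] x y by auto
qed

lemma Aut_Suc: "Aut (Suc m) = case_prod (node_wreath m) ` (({b. S3 b} \<times> Aut m \<times> Aut m) \<times> Aut m)"
proof
  show "Aut (Suc m) \<subseteq> case_prod (node_wreath m) ` (({b. S3 b} \<times> Aut m \<times> Aut m) \<times> Aut m)"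
  proof
    fix \<sigma> assume \<sigma>: "\<sigma> \<in> Aut (Suc m)"
    obtain a where a: "\<And>i. i \<in> {1, 2, 3} \<Longrightarrow> a i \<in> Aut m" "\<sigma> = wreath (Suc m) a (local_perm \<sigma> [])"
      using Aut_wreath_decomposition[OF \<sigma>] by metis
    have "S3 (local_perm \<sigma> [])" by (rule S3_local_perm[OF Aut_imp_tree_auto[OF \<sigma>], of "[]" 0]) auto
    then have "((local_perm \<sigma> [], a 2, a 3), a 1) \<in> ({b. S3 b} \<times> Aut m \<times> Aut m) \<times> Aut m" using a(1) by auto
    moreover have "\<sigma> = case_prod (node_wreath m) ((local_perm \<sigma> [], a 2, a 3), a 1)"
      using a(2) node_wreath_wreath[of m a] by simp
    ultimately show "\<sigma> \<in> case_prod (node_wreath m) ` (({b. S3 b} \<times> Aut m \<times> Aut m) \<times> Aut m)" by (rule rev_image_eqI)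
  qed
  show "case_prod (node_wreath m) ` (({b. S3 b} \<times> Aut m \<times> Aut m) \<times> Aut m) \<subseteq> Aut (Suc m)"
  proof (rule image_subsetI)
    fix x assume "x \<in> ({b. S3 b} \<times> Aut m \<times> Aut m) \<times> Aut m"
    then obtain b a2 a3 a1 where "x = ((b, a2, a3), a1)" "S3 b" "a2 \<in> Aut m" "a3 \<in> Aut m" "a1 \<in> Aut m"
      by blast
    then show "case_prod (node_wreath m) x \<in> Aut (Suc m)"
      using node_wreath_Aut[of b a1 m a2 a3] by simp
  qed
qed

lemma card_S3: "card {b. S3 b} = 6"
proof -
  have "card {b. S3 b} = fact 3" by (rule card_permutations) auto
  then show ?thesis by (simp add: fact_numeral)
qed

lemma card_Aut_Suc: "card (Aut (Suc m)) = 6 * card (Aut m) ^ 3"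
proof -
  have "inj_on (case_prod (node_wreath m)) (({b. S3 b} \<times> Aut m \<times> Aut m) \<times> Aut m)"
    by (rule inj_on_node_wreath) auto
  then have "card (Aut (Suc m)) = card (({b. S3 b} \<times> Aut m \<times> Aut m) \<times> Aut m)"
    unfolding Aut_Suc by (rule card_image)
  then show ?thesis by (simp add: card_cartesian_product card_S3 power3_eq_cube)
qed

lemma finite_Aut: "finite (Aut m)"
proof (induction m)
  case 0
  show ?case unfolding Aut_0 by simp
next
  case (Suc m)
  have "finite {b. S3 b}" by (rule card_ge_0_finite) (simp only: card_S3)
  then show ?case unfolding Aut_Suc using Suc by simp
qed

text \<open>The two parts of \<open>E (Suc n)\<close> by the sign at the root. They have equal size,
  so the sign condition one level higher halves the choices for one of the subtrees.\<close>

definition E_sign :: "nat \<Rightarrow> int \<Rightarrow> (nat list \<Rightarrow> nat list) set" where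
  "E_sign n s = {\<sigma> \<in> E (Suc n). sign (local_perm \<sigma> []) = s}"

lemma E_subset_Aut: "E (Suc n) \<subseteq> Aut (Suc n)"
  using E_iff by blast

lemma finite_E: "finite (E (Suc n))"
  using finite_subset[OF E_subset_Aut finite_Aut] .

lemma card_S3_sign:
  assumes "s = 1 \<or> s = - 1"
  shows "card {b. S3 b \<and> sign b = s} = 3"
  using assms
proof
  assume s: "s = 1"
  have "b \<in> {tri 1 2 3, tri 2 3 1, tri 3 1 2}" if "S3 b" "sign b = s" for b
    using S3_cases[OF that(1)] that(2) by (auto simp: s sign_tri)
  then have "{b. S3 b \<and> sign b = s} = {tri 1 2 3, tri 2 3 1, tri 3 1 2}"
    using S3_tri by (auto simp: s sign_tri)
  then show ?thesis by (simp add: tri_eq_iff)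
next
  assume s: "s = - 1"
  have "b \<in> {tri 1 3 2, tri 2 1 3, tri 3 2 1}" if "S3 b" "sign b = s" for b
    using S3_cases[OF that(1)] that(2) by (auto simp: s sign_tri)
  then have "{b. S3 b \<and> sign b = s} = {tri 1 3 2, tri 2 1 3, tri 3 2 1}"
    using S3_tri by (auto simp: s sign_tri)
  then show ?thesis by (simp add: tri_eq_iff)
qed

lemma card_E_eq_sum: "card (E (Suc n)) = card (E_sign n 1) + card (E_sign n (- 1))"
proof -
  have "E (Suc n) = E_sign n 1 \<union> E_sign n (- 1)" using sign_cases by (auto simp: E_sign_def)
  moreover have "E_sign n 1 \<inter> E_sign n (- 1) = {}" by (auto simp: E_sign_def)
  moreover have "finite (E_sign n s)" for s unfolding E_sign_def using finite_E by simp
  ultimately show ?thesis by (simp add: card_Un_disjoint)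
qed

lemma card_E_sign_0: "s = 1 \<or> s = - 1 \<Longrightarrow> card (E_sign 0 s) = 3"
proof -
  assume s: "s = 1 \<or> s = - 1"
  let ?D = "({b. S3 b \<and> sign b = s} \<times> Aut 0 \<times> Aut 0) \<times> Aut 0"
  have inj: "inj_on (case_prod (node_wreath 0)) ?D" by (rule inj_on_node_wreath) auto
  have "E_sign 0 s = {\<sigma> \<in> Aut (Suc 0). sign (local_perm \<sigma> []) = s}" by (simp add: E_sign_def One_nat_def)
  also have "\<dots> = case_prod (node_wreath 0) ` ?D"
    unfolding Aut_Suc
  proof (intro equalityI subsetI)
    fix \<sigma> assume "\<sigma> \<in> {\<sigma> \<in> case_prod (node_wreath 0) ` (({b. S3 b} \<times> Aut 0 \<times> Aut 0) \<times> Aut 0). sign (local_perm \<sigma> []) = s}"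
    then obtain b a2 a3 a1 where "\<sigma> = node_wreath 0 (b, a2, a3) a1" "S3 b" "a1 \<in> Aut 0" "a2 \<in> Aut 0" "a3 \<in> Aut 0"
      "sign (local_perm \<sigma> []) = s" by auto
    moreover from this have "sign b = s" using local_perm_node_wreath_Nil[of b a1 0 a2 a3] by simp
    ultimately show "\<sigma> \<in> case_prod (node_wreath 0) ` ?D" by (auto intro!: image_eqI[of _ _ "((b, a2, a3), a1)"])
  next
    fix \<sigma> assume "\<sigma> \<in> case_prod (node_wreath 0) ` ?D"
    then obtain b a2 a3 a1 where "\<sigma> = node_wreath 0 (b, a2, a3) a1" "S3 b" "a1 \<in> Aut 0" "a2 \<in> Aut 0" "a3 \<in> Aut 0"
      "sign b = s" by auto
    moreover from this have "sign (local_perm \<sigma> []) = s" using local_perm_node_wreath_Nil[of b a1 0 a2 a3] by simp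
    ultimately show "\<sigma> \<in> {\<sigma> \<in> case_prod (node_wreath 0) ` (({b. S3 b} \<times> Aut 0 \<times> Aut 0) \<times> Aut 0). sign (local_perm \<sigma> []) = s}"
      by (auto intro!: image_eqI[of _ _ "((b, a2, a3), a1)"])
  qed
  finally have "card (E_sign 0 s) = card ?D" using card_image[OF inj] by simp
  then show ?thesis using card_S3_sign[OF s] by (simp add: card_cartesian_product Aut_0)
qed

lemma E_sign_Suc:
  "E_sign (Suc n) s = case_prod (node_wreath (Suc n)) `
     (SIGMA (b, a2, a3) : {b. S3 b \<and> sign b = s} \<times> E (Suc n) \<times> E (Suc n).
        E_sign n (s * sign (local_perm a2 []) * sign (local_perm a3 [])))" (is "_ = _ ` ?D")
proof (intro equalityI subsetI)
  fix \<sigma> assume "\<sigma> \<in> E_sign (Suc n) s"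
  then have \<sigma>E: "\<sigma> \<in> E (Suc (Suc n))" and s: "sign (local_perm \<sigma> []) = s" by (auto simp: E_sign_def)
  then obtain a b where a: "\<And>i. i \<in> {1, 2, 3} \<Longrightarrow> a i \<in> E (Suc n)" and b: "S3 b"
    and \<sigma>: "\<sigma> = wreath (Suc (Suc n)) a b" by auto
  have aA: "a i \<in> Aut (Suc n)" if "i \<in> {1, 2, 3}" for i using a[OF that] E_subset_Aut by blast
  have nw: "\<sigma> = node_wreath (Suc n) (b, a 2, a 3) (a 1)" using \<sigma> node_wreath_wreath by simp
  have A3: "a 1 \<in> Aut (Suc n)" "a 2 \<in> Aut (Suc n)" "a 3 \<in> Aut (Suc n)" using aA by auto
  have nil: "local_perm \<sigma> [] = b" unfolding nw by (rule local_perm_node_wreath_Nil[OF b A3])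
  have "sign_relation (local_perm \<sigma>) []" using \<sigma>E E_iff[of \<sigma> "Suc n"] by auto
  then have rel: "sign (local_perm (a 1) []) * sign (local_perm (a 2) []) * sign (local_perm (a 3) []) = s"
    using local_perm_node_wreath_Cons[OF b A3, of "[]" 0] s unfolding nw sign_relation_def by simp
  have "sign (local_perm (a 1) []) = s * sign (local_perm (a 2) []) * sign (local_perm (a 3) [])"
    using rel sign_cases[of "local_perm (a 2) []"] sign_cases[of "local_perm (a 3) []"] by auto
  then have "((b, a 2, a 3), a 1) \<in> ?D" using a b s nil by (auto simp: E_sign_def)
  then show "\<sigma> \<in> case_prod (node_wreath (Suc n)) ` ?D"
    by (rule rev_image_eqI) (simp add: nw)
next
  fix \<sigma> assume "\<sigma> \<in> case_prod (node_wreath (Suc n)) ` ?D"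
  then obtain b a2 a3 a1 where \<sigma>: "\<sigma> = node_wreath (Suc n) (b, a2, a3) a1" and b: "S3 b" "sign b = s"
    and a: "a1 \<in> E (Suc n)" "a2 \<in> E (Suc n)" "a3 \<in> E (Suc n)"
    and s: "sign (local_perm a1 []) = s * sign (local_perm a2 []) * sign (local_perm a3 [])"
    by (auto simp: E_sign_def)
  have A3: "a1 \<in> Aut (Suc n)" "a2 \<in> Aut (Suc n)" "a3 \<in> Aut (Suc n)" using a E_subset_Aut by blast+
  have nil: "local_perm \<sigma> [] = b" unfolding \<sigma> by (rule local_perm_node_wreath_Nil[OF b(1) A3])
  have \<sigma>A: "\<sigma> \<in> Aut (Suc (Suc n))" unfolding \<sigma> by (rule node_wreath_Aut[OF b(1) A3])
  have "sign_relation (local_perm \<sigma>) []"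
    using local_perm_node_wreath_Cons[OF b(1) A3, of "[]" 0] s nil b(2)
      sign_cases[of "local_perm a2 []"] sign_cases[of "local_perm a3 []"]
    unfolding \<sigma> sign_relation_def by auto
  then have "sgn_at 2 \<sigma> = 1" using sgn_at_2_iff[OF Aut_imp_tree_auto[OF \<sigma>A]] by simp
  moreover have "\<exists>a b. (\<forall>i\<in>{1, 2, 3}. a i \<in> E (Suc n)) \<and> S3 b \<and> \<sigma> = wreath (Suc (Suc n)) a b"
    using a b(1) unfolding \<sigma> node_wreath_def prod.case
    by (intro exI[of _ "\<lambda>i :: nat. if i = 1 then a1 else if i = 2 then a2 else a3"] exI[of _ b]) auto
  ultimately have "\<sigma> \<in> E (Suc (Suc n))" using \<sigma>A by simp
  then show "\<sigma> \<in> E_sign (Suc n) s" using nil b by (simp add: E_sign_def)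
qed

text \<open>With c elements of each sign at level n there are 3 choices for b, 2 c for each of a2
  and a3, and c for a1, whose sign is forced. This gives 12 c^3 for either sign, so equality of the
  two parts is passed on.\<close>

lemma card_E_sign: "s = 1 \<or> s = - 1 \<Longrightarrow> card (E_sign n s) = card (E_sign n 1)"
  and card_E_sign_Suc: "s = 1 \<or> s = - 1 \<Longrightarrow> card (E_sign (Suc n) s) = 12 * card (E_sign n 1) ^ 3"
proof -
  have step: "card (E_sign (Suc n) s) = 12 * card (E_sign n 1) ^ 3"
    if same: "\<And>s. s = 1 \<or> s = - 1 \<Longrightarrow> card (E_sign n s) = card (E_sign n 1)" and s: "s = 1 \<or> s = - 1" for n s
  proof -
    let ?I = "{b. S3 b \<and> sign b = s} \<times> E (Suc n) \<times> E (Suc n)"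
    let ?F = "\<lambda>(b, a2, a3). E_sign n (s * sign (local_perm a2 []) * sign (local_perm a3 []))"
    have "inj_on (case_prod (node_wreath (Suc n))) (Sigma ?I ?F)"
      by (rule inj_on_node_wreath) (use E_subset_Aut in \<open>auto simp: E_sign_def\<close>)
    then have "card (E_sign (Suc n) s) = card (Sigma ?I ?F)"
      unfolding E_sign_Suc by (rule card_image)
    also have "\<dots> = (\<Sum>i\<in>?I. card (?F i))"
    proof (rule card_SigmaI)
      have "finite {b. S3 b \<and> sign b = s}" by (rule card_ge_0_finite) (simp only: card_S3_sign[OF s])
      then show "finite ?I" using finite_E by simp
      show "\<forall>i\<in>?I. finite (?F i)" using finite_E by (auto simp: E_sign_def)
    qed
    also have "\<dots> = (\<Sum>i\<in>?I. card (E_sign n 1))"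
    proof (rule sum.cong)
      fix i assume "i \<in> ?I"
      obtain b a2 a3 where i: "i = (b, a2, a3)" by (metis prod.exhaust)
      have "s * sign (local_perm a2 []) * sign (local_perm a3 []) \<in> {1, - 1}"
        using s sign_cases[of "local_perm a2 []"] sign_cases[of "local_perm a3 []"] by auto
      then show "card (?F i) = card (E_sign n 1)" unfolding i prod.case by (intro same) auto
    qed simp
    also have "\<dots> = card ?I * card (E_sign n 1)" by simp
    also have "card ?I = 3 * (card (E (Suc n)) * card (E (Suc n)))"
      using card_S3_sign[OF s] by (simp add: card_cartesian_product)
    also have "card (E (Suc n)) = 2 * card (E_sign n 1)" using card_E_eq_sum[of n] same[of "- 1"] by (simp del: E.simps)
    finally show ?thesis by (simp add: power3_eq_cube)
  qed
  have same: "s = 1 \<or> s = - 1 \<Longrightarrow> card (E_sign n s) = card (E_sign n 1)" for n s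
  proof (cases n)
    case (Suc k)
    have "\<forall>s. s = 1 \<or> s = - 1 \<longrightarrow> card (E_sign k s) = card (E_sign k 1)" for k
    proof (induction k)
      case (Suc k)
      then have same: "card (E_sign k s) = card (E_sign k 1)" if "s = 1 \<or> s = - 1" for s
        using that by blast
      have "card (E_sign (Suc k) s) = card (E_sign (Suc k) 1)" if "s = 1 \<or> s = - 1" for s
        using step[OF same that] step[OF same, of 1] by simp
      then show ?case by blast
    qed (use card_E_sign_0 in auto)
    then show "s = 1 \<or> s = - 1 \<Longrightarrow> card (E_sign n s) = card (E_sign n 1)" by blast
  qed (use card_E_sign_0 in auto)
  show "s = 1 \<or> s = - 1 \<Longrightarrow> card (E_sign n s) = card (E_sign n 1)" by (rule same)
  show "s = 1 \<or> s = - 1 \<Longrightarrow> card (E_sign (Suc n) s) = 12 * card (E_sign n 1) ^ 3"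
    using step same by blast
qed

lemma card_E_Suc: "card (E (Suc (Suc n))) = 3 * card (E (Suc n)) ^ 3"
proof -
  have "card (E (Suc n)) = 2 * card (E_sign n 1)" for n
    using card_E_eq_sum[of n] card_E_sign[of "- 1" n] by (simp del: E.simps)
  then show ?thesis using card_E_sign_Suc[of 1 n] by (simp add: power_mult_distrib del: E.simps)
qed

lemma card_E_1: "card (E (Suc 0)) = 6"
  using card_E_eq_sum[of 0] card_E_sign_0 by simp

section \<open>Logarithms of the orders and the limit\<close>

lemma ln_card_Aut: "ln (real (card (Aut n))) = (3 ^ n - 1) / 2 * ln 6 \<and> card (Aut n) > 0"
proof (induction n)
  case 0
  show ?case by (simp add: Aut_0)
next
  case (Suc n)
  then have "ln (real (card (Aut (Suc n)))) = ln 6 + 3 * ln (real (card (Aut n)))"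
    by (simp add: card_Aut_Suc ln_mult ln_realpow)
  then show ?case using Suc by (simp add: card_Aut_Suc field_simps)
qed

text \<open>The solution of the recursion L_(n+1) = 3 L_n + ln 3 with L_1 = ln 6. Its fixed point is
  -(ln 3)/2, and the coefficient of 3^n is determined by the initial value.\<close>

lemma ln_card_E:
  "ln (real (card (E (Suc n)))) = (2 * ln 6 + ln 3) / 6 * 3 ^ Suc n - ln 3 / 2 \<and> card (E (Suc n)) > 0"
proof (induction n)
  case 0
  show ?case unfolding card_E_1 by simp
next
  case (Suc n)
  have card: "real (card (E (Suc (Suc n)))) = 3 * real (card (E (Suc n))) ^ 3"
    unfolding card_E_Suc by simp
  have "ln (real (card (E (Suc (Suc n))))) = ln 3 + 3 * ln (real (card (E (Suc n))))"
    unfolding card using Suc by (simp add: ln_mult ln_realpow del: E.simps)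
  also have "\<dots> = ln 3 + 3 * ((2 * ln 6 + ln 3) / 6 * 3 ^ Suc n - ln 3 / 2)"
    by (simp only: conjunct1[OF Suc])
  also have "\<dots> = (2 * ln 6 + ln 3) / 6 * 3 ^ Suc (Suc n) - ln 3 / 2"
    by (simp add: algebra_simps)
  finally have "ln (real (card (E (Suc (Suc n))))) = (2 * ln 6 + ln 3) / 6 * 3 ^ Suc (Suc n) - ln 3 / 2" .
  moreover have "card (E (Suc (Suc n))) > 0" unfolding card_E_Suc using Suc by simp
  ultimately show ?case by (rule conjI)
qed

theorem log_order_ratio:
  "(\<lambda>n. ln (real (card (E n))) / ln (real (card (Aut n)))) \<longlonglongrightarrow> 1 - 1 / 3 * (ln 2 / ln 6)"
proof -
  define c :: real where "c = (2 * ln 6 + ln 3) / 6"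
  have pos: "ln (6 :: real) > 0" by simp
  have lim: "(\<lambda>n. (c - ln 3 / 2 * (1 / 3) ^ Suc n) / ((1 - (1 / 3) ^ Suc n) / 2 * ln 6))
      \<longlonglongrightarrow> (c - ln 3 / 2 * 0) / ((1 - 0) / 2 * ln 6)"
    by (intro tendsto_intros LIMSEQ_Suc LIMSEQ_power_zero) auto
  have "ln (real (card (E (Suc n)))) / ln (real (card (Aut (Suc n))))
      = (c - ln 3 / 2 * (1 / 3) ^ Suc n) / ((1 - (1 / 3) ^ Suc n) / 2 * ln 6)" for n
  proof -
    have "ln (real (card (E (Suc n)))) = (c - ln 3 / 2 * (1 / 3) ^ Suc n) * 3 ^ Suc n"
      using ln_card_E[of n] by (simp add: c_def left_diff_distrib power_divide)
    moreover have "ln (real (card (Aut (Suc n)))) = ((1 - (1 / 3) ^ Suc n) / 2 * ln 6) * 3 ^ Suc n"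
    proof -
      have "((1 - (1 / 3) ^ Suc n) / 2 * ln 6) * 3 ^ Suc n = ((1 - (1 / 3) ^ Suc n) * 3 ^ Suc n) / 2 * ln (6 :: real)"
        by simp
      also have "(1 - (1 / 3) ^ Suc n) * 3 ^ Suc n = (3 ^ Suc n - 1 :: real)"
        by (simp add: left_diff_distrib power_divide)
      finally show ?thesis by (simp only: conjunct1[OF ln_card_Aut])
    qed
    moreover have "u * 3 ^ Suc n / (v * 3 ^ Suc n) = u / v" for u v :: real
      by (rule nonzero_mult_divide_mult_cancel_right) simp
    ultimately show ?thesis by (simp only:)
  qed
  \<comment> \<open>The ratio of the leading coefficients is (2 ln 6 + ln 3) / (3 ln 6), and ln 3 =
    ln 6 - ln 2.\<close>
  moreover have "(c - ln 3 / 2 * 0) / ((1 - 0) / 2 * ln 6) = 1 - 1 / 3 * (ln 2 / ln (6 :: real))"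
  proof -
    have "ln (6 :: real) = ln 2 + ln 3" using ln_mult[of 2 "3 :: real"] by simp
    then have "c = (3 * ln 6 - ln 2) / 6" by (simp add: c_def)
    then show ?thesis using pos by (simp add: field_simps)
  qed
  ultimately have "(\<lambda>n. ln (real (card (E (Suc n)))) / ln (real (card (Aut (Suc n)))))
      \<longlonglongrightarrow> 1 - 1 / 3 * (ln 2 / ln 6)" using lim by simp
  then show ?thesis by (rule LIMSEQ_imp_Suc)
qed

section \<open>The Galois action on the preimage tree\<close>

lemma square_root_exists:
  obtains s :: "'k::field alg_closure" where "s * s = a"
proof -
  obtain s where "poly [:- a, 0, 1:] s = 0"
    using alg_closed_imp_poly_has_root[of "[:- a, 0, 1:]"] by auto
  then show ?thesis using that[of s] by (simp add: algebra_simps)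
qed

section \<open>Labelling of the tree by roots and square roots of discriminants\<close>

definition vandermonde :: "(nat \<Rightarrow> 'a::comm_ring_1) \<Rightarrow> 'a" where
  "vandermonde r = (r 1 - r 2) * (r 1 - r 3) * (r 2 - r 3)"

lemma vandermonde_permute:
  assumes "S3 p"
  shows "vandermonde (\<lambda>l. r (p l)) = of_int (sign p) * vandermonde r"
  using S3_cases[OF assms] by (auto simp: vandermonde_def sign_tri tri_def algebra_simps)

definition root_triple :: "'a::field_char_0 \<Rightarrow> (nat \<Rightarrow> 'a) \<Rightarrow> bool" where
  "root_triple t r \<longleftrightarrow> 2 * (r 1 + r 2 + r 3) = 3 \<and> r 1 * r 2 + r 1 * r 3 + r 2 * r 3 = 0 \<and>
     2 * (r 1 * r 2 * r 3) = - t"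

lemma root_triple_cubic:
  assumes "root_triple t r"
  shows "cubic z = t \<longleftrightarrow> z = r 1 \<or> z = r 2 \<or> z = r 3"
  using cubic_factorization[of "r 1" "r 2" "r 3" t z] assms by (auto simp: root_triple_def)

lemma root_triple_elementary:
  assumes "root_triple t r"
  shows "r 1 + r 2 + r 3 = 3 / 2" "r 1 * r 2 + r 1 * r 3 + r 2 * r 3 = 0" "r 1 * r 2 * r 3 = - t / 2"
  using assms by (auto simp: root_triple_def field_simps)

text \<open>The intermediate expression is the classical discriminant of a monic cubic in its
  elementary symmetric functions; here the second of them vanishes.\<close>

lemma root_triple_vandermonde:
  assumes "root_triple t r"
  shows "vandermonde r * vandermonde r = node_disc t"
proof -
  define e1 e2 e3 where "e1 = r 1 + r 2 + r 3" and "e2 = r 1 * r 2 + r 1 * r 3 + r 2 * r 3"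
    and "e3 = r 1 * r 2 * r 3"
  have "vandermonde r * vandermonde r =
      e1\<^sup>2 * e2\<^sup>2 - 4 * e2 ^ 3 - 4 * e1 ^ 3 * e3 + 18 * e1 * e2 * e3 - 27 * e3\<^sup>2"
    unfolding vandermonde_def e1_def e2_def e3_def by (simp add: algebra_simps power2_eq_square power3_eq_cube)
  also have "\<dots> = node_disc t"
    unfolding e1_def e2_def e3_def root_triple_elementary[OF assms]
    by (simp add: node_disc_def power2_eq_square power3_eq_cube algebra_simps)
  finally show ?thesis .
qed

text \<open>The products of the r and of the 1 - r are values of the monic cubic at 0 and 1 up to
  sign, which reproduces t (1 - t) with a factor 1/4. The constant is (27/4)^3 / 4 = (27/8)^2 *
  27/4, whence the 27/8 in the relation between the square roots.\<close>

lemma root_triple_node_disc: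
  assumes "root_triple t r"
  shows "node_disc (r 1) * node_disc (r 2) * node_disc (r 3) = (27 / 8)\<^sup>2 * node_disc t"
proof -
  define e1 e2 e3 where "e1 = r 1 + r 2 + r 3" and "e2 = r 1 * r 2 + r 1 * r 3 + r 2 * r 3"
    and "e3 = r 1 * r 2 * r 3"
  have "(k * a * (1 - a)) * (k * b * (1 - b)) * (k * c * (1 - c)) =
      k ^ 3 * (a * b * c * (1 - (a + b + c) + (a * b + a * c + b * c) - a * b * c))" for k a b c :: 'a
    by (simp add: algebra_simps power3_eq_cube)
  then have "node_disc (r 1) * node_disc (r 2) * node_disc (r 3) = (27 / 4) ^ 3 * (e3 * (1 - e1 + e2 - e3))"
    unfolding node_disc_def e1_def e2_def e3_def .
  also have "e3 * (1 - e1 + e2 - e3) = t * (1 - t) / 4"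
    unfolding e1_def e2_def e3_def root_triple_elementary[OF assms] by (simp add: field_simps)
  also have "(27 / 4) ^ 3 * (t * (1 - t) / 4) = (27 / 8)\<^sup>2 * node_disc t"
    by (simp add: node_disc_def power2_eq_square power3_eq_cube)
  finally show ?thesis .
qed

text \<open>A node carries a value \<open>t\<close> and a square root of \<open>node_disc t\<close>. The children are ordered so that
  their Vandermonde determinant is that square root, and their own square roots are normalised so
  that a fixed relation between the three of them and that of the parent holds. Applying a field
  automorphism to this relation shows that its local permutations satisfy the sign relation.\<close>

definition valid_node :: "'a::field_char_0 \<times> 'a \<Rightarrow> bool" where
  "valid_node s \<longleftrightarrow> fst s \<noteq> 0 \<and> fst s \<noteq> 1 \<and> snd s * snd s = node_disc (fst s)"

definition valid_children :: "'a::field_char_0 \<times> 'a \<Rightarrow> (nat \<Rightarrow> 'a \<times> 'a) \<Rightarrow> bool" where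
  "valid_children s c \<longleftrightarrow> (\<forall>l. valid_node (c l)) \<and> root_triple (fst s) (\<lambda>l. fst (c l)) \<and>
     vandermonde (\<lambda>l. fst (c l)) = snd s \<and> snd (c 1) * snd (c 2) * snd (c 3) = 27 / 8 * snd s"

text \<open>The Vandermonde determinant of the roots is the given square root up to sign, and
  exchanging two roots corrects the sign. Two of the new square roots are free; the third is defined
  by the product relation.\<close>

lemma valid_children_exist:
  fixes s :: "'k::field_char_0 alg_closure \<times> 'k alg_closure"
  assumes "valid_node s"
  shows "\<exists>c. valid_children s c"
proof -
  obtain t \<delta> where s: "s = (t, \<delta>)" by (cases s)
  have t: "t \<noteq> 0" "t \<noteq> 1" "\<delta> * \<delta> = node_disc t" using assms by (auto simp: s valid_node_def)
  obtain r1 r2 r3 where r: "2 * (r1 + r2 + r3) = 3" "r1 * r2 + r1 * r3 + r2 * r3 = 0"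
    "2 * (r1 * r2 * r3) = - t" by (rule cubic_roots)
  \<comment> \<open>All numbers other than 1 and 2 are sent to the third root, since
    \<open>valid_children\<close> asks for a valid node at every label.\<close>
  define q where "q l = (if l = 1 then r1 else if l = 2 then r2 else r3)" for l :: nat
  have q: "root_triple t q" using r by (simp add: root_triple_def q_def)
  have "vandermonde q * vandermonde q = \<delta> * \<delta>" using root_triple_vandermonde[OF q] t by simp
  then have "vandermonde q = \<delta> \<or> vandermonde q = - \<delta>" by (metis square_eq_iff)
  then have "\<exists>q. root_triple t q \<and> vandermonde q = \<delta> \<and> (\<forall>l. l \<noteq> 1 \<longrightarrow> l \<noteq> 2 \<longrightarrow> q l = q 3)"
  proof
    assume "vandermonde q = \<delta>"
    then show ?thesis using q by (intro exI[of _ q]) (auto simp: q_def)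
  next
    assume v: "vandermonde q = - \<delta>"
    define q' where "q' l = (if l = 1 then r2 else if l = 2 then r1 else r3)" for l :: nat
    have "root_triple t q'" using r by (simp add: root_triple_def q'_def algebra_simps)
    moreover have "vandermonde q' = - vandermonde q" by (simp add: vandermonde_def q_def q'_def algebra_simps)
    ultimately show ?thesis using v by (intro exI[of _ q']) (auto simp: q'_def)
  qed
  then obtain r where rt: "root_triple t r" and v: "vandermonde r = \<delta>"
    and r3: "\<And>l. l \<noteq> 1 \<Longrightarrow> l \<noteq> 2 \<Longrightarrow> r l = r 3" by blast
  have r01: "r l \<noteq> 0" "r l \<noteq> 1" for l
  proof -
    have "cubic (r l) = t" using root_triple_cubic[OF rt, of "r l"] r3[of l] by metis
    then show "r l \<noteq> 0" "r l \<noteq> 1" using t by (auto simp: cubic_def)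
  qed
  have nz: "node_disc (r l) \<noteq> 0" for l using r01[of l] by (simp add: node_disc_def)
  obtain d1 where d1: "d1 * d1 = node_disc (r 1)" by (rule square_root_exists)
  obtain d2 where d2: "d2 * d2 = node_disc (r 2)" by (rule square_root_exists)
  define d3 where "d3 = 27 / 8 * \<delta> / (d1 * d2)"
  have d12: "d1 \<noteq> 0" "d2 \<noteq> 0" using d1 d2 nz by (metis mult_zero_left)+
  have "d3 * d3 = (27 / 8)\<^sup>2 * (\<delta> * \<delta>) / ((d1 * d1) * (d2 * d2))"
    by (simp add: d3_def power2_eq_square)
  also have "\<dots> = node_disc (r 1) * node_disc (r 2) * node_disc (r 3) / (node_disc (r 1) * node_disc (r 2))"
    unfolding d1 d2 t(3) root_triple_node_disc[OF rt] by simp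
  also have "\<dots> = node_disc (r 3)" using nz by simp
  finally have d3: "d3 * d3 = node_disc (r 3)" .
  define c where "c l = (r l, if l = 1 then d1 else if l = 2 then d2 else d3)" for l :: nat
  have "valid_node (c l)" for l
    using r01[of l] d1 d2 d3 r3[of l] by (auto simp: valid_node_def c_def)
  moreover have "snd (c 1) * snd (c 2) * snd (c 3) = 27 / 8 * snd s"
    using d12 by (simp add: c_def d3_def s)
  ultimately show ?thesis using rt v by (intro exI[of _ c]) (simp add: valid_children_def c_def s)
qed

text \<open>The pair of value and square root is propagated from the root along each word. All lists
  of numbers get a label, not just vertices, so the relations hold without side conditions.\<close>

lemma tree_labelling_exists:
  fixes t :: "'k::field_char_0 alg_closure"
  assumes "t \<noteq> 0" "t \<noteq> 1"
  obtains r \<delta> :: "nat list \<Rightarrow> 'k alg_closure" where "r [] = t"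
    "\<And>w. root_triple (r w) (\<lambda>l. r (w @ [l]))" "\<And>w. \<delta> w = vandermonde (\<lambda>l. r (w @ [l]))"
    "\<And>w. \<delta> (w @ [1]) * \<delta> (w @ [2]) * \<delta> (w @ [3]) = 27 / 8 * \<delta> w"
    "\<And>w. \<delta> w * \<delta> w = node_disc (r w)" "\<And>w. \<delta> w \<noteq> 0"
proof -
  define nxt where "nxt s = (SOME c. valid_children s c)" for s :: "'k alg_closure \<times> 'k alg_closure"
  have nxt: "valid_children s (nxt s)" if "valid_node s" for s
    unfolding nxt_def by (rule someI_ex[OF valid_children_exist[OF that]])
  obtain d where d: "d * d = node_disc t" by (rule square_root_exists)
  define st where "st w = foldl nxt (t, d) w" for w
  have st: "valid_node (st w)" for w
  proof (induction w rule: rev_induct)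
    case Nil
    then show ?case using assms d by (simp add: st_def valid_node_def)
  next
    case (snoc l w)
    then show ?case using nxt[of "st w"] by (simp add: st_def valid_children_def)
  qed
  have ch: "st (w @ [l]) = nxt (st w) l" for w l by (simp add: st_def)
  show ?thesis
  proof (rule that[of "\<lambda>w. fst (st w)" "\<lambda>w. snd (st w)"])
    fix w
    show "snd (st w) \<noteq> 0" using st[of w] by (auto simp: valid_node_def node_disc_def)
  qed (use nxt[OF st] st in \<open>auto simp: ch valid_children_def valid_node_def\<close>, simp add: st_def)
qed

section \<open>The Galois action on the labelled tree\<close>

lemma poly_iter_poly:
  "poly (ac_poly (iter_poly [:0, 0, 3, - 2 :: 'k::field_char_0:] n)) z = (cubic ^^ n) z"
proof (induction n)
  case 0
  then show ?case by (simp add: iter_poly_def)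
next
  case (Suc n)
  have "iter_poly [:0, 0, 3, - 2 :: 'k:] (Suc n) = pcompose [:0, 0, 3, - 2:] (iter_poly [:0, 0, 3, - 2:] n)"
    by (simp add: iter_poly_def)
  then have "poly (ac_poly (iter_poly [:0, 0, 3, - 2 :: 'k:] (Suc n))) z
      = poly (ac_poly [:0, 0, 3, - 2:]) ((cubic ^^ n) z)"
    using Suc by (simp only: ac_poly_pcompose)
  also have "\<dots> = cubic ((cubic ^^ n) z)"
    by (simp add: cubic_def power2_eq_square algebra_simps)
  finally show ?case by simp
qed

lemma degree_iter_poly: "degree (iter_poly [:0, 0, 3, - 2 :: 'k::field_char_0:] n - [:x:]) = 3 ^ n"
proof -
  have "degree (iter_poly [:0, 0, 3, - 2 :: 'k:] n) = 3 ^ n"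
    by (induction n) (auto simp: iter_poly_def degree_pcompose One_nat_def)
  then show ?thesis by (subst diff_conv_add_uminus, subst degree_add_eq_left) auto
qed

text \<open>Collects the three inputs: the degree bound from the prime above 3, the branch from the
  prime above 2, and the labelling. Branch and labelling are unrelated; the vertices of the branch
  are located through \<open>label\<close>.\<close>

locale cubic_preimages =
  fixes x :: "'k::field_char_0" and \<alpha> :: "nat \<Rightarrow> 'k alg_closure"
    and r \<delta> :: "nat list \<Rightarrow> 'k alg_closure"
  assumes min_degree: "\<And>n z p. (cubic ^^ n) z = to_ac x \<Longrightarrow> p \<noteq> 0 \<Longrightarrow> poly (ac_poly p) z = 0 \<Longrightarrow> 3 ^ n \<le> degree p"
    and chain: "ramified_chain \<alpha>" "\<alpha> 0 = to_ac x"
    and r_Nil: "r [] = to_ac x"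
    and r_triple: "root_triple (r w) (\<lambda>l. r (w @ [l]))"
    and \<delta>_vandermonde: "\<delta> w = vandermonde (\<lambda>l. r (w @ [l]))"
    and \<delta>_product: "\<delta> (w @ [1]) * \<delta> (w @ [2]) * \<delta> (w @ [3]) = 27 / 8 * \<delta> w"
    and \<delta>_square: "\<delta> w * \<delta> w = node_disc (r w)"
    and \<delta>_nz: "\<delta> w \<noteq> 0"
begin

lemma cubic_r: "l \<in> {1, 2, 3} \<Longrightarrow> cubic (r (w @ [l])) = r w"
  using root_triple_cubic[OF r_triple, of "r (w @ [l])" w] by auto

lemma cubic_eq_r_iff: "cubic z = r w \<longleftrightarrow> (\<exists>l\<in>{1, 2, 3}. z = r (w @ [l]))"
  using root_triple_cubic[OF r_triple, of z w] by auto

lemma r_siblings_inj: "a \<in> {1, 2, 3} \<Longrightarrow> b \<in> {1, 2, 3} \<Longrightarrow> r (w @ [a]) = r (w @ [b]) \<Longrightarrow> a = b"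
  using \<delta>_nz[of w] by (auto simp: \<delta>_vandermonde vandermonde_def)

definition fiber :: "nat \<Rightarrow> 'k alg_closure set" where
  "fiber n = {z. (cubic ^^ n) z = to_ac x}"

lemma bij_r: "bij_betw r (level n) (fiber n)"
proof (induction n)
  case 0
  then show ?case by (simp add: fiber_def r_Nil)
next
  case (Suc n)
  have "inj_on r (level (Suc n))"
  proof (rule inj_onI)
    fix u v assume uv: "u \<in> level (Suc n)" "v \<in> level (Suc n)" "r u = r v"
    obtain u' a where u: "u = u' @ [a]" "u' \<in> level n" "a \<in> {1, 2, 3}" using level_SucE[OF uv(1)] .
    obtain v' b where v: "v = v' @ [b]" "v' \<in> level n" "b \<in> {1, 2, 3}" using level_SucE[OF uv(2)] .
    have "r u' = r v'" using cubic_r[OF u(3), of u'] cubic_r[OF v(3), of v'] uv(3) u(1) v(1) by simp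
    then have "u' = v'" using Suc u(2) v(2) by (auto simp: bij_betw_def dest: inj_onD)
    then show "u = v" using r_siblings_inj[OF u(3) v(3)] uv(3) u(1) v(1) by simp
  qed
  moreover have "r ` level (Suc n) = fiber (Suc n)"
  proof (intro equalityI subsetI)
    fix z assume "z \<in> r ` level (Suc n)"
    then obtain w l where w: "z = r (w @ [l])" "w \<in> level n" "l \<in> {1, 2, 3}" by (auto elim!: level_SucE)
    then have "cubic z \<in> fiber n" using cubic_r[of l w] Suc by (auto simp: bij_betw_def)
    then show "z \<in> fiber (Suc n)" by (simp add: fiber_def funpow_swap1)
  next
    fix z assume "z \<in> fiber (Suc n)"
    then have "cubic z \<in> fiber n" by (simp add: fiber_def funpow_swap1)
    then obtain w where w: "w \<in> level n" "cubic z = r w" using Suc by (auto simp: bij_betw_def)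
    then obtain l where "l \<in> {1, 2, 3}" "z = r (w @ [l])" using cubic_eq_r_iff by blast
    then show "z \<in> r ` level (Suc n)" using level_SucI[OF w(1)] by blast
  qed
  ultimately show ?case by (simp add: bij_betw_def)
qed

lemma r_fiber: "w \<in> level n \<Longrightarrow> r w \<in> fiber n"
  using bij_r by (auto simp: bij_betw_def)

lemma r_inj: "u \<in> level n \<Longrightarrow> v \<in> level n \<Longrightarrow> r u = r v \<Longrightarrow> u = v"
  using bij_r by (auto simp: bij_betw_def dest: inj_onD)

definition label :: "nat \<Rightarrow> 'k alg_closure \<Rightarrow> nat list" where
  "label n = inv_into (level n) r"

lemma label_r: "w \<in> level n \<Longrightarrow> label n (r w) = w"
  unfolding label_def using bij_r by (intro inv_into_f_f) (auto simp: bij_betw_def)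

lemma label_level: "z \<in> fiber n \<Longrightarrow> label n z \<in> level n"
  unfolding label_def using bij_r[of n] by (intro inv_into_into) (auto simp: bij_betw_def)

lemma r_label: "z \<in> fiber n \<Longrightarrow> r (label n z) = z"
  unfolding label_def using bij_r[of n] by (intro f_inv_into_f) (auto simp: bij_betw_def)

definition tree_action :: "('k alg_closure \<Rightarrow> 'k alg_closure) \<Rightarrow> nat list \<Rightarrow> nat list" where
  "tree_action \<sigma> w = (if w \<in> level (length w) then label (length w) (\<sigma> (r w)) else w)"

context
  fixes \<sigma> :: "'k alg_closure \<Rightarrow> 'k alg_closure"
  assumes aut: "ac_aut \<sigma>"
begin

lemma ac_aut_numeral: "\<sigma> (numeral k) = numeral k"
  using ac_aut_simps(3)[OF aut, of "numeral k"] by simp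

lemma ac_aut_cubic: "\<sigma> (cubic z) = cubic (\<sigma> z)"
  by (simp add: cubic_def power2_eq_square ac_aut_simps[OF aut] ac_aut_diff[OF aut] ac_aut_numeral)

lemma ac_aut_fiber: "z \<in> fiber n \<Longrightarrow> \<sigma> z \<in> fiber n"
proof -
  have "\<sigma> ((cubic ^^ n) z) = (cubic ^^ n) (\<sigma> z)" by (induction n) (simp_all add: ac_aut_cubic)
  moreover assume "z \<in> fiber n"
  ultimately show ?thesis using ac_aut_simps(3)[OF aut] by (simp add: fiber_def)
qed

lemma tree_action_eq: "w \<in> level n \<Longrightarrow> tree_action \<sigma> w = label n (\<sigma> (r w))"
  using level_length by (auto simp: tree_action_def)

lemma tree_action_level: "w \<in> level n \<Longrightarrow> tree_action \<sigma> w \<in> level n"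
  by (simp add: tree_action_eq label_level ac_aut_fiber r_fiber)

lemma r_tree_action: "w \<in> level n \<Longrightarrow> r (tree_action \<sigma> w) = \<sigma> (r w)"
  by (simp add: tree_action_eq r_label ac_aut_fiber r_fiber)

lemma tree_action_eq_iff: "w \<in> level n \<Longrightarrow> v \<in> level n \<Longrightarrow> tree_action \<sigma> w = v \<longleftrightarrow> \<sigma> (r w) = r v"
  using r_tree_action[of w n] tree_action_level[of w n] r_inj by metis

lemma tree_auto_action: "tree_auto n (tree_action \<sigma>)"
  unfolding tree_auto_def
proof (intro conjI allI impI ballI)
  fix i
  have "inj_on (tree_action \<sigma>) (level i)"
  proof (rule inj_onI)
    fix u v assume uv: "u \<in> level i" "v \<in> level i" "tree_action \<sigma> u = tree_action \<sigma> v"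
    then have "\<sigma> (r u) = \<sigma> (r v)" using r_tree_action by metis
    then show "u = v" using ac_aut_eq_iff[OF aut] r_inj uv by blast
  qed
  moreover have "tree_action \<sigma> ` level i \<subseteq> level i" using tree_action_level by blast
  ultimately show "bij_betw (tree_action \<sigma>) (level i) (level i)" by (simp add: bij_betw_def endo_inj_surj)
next
  fix i w assume w: "w \<in> level (Suc i)"
  obtain v l where v: "w = v @ [l]" "v \<in> level i" "l \<in> {1, 2, 3}" using level_SucE[OF w] .
  obtain v' l' where v': "tree_action \<sigma> w = v' @ [l']" "v' \<in> level i" "l' \<in> {1, 2, 3}"
    using level_SucE[OF tree_action_level[OF w]] .
  have "r v' = cubic (r (tree_action \<sigma> w))" using cubic_r[OF v'(3)] v'(1) by simp
  also have "\<dots> = \<sigma> (cubic (r w))" using r_tree_action[OF w] by (simp add: ac_aut_cubic)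
  also have "\<dots> = \<sigma> (r v)" using cubic_r[OF v(3)] v(1) by simp
  finally have "tree_action \<sigma> v = v'" using tree_action_eq_iff[OF v(2) v'(2)] by simp
  then show "butlast (tree_action \<sigma> w) = tree_action \<sigma> (butlast w)" using v v' by simp
qed

lemma S3_tree_action: "w \<in> level n \<Longrightarrow> S3 (local_perm (tree_action \<sigma>) w)"
  using S3_local_perm[OF tree_auto_action, of w n "Suc n"] by simp

text \<open>Since \<open>\<delta> w\<close> is the Vandermonde determinant of the ordered children,
  the sign of a local permutation is visible on the square root: an automorphism that fixes the node
  is odd there exactly if it negates \<open>\<delta> w\<close>.\<close>

lemma \<delta>_tree_action:
  assumes "w \<in> level n"
  shows "\<sigma> (\<delta> w) = of_int (sign (local_perm (tree_action \<sigma>) w)) * \<delta> (tree_action \<sigma> w)"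
proof -
  let ?p = "local_perm (tree_action \<sigma>) w"
  have "\<sigma> (r (w @ [l])) = r (tree_action \<sigma> w @ [?p l])" if "l \<in> {1, 2, 3}" for l
    using r_tree_action[OF level_SucI[OF assms that]] tree_auto_snoc[OF tree_auto_action assms _ that, of "Suc n"]
    by simp
  then have "\<sigma> (\<delta> w) = vandermonde (\<lambda>l. r (tree_action \<sigma> w @ [?p l]))"
    by (simp add: \<delta>_vandermonde vandermonde_def ac_aut_simps[OF aut] ac_aut_diff[OF aut])
  also have "\<dots> = of_int (sign ?p) * \<delta> (tree_action \<sigma> w)"
    using vandermonde_permute[OF S3_tree_action[OF assms], of "\<lambda>l. r (tree_action \<sigma> w @ [l])"]
    by (simp add: \<delta>_vandermonde)
  finally show ?thesis .
qed

lemma sign_relation_tree_action: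
  assumes w: "w \<in> level n"
  shows "sign_relation (local_perm (tree_action \<sigma>)) w"
proof -
  let ?p = "local_perm (tree_action \<sigma>)" and ?w = "tree_action \<sigma> w"
  define s where "s l = sign (?p (w @ [l]))" for l
  have child: "\<sigma> (\<delta> (w @ [l])) = of_int (s l) * \<delta> (?w @ [?p w l])" if "l \<in> {1, 2, 3}" for l
    using \<delta>_tree_action[OF level_SucI[OF w that]] tree_auto_snoc[OF tree_auto_action w _ that, of "Suc n"]
    by (simp add: s_def)
  have prod: "\<delta> (?w @ [?p w 1]) * \<delta> (?w @ [?p w 2]) * \<delta> (?w @ [?p w 3]) = 27 / 8 * \<delta> ?w"
    unfolding \<delta>_product[symmetric] using S3_cases[OF S3_tree_action[OF w]]
    by (auto simp: tri_def mult_ac)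
  have "\<sigma> (\<delta> (w @ [1]) * \<delta> (w @ [2]) * \<delta> (w @ [3]))
      = of_int (s 1 * s 2 * s 3) * (\<delta> (?w @ [?p w 1]) * \<delta> (?w @ [?p w 2]) * \<delta> (?w @ [?p w 3]))"
    using child by (simp add: ac_aut_simps[OF aut] mult_ac)
  also have "\<dots> = of_int (s 1 * s 2 * s 3) * (27 / 8 * \<delta> ?w)" unfolding prod ..
  finally have 1: "\<sigma> (27 / 8 * \<delta> w) = of_int (s 1 * s 2 * s 3) * (27 / 8 * \<delta> ?w)" unfolding \<delta>_product .
  have "\<sigma> (27 / 8 * \<delta> w) = 27 / 8 * (of_int (sign (?p w)) * \<delta> ?w)"
  proof -
    have c: "(27 / 8 :: 'k alg_closure) = to_ac (27 / 8)" by simp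
    have "\<sigma> (27 / 8 * \<delta> w) = 27 / 8 * \<sigma> (\<delta> w)" unfolding c by (simp only: ac_aut_simps[OF aut])
    then show ?thesis by (simp only: \<delta>_tree_action[OF w])
  qed
  then have "27 / 8 * (of_int (s 1 * s 2 * s 3) * \<delta> ?w) = 27 / 8 * (of_int (sign (?p w)) * \<delta> ?w)"
    using 1 by (metis mult.left_commute)
  moreover have "(27 / 8 :: 'k alg_closure) \<noteq> 0" by simp
  ultimately have "of_int (s 1 * s 2 * s 3) * \<delta> ?w = of_int (sign (?p w)) * \<delta> ?w"
    by (metis mult_left_cancel)
  then have "(of_int (s 1 * s 2 * s 3) :: 'k alg_closure) = of_int (sign (?p w))" using \<delta>_nz by simp
  then have "s 1 * s 2 * s 3 = sign (?p w)" by (simp only: of_int_eq_iff)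
  then show ?thesis by (simp add: sign_relation_def s_def)
qed

end

lemma tree_action_id: "tree_action id = id"
proof
  fix w show "tree_action id w = id w" using label_r by (simp add: tree_action_def)
qed

lemma tree_action_comp:
  assumes "ac_aut \<sigma>" "ac_aut \<tau>"
  shows "tree_action (\<sigma> \<circ> \<tau>) = tree_action \<sigma> \<circ> tree_action \<tau>"
proof
  fix w show "tree_action (\<sigma> \<circ> \<tau>) w = (tree_action \<sigma> \<circ> tree_action \<tau>) w"
  proof (cases "w \<in> level (length w)")
    case True
    have "tree_action \<tau> w \<in> level (length w)" by (rule tree_action_level[OF assms(2) True])
    then show ?thesis
      using tree_action_eq[OF assms(1)] tree_action_eq[OF ac_aut_comp[OF assms] True] r_tree_action[OF assms(2) True]
      by simp
  qed (simp add: tree_action_def)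
qed

lemma ac_aut_node: "ac_aut \<sigma> \<Longrightarrow> \<sigma> (r w) = r w \<Longrightarrow> w \<in> level n \<Longrightarrow> tree_action \<sigma> w = w"
  using tree_action_eq_iff by blast

theorem tree_group_tree_action: "tree_group {tree_action \<sigma> | \<sigma>. ac_aut \<sigma>}"
proof
  fix g n assume "g \<in> {tree_action \<sigma> | \<sigma>. ac_aut \<sigma>}"
  then show "tree_auto n g" using tree_auto_action by blast
next
  show "id \<in> {tree_action \<sigma> | \<sigma>. ac_aut \<sigma>}" using tree_action_id ac_aut_id by force
next
  fix g h assume "g \<in> {tree_action \<sigma> | \<sigma>. ac_aut \<sigma>}" "h \<in> {tree_action \<sigma> | \<sigma>. ac_aut \<sigma>}"
  then obtain \<sigma> \<tau> where "g = tree_action \<sigma>" "ac_aut \<sigma>" "h = tree_action \<tau>" "ac_aut \<tau>" by blast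
  then have "g \<circ> h = tree_action (\<sigma> \<circ> \<tau>)" "ac_aut (\<sigma> \<circ> \<tau>)"
    using tree_action_comp ac_aut_comp by metis+
  then show "g \<circ> h \<in> {tree_action \<sigma> | \<sigma>. ac_aut \<sigma>}" by blast
next
  fix g assume "g \<in> {tree_action \<sigma> | \<sigma>. ac_aut \<sigma>}"
  then obtain \<sigma> where \<sigma>: "g = tree_action \<sigma>" "ac_aut \<sigma>" by blast
  let ?\<tau> = "inv_into UNIV \<sigma>"
  have "?\<tau> \<circ> \<sigma> = id" "\<sigma> \<circ> ?\<tau> = id" using ac_aut_bij[OF \<sigma>(2)] by (auto simp: bij_def surj_iff)
  then have "tree_action ?\<tau> \<circ> g = id" "g \<circ> tree_action ?\<tau> = id"
    using tree_action_comp[OF ac_aut_inv[OF \<sigma>(2)] \<sigma>(2)] tree_action_comp[OF \<sigma>(2) ac_aut_inv[OF \<sigma>(2)]] tree_action_id \<sigma>(1)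
    by simp_all
  then show "\<exists>g'\<in>{tree_action \<sigma> | \<sigma>. ac_aut \<sigma>}. \<forall>n. \<forall>w\<in>level n. g' (g w) = w \<and> g (g' w) = w"
    using ac_aut_inv[OF \<sigma>(2)] by (intro bexI[of _ "tree_action ?\<tau>"]) (auto simp: fun_eq_iff)
next
  fix g n w assume "g \<in> {tree_action \<sigma> | \<sigma>. ac_aut \<sigma>}" "w \<in> level n"
  then show "sign_relation (local_perm g) w" using sign_relation_tree_action by blast
next
  fix w w' n assume w: "w \<in> level n" "w' \<in> level n"
  \<comment> \<open>By the degree bound this polynomial has least possible degree for each of its
    roots, so its roots are conjugate.\<close>
  define h where "h = iter_poly [:0, 0, 3, - 2:] n - [:x:]"
  have root: "poly (ac_poly h) (r v) = 0" if "v \<in> level n" for v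
    using r_fiber[OF that] by (simp add: h_def fiber_def poly_iter_poly)
  have deg: "degree h = 3 ^ n" by (simp add: h_def degree_iter_poly)
  then have "h \<noteq> 0" by auto
  have "\<exists>\<sigma>. ac_aut \<sigma> \<and> \<sigma> (r w) = r w'"
    by (rule exists_ac_aut_root[OF root[OF w(1)] root[OF w(2)] \<open>h \<noteq> 0\<close>])
       (use min_degree r_fiber[OF w(1)] in \<open>auto simp: fiber_def deg\<close>)
  then show "\<exists>g\<in>{tree_action \<sigma> | \<sigma>. ac_aut \<sigma>}. g w = w'"
    using tree_action_eq_iff[OF _ w] by blast
next
  interpret M: type_subring "simple_ext (\<alpha> 0)"
    by (rule type_subfield.axioms(1)[OF type_subfield_simple_ext])
  have d: "\<delta> [] * \<delta> [] = node_disc (\<alpha> 0)" using \<delta>_square[of "[]"] r_Nil chain(2) by simp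
  then have "\<delta> [] \<notin> simple_ext (\<alpha> 0)" using chain(1) by (simp add: ramified_chain_def)
  moreover have "node_disc (\<alpha> 0) \<in> simple_ext (\<alpha> 0)"
    unfolding node_disc_def
    by (intro M.mult_mem M.diff_mem M.one_mem mem_simple_ext
        type_subfield.divide_mem[OF type_subfield_simple_ext] M.numeral_mem)
  ultimately obtain \<sigma> where \<sigma>: "ac_aut \<sigma>" "\<forall>a\<in>simple_ext (\<alpha> 0). \<sigma> a = a" "\<sigma> (\<delta> []) = - \<delta> []"
    using exists_ac_aut_conjugate_sqrt[OF M.type_subring_axioms range_subset_simple_ext, of "\<delta> []"] d by auto
  have nil: "[] \<in> level 0" by simp
  have "of_int (sign (local_perm (tree_action \<sigma>) [])) * \<delta> [] = - \<delta> []"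
    using \<delta>_tree_action[OF \<sigma>(1) nil] tree_auto_Nil[OF tree_auto_action[OF \<sigma>(1)]] \<sigma>(3) by simp
  then have "sign (local_perm (tree_action \<sigma>) []) \<noteq> 1" using \<delta>_nz[of "[]"] by auto
  then have "sign (local_perm (tree_action \<sigma>) []) = - 1" using sign_cases by blast
  then show "\<exists>g\<in>{tree_action \<sigma> | \<sigma>. ac_aut \<sigma>}. sign (local_perm g []) = - 1" using \<sigma>(1) by blast
next
  \<comment> \<open>The separating element lives at the vertex \<open>w\<close> of the ramified
    branch and its parent \<open>u\<close>. Over F, the field generated by r w and
    \<open>\<delta> u\<close>, the square root \<open>\<delta> w\<close> can still be negated; such
    an automorphism fixes w and u, is even at u and odd at w.\<close>
  fix n
  have iter: "(cubic ^^ k) (\<alpha> k) = to_ac x" for k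
    using chain by (induction k) (simp_all add: funpow_swap1 ramified_chain_def)
  have "\<alpha> (Suc n) \<in> fiber (Suc n)" unfolding fiber_def using iter by blast
  then obtain w where w: "w \<in> level (Suc n)" "r w = \<alpha> (Suc n)"
    using r_label label_level by blast
  obtain u l where u: "w = u @ [l]" "u \<in> level n" "l \<in> {1, 2, 3}" using level_SucE[OF w(1)] .
  have ru: "r u = \<alpha> n" using cubic_r[OF u(3), of u] u(1) w(2) chain(1) by (simp add: ramified_chain_def)
  define M where "M = simple_ext (\<alpha> (Suc n))"
  interpret M: type_subfield M unfolding M_def by (rule type_subfield_simple_ext)
  have KM: "range to_ac \<subseteq> M" unfolding M_def by (rule range_subset_simple_ext)
  have wM: "\<alpha> (Suc n) \<in> M" unfolding M_def by (rule mem_simple_ext)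
  have "cubic (\<alpha> (Suc n)) \<in> M"
    unfolding cubic_def by (intro M.mult_mem M.diff_mem M.numeral_mem M.power_mem wM)
  then have uM: "\<alpha> n \<in> M" using chain(1) by (simp add: ramified_chain_def)
  have disc: "node_disc a \<in> M" if "a \<in> M" for a
    unfolding node_disc_def by (intro M.mult_mem M.diff_mem M.one_mem M.divide_mem M.numeral_mem that)
  have dd: "\<delta> w * \<delta> w = node_disc (\<alpha> (Suc n))" "\<delta> u * \<delta> u = node_disc (\<alpha> n)"
    using \<delta>_square w(2) ru by simp_all
  have no: "\<delta> w \<notin> M" "\<delta> w * \<delta> u \<notin> M"
    using chain(1) dd unfolding ramified_chain_def M_def by blast+
  define F where "F = {a + b * \<delta> u | a b. a \<in> M \<and> b \<in> M}"
  have FI: "a + b * \<delta> u \<in> F" if "a \<in> M" "b \<in> M" for a b using that by (auto simp: F_def)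
  have MF: "M \<subseteq> F" using FI[OF _ M.zero_mem] by auto
  have F: "type_subring F"
  proof
    show "1 \<in> F" using MF M.one_mem by blast
  next
    fix a b assume "a \<in> F" "b \<in> F"
    then obtain a0 a1 b0 b1 where *: "a0 \<in> M" "a1 \<in> M" "b0 \<in> M" "b1 \<in> M" "a = a0 + a1 * \<delta> u" "b = b0 + b1 * \<delta> u"
      by (auto simp: F_def)
    show "a + b \<in> F" using FI[of "a0 + b0" "a1 + b1"] * M.add_mem by (simp add: algebra_simps)
    have "a0 * b0 + a1 * b1 * (\<delta> u * \<delta> u) \<in> M" "a0 * b1 + a1 * b0 \<in> M"
      using * M.add_mem M.mult_mem dd(2) disc[OF uM] by simp_all
    from FI[OF this] show "a * b \<in> F" using * by (simp add: algebra_simps)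
  next
    fix a assume "a \<in> F"
    then obtain a0 a1 where *: "a0 \<in> M" "a1 \<in> M" "a = a0 + a1 * \<delta> u" by (auto simp: F_def)
    then show "- a \<in> F" using FI[of "- a0" "- a1"] M.uminus_mem by simp
  qed
  \<comment> \<open>An element a + b \<open>\<delta> u\<close> with square in M has a b = 0 unless
    \<open>\<delta> u\<close> is itself in M, because of the cross term. Thus membership in F would
    put \<open>\<delta> w\<close> or \<open>\<delta> w * \<delta> u\<close> into M.\<close>
  have "\<delta> w \<notin> F"
  proof
    assume "\<delta> w \<in> F"
    then obtain a b where ab: "a \<in> M" "b \<in> M" "\<delta> w = a + b * \<delta> u" by (auto simp: F_def)
    show False
    proof (cases "a = 0 \<or> b = 0")
      case True
      then show ?thesis
      proof
        assume "a = 0"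
        then have "\<delta> w * \<delta> u = b * (\<delta> u * \<delta> u)" using ab by simp
        then show False using no(2) ab M.mult_mem disc[OF uM] dd(2) by simp
      next
        assume "b = 0"
        then show False using no(1) ab by simp
      qed
    next
      case False
      have "\<delta> w * \<delta> w = a * a + b * b * (\<delta> u * \<delta> u) + 2 * a * b * \<delta> u" using ab by (simp add: algebra_simps)
      then have "\<delta> u = (\<delta> w * \<delta> w - a * a - b * b * (\<delta> u * \<delta> u)) / (2 * a * b)" using False by (simp add: field_simps)
      also have "\<dots> \<in> M" unfolding dd
        using ab disc[OF wM] disc[OF uM] by (intro M.divide_mem M.diff_mem M.mult_mem M.numeral_mem)
      finally have "\<delta> w \<in> M" using ab M.add_mem M.mult_mem by simp
      then show False using no(1) by simp
    qed
  qed
  moreover have "\<delta> w * \<delta> w \<in> F" using dd disc[OF wM] MF by auto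
  ultimately obtain \<sigma> where \<sigma>: "ac_aut \<sigma>" "\<And>a. a \<in> F \<Longrightarrow> \<sigma> a = a" "\<sigma> (\<delta> w) = - \<delta> w"
    using exists_ac_aut_conjugate_sqrt[OF F, of "\<delta> w"] KM MF by blast
  have fix_w: "tree_action \<sigma> w = w" using \<sigma>(2)[of "r w"] w MF wM by (intro ac_aut_node[OF \<sigma>(1) _ w(1)]) auto
  have fix_u: "tree_action \<sigma> u = u" using \<sigma>(2)[of "r u"] ru MF uM by (intro ac_aut_node[OF \<sigma>(1) _ u(2)]) auto
  have "\<sigma> (\<delta> u) = \<delta> u" using \<sigma>(2)[of "\<delta> u"] FI[OF M.zero_mem M.one_mem] by simp
  then have "of_int (sign (local_perm (tree_action \<sigma>) u)) * \<delta> u = \<delta> u"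
    using \<delta>_tree_action[OF \<sigma>(1) u(2)] fix_u by simp
  then have "(of_int (sign (local_perm (tree_action \<sigma>) u)) :: 'k alg_closure) = 1" using \<delta>_nz[of u] by simp
  then have su: "sign (local_perm (tree_action \<sigma>) u) = 1" by (simp only: of_int_eq_1_iff)
  have "of_int (sign (local_perm (tree_action \<sigma>) w)) * \<delta> w = - \<delta> w"
    using \<delta>_tree_action[OF \<sigma>(1) w(1)] fix_w \<sigma>(3) by simp
  then have "sign (local_perm (tree_action \<sigma>) w) \<noteq> 1" using \<delta>_nz[of w] by auto
  then have sw: "sign (local_perm (tree_action \<sigma>) w) = - 1" using sign_cases by blast
  show "\<exists>g\<in>{tree_action \<sigma> | \<sigma>. ac_aut \<sigma>}. \<exists>u\<in>level n. \<exists>l\<in>{1, 2, 3}. g (u @ [l]) = u @ [l] \<and>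
      sign (local_perm g u) = 1 \<and> sign (local_perm g (u @ [l])) = - 1"
    using \<sigma>(1) u fix_w su sw by blast
qed

end

section \<open>The splitting field and its Galois group\<close>

lemma ring_of_type_algebra_ops:
  "x \<otimes>\<^bsub>ring_of_type_algebra\<^esub> y = x * y" "x \<oplus>\<^bsub>ring_of_type_algebra\<^esub> y = x + y"
  "\<one>\<^bsub>ring_of_type_algebra\<^esub> = 1" "\<zero>\<^bsub>ring_of_type_algebra\<^esub> = 0" "carrier ring_of_type_algebra = UNIV"
  by (simp_all add: ring_of_type_algebra_def)

lemma ring_of_type_algebra_inverses:
  fixes a :: "'a::field"
  shows "\<ominus>\<^bsub>ring_of_type_algebra\<^esub> a = - a" "a \<noteq> 0 \<Longrightarrow> inv\<^bsub>ring_of_type_algebra\<^esub> a = inverse a"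
proof -
  interpret R: field "ring_of_type_algebra :: 'a ring" by (rule field_from_type_algebra)
  show "\<ominus>\<^bsub>ring_of_type_algebra\<^esub> a = - a"
    by (rule R.minus_equality) (simp_all add: ring_of_type_algebra_ops)
  show "inv\<^bsub>ring_of_type_algebra\<^esub> a = inverse a" if "a \<noteq> 0"
    by (rule R.inv_char) (simp_all add: ring_of_type_algebra_ops that)
qed

lemma generate_field_type_induct [consumes 1, case_names incl one uminus inverse add mult]:
  fixes a :: "'a::field"
  assumes "a \<in> generate_field ring_of_type_algebra S"
    and "\<And>a. a \<in> S \<Longrightarrow> Q a" "Q 1" "\<And>a. Q a \<Longrightarrow> Q (- a)" "\<And>a. a \<noteq> 0 \<Longrightarrow> Q a \<Longrightarrow> Q (inverse a)"
    "\<And>a b. Q a \<Longrightarrow> Q b \<Longrightarrow> Q (a + b)" "\<And>a b. Q a \<Longrightarrow> Q b \<Longrightarrow> Q (a * b)"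
  shows "Q a"
  using assms(1)
proof (induction rule: generate_field.induct)
  case (m_inv h)
  then show ?case using assms(5) by (simp add: ring_of_type_algebra_inverses ring_of_type_algebra_ops)
qed (use assms in \<open>auto simp: ring_of_type_algebra_inverses ring_of_type_algebra_ops\<close>)

lemma type_subring_generate_field: "type_subring (generate_field (ring_of_type_algebra :: 'a::field ring) S)"
proof
  show "1 \<in> generate_field (ring_of_type_algebra :: 'a ring) S"
    using generate_field.one[of ring_of_type_algebra S] by (simp add: ring_of_type_algebra_ops)
next
  fix a b :: 'a assume *: "a \<in> generate_field ring_of_type_algebra S" "b \<in> generate_field ring_of_type_algebra S"
  show "a + b \<in> generate_field ring_of_type_algebra S"
    using generate_field.eng_add[OF *] by (simp add: ring_of_type_algebra_ops)
  show "a * b \<in> generate_field ring_of_type_algebra S"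
    using generate_field.eng_mult[OF *] by (simp add: ring_of_type_algebra_ops)
next
  fix a :: 'a assume *: "a \<in> generate_field ring_of_type_algebra S"
  show "- a \<in> generate_field ring_of_type_algebra S"
    using generate_field.a_inv[OF *] by (simp add: ring_of_type_algebra_inverses)
qed

context cubic_preimages
begin

abbreviation node_poly :: "nat \<Rightarrow> 'k poly" where
  "node_poly n \<equiv> iter_poly [:0, 0, 3, - 2:] n - [:x:]"

lemma ac_roots_node_poly: "ac_roots (node_poly n) = fiber n"
  by (simp add: ac_roots_def fiber_def poly_iter_poly)

text \<open>A root of the product is a root of one factor, which by the degree bound then has the
  full degree.\<close>

theorem irreducible_node_poly: "irreducible (node_poly n)"
proof (rule irreducibleI)
  have deg: "degree (node_poly n) = 3 ^ n" by (rule degree_iter_poly)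
  then show nz: "node_poly n \<noteq> 0" by auto
  show "\<not> node_poly n dvd 1"
  proof
    assume "node_poly n dvd 1"
    then have "degree (node_poly n) \<le> degree (1 :: 'k poly)" by (rule dvd_imp_degree_le) simp
    then show False using deg by simp
  qed
  fix a b assume ab: "node_poly n = a * b"
  have unit: "b dvd 1" if "poly (ac_poly a) z = 0" "z \<in> fiber n" "a * b = node_poly n" for a b z
  proof -
    have "a \<noteq> 0" "b \<noteq> 0" using that(3) nz by auto
    then have "3 ^ n \<le> degree a" using min_degree that(1,2) by (auto simp: fiber_def)
    moreover have "degree a + degree b = 3 ^ n" using degree_mult_eq[OF \<open>a \<noteq> 0\<close> \<open>b \<noteq> 0\<close>] that(3) deg by simp
    ultimately have "degree b = 0" by simp
    then show ?thesis using \<open>b \<noteq> 0\<close> by (metis is_unit_iff_degree)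
  qed
  define w where "w = replicate n (1 :: nat)"
  have w: "w \<in> level n" by (auto simp: w_def level_def)
  have "r w \<in> ac_roots (node_poly n)" using r_fiber[OF w] ac_roots_node_poly by simp
  then have "poly (ac_poly (node_poly n)) (r w) = 0" by (simp add: ac_roots_def)
  then have "poly (ac_poly a) (r w) = 0 \<or> poly (ac_poly b) (r w) = 0" unfolding ab by simp
  then show "a dvd 1 \<or> b dvd 1" using unit[of a "r w" b] unit[of b "r w" a] r_fiber[OF w] ab by (auto simp: mult.commute)
qed

definition split_field :: "nat \<Rightarrow> 'k alg_closure set" where
  "split_field n = generate_field ring_of_type_algebra (range to_ac \<union> fiber n)"

lemma splitting_field_node_poly:
  "splitting_field (node_poly n) = ring_of_type_algebra\<lparr>carrier := split_field n\<rparr>"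
  by (simp add: splitting_field_def split_field_def ac_roots_node_poly)

lemma type_subring_split_field: "type_subring (split_field n)"
  unfolding split_field_def by (rule type_subring_generate_field)

lemma base_subset_split_field: "to_ac c \<in> split_field n"
  unfolding split_field_def by (rule generate_field.incl) simp

text \<open>The field is generated by the last level only; earlier levels belong to it because they
  are images of later ones under \<open>cubic\<close>.\<close>

lemma r_split_field:
  assumes "w \<in> level i" "i \<le> n"
  shows "r w \<in> split_field n"
proof -
  interpret S: type_subring "split_field n" by (rule type_subring_split_field)
  have *: "\<forall>w\<in>level i. r w \<in> split_field n" if "i \<le> n" for i
    using that
  proof (induction "n - i" arbitrary: i)
    case 0
    then have "i = n" by simp
    show ?case
    proof
      fix w assume "w \<in> level i"
      then have "r w \<in> fiber n" using r_fiber \<open>i = n\<close> by simp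
      then show "r w \<in> split_field n" unfolding split_field_def by (intro generate_field.incl) simp
    qed
  next
    case (Suc d)
    have IH: "\<forall>w\<in>level (Suc i). r w \<in> split_field n" using Suc.hyps Suc.prems by (intro Suc.hyps(1)) auto
    show ?case
    proof
      fix w assume "w \<in> level i"
      then have "r (w @ [1]) \<in> split_field n" using IH level_SucI[of w i 1] by auto
      then have "cubic (r (w @ [1])) \<in> split_field n"
        unfolding cubic_def by (intro S.mult_mem S.diff_mem S.numeral_mem S.power_mem)
      then show "r w \<in> split_field n" using cubic_r[of 1 w] by simp
    qed
  qed
  then show ?thesis using assms by blast
qed

lemma ac_aut_split_field:
  assumes "ac_aut \<sigma>" "a \<in> split_field n"
  shows "\<sigma> a \<in> split_field n"
proof -
  interpret S: type_subring "split_field n" by (rule type_subring_split_field)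
  interpret S: type_subfield "split_field n"
    by (rule type_subfield_if_contains_base[OF type_subring_split_field]) (use base_subset_split_field in blast)
  have incl: "a \<in> range to_ac \<union> fiber n \<Longrightarrow> a \<in> split_field n" for a
    unfolding split_field_def by (rule generate_field.incl)
  have "a \<in> generate_field ring_of_type_algebra (range to_ac \<union> fiber n)"
    using assms(2) by (simp only: split_field_def)
  then show ?thesis
  proof (induction rule: generate_field_type_induct)
    case (incl a)
    then have "\<sigma> a \<in> range to_ac \<union> fiber n"
      using ac_aut_fiber[OF assms(1)] ac_aut_simps(3)[OF assms(1)] by auto
    then show ?case using \<open>\<And>a. a \<in> range to_ac \<union> fiber n \<Longrightarrow> a \<in> split_field n\<close> by blast
  qed (simp_all add: ac_aut_0_1[OF assms(1)] ac_aut_uminus[OF assms(1)] ac_aut_inverse[OF assms(1)]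
      ac_aut_simps[OF assms(1)] S.one_mem S.uminus_mem S.inverse_mem S.add_mem S.mult_mem)
qed

lemma galois_carrier_iff:
  "g \<in> carrier (galois_group (node_poly n)) \<longleftrightarrow>
     g \<in> extensional (split_field n) \<and> bij_betw g (split_field n) (split_field n) \<and>
     (\<forall>a\<in>split_field n. \<forall>b\<in>split_field n. g (a + b) = g a + g b \<and> g (a * b) = g a * g b) \<and>
     (\<forall>c. g (to_ac c) = to_ac c)"
proof -
  have one: "g 1 = 1" if "\<forall>c. g (to_ac c) = to_ac c" using that[rule_format, of 1] by simp
  show ?thesis
    unfolding galois_group_def splitting_field_node_poly
    by (auto simp: Bij_def ring_iso_def ring_hom_def ring_of_type_algebra_ops one bij_betw_def)
qed

lemma restrict_galois:
  assumes "ac_aut \<sigma>"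
  shows "restrict \<sigma> (split_field n) \<in> carrier (galois_group (node_poly n))"
proof -
  interpret S: type_subring "split_field n" by (rule type_subring_split_field)
  have "\<sigma> ` split_field n = split_field n"
  proof (intro equalityI subsetI)
    fix a assume "a \<in> split_field n"
    then have "inv_into UNIV \<sigma> a \<in> split_field n" by (rule ac_aut_split_field[OF ac_aut_inv[OF assms]])
    moreover have "a = \<sigma> (inv_into UNIV \<sigma> a)" using ac_aut_bij[OF assms] by (simp add: bij_def surj_f_inv_f)
    ultimately show "a \<in> \<sigma> ` split_field n" by blast
  qed (use ac_aut_split_field[OF assms] in blast)
  moreover have "inj_on \<sigma> (split_field n)" using ac_aut_eq_iff[OF assms] by (auto intro: inj_onI)
  ultimately show ?thesis
    unfolding galois_carrier_iff
    by (auto simp: bij_betw_def inj_on_restrict_eq base_subset_split_field ac_aut_simps[OF assms] S.add_mem S.mult_mem)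
qed

text \<open>The graph of an automorphism of the splitting field is a partial homomorphism. Hence the
  finite Galois groups are restrictions of automorphisms of the closure, to which the group theory
  applies for all levels at once.\<close>

lemma galois_extends:
  assumes "g \<in> carrier (galois_group (node_poly n))"
  obtains \<sigma> where "ac_aut \<sigma>" "g = restrict \<sigma> (split_field n)"
proof -
  interpret S: type_subring "split_field n" by (rule type_subring_split_field)
  note g = assms[unfolded galois_carrier_iff]
  define R where "R = {(a, g a) | a. a \<in> split_field n}"
  have "partial_hom R"
    unfolding partial_hom_def
  proof (intro conjI allI impI)
    fix c show "(to_ac c, to_ac c) \<in> R" using g base_subset_split_field unfolding R_def by force
  next
    fix a b a' b' assume "(a, b) \<in> R" "(a', b') \<in> R"
    then have *: "a \<in> split_field n" "a' \<in> split_field n" "b = g a" "b' = g a'" by (auto simp: R_def)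
    have "g (a + a') = b + b'" "g (a * a') = b * b'" using g * by auto
    then show "(a + a', b + b') \<in> R" "(a * a', b * b') \<in> R"
      using S.add_mem[OF *(1,2)] S.mult_mem[OF *(1,2)] by (auto simp: R_def)
  next
    fix b assume "(0, b) \<in> R"
    then have "b = g (to_ac 0)" by (auto simp: R_def)
    also have "\<dots> = to_ac 0" using g by blast
    finally show "b = 0" by simp
  qed
  then obtain \<sigma> where \<sigma>: "ac_aut \<sigma>" "\<forall>(a, b)\<in>R. \<sigma> a = b" using exists_ac_aut_extending by blast
  have "g = restrict \<sigma> (split_field n)"
  proof
    fix a show "g a = restrict \<sigma> (split_field n) a"
    proof (cases "a \<in> split_field n")
      case True
      then show ?thesis using \<sigma>(2) by (auto simp: R_def)
    next
      case False
      then show ?thesis using g by (simp add: extensional_def)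
    qed
  qed
  then show ?thesis using that \<sigma> by blast
qed

definition galois_tree_map :: "nat \<Rightarrow> ('k alg_closure \<Rightarrow> 'k alg_closure) \<Rightarrow> nat list \<Rightarrow> nat list" where
  "galois_tree_map n g w = (if w \<in> vertices (ternary_tree n) then label (length w) (g (r w)) else w)"

lemma galois_tree_map_restrict:
  "galois_tree_map n (restrict \<sigma> (split_field n)) = restrict_id (tree_action \<sigma>) (vertices (ternary_tree n))"
proof
  fix w show "galois_tree_map n (restrict \<sigma> (split_field n)) w = restrict_id (tree_action \<sigma>) (vertices (ternary_tree n)) w"
  proof (cases "w \<in> vertices (ternary_tree n)")
    case True
    then have w: "w \<in> level (length w)" "length w \<le> n" using mem_vertices_ternary by blast+
    then have "r w \<in> split_field n" by (rule r_split_field)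
    then show ?thesis using True w by (simp add: galois_tree_map_def tree_action_def restrict_id_def)
  qed (simp add: galois_tree_map_def restrict_id_def)
qed

lemma restrict_id_level: "w \<in> level i \<Longrightarrow> i \<le> n \<Longrightarrow> restrict_id g (vertices (ternary_tree n)) w = g w"
  using level_subset_vertices by (simp add: restrict_id_def)

lemma tree_auto_restrict_id:
  assumes "tree_auto n g"
  shows "tree_auto n (restrict_id g (vertices (ternary_tree n)))"
  unfolding tree_auto_def
proof (intro conjI allI impI ballI)
  fix i assume i: "i \<le> n"
  have "bij_betw g (level i) (level i)" using assms i by (simp add: tree_auto_def)
  then show "bij_betw (restrict_id g (vertices (ternary_tree n))) (level i) (level i)"
    by (rule iffD1[OF bij_betw_cong, rotated]) (use i in \<open>simp add: restrict_id_level\<close>)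
next
  fix i w assume i: "i < n" and w: "w \<in> level (Suc i)"
  then show "butlast (restrict_id g (vertices (ternary_tree n)) w) = restrict_id g (vertices (ternary_tree n)) (butlast w)"
    using restrict_id_level[OF w] restrict_id_level[OF butlast_level[OF w]] tree_auto_butlast[OF assms w i] by simp
qed

lemma local_perm_restrict_id:
  assumes "v \<in> level i" "i < n"
  shows "local_perm (restrict_id g (vertices (ternary_tree n))) v = local_perm g v"
proof
  fix l show "local_perm (restrict_id g (vertices (ternary_tree n))) v l = local_perm g v l"
    using restrict_id_level[OF level_SucI[OF assms(1)], of l n g] assms(2) by (simp add: local_perm_def)
qed

lemma restrict_id_Aut: "tree_auto n g \<Longrightarrow> restrict_id g (vertices (ternary_tree n)) \<in> Aut n"
  by (rule AutI[OF tree_auto_restrict_id]) (auto simp: restrict_id_def)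

lemma tree_action_E:
  assumes "ac_aut \<sigma>"
  shows "restrict_id (tree_action \<sigma>) (vertices (ternary_tree (Suc m))) \<in> E (Suc m)"
  unfolding E_iff
proof (intro conjI allI impI)
  show "restrict_id (tree_action \<sigma>) (vertices (ternary_tree (Suc m))) \<in> Aut (Suc m)"
    by (rule restrict_id_Aut[OF tree_auto_action[OF assms]])
  fix i v assume i: "i < m" and v: "v \<in> level i"
  show "sign_relation (local_perm (restrict_id (tree_action \<sigma>) (vertices (ternary_tree (Suc m))))) v"
    using sign_relation_tree_action[OF assms v] i
      local_perm_restrict_id[OF v, of "Suc m" "tree_action \<sigma>"]
      local_perm_restrict_id[OF level_SucI[OF v], of _ "Suc m" "tree_action \<sigma>"]
    by (simp add: sign_relation_def)
qed

lemma E_realized: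
  assumes "e \<in> E (Suc m)"
  obtains \<sigma> where "ac_aut \<sigma>" "restrict_id (tree_action \<sigma>) (vertices (ternary_tree (Suc m))) = e"
proof -
  interpret tree_group "{tree_action \<sigma> | \<sigma>. ac_aut \<sigma>}" by (rule tree_group_tree_action)
  have e: "e \<in> Aut (Suc m)" "\<And>i v. i < m \<Longrightarrow> v \<in> level i \<Longrightarrow> sign_relation (local_perm e) v"
    using assms unfolding E_iff by blast+
  \<comment> \<open>Continued by the identity, because \<open>attains\<close> expects a permutation
    at every list while \<open>e\<close> is controlled only up to its last level.\<close>
  define c where "c v = (if length v < Suc m \<and> v \<in> level (length v) then local_perm e v else id)" for v
  have c: "c v = local_perm e v" if "v \<in> level i" "i < Suc m" for v i
    using that level_length by (auto simp: c_def)
  have "\<exists>g\<in>{tree_action \<sigma> | \<sigma>. ac_aut \<sigma>}. \<forall>i<Suc m. \<forall>v\<in>level i. local_perm g v = c v"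
  proof (rule attainsD[OF attains_all])
    fix v show "S3 (c v)"
      using S3_local_perm[OF Aut_imp_tree_auto[OF e(1)], of v "length v"] S3_id by (simp only: c_def) simp
  next
    fix i v assume i: "Suc i < Suc m" and v: "v \<in> level i"
    then show "sign_relation c v"
      using e(2)[of i v] c[OF v] c[OF level_SucI[OF v]] by (simp add: sign_relation_def)
  qed
  then obtain \<sigma> where \<sigma>: "ac_aut \<sigma>" "\<And>i v. i < Suc m \<Longrightarrow> v \<in> level i \<Longrightarrow> local_perm (tree_action \<sigma>) v = c v" by blast
  have "restrict_id (tree_action \<sigma>) (vertices (ternary_tree (Suc m))) = e"
  proof (rule Aut_eqI[OF restrict_id_Aut[OF tree_auto_action[OF \<sigma>(1)]] e(1)])
    fix i v assume "i < Suc m" "v \<in> level i"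
    then show "local_perm (restrict_id (tree_action \<sigma>) (vertices (ternary_tree (Suc m)))) v = local_perm e v"
      using local_perm_restrict_id \<sigma>(2) c by simp
  qed
  then show ?thesis using that \<sigma>(1) by blast
qed

lemma galois_mult:
  assumes "g \<in> carrier (galois_group (node_poly n))" "h \<in> carrier (galois_group (node_poly n))"
  shows "g \<otimes>\<^bsub>galois_group (node_poly n)\<^esub> h = compose (split_field n) g h"
proof -
  have "g \<in> Bij (split_field n)" "h \<in> Bij (split_field n)"
    using assms unfolding galois_carrier_iff by (auto simp: Bij_def)
  then show ?thesis by (simp add: galois_group_def BijGroup_def splitting_field_node_poly)
qed

text \<open>Injective because the last level generates the splitting field over the base; surjective
  because every element of \<open>E\<close> comes from an automorphism of the closure.\<close>

lemma galois_group_iso: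
  "galois_tree_map (Suc m) \<in> iso (galois_group (node_poly (Suc m))) (tree_aut (ternary_tree (Suc m))\<lparr>carrier := E (Suc m)\<rparr>)"
proof -
  let ?n = "Suc m"
  let ?G = "galois_group (node_poly ?n)" and ?V = "vertices (ternary_tree ?n)"
  have mem: "galois_tree_map ?n g \<in> E ?n" if "g \<in> carrier ?G" for g
    using galois_extends[OF that] tree_action_E galois_tree_map_restrict by metis
  have hom: "galois_tree_map ?n (g \<otimes>\<^bsub>?G\<^esub> h) = galois_tree_map ?n g \<circ> galois_tree_map ?n h"
    if gh: "g \<in> carrier ?G" "h \<in> carrier ?G" for g h
  proof -
    obtain \<sigma> where \<sigma>: "ac_aut \<sigma>" "g = restrict \<sigma> (split_field ?n)" using galois_extends[OF gh(1)] .
    obtain \<tau> where \<tau>: "ac_aut \<tau>" "h = restrict \<tau> (split_field ?n)" using galois_extends[OF gh(2)] .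
    have "g \<otimes>\<^bsub>?G\<^esub> h = restrict (\<sigma> \<circ> \<tau>) (split_field ?n)"
      unfolding galois_mult[OF gh] unfolding \<sigma>(2) \<tau>(2)
      using ac_aut_split_field[OF \<tau>(1)] by (auto simp: compose_def fun_eq_iff restrict_def)
    then have "galois_tree_map ?n (g \<otimes>\<^bsub>?G\<^esub> h) = restrict_id (tree_action \<sigma> \<circ> tree_action \<tau>) ?V"
      by (simp only: galois_tree_map_restrict tree_action_comp[OF \<sigma>(1) \<tau>(1)])
    also have "\<dots> = restrict_id (tree_action \<sigma>) ?V \<circ> restrict_id (tree_action \<tau>) ?V"
    proof
      fix w show "restrict_id (tree_action \<sigma> \<circ> tree_action \<tau>) ?V w
          = (restrict_id (tree_action \<sigma>) ?V \<circ> restrict_id (tree_action \<tau>) ?V) w"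
      proof (cases "w \<in> ?V")
        case True
        then have w: "w \<in> level (length w)" "length w \<le> ?n" using mem_vertices_ternary by blast+
        have "tree_action \<tau> w \<in> ?V"
          using level_subset_vertices[OF tree_action_level[OF \<tau>(1) w(1)] w(2)] .
        then show ?thesis using True by (simp add: restrict_id_def)
      qed (simp add: restrict_id_def)
    qed
    finally show ?thesis by (simp only: \<sigma>(2) \<tau>(2) galois_tree_map_restrict)
  qed
  have inj: "inj_on (galois_tree_map ?n) (carrier ?G)"
  proof (rule inj_onI)
    fix g h assume gh: "g \<in> carrier ?G" "h \<in> carrier ?G" "galois_tree_map ?n g = galois_tree_map ?n h"
    obtain \<sigma> where \<sigma>: "ac_aut \<sigma>" "g = restrict \<sigma> (split_field ?n)" using galois_extends[OF gh(1)] .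
    obtain \<tau> where \<tau>: "ac_aut \<tau>" "h = restrict \<tau> (split_field ?n)" using galois_extends[OF gh(2)] .
    have fib: "\<sigma> z = \<tau> z" if z: "z \<in> fiber ?n" for z
    proof -
      define w where "w = label ?n z"
      have w: "w \<in> level ?n" "r w = z" using label_level r_label z by (auto simp: w_def)
      have "restrict_id (tree_action \<sigma>) ?V w = restrict_id (tree_action \<tau>) ?V w"
        using gh(3) by (simp only: \<sigma>(2) \<tau>(2) galois_tree_map_restrict)
      then have "tree_action \<sigma> w = tree_action \<tau> w" using restrict_id_level[OF w(1) order_refl] by simp
      then show ?thesis using r_tree_action[OF \<sigma>(1) w(1)] r_tree_action[OF \<tau>(1) w(1)] w(2) by simp
    qed
    have "\<sigma> a = \<tau> a" if "a \<in> split_field ?n" for a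
      using that unfolding split_field_def
    proof (induction rule: generate_field_type_induct)
      case (incl a)
      then show ?case using fib ac_aut_simps(3)[OF \<sigma>(1)] ac_aut_simps(3)[OF \<tau>(1)] by auto
    qed (simp_all add: ac_aut_0_1[OF \<sigma>(1)] ac_aut_uminus[OF \<sigma>(1)] ac_aut_inverse[OF \<sigma>(1)] ac_aut_simps[OF \<sigma>(1)]
        ac_aut_0_1[OF \<tau>(1)] ac_aut_uminus[OF \<tau>(1)] ac_aut_inverse[OF \<tau>(1)] ac_aut_simps[OF \<tau>(1)])
    then show "g = h" by (auto simp: \<sigma>(2) \<tau>(2) fun_eq_iff)
  qed
  have "galois_tree_map ?n ` carrier ?G = E ?n"
  proof (intro equalityI subsetI)
    fix e assume "e \<in> E ?n"
    then obtain \<sigma> where "ac_aut \<sigma>" "restrict_id (tree_action \<sigma>) ?V = e" by (rule E_realized)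
    then show "e \<in> galois_tree_map ?n ` carrier ?G"
      using restrict_galois galois_tree_map_restrict by (metis image_eqI)
  qed (use mem in blast)
  then show ?thesis
    unfolding iso_def hom_def bij_betw_def using mem hom inj by (simp add: tree_aut_def del: E.simps)
qed

section \<open>The preimage tree as a ternary tree\<close>

definition tree_label :: "nat \<times> 'k alg_closure \<Rightarrow> nat list" where
  "tree_label = (\<lambda>(i, a). label i a)"

lemma vertices_preimage_tree: "vertices (preimage_tree [:0, 0, 3, - 2:] x n) = {(i, a). i \<le> n \<and> a \<in> fiber i}"
  by (simp add: preimage_tree_def ac_roots_node_poly)

lemma edge_preimage_iff:
  assumes "a \<in> fiber i" "b \<in> fiber j" "i \<le> n" "j \<le> n"
  shows "{(i, a), (j, b)} \<in> edges (preimage_tree [:0, 0, 3, - 2:] x n) \<longleftrightarrow>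
    j = Suc i \<and> a = cubic b \<or> i = Suc j \<and> b = cubic a"
proof -
  have f: "poly (ac_poly [:0, 0, 3, - 2 :: 'k:]) z = cubic z" for z
    by (simp add: cubic_def power2_eq_square algebra_simps)
  have "edges (preimage_tree [:0, 0, 3, - 2:] x n) =
      {{(Suc i, a), (i, cubic a)} | i a. Suc i \<le> n \<and> a \<in> fiber (Suc i)}"
    unfolding preimage_tree_def by (simp only: f ac_roots_node_poly rooted_graph.simps)
  then show ?thesis using assms by (auto simp: doubleton_eq_iff)
qed

lemma rooted_iso_tree_label:
  "rooted_iso (preimage_tree [:0, 0, 3, - 2:] x n) (ternary_tree n) tree_label"
proof -
  have "bij_betw tree_label {(i, a). i \<le> n \<and> a \<in> fiber i} (vertices (ternary_tree n))"
    unfolding bij_betw_def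
  proof
    show "inj_on tree_label {(i, a). i \<le> n \<and> a \<in> fiber i}"
    proof (rule inj_onI, clarify)
      fix i a j b assume *: "a \<in> fiber i" "b \<in> fiber j" "tree_label (i, a) = tree_label (j, b)"
      then have "label i a = label j b" by (simp add: tree_label_def)
      moreover from this have "i = j" using label_level[OF *(1)] label_level[OF *(2)] level_length by metis
      ultimately show "i = j \<and> a = b" using r_label[OF *(1)] r_label[OF *(2)] by metis
    qed
    show "tree_label ` {(i, a). i \<le> n \<and> a \<in> fiber i} = vertices (ternary_tree n)"
    proof (intro equalityI subsetI)
      fix w assume "w \<in> tree_label ` {(i, a). i \<le> n \<and> a \<in> fiber i}"
      then obtain i a where "i \<le> n" "a \<in> fiber i" and w: "w = label i a" by (auto simp: tree_label_def)
      then have "w \<in> level i" using label_level by blast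
      then show "w \<in> vertices (ternary_tree n)" using level_subset_vertices[OF _ \<open>i \<le> n\<close>] by blast
    next
      fix w assume "w \<in> vertices (ternary_tree n)"
      then have w: "w \<in> level (length w)" "length w \<le> n" using mem_vertices_ternary by blast+
      then have "w = tree_label (length w, r w)" using label_r by (simp add: tree_label_def)
      then show "w \<in> tree_label ` {(i, a). i \<le> n \<and> a \<in> fiber i}" using w r_fiber by blast
    qed
  qed
  moreover have "tree_label (0, to_ac x) = []"
    using label_level[of "to_ac x" 0] by (simp add: tree_label_def fiber_def)
  moreover have "{(i, a), (j, b)} \<in> edges (preimage_tree [:0, 0, 3, - 2:] x n) \<longleftrightarrow>
      {tree_label (i, a), tree_label (j, b)} \<in> edges (ternary_tree n)"
    if ij: "i \<le> n" "a \<in> fiber i" "j \<le> n" "b \<in> fiber j" for i a j b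
  proof -
    have l: "label i a \<in> level i" "label j b \<in> level j" using label_level ij by auto
    have *: "label j b \<noteq> [] \<and> label i a = butlast (label j b) \<longleftrightarrow> j = Suc i \<and> a = cubic b"
      if ab: "a \<in> fiber i" "b \<in> fiber j" for i j a b
    proof (cases j)
      case 0
      then show ?thesis using label_level[OF ab(2)] by simp
    next
      case (Suc k)
      obtain v l where v: "label j b = v @ [l]" "v \<in> level k" "l \<in> {1, 2, 3}"
        using label_level[OF ab(2)] Suc by (metis level_SucE)
      have rv: "r v = cubic b" using cubic_r[OF v(3), of v] v(1) r_label[OF ab(2)] by simp
      have "label i a = v \<longleftrightarrow> i = k \<and> a = cubic b"
      proof
        assume "label i a = v"
        then show "i = k \<and> a = cubic b"
          using label_level[OF ab(1)] v(2) level_length r_label[OF ab(1)] rv by metis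
      next
        assume "i = k \<and> a = cubic b"
        then show "label i a = v" using rv label_r[OF v(2)] by simp
      qed
      then show ?thesis using v(1) Suc by auto
    qed
    show ?thesis
      using edge_preimage_iff[OF ij(2,4,1,3)] edge_ternary_iff[OF l ij(1,3)] *[OF ij(2,4)] *[OF ij(4,2)]
      by (simp add: tree_label_def)
  qed
  ultimately show ?thesis
    unfolding rooted_iso_def vertices_preimage_tree
    by (auto simp: preimage_tree_def ternary_tree_def)
qed

lemma galois_equivariant:
  assumes "g \<in> carrier (galois_group (node_poly n))" "(i, a) \<in> vertices (preimage_tree [:0, 0, 3, - 2:] x n)"
  shows "tree_label (i, g a) = galois_tree_map n g (tree_label (i, a))"
proof -
  have ia: "i \<le> n" "a \<in> fiber i" using assms(2) vertices_preimage_tree by auto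
  have "label i a \<in> level i" using label_level ia by blast
  then show ?thesis
    using ia level_subset_vertices level_length r_label by (simp add: tree_label_def galois_tree_map_def)
qed

end

section \<open>From the hypotheses on the two primes to the theorem\<close>

declare One_nat_def [simp]

lemma (in discrete_valuation_ring) nonunit_divide_uniformizer:
  assumes "y \<in> nonunits B" "y \<noteq> 0"
  shows "y / u \<in> B"
proof -
  obtain k where k: "vunit B (y / u powi k)" using exists_order[OF assms(2)] by blast
  have "y \<in> B" using assms(1) nonunits_subset by blast
  then have "0 \<le> k" using mem_iff_order[OF k] by simp
  moreover have "k \<noteq> 0" using k assms(1) vunit_not_nonunit by fastforce
  moreover have "vunit B (y / u / u powi (k - 1))"
    using k uniformizer_nz by (simp add: power_int_diff)
  ultimately show ?thesis using mem_iff_order[of "y / u" "k - 1"] by simp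
qed

text \<open>An element of value 1 is itself a uniformizer, so \<open>y\<close> takes the part of
  \<open>u\<close> and the ramification statements speak about preimages of \<open>y\<close>
  directly. The second alternative is the form needed for \<open>y = inverse x\<close> at a simple
  pole.\<close>

lemma (in number_field_prime) exists_ac_valuation_over_p:
  assumes "val P y = Fin 1 \<or> y \<noteq> 0 \<and> val P (inverse y) = Fin (- 1)"
  obtains V where "ac_valuation V y" "of_nat p \<in> nonunits V" "of_nat p / to_ac y \<in> V"
proof -
  obtain B u where B: "discrete_valuation_ring B u" "of_nat p \<in> nonunits B"
    and val: "\<And>y k. y \<noteq> 0 \<Longrightarrow> val P y = Fin k \<longleftrightarrow> vunit B (y / u powi k)"
    using exists_valuation by metis
  interpret u: discrete_valuation_ring B u by (rule B)
  have "y \<noteq> 0" using assms by (auto simp: val_def)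
  have "vunit B (y / u)"
    using assms
  proof
    assume "val P y = Fin 1"
    then show ?thesis using val[OF \<open>y \<noteq> 0\<close>] by simp
  next
    assume "y \<noteq> 0 \<and> val P (inverse y) = Fin (- 1)"
    then have "vunit B (inverse y / u powi (- 1))" by (intro val[THEN iffD1]) simp_all
    then have "vunit B (inverse (y / u))" by (simp add: power_int_minus divide_inverse)
    then show ?thesis by (simp only: u.vunit_inverse_iff)
  qed
  then have y: "discrete_valuation_ring B y" by (rule u.discrete_valuation_ring_change)
  obtain V where V: "ac_valuation V y" "\<And>a. a \<in> B \<Longrightarrow> to_ac a \<in> V"
      "\<And>a. a \<in> nonunits B \<Longrightarrow> to_ac a \<in> nonunits V"
    using exists_ac_valuation[OF y] by blast
  have "of_nat p / y \<in> B"
    using discrete_valuation_ring.nonunit_divide_uniformizer[OF y B(2)] prime_p by auto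
  then have "of_nat p / to_ac y \<in> V" using V(2)[of "of_nat p / y"] by simp
  then show ?thesis using that[OF V(1)] V(3)[OF B(2)] by simp
qed

lemma min_degree_of_prime_over_3:
  fixes x :: "'k::field_char_0"
  assumes "number_field TYPE('k)" "prime_over 3 Q" "val Q x = Fin 1"
    and z: "(cubic ^^ n) z = to_ac x" and p: "p \<noteq> 0" "poly (ac_poly p) z = 0"
  shows "3 ^ n \<le> degree p"
proof -
  interpret number_field_prime Q 3 by unfold_locales (use assms in simp_all)
  obtain V where V: "ac_valuation V x" "3 \<in> nonunits V" "3 / to_ac x \<in> V"
    using exists_ac_valuation_over_p[of x] assms(3) by auto
  interpret ac_valuation V x by fact
  show ?thesis using degree_ge_if_has_order_1[OF _ p] totally_ramified[OF V(2,3) z] by blast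
qed

lemma ramified_chain_of_prime_over_2:
  fixes x :: "'k::field_char_0"
  assumes "number_field TYPE('k)" "prime_over 2 P"
    and v: "val P x = Fin 1 \<or> val P x = Fin (-1) \<or> val P (1 - x) = Fin 1" and "x \<noteq> 0"
  obtains \<alpha> where "ramified_chain \<alpha>" "\<alpha> 0 = to_ac x"
proof -
  interpret number_field_prime P 2 by unfold_locales (use assms in simp_all)
  have zero_side: "\<exists>\<alpha>. ramified_chain \<alpha> \<and> \<alpha> 0 = to_ac y" if "val P y = Fin 1" for y
  proof -
    obtain V where V: "ac_valuation V y" "2 \<in> nonunits V"
      using exists_ac_valuation_over_p[of y] \<open>val P y = Fin 1\<close> by auto
    show ?thesis using ac_valuation.ramified_chain_zero_side[OF V] by blast
  qed
  have pole_side: "\<exists>\<alpha>. ramified_chain \<alpha> \<and> \<alpha> 0 = to_ac x" if "val P x = Fin (-1)"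
  proof -
    obtain V where V: "ac_valuation V (inverse x)" "2 \<in> nonunits V" "2 / to_ac (inverse x) \<in> V"
      using exists_ac_valuation_over_p[of "inverse x"] \<open>val P x = Fin (-1)\<close> \<open>x \<noteq> 0\<close> by auto
    show ?thesis using ac_valuation.ramified_chain_pole_side[OF V] by (metis inverse_inverse_eq)
  qed
  from v consider "val P x = Fin 1" | "val P x = Fin (-1)" | "val P (1 - x) = Fin 1" by blast
  then have "\<exists>\<alpha>. ramified_chain \<alpha> \<and> \<alpha> 0 = to_ac x"
  proof cases
    case 3
    then obtain \<alpha> where \<alpha>: "ramified_chain \<alpha>" "\<alpha> 0 = to_ac (1 - x)" using zero_side by blast
    have "1 - \<alpha> 0 = to_ac x" using \<alpha>(2) by simp
    then show ?thesis using ramified_chain_one_minus[OF \<alpha>(1)] by (intro exI[of _ "\<lambda>n. 1 - \<alpha> n"]) simp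
  qed (use zero_side pole_side in blast)+
  then show ?thesis using that by blast
qed

theorem theorem1p1:
  fixes x :: "'k::field_char_0" and P Q :: "'k set" and f :: "'k poly"
  assumes "f = [:0, 0, 3, -2:]"
    and "number_field TYPE('k)"
    and "prime_over 2 P" and "prime_over 3 Q"
    and "val Q x = Fin 1"
    and "val P x = Fin 1 \<or> val P x = Fin (-1) \<or> val P (1 - x) = Fin 1"
  shows "(\<forall>n\<ge>1.
            irreducible (iter_poly f n - [:x:]) \<and>
            (\<exists>\<phi> \<Psi>. rooted_iso (preimage_tree f x n) (ternary_tree n) \<phi> \<and>
               \<Psi> \<in> iso (galois_group (iter_poly f n - [:x:])) (tree_aut (ternary_tree n)\<lparr>carrier := E n\<rparr>) \<and>
               (\<forall>g \<in> carrier (galois_group (iter_poly f n - [:x:])).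
                  \<forall>(i, \<alpha>) \<in> vertices (preimage_tree f x n). \<phi> (i, g \<alpha>) = \<Psi> g (\<phi> (i, \<alpha>))))) \<and>
         (\<lambda>n. ln (real (card (E n))) / ln (real (card (Aut n))))
           \<longlonglongrightarrow> 1 - 1 / 3 * (ln 2 / ln 6)"
proof -
  have "x \<noteq> 0" using assms(5) by (auto simp: val_def)
  obtain \<alpha> where \<alpha>: "ramified_chain \<alpha>" "\<alpha> 0 = to_ac x"
    using ramified_chain_of_prime_over_2 assms(2,3,6) \<open>x \<noteq> 0\<close> by blast
  \<comment> \<open>The labelling needs x different from the critical values 0 and 1. If x were 1,
    the fixed point 1 would be a preimage of x of degree one, against the bound 3.\<close>
  have "x \<noteq> 1"
  proof
    assume "x = 1"
    then have "(cubic ^^ 1) 1 = to_ac x" by (simp add: cubic_def)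
    moreover have "poly (ac_poly [:- 1, 1 :: 'k:]) 1 = 0" by simp
    ultimately have "3 ^ 1 \<le> degree [:- 1, 1 :: 'k:]"
      by (intro min_degree_of_prime_over_3[OF assms(2,4,5)]) simp_all
    then show False by simp
  qed
  obtain r \<delta> where r: "r [] = to_ac x"
    "\<And>w. root_triple (r w) (\<lambda>l. r (w @ [l]))" "\<And>w. \<delta> w = vandermonde (\<lambda>l. r (w @ [l]))"
    "\<And>w. \<delta> (w @ [1]) * \<delta> (w @ [2]) * \<delta> (w @ [3]) = 27 / 8 * \<delta> w"
    "\<And>w. \<delta> w * \<delta> w = node_disc (r w)" "\<And>w. \<delta> w \<noteq> 0"
    using tree_labelling_exists[of "to_ac x"] \<open>x \<noteq> 0\<close> \<open>x \<noteq> 1\<close> by (auto simp del: One_nat_def)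
  interpret cubic_preimages x \<alpha> r \<delta>
    by unfold_locales (fact \<alpha> r min_degree_of_prime_over_3[OF assms(2,4,5)])+
  have "irreducible (iter_poly f n - [:x:]) \<and>
      (\<exists>\<phi> \<Psi>. rooted_iso (preimage_tree f x n) (ternary_tree n) \<phi> \<and>
         \<Psi> \<in> iso (galois_group (iter_poly f n - [:x:])) (tree_aut (ternary_tree n)\<lparr>carrier := E n\<rparr>) \<and>
         (\<forall>g \<in> carrier (galois_group (iter_poly f n - [:x:])).
            \<forall>(i, \<alpha>) \<in> vertices (preimage_tree f x n). \<phi> (i, g \<alpha>) = \<Psi> g (\<phi> (i, \<alpha>))))"
    if "1 \<le> n" for n
  proof -
    obtain m where n: "n = Suc m" using \<open>1 \<le> n\<close> by (cases n) auto
    show ?thesis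
      unfolding assms(1)
    proof (intro conjI exI[of _ tree_label] exI[of _ "galois_tree_map n"] ballI)
      show "galois_tree_map n \<in> iso (galois_group (node_poly n)) (tree_aut (ternary_tree n)\<lparr>carrier := E n\<rparr>)"
        unfolding n by (rule galois_group_iso)
    qed (use irreducible_node_poly rooted_iso_tree_label galois_equivariant in blast)+
  qed
  then show ?thesis using log_order_ratio by blast
qed

end
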